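(* Let $\gamma\in(1,5/3]$. Assume that the sequence $(\rho^n,u^n)$ of finite energy approximate solutions (see context) generates a Young measure $\nu$, and let $(\mathbf z^n)$ be the associated Riemann invariants. For any weight $\psi\in C^2(\mathbb R)$ with subcubic growth at infinity, $$\eta_\psi(\mathbf z^n)A^n\rightharpoonup\langle\eta_\psi\rangle A\quad\text{weakly in }L^1_{\mathrm{loc}}\big([0,\infty)\times\bar\Omega\big).$$ Moreover, if $\psi$ has subquadratic growth at infinity, then $$q_\psi(\mathbf z^n)A^n\rightharpoonup\langle q_\psi\rangle A\quad\text{and}\quad(\rho u\,\eta_{\psi,\rho})(\mathbf z^n)A^n\rightharpoonup\langle\rho u\,\eta_{\psi,\rho}\rangle A\quad\text{weakly in }L^1_{\mathrm{loc}}\big([0,\infty)\times\bar\Omega\big).$$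
   Context: Constants and geometry: $\theta:=(\gamma-1)/2$, $\kappa:=\theta^2/\gamma$, $\lambda:=(3-\gamma)/(2(\gamma-1))$, $P(\rho)=\kappa\rho^\gamma$, $U(\rho)=\frac{\kappa}{\gamma-1}\rho^\gamma$. $A$ is continuously differentiable and either (nozzle flow) $\Omega=\mathbb R$, $A:\mathbb R\to[\underline A,\overline A]$ with positive constants $\underline A<\overline A$, or (spherical symmetry) $\Omega=(0,\infty)$, $A(x)=x^\alpha$ with $\alpha>0$. Moreover $(\partial_xA)_-\in L^1\cap L^\infty(\Omega)$, with $(b)_-:=-\min\{b,0\}$. Euler equations with geometry $A$: $\partial_t(\rho A)+\partial_x(\rho uA)=0$, $\partial_t(\rho uA)+\partial_x(\rho u^2A)+A\partial_xP(\rho)=0$. With $(b)_+:=\max\{b,0\}$, $\chi(s|\rho,u):=(\rho^{2\theta}-(s-u)^2)_+^\lambda$, $\sigma(s|\rho,u):=(\theta s+(1-\theta)u)\chi(s|\rho,u)$, set $(\eta_\psi,q_\psi)(\rho,u):=\int_{\mathbb R}\psi(s)(\chi,\sigma)(s|\rho,u)\,ds$ and $\eta_{\psi,\rho}:=\partial_\rho\eta_\psi$. An entropy solution satisfies, for all convex $\psi\in C^2(\mathbb R)$ of subquadratic growth, in the distribution sense, $\partial_t(\eta_\psi A)+\partial_x(q_\psi A)+(\rho u\,\eta_{\psi,\rho}-q_\psi)(\partial_xA)\le0$ (this contains the Euler equations, by taking $\psi$ constant or linear). Finite energy approximate solutions: let $A^n(x):=(x+1/n)^\alpha$ in the spherically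 symmetric case and $A^n:=A$ in the nozzle case; $M^n[\rho]:=\int_\Omega\rho A^n\,dx$, $E^n[\rho,u]:=\int_\Omega(\frac12\rho u^2+U(\rho))A^n\,dx$. Let $(\overline\rho,\overline u)$, $\overline\rho\ge0$, be initial data with finite mass $\overline M:=\int_\Omega\overline\rho A\,dx$ and finite energy $\overline E:=\int_\Omega(\frac12\overline\rho\,\overline u^2+U(\overline\rho))A\,dx$. Let $(\overline\rho^n,\overline u^n)$ be measurable with $\overline\rho^n\ge0$ such that: (i) they are bounded and compactly supported in $\bar\Omega$; (ii) $(\overline\rho^n,\overline u^n)\to(\overline\rho,\overline u)$ in measure; (iii) $M^n[\overline\rho^n]=\overline M$ for all $n$; (iv) $\sup_nE^n[\overline\rho^n,\overline u^n]\le2\overline E$ and $E^n[\overline\rho^n,\overline u^n]\to\overline E$. Then $(\rho^n,u^n)$ is a sequence of entropy solutions of the Euler equations with geometry $A^n$ and initial data $(\overline\rho^n,\overline u^n)$ such that: for each $n$, $(\rho^n,u^n)$ is bounded in $L^\infty([0,\infty)\times\Omega)$ and has compact support in space for all times; $M^n[\rho^n](t)=M^n[\overline\rho^n]$ for a.e. $t$; the total energy $E^n[\rho^n,u^n](t)$ is nonincreasing in time, in particular $E^n[\rho^n,u^n](t)\le E^n[\overline\rho^n,\overline u^n]$ for a.e. $t$. In the spherically symmetric case $\rho^nu^nA^n$ vanishes at $x=0$. Riemann invariants: $\mathbf z=(\overline z,\underline z)$ with $\overline z=u+\rho^\theta$, $\underline z=u-\rho^\theta$; for $\mathbf a=(\overline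 a,\underline a)$, $\rho(\mathbf a)=\big((\overline a-\underline a)/2\big)^{1/\theta}$, $u(\mathbf a)=(\overline a+\underline a)/2$. Functions of $(\rho,u)$ are also regarded as functions of $\mathbf z$. State space: $H:=\{\mathbf a\in\mathbb R^2:\overline a>\underline a\}$. $\bar C(H)$ is the ring of bounded $\varphi\in C(\bar H)$ that are constant on the diagonal $\{\overline a=\underline a\}$ and for which $\mathbf a\mapsto\lim_{s\to\infty}\varphi(s\mathbf a)$ belongs to $C(S^1\cap\bar H)$. $\bar{\mathcal H}$ is the compact metrizable compactification of $H$ with $\bar C(H)\cong C(\bar{\mathcal H})$. $V\subset\bar{\mathcal H}$ (the vacuum) is the compactification of the diagonal (its points are not distinguished by the topology), $\mathcal H:=H\cup V$. The functions $\eta_\psi,q_\psi,\rho u\,\eta_{\psi,\rho}$ are zero on $V$. Young measure: after passing to a subsequence, $(\mathbf z^n)$ generates a weakly-$\star$ measurable map $\nu$ from $[0,\infty)\times\Omega$ to probability measures on $\bar{\mathcal H}$, i.e. $\varphi(\mathbf z^n)\rightharpoonup\int\varphi\,d\nu$ weakly-$\star$ in $L^\infty$ for all $\varphi\in C(\bar{\mathcal H})$. For a.e. $(t,x)$, $\nu_{(t,x)}$ is concentrated on $\mathcal H$ and $\int_{\mathcal H}(1+\rho(\mathbf a)^{\gamma+1})\,\nu_{(t,x)}(d\mathbf a)<\infty$. Notation: $\langle\varphi\rangle:=\int_{\mathcal H}\varphi(\mathbf a)\,\nu(d\mathbf a)$. *)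

theory Defs
  imports "HOL-Probability.Probability" "HOL-Library.Landau_Symbols"
begin

definition theta :: "real \<Rightarrow> real" where
  "theta \<gamma> = (\<gamma> - 1) / 2"

definition kappa :: "real \<Rightarrow> real" where
  "kappa \<gamma> = (theta \<gamma>)\<^sup>2 / \<gamma>"

definition lam :: "real \<Rightarrow> real" where
  "lam \<gamma> = (3 - \<gamma>) / (2 * (\<gamma> - 1))"

definition internal_energy :: "real \<Rightarrow> real \<Rightarrow> real" where
  "internal_energy \<gamma> r = kappa \<gamma> / (\<gamma> - 1) * r powr \<gamma>"

datatype geometry = Nozzle "real \<Rightarrow> real" | Spherical real

fun Omega :: "geometry \<Rightarrow> real set" where
  "Omega (Nozzle A) = UNIV"
| "Omega (Spherical \<alpha>) = {0<..}"

fun area :: "geometry \<Rightarrow> real \<Rightarrow> real" where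
  "area (Nozzle A) x = A x"
| "area (Spherical \<alpha>) x = x powr \<alpha>"

fun area_n :: "geometry \<Rightarrow> nat \<Rightarrow> real \<Rightarrow> real" where
  "area_n (Nozzle A) n x = A x"
| "area_n (Spherical \<alpha>) n x = (x + 1 / real n) powr \<alpha>"

definition neg_part :: "real \<Rightarrow> real" where
  "neg_part b = - min b 0"

definition admissible :: "geometry \<Rightarrow> bool" where
  "admissible G \<longleftrightarrow>
     (case G of
        Nozzle A \<Rightarrow> (\<exists>lo hi. 0 < lo \<and> lo < hi \<and> (\<forall>x. A x \<in> {lo..hi}))
      | Spherical \<alpha> \<Rightarrow> \<alpha> > 0) \<and>
     (\<forall>x\<in>Omega G. area G differentiable (at x)) \<and>
     continuous_on (Omega G) (deriv (area G)) \<and>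
     integrable (lebesgue_on (Omega G)) (\<lambda>x. neg_part (deriv (area G) x)) \<and>
     (\<exists>C. AE x in lebesgue_on (Omega G). neg_part (deriv (area G) x) \<le> C)"

text \<open>Points of space-time are pairs \<open>(t, x)\<close>.\<close>

definition spacetime :: "geometry \<Rightarrow> (real \<times> real) set" where
  "spacetime G = {0..} \<times> Omega G"

definition chi_kernel :: "real \<Rightarrow> real \<Rightarrow> real \<Rightarrow> real \<Rightarrow> real" where
  "chi_kernel \<gamma> s r v = (max 0 (r powr (2 * theta \<gamma>) - (s - v)\<^sup>2)) powr lam \<gamma>"

definition sigma_kernel :: "real \<Rightarrow> real \<Rightarrow> real \<Rightarrow> real \<Rightarrow> real" where
  "sigma_kernel \<gamma> s r v = (theta \<gamma> * s + (1 - theta \<gamma>) * v) * chi_kernel \<gamma> s r v"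

definition eta :: "real \<Rightarrow> (real \<Rightarrow> real) \<Rightarrow> real \<Rightarrow> real \<Rightarrow> real" where
  "eta \<gamma> \<psi> r v = (LBINT s. \<psi> s * chi_kernel \<gamma> s r v)"

definition q :: "real \<Rightarrow> (real \<Rightarrow> real) \<Rightarrow> real \<Rightarrow> real \<Rightarrow> real" where
  "q \<gamma> \<psi> r v = (LBINT s. \<psi> s * sigma_kernel \<gamma> s r v)"

text \<open>The function \<open>\<rho> u \<eta>\<^sub>\<psi>\<^sub>,\<^sub>\<rho>\<close>, the derivative being taken at fixed velocity. For \<open>r = 0\<close> the
  prefactor makes the value \<open>0\<close>, whatever \<^const>\<open>deriv\<close> returns there.\<close>

definition ru_eta_r :: "real \<Rightarrow> (real \<Rightarrow> real) \<Rightarrow> real \<Rightarrow> real \<Rightarrow> real" where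
  "ru_eta_r \<gamma> \<psi> r v = r * v * deriv (\<lambda>r'. eta \<gamma> \<psi> r' v) r"

definition C2 :: "(real \<Rightarrow> real) \<Rightarrow> bool" where
  "C2 \<psi> \<longleftrightarrow> (\<forall>s. \<psi> differentiable (at s)) \<and> (\<forall>s. deriv \<psi> differentiable (at s)) \<and>
     continuous_on UNIV (deriv (deriv \<psi>))"

text \<open>Growth strictly below the power \<open>k\<close>: \<open>\<psi>(s) / |s|\<^sup>k\<close> tends to \<open>0\<close> at infinity.\<close>

definition growth_below :: "nat \<Rightarrow> (real \<Rightarrow> real) \<Rightarrow> bool" where
  "growth_below k \<psi> \<longleftrightarrow> \<psi> \<in> o[at_infinity](\<lambda>s. \<bar>s\<bar> ^ k)"

definition d_t :: "(real \<times> real \<Rightarrow> real) \<Rightarrow> real \<times> real \<Rightarrow> real" where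
  "d_t \<phi> = (\<lambda>(t, x). deriv (\<lambda>s. \<phi> (s, x)) t)"

definition d_x :: "(real \<times> real \<Rightarrow> real) \<Rightarrow> real \<times> real \<Rightarrow> real" where
  "d_x \<phi> = (\<lambda>(t, x). deriv (\<lambda>y. \<phi> (t, y)) x)"

fun Ck :: "nat \<Rightarrow> (real \<times> real \<Rightarrow> real) \<Rightarrow> bool" where
  "Ck 0 \<phi> \<longleftrightarrow> continuous_on UNIV \<phi>"
| "Ck (Suc k) \<phi> \<longleftrightarrow> (\<forall>p. \<phi> differentiable (at p)) \<and> Ck k (d_t \<phi>) \<and> Ck k (d_x \<phi>)"

text \<open>Test functions for \<open>[0,\<infinity>) \<times> \<Omega>\<close>: restrictions to \<open>t \<ge> 0\<close> of smooth functions with compact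
  support in \<open>\<real> \<times> \<Omega>\<close>. They need not vanish at \<open>t = 0\<close>, so that the inequality below also encodes
  the initial data.\<close>

definition test_function :: "real set \<Rightarrow> (real \<times> real \<Rightarrow> real) \<Rightarrow> bool" where
  "test_function \<Omega> \<phi> \<longleftrightarrow> (\<forall>k. Ck k \<phi>) \<and>
     (\<exists>K. compact K \<and> K \<subseteq> UNIV \<times> \<Omega> \<and> (\<forall>p. p \<notin> K \<longrightarrow> \<phi> p = 0))"

definition entropy_solution ::
  "real \<Rightarrow> real set \<Rightarrow> (real \<Rightarrow> real) \<Rightarrow> (real \<Rightarrow> real) \<Rightarrow> (real \<Rightarrow> real) \<Rightarrow>
   (real \<times> real \<Rightarrow> real) \<Rightarrow> (real \<times> real \<Rightarrow> real) \<Rightarrow> bool" where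
  "entropy_solution \<gamma> \<Omega> B \<rho>i ui \<rho> u \<longleftrightarrow>
     (\<forall>\<psi> \<phi>. convex_on UNIV \<psi> \<and> C2 \<psi> \<and> growth_below 2 \<psi> \<and> test_function \<Omega> \<phi> \<and> (\<forall>p. \<phi> p \<ge> 0) \<longrightarrow>
        0 \<le> (\<integral>p. eta \<gamma> \<psi> (\<rho> p) (u p) * B (snd p) * d_t \<phi> p
                + q \<gamma> \<psi> (\<rho> p) (u p) * B (snd p) * d_x \<phi> p
                - (ru_eta_r \<gamma> \<psi> (\<rho> p) (u p) - q \<gamma> \<psi> (\<rho> p) (u p)) * deriv B (snd p) * \<phi> p
              \<partial>lebesgue_on ({0..} \<times> \<Omega>))
            + (\<integral>x. eta \<gamma> \<psi> (\<rho>i x) (ui x) * B x * \<phi> (0, x) \<partial>lebesgue_on \<Omega>))"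

definition mass :: "real set \<Rightarrow> (real \<Rightarrow> real) \<Rightarrow> (real \<Rightarrow> real) \<Rightarrow> ennreal" where
  "mass \<Omega> B r = (\<integral>\<^sup>+x. ennreal (r x * B x) \<partial>lebesgue_on \<Omega>)"

definition energy ::
  "real \<Rightarrow> real set \<Rightarrow> (real \<Rightarrow> real) \<Rightarrow> (real \<Rightarrow> real) \<Rightarrow> (real \<Rightarrow> real) \<Rightarrow> ennreal" where
  "energy \<gamma> \<Omega> B r v =
     (\<integral>\<^sup>+x. ennreal ((1/2 * r x * (v x)\<^sup>2 + internal_energy \<gamma> (r x)) * B x) \<partial>lebesgue_on \<Omega>)"

definition finite_energy_data ::
  "real \<Rightarrow> geometry \<Rightarrow> (real \<Rightarrow> real) \<Rightarrow> (real \<Rightarrow> real) \<Rightarrow> bool" where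
  "finite_energy_data \<gamma> G \<rho>0 u0 \<longleftrightarrow>
     \<rho>0 \<in> borel_measurable (lebesgue_on (Omega G)) \<and>
     u0 \<in> borel_measurable (lebesgue_on (Omega G)) \<and>
     (AE x in lebesgue_on (Omega G). \<rho>0 x \<ge> 0) \<and>
     mass (Omega G) (area G) \<rho>0 < \<infinity> \<and>
     energy \<gamma> (Omega G) (area G) \<rho>0 u0 < \<infinity>"

text \<open>Convergence in measure on every set of finite measure, which is implied by convergence in
  measure on all of \<open>\<Omega>\<close>.\<close>

definition tendsto_in_measure ::
  "real set \<Rightarrow> (nat \<Rightarrow> real \<Rightarrow> real) \<Rightarrow> (real \<Rightarrow> real) \<Rightarrow> bool" where
  "tendsto_in_measure \<Omega> f g \<longleftrightarrow>
     (\<forall>B\<in>sets lebesgue. B \<subseteq> \<Omega> \<and> emeasure lebesgue B < \<infinity> \<longrightarrow>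
        (\<forall>\<epsilon>>0. (\<lambda>n. emeasure lebesgue {x\<in>B. \<bar>f n x - g x\<bar> > \<epsilon>}) \<longlonglongrightarrow> 0))"

text \<open>All sequences start at index \<open>1\<close>; their values at \<open>0\<close> are irrelevant.\<close>

definition approximate_data ::
  "real \<Rightarrow> geometry \<Rightarrow> (real \<Rightarrow> real) \<Rightarrow> (real \<Rightarrow> real) \<Rightarrow>
   (nat \<Rightarrow> real \<Rightarrow> real) \<Rightarrow> (nat \<Rightarrow> real \<Rightarrow> real) \<Rightarrow> bool" where
  "approximate_data \<gamma> G \<rho>0 u0 \<rho>i ui \<longleftrightarrow>
     (\<forall>n\<ge>1. \<rho>i n \<in> borel_measurable (lebesgue_on (Omega G)) \<and>
            ui n \<in> borel_measurable (lebesgue_on (Omega G)) \<and>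
            (AE x in lebesgue_on (Omega G). \<rho>i n x \<ge> 0) \<and>
            (\<exists>C. AE x in lebesgue_on (Omega G). \<bar>\<rho>i n x\<bar> \<le> C \<and> \<bar>ui n x\<bar> \<le> C) \<and>
            (\<exists>R. AE x in lebesgue_on (Omega G). \<bar>x\<bar> > R \<longrightarrow> \<rho>i n x = 0 \<and> ui n x = 0)) \<and>
     tendsto_in_measure (Omega G) \<rho>i \<rho>0 \<and>
     tendsto_in_measure (Omega G) ui u0 \<and>
     (\<forall>n\<ge>1. mass (Omega G) (area_n G n) (\<rho>i n) = mass (Omega G) (area G) \<rho>0) \<and>
     (\<forall>n\<ge>1. energy \<gamma> (Omega G) (area_n G n) (\<rho>i n) (ui n)
               \<le> 2 * energy \<gamma> (Omega G) (area G) \<rho>0 u0) \<and>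
     (\<lambda>n. energy \<gamma> (Omega G) (area_n G n) (\<rho>i n) (ui n))
        \<longlonglongrightarrow> energy \<gamma> (Omega G) (area G) \<rho>0 u0"

text \<open>Vanishing of a function of \<open>(t, x)\<close> at \<open>x = 0\<close>, in the sense of \<open>L\<^sup>1\<close> traces.\<close>

definition vanishes_at_origin :: "(real \<times> real \<Rightarrow> real) \<Rightarrow> bool" where
  "vanishes_at_origin f \<longleftrightarrow>
     (\<forall>T>0. ((\<lambda>\<epsilon>. 1 / \<epsilon> * (\<integral>p. \<bar>f p\<bar> \<partial>lebesgue_on ({0..T} \<times> {0<..<\<epsilon>}))) \<longlongrightarrow> 0) (at_right 0))"

definition approximate_solutions ::
  "real \<Rightarrow> geometry \<Rightarrow> (nat \<Rightarrow> real \<Rightarrow> real) \<Rightarrow> (nat \<Rightarrow> real \<Rightarrow> real) \<Rightarrow>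
   (nat \<Rightarrow> real \<times> real \<Rightarrow> real) \<Rightarrow> (nat \<Rightarrow> real \<times> real \<Rightarrow> real) \<Rightarrow> bool" where
  "approximate_solutions \<gamma> G \<rho>i ui \<rho> u \<longleftrightarrow> (\<forall>n\<ge>1.
     \<rho> n \<in> borel_measurable (lebesgue_on (spacetime G)) \<and>
     u n \<in> borel_measurable (lebesgue_on (spacetime G)) \<and>
     (AE p in lebesgue_on (spacetime G). \<rho> n p \<ge> 0) \<and>
     entropy_solution \<gamma> (Omega G) (area_n G n) (\<rho>i n) (ui n) (\<rho> n) (u n) \<and>
     (\<exists>C. AE p in lebesgue_on (spacetime G). \<bar>\<rho> n p\<bar> \<le> C \<and> \<bar>u n p\<bar> \<le> C) \<and>
     (AE t in lebesgue_on {0..}. \<exists>R. AE x in lebesgue_on (Omega G).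
         \<bar>x\<bar> > R \<longrightarrow> \<rho> n (t, x) = 0 \<and> u n (t, x) = 0) \<and>
     (AE t in lebesgue_on {0..}.
         mass (Omega G) (area_n G n) (\<lambda>x. \<rho> n (t, x)) = mass (Omega G) (area_n G n) (\<rho>i n)) \<and>
     (\<exists>N\<in>null_sets lebesgue. \<forall>s t. 0 \<le> s \<and> s \<le> t \<and> s \<notin> N \<and> t \<notin> N \<longrightarrow>
         energy \<gamma> (Omega G) (area_n G n) (\<lambda>x. \<rho> n (t, x)) (\<lambda>x. u n (t, x))
           \<le> energy \<gamma> (Omega G) (area_n G n) (\<lambda>x. \<rho> n (s, x)) (\<lambda>x. u n (s, x))) \<and>
     (AE t in lebesgue_on {0..}.
         energy \<gamma> (Omega G) (area_n G n) (\<lambda>x. \<rho> n (t, x)) (\<lambda>x. u n (t, x))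
           \<le> energy \<gamma> (Omega G) (area_n G n) (\<rho>i n) (ui n)) \<and>
     (case G of
        Nozzle A \<Rightarrow> True
      | Spherical \<alpha> \<Rightarrow> vanishes_at_origin (\<lambda>p. \<rho> n p * u n p * area_n G n (snd p))))"

text \<open>A vector of Riemann invariants is a pair \<open>(upper, lower)\<close>.\<close>

definition riemann :: "real \<Rightarrow> real \<Rightarrow> real \<Rightarrow> real \<times> real" where
  "riemann \<gamma> r v = (v + r powr theta \<gamma>, v - r powr theta \<gamma>)"

definition dens :: "real \<Rightarrow> real \<times> real \<Rightarrow> real" where
  "dens \<gamma> a = ((fst a - snd a) / 2) powr (1 / theta \<gamma>)"

definition vel :: "real \<times> real \<Rightarrow> real" where
  "vel a = (fst a + snd a) / 2"

definition of_riemann :: "real \<Rightarrow> (real \<Rightarrow> real \<Rightarrow> real) \<Rightarrow> real \<times> real \<Rightarrow> real" where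
  "of_riemann \<gamma> f a = f (dens \<gamma> a) (vel a)"

definition H_cl :: "(real \<times> real) set" where
  "H_cl = {a. fst a \<ge> snd a}"

text \<open>The ring of admissible functions. The radial limit is required to be attained uniformly with
  respect to the direction: with mere pointwise limits the ring would contain, for instance, all
  bounded continuous functions supported near a parabola, and the associated compactification would
  not be metrizable.\<close>

definition C_bar :: "(real \<times> real \<Rightarrow> real) set" where
  "C_bar = {\<phi>. continuous_on H_cl \<phi> \<and> bounded (\<phi> ` H_cl) \<and>
     (\<exists>c. \<forall>s. \<phi> (s, s) = c) \<and>
     (\<exists>g. continuous_on (sphere 0 1 \<inter> H_cl) g \<and>
          uniform_limit (sphere 0 1 \<inter> H_cl) (\<lambda>s a. \<phi> (s *\<^sub>R a)) g at_top)}"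

text \<open>The compactification \<open>X\<close> of \<open>H\<close> with \<open>C(X)\<close> isomorphic to the ring \<^const>\<open>C_bar\<close>, in its
  standard realization: the closure, in the product topology, of the image of \<open>H\<close> under evaluation
  of all functions of the ring. Evaluation is also defined on the diagonal, which it collapses to a
  single point (the vacuum), since the functions of the ring are constant there.\<close>

definition ev :: "real \<times> real \<Rightarrow> (real \<times> real \<Rightarrow> real) \<Rightarrow> real" where
  "ev a = (\<lambda>\<phi>. if \<phi> \<in> C_bar then \<phi> a else 0)"

definition H_bar :: "((real \<times> real \<Rightarrow> real) \<Rightarrow> real) set" where
  "H_bar = closure (ev ` {a. fst a > snd a})"

definition vacuum :: "((real \<times> real \<Rightarrow> real) \<Rightarrow> real) set" where
  "vacuum = closure (ev ` {a. fst a = snd a})"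

definition H_vac :: "((real \<times> real \<Rightarrow> real) \<Rightarrow> real) set" where
  "H_vac = ev ` {a. fst a > snd a} \<union> vacuum"

text \<open>A function \<open>f\<close> of the Riemann invariants in \<open>H\<close>, regarded as a function on \<^const>\<open>H_vac\<close> that
  vanishes on the vacuum.\<close>

definition on_H_vac :: "(real \<times> real \<Rightarrow> real) \<Rightarrow> ((real \<times> real \<Rightarrow> real) \<Rightarrow> real) \<Rightarrow> real" where
  "on_H_vac f \<xi> = (if \<xi> \<in> vacuum then 0 else f (inv_into {a. fst a > snd a} ev \<xi>))"

definition generates_young_measure ::
  "real \<Rightarrow> (real \<times> real) set \<Rightarrow> (nat \<Rightarrow> real \<times> real \<Rightarrow> real \<times> real) \<Rightarrow>
   (real \<times> real \<Rightarrow> ((real \<times> real \<Rightarrow> real) \<Rightarrow> real) measure) \<Rightarrow> bool" where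
  "generates_young_measure \<gamma> S z \<nu> \<longleftrightarrow>
     (\<forall>p\<in>S. prob_space (\<nu> p) \<and> sets (\<nu> p) = sets (restrict_space borel H_bar)) \<and>
     (\<forall>\<Phi> :: ((real \<times> real \<Rightarrow> real) \<Rightarrow> real) \<Rightarrow> real. continuous_on H_bar \<Phi> \<longrightarrow>
        (\<lambda>p. \<integral>\<xi>. \<Phi> \<xi> \<partial>\<nu> p) \<in> borel_measurable (lebesgue_on S) \<and>
        (\<forall>g. integrable (lebesgue_on S) g \<longrightarrow>
           (\<lambda>n. \<integral>p. \<Phi> (ev (z n p)) * g p \<partial>lebesgue_on S)
             \<longlonglongrightarrow> (\<integral>p. (\<integral>\<xi>. \<Phi> \<xi> \<partial>\<nu> p) * g p \<partial>lebesgue_on S))) \<and>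
     (AE p in lebesgue_on S. AE \<xi> in \<nu> p. \<xi> \<in> H_vac) \<and>
     (AE p in lebesgue_on S.
        (\<integral>\<^sup>+\<xi>\<in>H_vac. ennreal (1 + on_H_vac (\<lambda>a. dens \<gamma> a powr (\<gamma> + 1)) \<xi>) \<partial>\<nu> p) < \<infinity>)"

definition mean ::
  "(real \<times> real \<Rightarrow> ((real \<times> real \<Rightarrow> real) \<Rightarrow> real) measure) \<Rightarrow> (real \<times> real \<Rightarrow> real) \<Rightarrow>
   real \<times> real \<Rightarrow> real" where
  "mean \<nu> f p = (\<integral>\<xi>\<in>H_vac. on_H_vac f \<xi> \<partial>\<nu> p)"

text \<open>The mean is meaningful almost everywhere (otherwise the integral above is \<open>0\<close> by
  convention).\<close>

definition has_mean ::
  "(real \<times> real) set \<Rightarrow> (real \<times> real \<Rightarrow> ((real \<times> real \<Rightarrow> real) \<Rightarrow> real) measure) \<Rightarrow>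
   (real \<times> real \<Rightarrow> real) \<Rightarrow> bool" where
  "has_mean S \<nu> f \<longleftrightarrow> (AE p in lebesgue_on S. set_integrable (\<nu> p) H_vac (on_H_vac f))"

text \<open>Weak convergence in \<open>L\<^sup>1\<close> on every compact subset of the closure of \<open>S\<close>; the boundary
  of \<open>S\<close> is a null set in the application.\<close>

definition weakly_L1_loc ::
  "(real \<times> real) set \<Rightarrow> (nat \<Rightarrow> real \<times> real \<Rightarrow> real) \<Rightarrow> (real \<times> real \<Rightarrow> real) \<Rightarrow> bool" where
  "weakly_L1_loc S F f \<longleftrightarrow> (\<forall>K. compact K \<and> K \<subseteq> closure S \<longrightarrow>
     (\<forall>n\<ge>1. integrable (lebesgue_on (K \<inter> S)) (F n)) \<and>
     integrable (lebesgue_on (K \<inter> S)) f \<and>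
     (\<forall>g. g \<in> borel_measurable (lebesgue_on (K \<inter> S)) \<and>
          (\<exists>C. AE p in lebesgue_on (K \<inter> S). \<bar>g p\<bar> \<le> C) \<longrightarrow>
        (\<lambda>n. \<integral>p. F n p * g p \<partial>lebesgue_on (K \<inter> S))
          \<longlonglongrightarrow> (\<integral>p. f p * g p \<partial>lebesgue_on (K \<inter> S))))"

definition young_limit ::
  "geometry \<Rightarrow> (nat \<Rightarrow> real \<times> real \<Rightarrow> real \<times> real) \<Rightarrow>
   (real \<times> real \<Rightarrow> ((real \<times> real \<Rightarrow> real) \<Rightarrow> real) measure) \<Rightarrow> (real \<times> real \<Rightarrow> real) \<Rightarrow> bool" where
  "young_limit G z \<nu> f \<longleftrightarrow>
     has_mean (spacetime G) \<nu> f \<and>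
     weakly_L1_loc (spacetime G)
       (\<lambda>n p. f (z n p) * area_n G n (snd p))
       (\<lambda>p. mean \<nu> f p * area G (snd p))"

end

theory Submission
  imports Defs "HOL-Computational_Algebra.Polynomial"
begin

text \<open>By the Young measure alone the limits hold for functions that are truncated at infinity; the
  point is to control the tails. Substituting \<open>s = u + \<rho>\<^sup>\<theta> y\<close>, all functions involved are \<open>\<rho>\<close> times a
  function of \<open>v = u\<close> and \<open>c = \<rho>\<^sup>\<theta>\<close> that is small at infinity relative to \<open>|v|\<^sup>3 + c\<^sup>3\<close>, so it suffices to
  bound \<open>\<rho> (|v|\<^sup>3 + c\<^sup>3) A\<^sup>n\<close> in \<open>L\<^sup>1\<close> locally, uniformly in \<open>n\<close>. The weight \<open>s |s|\<close> would give such a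
  bound, its flux being coercive, but it is not convex. Up to lower order it is the difference of \<open>s\<^sup>2\<close>
  and of twice a smoothed \<open>((s)\<^sub>-)\<^sup>2\<close>, both convex. The entropy inequality for the latter is tested with an
  increasing function \<open>h\<close> of \<open>x\<close>, and that for \<open>s\<^sup>2\<close> with \<open>k = const - h\<close>, so that both fluxes enter with
  the good sign. In a nozzle, \<open>h\<close> grows exponentially at the rate of \<open>(A')\<^sub>-\<close>, which absorbs the
  geometric source term; integrability of \<open>(A')\<^sub>-\<close> keeps \<open>h\<close> bounded. In spherical symmetry
  \<open>h = 1 - exp (- x)\<close> works; near \<open>x = 0\<close>, the function \<open>h\<close> is small and the momentum in the flux of \<open>s\<^sup>2\<close>
  vanishes.\<close>

section \<open>Entropies as averages over a fixed interval\<close>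

text \<open>Mass and energy control only \<open>\<rho> (1 + v^2 + c^2)\<close>, one power short of
  the fluxes. The missing power is the flux of an entropy, which the time integrated inequality
  controls once it is tested with a function that is monotone in \<open>x\<close>. Only inequalities
  are available, and only for nonnegative test functions; hence a weight that is not convex is
  accessible only through convex ones, each with a test function of its own. No bound on the
  approximate solutions in the sup norm is uniform in \<open>n\<close>. Such a norm enters twice: in
  replacing \<open>s^2\<close> and \<open>bend 0\<close>, which grow too fast to be admissible, by
  convex functions of linear growth with the same values on the range of the solution; and in the
  terms with the derivative of the spatial cutoff. The replacement leaves no trace in the estimate,
  and those terms vanish for each fixed solution when the cutoff is removed. The final constant
  depends on the geometry, the compact set and the initial mass and energy. The range
  \<open>\<gamma> \<le> 5/3\<close> means \<open>1 \<le> lam \<gamma>\<close>, which keeps the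
  profile \<open>wgtr\<close> of the density derivative bounded.\<close>

definition avg :: "(real \<Rightarrow> real) \<Rightarrow> (real \<Rightarrow> real) \<Rightarrow> real \<Rightarrow> real \<Rightarrow> real" where
  "avg \<kappa> \<psi> v c = integral {-1..1} (\<lambda>y. \<kappa> y * \<psi> (v + c * y))"

lemma avg_integrable:
  fixes \<kappa> \<psi> :: "real \<Rightarrow> real"
  assumes "continuous_on {-1..1} \<kappa>" "continuous_on UNIV \<psi>"
  shows "(\<lambda>y. \<kappa> y * \<psi> (v + c * y)) integrable_on {-1..1}"
  by (intro integrable_continuous_real continuous_intros assms continuous_on_compose2[OF assms(2)])
     auto

lemma continuous_avg:
  assumes "continuous_on {-1..1} \<kappa>" "continuous_on UNIV \<psi>"
  shows "continuous_on UNIV (\<lambda>p. avg \<kappa> \<psi> (fst p) (snd p))"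
proof -
  have "continuous_on (UNIV \<times> cbox (-1) 1) (\<lambda>(p, y). \<kappa> y * \<psi> (fst p + snd p * y))"
    unfolding split_beta
    by (intro continuous_intros continuous_on_compose2[OF assms(1)] continuous_on_compose2[OF assms(2)])
       auto
  from integral_continuous_on_param[OF this] show ?thesis
    unfolding avg_def by (simp add: cbox_interval)
qed

lemma avg_abs_le:
  assumes "continuous_on {-1..1} \<kappa>" "continuous_on UNIV \<psi>"
    and "\<And>y. y \<in> {-1..1} \<Longrightarrow> \<bar>\<kappa> y\<bar> \<le> k" and "\<And>y. y \<in> {-1..1} \<Longrightarrow> \<bar>\<psi> (v + c * y)\<bar> \<le> b"
  shows "\<bar>avg \<kappa> \<psi> v c\<bar> \<le> 2 * k * b"
proof -
  have "norm (avg \<kappa> \<psi> v c) \<le> (k * b) * (1 - (-1))"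
    unfolding avg_def
  proof (rule integral_bound)
    fix y :: real assume "y \<in> {-1..1}"
    then show "norm (\<kappa> y * \<psi> (v + c * y)) \<le> k * b"
      using assms(3,4)[of y] by (auto simp: abs_mult intro!: mult_mono intro: order_trans[OF abs_ge_zero])
  qed (auto intro!: continuous_intros assms continuous_on_compose2[OF assms(2)])
  then show ?thesis by simp
qed

lemma avg_cong:
  assumes "\<And>y. y \<in> {-1..1} \<Longrightarrow> \<psi>1 (v + c * y) = \<psi>2 (v + c * y)"
  shows "avg \<kappa> \<psi>1 v c = avg \<kappa> \<psi>2 v c"
  unfolding avg_def by (rule Henstock_Kurzweil_Integration.integral_cong) (simp add: assms)

lemma avg_add:
  assumes "continuous_on {-1..1} \<kappa>" "continuous_on UNIV \<psi>1" "continuous_on UNIV \<psi>2"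
  shows "avg \<kappa> (\<lambda>s. \<psi>1 s + \<psi>2 s) v c = avg \<kappa> \<psi>1 v c + avg \<kappa> \<psi>2 v c"
proof -
  have "avg \<kappa> (\<lambda>s. \<psi>1 s + \<psi>2 s) v c =
      integral {-1..1} (\<lambda>y. \<kappa> y * \<psi>1 (v + c * y) + \<kappa> y * \<psi>2 (v + c * y))"
    unfolding avg_def by (simp add: algebra_simps)
  also have "\<dots> = avg \<kappa> \<psi>1 v c + avg \<kappa> \<psi>2 v c"
    unfolding avg_def by (intro integral_add avg_integrable assms)
  finally show ?thesis .
qed

lemma avg_cmult: "avg \<kappa> (\<lambda>s. a * \<psi> s) v c = a * avg \<kappa> \<psi> v c"
  unfolding avg_def by (simp flip: integral_mult_right add: ac_simps)

lemma avg_add_weight: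
  assumes "continuous_on {-1..1} \<kappa>1" "continuous_on {-1..1} \<kappa>2" "continuous_on UNIV \<psi>"
  shows "avg (\<lambda>y. a * \<kappa>1 y + b * \<kappa>2 y) \<psi> v c = a * avg \<kappa>1 \<psi> v c + b * avg \<kappa>2 \<psi> v c"
proof -
  have "avg (\<lambda>y. a * \<kappa>1 y + b * \<kappa>2 y) \<psi> v c =
      integral {-1..1} (\<lambda>y. a * (\<kappa>1 y * \<psi> (v + c * y)) + b * (\<kappa>2 y * \<psi> (v + c * y)))"
    unfolding avg_def by (simp add: algebra_simps)
  also have "\<dots> = integral {-1..1} (\<lambda>y. a * (\<kappa>1 y * \<psi> (v + c * y))) +
       integral {-1..1} (\<lambda>y. b * (\<kappa>2 y * \<psi> (v + c * y)))"
    by (intro integral_add integrable_on_mult_right avg_integrable assms)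
  finally show ?thesis unfolding avg_def by simp
qed

lemma avg_deriv:
  assumes "continuous_on {-1..1} \<kappa>" "\<And>s. (\<psi> has_real_derivative \<psi>' s) (at s)" "continuous_on UNIV \<psi>'"
  shows "((\<lambda>c. avg \<kappa> \<psi> v c) has_real_derivative avg (\<lambda>y. y * \<kappa> y) \<psi>' v c) (at c)"
proof -
  have c: "continuous_on UNIV \<psi>"
    using assms(2) by (meson DERIV_continuous continuous_at_imp_continuous_on)
  have "((\<lambda>c. integral (cbox (-1) 1) (\<lambda>y. \<kappa> y * \<psi> (v + c * y))) has_field_derivative
     integral (cbox (-1) 1) (\<lambda>y. y * \<kappa> y * \<psi>' (v + c * y))) (at c within UNIV)"
  proof (rule leibniz_rule_field_derivative)
    fix x t :: real
    show "((\<lambda>c. \<kappa> t * \<psi> (v + c * t)) has_real_derivative t * \<kappa> t * \<psi>' (v + x * t)) (at x within UNIV)"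
      by (auto intro!: derivative_eq_intros DERIV_chain2[OF assms(2)])
    show "(\<lambda>t. \<kappa> t * \<psi> (v + x * t)) integrable_on cbox (-1) 1"
      using avg_integrable[OF assms(1) c] by (simp add: cbox_interval)
    show "continuous_on (UNIV \<times> cbox (-1) 1) (\<lambda>(x, t). t * \<kappa> t * \<psi>' (v + x * t))"
      unfolding split_beta
      by (intro continuous_intros continuous_on_compose2[OF assms(1)] continuous_on_compose2[OF assms(3)])
        auto
  qed auto
  then show ?thesis by (simp add: avg_def cbox_interval)
qed

section \<open>The rescaled kernel and integral formulas for entropy, flux and density
  derivative\<close>

definition wgt :: "real \<Rightarrow> real \<Rightarrow> real" where
  "wgt \<gamma> y = max 0 (1 - y\<^sup>2) powr lam \<gamma>"

text \<open>The case distinction repairs \<open>0 powr 0 = 0\<close> and makes the function continuous.\<close>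
definition wgt1 :: "real \<Rightarrow> real \<Rightarrow> real" where
  "wgt1 \<gamma> y = (if lam \<gamma> = 1 then 1 else max 0 (1 - y\<^sup>2) powr (lam \<gamma> - 1))"

text \<open>The profile of the density derivative of the entropy. Differentiating
  \<open>r * avg (wgt \<gamma>) \<psi> v (r powr theta \<gamma>)\<close> in \<open>r\<close>
  produces a term with the derivative of \<open>\<psi>\<close>; integrating it by parts in
  \<open>y\<close> moves the derivative to \<open>y * wgt \<gamma> y\<close>, and the two terms add
  up to this weight.\<close>

definition wgtr :: "real \<Rightarrow> real \<Rightarrow> real" where
  "wgtr \<gamma> y = (1 - theta \<gamma>) * wgt \<gamma> y + theta \<gamma> * (2 * lam \<gamma> * y\<^sup>2 * wgt1 \<gamma> y)"

locale exponent =
  fixes \<gamma> :: real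
  assumes gamma_gt: "1 < \<gamma>" and gamma_le: "\<gamma> \<le> 5/3"
begin

lemma theta_bounds: "0 < theta \<gamma>" "theta \<gamma> \<le> 1/3"
  using gamma_gt gamma_le by (auto simp: theta_def)

text \<open>This is where \<open>\<gamma> \<le> 5/3\<close> enters: the exponent
  \<open>lam \<gamma> - 1\<close> of \<open>wgt1\<close> is nonnegative, so that \<open>wgt1\<close>
  has no singularity at the end points.\<close>

lemma lam_ge: "1 \<le> lam \<gamma>"
  using gamma_gt gamma_le by (simp add: lam_def field_simps)

text \<open>Homogeneity: with \<open>c = r powr theta \<gamma>\<close> the kernel contributes
  \<open>c powr (2 * lam \<gamma>)\<close> and the substitution in the integral one more
  \<open>c\<close>; by this identity the product is exactly the density.\<close>

lemma theta_lam: "theta \<gamma> * (2 * lam \<gamma> + 1) = 1"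
  using gamma_gt by (simp add: theta_def lam_def field_simps)

lemma continuous_wgt: "continuous_on A (wgt \<gamma>)"
  unfolding wgt_def using lam_ge by (intro continuous_on_powr' continuous_intros) auto

lemma continuous_wgt1: "continuous_on A (wgt1 \<gamma>)"
proof (cases "lam \<gamma> = 1")
  case False
  then have "lam \<gamma> > 1" using lam_ge by simp
  then have "continuous_on A (\<lambda>y. max 0 (1 - y\<^sup>2) powr (lam \<gamma> - 1))"
    by (intro continuous_on_powr' continuous_intros) auto
  with False show ?thesis by (simp add: wgt1_def[abs_def])
qed (simp add: wgt1_def[abs_def])

lemma continuous_wgtr: "continuous_on A (wgtr \<gamma>)"
  unfolding wgtr_def by (intro continuous_intros continuous_wgt continuous_wgt1)

lemma wgt_nonneg: "0 \<le> wgt \<gamma> y"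
  by (simp add: wgt_def)

lemma wgt_le_1: "wgt \<gamma> y \<le> 1"
  using lam_ge powr_mono2[of "lam \<gamma>" "max 0 (1 - y\<^sup>2)" 1] by (simp add: wgt_def)

lemma wgt_minus: "wgt \<gamma> (- y) = wgt \<gamma> y"
  by (simp add: wgt_def)

lemma wgt_zero: "1 \<le> \<bar>y\<bar> \<Longrightarrow> wgt \<gamma> y = 0"
  by (simp add: wgt_def abs_le_square_iff[of 1, simplified])

text \<open>Confined to the open interval, since for \<open>lam \<gamma> = 1\<close> the profile has
  corners at the end points. That case is separate because \<open>wgt1\<close> has a branch for
  it.\<close>

lemma wgt_deriv:
  assumes "\<bar>y\<bar> < 1"
  shows "(wgt \<gamma> has_real_derivative - 2 * lam \<gamma> * y * wgt1 \<gamma> y) (at y)"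
proof -
  have pos: "0 < 1 - y\<^sup>2" using assms by (simp add: abs_square_less_1)
  have "open {x::real. 0 < 1 - x\<^sup>2}" by (intro open_Collect_less continuous_intros)
  then have ev: "\<forall>\<^sub>F x in nhds y. 0 < 1 - x\<^sup>2" using pos by (auto simp: eventually_nhds)
  have "((\<lambda>y. (1 - y\<^sup>2) powr lam \<gamma>) has_real_derivative - 2 * lam \<gamma> * y * wgt1 \<gamma> y) (at y)"
  proof (cases "lam \<gamma> = 1")
    case True
    have "\<forall>\<^sub>F x in nhds y. (1 - x\<^sup>2) powr lam \<gamma> = 1 - x\<^sup>2"
      using ev by eventually_elim (simp add: True)
    moreover have "((\<lambda>x. 1 - x\<^sup>2) has_real_derivative - 2 * lam \<gamma> * y * wgt1 \<gamma> y) (at y)"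
      by (auto intro!: derivative_eq_intros simp: wgt1_def True)
    ultimately show ?thesis by (subst DERIV_cong_ev[OF refl _ refl]) auto
  qed (use pos in \<open>auto intro!: derivative_eq_intros simp: wgt1_def\<close>)
  moreover have "\<forall>\<^sub>F x in nhds y. wgt \<gamma> x = (1 - x\<^sup>2) powr lam \<gamma>"
    using ev by eventually_elim (simp add: wgt_def)
  ultimately show ?thesis by (subst DERIV_cong_ev[OF refl _ refl]) auto
qed

lemma chi_kernel_scaled:
  assumes c: "c = r powr theta \<gamma>"
  shows "chi_kernel \<gamma> (v + c * y) r v * c = \<bar>r\<bar> * wgt \<gamma> y"
proof (cases "r = 0")
  case False
  then have cp: "c > 0" using c by simp
  have c2: "r powr (2 * theta \<gamma>) = c\<^sup>2"
    by (simp add: c power2_eq_square flip: powr_add)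
  have scale: "c\<^sup>2 powr lam \<gamma> * c = \<bar>r\<bar>"
  proof -
    have "(c\<^sup>2) powr lam \<gamma> * c = c powr (2 * lam \<gamma> + 1)"
      using cp by (simp add: powr_add flip: powr_powr)
    also have "\<dots> = \<bar>r\<bar>"
      using False by (simp add: c powr_powr theta_lam)
    finally show ?thesis .
  qed
  have "max 0 (c\<^sup>2 - (c*y)\<^sup>2) = c\<^sup>2 * max 0 (1 - y\<^sup>2)"
    using cp by (simp add: max_def algebra_simps power_mult_distrib mult_le_cancel_left1)
  then have "chi_kernel \<gamma> (v + c * y) r v * c = (c\<^sup>2 powr lam \<gamma> * c) * wgt \<gamma> y"
    by (simp add: chi_kernel_def c2 powr_mult wgt_def)
  then show ?thesis by (simp only: scale)
qed (simp add: c)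

lemma lborel_avg:
  assumes "continuous_on UNIV g"
  shows "(LBINT y. wgt \<gamma> y * g y) = integral {-1..1} (\<lambda>y. wgt \<gamma> y * g y)"
proof -
  have i: "set_integrable lborel {-1..1} (\<lambda>y. wgt \<gamma> y * g y)"
    by (intro borel_integrable_atLeastAtMost' continuous_intros continuous_wgt continuous_on_subset[OF assms]) auto
  have "(LBINT y. wgt \<gamma> y * g y) = (LBINT y:{-1..1}. wgt \<gamma> y * g y)"
    unfolding set_lebesgue_integral_def
    using wgt_zero by (intro Bochner_Integration.integral_cong) (force simp: indicator_def)+
  also have "\<dots> = integral {-1..1} (\<lambda>y. wgt \<gamma> y * g y)"
    by (rule set_borel_integral_eq_integral(2)[OF i])
  finally show ?thesis .
qed

text \<open>The substitution \<open>s = v + c * y\<close>. It degenerates at vacuum, where the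
  kernel is zero and the factor \<open>r\<close> accounts for it.\<close>

lemma chi_integral:
  assumes "continuous_on UNIV g" and c: "c = r powr theta \<gamma>"
  shows "(LBINT s. g s * chi_kernel \<gamma> s r v) = \<bar>r\<bar> * avg (wgt \<gamma>) g v c"
proof (cases "r = 0")
  case True
  then show ?thesis using theta_bounds by (simp add: chi_kernel_def)
next
  case False
  then have cp: "c > 0" using c by simp
  have "(LBINT s. g s * chi_kernel \<gamma> s r v) =
      \<bar>c\<bar> * (LBINT y. g (v + c * y) * chi_kernel \<gamma> (v + c * y) r v)"
    using cp by (subst lborel_integral_real_affine[of c _ v]) auto
  also have "\<dots> = (LBINT y. g (v + c * y) * (chi_kernel \<gamma> (v + c * y) r v * c))"
    using cp by (simp flip: Bochner_Integration.integral_mult_right_zero add: ac_simps)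
  also have "\<dots> = (LBINT y. \<bar>r\<bar> * (wgt \<gamma> y * g (v + c * y)))"
  proof (intro Bochner_Integration.integral_cong refl)
    show "g (v + c * y) * (chi_kernel \<gamma> (v + c * y) r v * c) = \<bar>r\<bar> * (wgt \<gamma> y * g (v + c * y))" for y
      by (subst chi_kernel_scaled[OF c]) simp
  qed
  also have "\<dots> = \<bar>r\<bar> * (LBINT y. wgt \<gamma> y * g (v + c * y))" by simp
  also have "(LBINT y. wgt \<gamma> y * g (v + c * y)) = avg (wgt \<gamma>) g v c"
    unfolding avg_def
    by (intro lborel_avg continuous_on_compose2[OF assms(1)] continuous_intros) auto
  finally show ?thesis .
qed

lemma eta_avg:
  assumes "continuous_on UNIV \<psi>"
  shows "eta \<gamma> \<psi> r v = \<bar>r\<bar> * avg (wgt \<gamma>) \<psi> v (r powr theta \<gamma>)"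
  unfolding eta_def by (rule chi_integral[OF assms refl])

definition ywgt :: "real \<Rightarrow> real" where "ywgt y = y * wgt \<gamma> y"

lemma continuous_ywgt: "continuous_on A ywgt"
  unfolding ywgt_def by (intro continuous_intros continuous_wgt)

text \<open>In the variable \<open>y\<close>, the factor
  \<open>theta \<gamma> * s + (1 - theta \<gamma>) * v\<close> of the flux kernel reads
  \<open>v + theta \<gamma> * c * y\<close>: transport with velocity \<open>v\<close> plus a
  correction that is odd in \<open>y\<close>.\<close>

lemma q_avg:
  assumes "continuous_on UNIV \<psi>" and c: "c = r powr theta \<gamma>"
  shows "q \<gamma> \<psi> r v = \<bar>r\<bar> * (v * avg (wgt \<gamma>) \<psi> v c + theta \<gamma> * c * avg ywgt \<psi> v c)"
proof -
  let ?g = "\<lambda>s. \<psi> s * (theta \<gamma> * s + (1 - theta \<gamma>) * v)"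
  have "q \<gamma> \<psi> r v = (LBINT s. ?g s * chi_kernel \<gamma> s r v)"
    unfolding q_def sigma_kernel_def by (simp add: ac_simps)
  also have "\<dots> = \<bar>r\<bar> * avg (wgt \<gamma>) ?g v c"
    by (intro chi_integral c continuous_intros assms)
  also have "avg (wgt \<gamma>) ?g v c = avg (\<lambda>y. v * wgt \<gamma> y + (theta \<gamma> * c) * ywgt y) \<psi> v c"
    unfolding avg_def ywgt_def
    by (intro Henstock_Kurzweil_Integration.integral_cong) (simp add: algebra_simps)
  also have "\<dots> = v * avg (wgt \<gamma>) \<psi> v c + theta \<gamma> * c * avg ywgt \<psi> v c"
    by (intro avg_add_weight continuous_wgt continuous_ywgt assms)
  finally show ?thesis .
qed

text \<open>The function \<open>y * wgt \<gamma> y\<close> vanishes at both end points, so no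
  boundary term appears; its derivative is
  \<open>wgt \<gamma> y - 2 * lam \<gamma> * y^2 * wgt1 \<gamma> y\<close>.\<close>

lemma avg_by_parts:
  assumes "\<And>s. (\<psi> has_real_derivative \<psi>' s) (at s)" "continuous_on UNIV \<psi>'"
  shows "theta \<gamma> * c * avg ywgt \<psi>' v c = avg (wgtr \<gamma>) \<psi> v c - avg (wgt \<gamma>) \<psi> v c"
proof -
  have cpsi: "continuous_on UNIV \<psi>"
    using assms(1) by (meson DERIV_continuous continuous_at_imp_continuous_on)
  define g where "g y = c * (ywgt y * \<psi>' (v + c * y)) +
     (wgt \<gamma> y - 2 * lam \<gamma> * y\<^sup>2 * wgt1 \<gamma> y) * \<psi> (v + c * y)" for y
  \<comment> \<open>The version of the fundamental theorem that asks for a derivative in the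
    interior only; the primitive is merely continuous at the end points.\<close>
  have "(g has_integral (ywgt 1 * \<psi> (v + c * 1) - ywgt (-1) * \<psi> (v + c * (-1)))) {-1..1}"
  proof (rule fundamental_theorem_of_calculus_interior)
    show "continuous_on {-1..1} (\<lambda>y. ywgt y * \<psi> (v + c * y))"
      by (intro continuous_intros continuous_ywgt continuous_on_compose2[OF cpsi]) auto
    fix y :: real assume "y \<in> {-1<..<1}"
    then have y: "\<bar>y\<bar> < 1" by auto
    have "((\<lambda>y. y * wgt \<gamma> y * \<psi> (v + c * y)) has_real_derivative g y) (at y)"
      by (rule derivative_eq_intros wgt_deriv[OF y] DERIV_chain2[OF assms(1)] refl)+
         (simp add: g_def ywgt_def algebra_simps power2_eq_square)
    then show "((\<lambda>y. ywgt y * \<psi> (v + c * y)) has_vector_derivative g y) (at y)"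
      by (simp add: ywgt_def has_real_derivative_iff_has_vector_derivative)
  qed simp
  then have "integral {-1..1} g = 0"
    by (simp add: ywgt_def wgt_zero integral_unique)
  also have "integral {-1..1} g = c * avg ywgt \<psi>' v c +
     avg (\<lambda>y. wgt \<gamma> y - 2 * lam \<gamma> * y\<^sup>2 * wgt1 \<gamma> y) \<psi> v c"
    unfolding g_def[abs_def] avg_def
    by (subst integral_add)
      (auto intro!: integrable_on_mult_right avg_integrable continuous_intros continuous_wgt continuous_wgt1 continuous_ywgt cpsi assms simp del: mult_minus_left)
  finally have *: "c * avg ywgt \<psi>' v c = - avg (\<lambda>y. wgt \<gamma> y - 2 * lam \<gamma> * y\<^sup>2 * wgt1 \<gamma> y) \<psi> v c" by simp
  have "avg (wgtr \<gamma>) \<psi> v c =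
     avg (\<lambda>y. 1 * wgt \<gamma> y + (- theta \<gamma>) * (wgt \<gamma> y - 2 * lam \<gamma> * y\<^sup>2 * wgt1 \<gamma> y)) \<psi> v c"
    unfolding avg_def wgtr_def
    by (intro Henstock_Kurzweil_Integration.integral_cong) (simp add: algebra_simps)
  also have "\<dots> = 1 * avg (wgt \<gamma>) \<psi> v c + (- theta \<gamma>) * avg (\<lambda>y. wgt \<gamma> y - 2 * lam \<gamma> * y\<^sup>2 * wgt1 \<gamma> y) \<psi> v c"
    by (intro avg_add_weight continuous_intros continuous_wgt continuous_wgt1 cpsi)
  finally have "avg (wgtr \<gamma>) \<psi> v c = avg (wgt \<gamma>) \<psi> v c + theta \<gamma> * (c * avg ywgt \<psi>' v c)"
    using * by simp
  then show ?thesis by simp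
qed

text \<open>For \<open>r > 0\<close> the chain rule produces \<open>r\<close> times the derivative
  of \<open>r powr theta \<gamma>\<close>, that is \<open>theta \<gamma> * c\<close>, and
  \<open>avg_by_parts\<close> removes the derivative of \<open>\<psi>\<close>. The entropy is even
  in \<open>r\<close>, so its derivative is odd, which settles \<open>r < 0\<close> and explains the
  absolute value.\<close>

lemma ru_avg:
  assumes "\<And>s. (\<psi> has_real_derivative \<psi>' s) (at s)" "continuous_on UNIV \<psi>'" and c: "c = r powr theta \<gamma>"
  shows "ru_eta_r \<gamma> \<psi> r v = \<bar>r\<bar> * (v * avg (wgtr \<gamma>) \<psi> v c)"
proof -
  have cpsi: "continuous_on UNIV \<psi>"
    using assms(1) by (meson DERIV_continuous continuous_at_imp_continuous_on)
  let ?e = "\<lambda>r. eta \<gamma> \<psi> r v"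
  have pos: "(?e has_real_derivative avg (wgtr \<gamma>) \<psi> v (r powr theta \<gamma>)) (at r)" if "r > 0" for r
  proof -
    have "((\<lambda>r. r * avg (wgt \<gamma>) \<psi> v (r powr theta \<gamma>)) has_real_derivative
        avg (wgt \<gamma>) \<psi> v (r powr theta \<gamma>) +
        theta \<gamma> * (r powr theta \<gamma>) * avg (\<lambda>y. y * wgt \<gamma> y) \<psi>' v (r powr theta \<gamma>)) (at r)"
      using that
      by (auto intro!: derivative_eq_intros DERIV_chain2[OF avg_deriv] continuous_wgt assms(1,2)
          simp: powr_diff field_simps)
    also have "avg (wgt \<gamma>) \<psi> v (r powr theta \<gamma>) +
        theta \<gamma> * (r powr theta \<gamma>) * avg (\<lambda>y. y * wgt \<gamma> y) \<psi>' v (r powr theta \<gamma>) = avg (wgtr \<gamma>) \<psi> v (r powr theta \<gamma>)"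
      using avg_by_parts[OF assms(1,2), of "r powr theta \<gamma>" v] by (simp add: ywgt_def[abs_def])
    finally have "((\<lambda>r. r * avg (wgt \<gamma>) \<psi> v (r powr theta \<gamma>)) has_real_derivative
        avg (wgtr \<gamma>) \<psi> v (r powr theta \<gamma>)) (at r)" .
    moreover have "\<forall>\<^sub>F x in nhds r. ?e x = x * avg (wgt \<gamma>) \<psi> v (x powr theta \<gamma>)"
      using eventually_nhds_in_open[of "{0<..}" r] that by (auto simp: eta_avg[OF cpsi] elim!: eventually_mono)
    ultimately show ?thesis by (subst DERIV_cong_ev[OF refl _ refl]) auto
  qed
  have even: "?e (- r) = ?e r" for r by (simp add: eta_avg[OF cpsi] powr_def ln_minus)
  have minus_r: "(- r) powr theta \<gamma> = c" by (simp add: c powr_def ln_minus)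
  consider "r = 0" | "r > 0" | "r < 0" by linarith
  then show ?thesis
  proof cases
    case 3
    have "((\<lambda>x. ?e (- x)) has_real_derivative - avg (wgtr \<gamma>) \<psi> v ((-r) powr theta \<gamma>)) (at r)"
      using iffD1[OF DERIV_mirror pos[of "- r"]] 3 by simp
    then have "deriv ?e r = - avg (wgtr \<gamma>) \<psi> v c"
      using even by (intro DERIV_imp_deriv) (simp add: minus_r)
    with 3 show ?thesis by (simp add: ru_eta_r_def)
  qed (auto simp: ru_eta_r_def DERIV_imp_deriv[OF pos] c)
qed

end

section \<open>Convex weights of subquadratic growth\<close>

text \<open>Only \<open>x = 0\<close> needs an argument: there the slope function
  \<open>max 0 z ^ Suc n\<close> in the criterion of Caratheodory is continuous because the power is
  at least two.\<close>

lemma has_derivative_max_0_power: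
  "((\<lambda>x::real. max 0 x ^ Suc (Suc n)) has_real_derivative real (n + 2) * max 0 x ^ Suc n) (at x)"
proof -
  consider "x = 0" | "x < 0" | "x > 0" by linarith
  then show ?thesis
  proof cases
    case 1
    have "max 0 z * max 0 z ^ Suc n = max 0 z ^ Suc n * z" for z :: real
      by (cases "z \<le> 0") (simp_all only: max_absorb1 max_absorb2 mult.commute mult_zero_left power_0_Suc linear not_le less_imp_le mult_zero_right)
    then have "max 0 z ^ Suc (Suc n) - max 0 x ^ Suc (Suc n) = max 0 z ^ Suc n * (z - x)" for z
      unfolding 1 power_Suc[of _ "Suc n"] by simp
    moreover have "isCont (\<lambda>z::real. max 0 z ^ Suc n) x"
      by (intro continuous_intros)
    ultimately show ?thesis
      unfolding CARAT_DERIV using 1 by (intro exI[of _ "\<lambda>z. max 0 z ^ Suc n"]) auto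
  next
    case 2
    have "\<forall>\<^sub>F z in nhds x. z \<in> {..<0}"
      by (rule eventually_nhds_in_open) (use 2 in auto)
    then have "\<forall>\<^sub>F z in nhds x. max 0 z ^ Suc (Suc n) = 0"
      by eventually_elim simp
    moreover have "((\<lambda>z. 0) has_real_derivative real (n + 2) * max 0 x ^ Suc n) (at x)"
      using 2 by simp
    ultimately show ?thesis by (subst DERIV_cong_ev[OF refl _ refl]) simp_all
  next
    case 3
    have "\<forall>\<^sub>F z in nhds x. z \<in> {0<..}"
      by (rule eventually_nhds_in_open) (use 3 in auto)
    then have "\<forall>\<^sub>F z in nhds x. max 0 z ^ Suc (Suc n) = z ^ Suc (Suc n)"
      by eventually_elim (simp only: greaterThan_iff max_absorb2 less_imp_le)
    moreover have "((\<lambda>z. z ^ Suc (Suc n)) has_real_derivative real (n + 2) * max 0 x ^ Suc n) (at x)"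
      using DERIV_pow[of "Suc (Suc n)" x] 3
      by (simp only: diff_Suc_Suc diff_zero max_absorb2 less_imp_le add_2_eq_Suc')
    ultimately show ?thesis
      using DERIV_cong_ev[OF refl _ refl, of "\<lambda>z. max 0 z ^ Suc (Suc n)" "\<lambda>z. z ^ Suc (Suc n)" x]
      by (simp only:)
  qed
qed

lemma has_derivative_max_0_reflected:
  "((\<lambda>s::real. max 0 (c - s) ^ 3) has_real_derivative - (3 * (max 0 (c - s))\<^sup>2)) (at s)"
  "((\<lambda>s::real. (max 0 (c - s))\<^sup>2) has_real_derivative - (2 * max 0 (c - s))) (at s)"
proof -
  have l: "((\<lambda>s. c - s) has_real_derivative -1) (at s)" by (auto intro!: derivative_eq_intros)
  show "((\<lambda>s::real. max 0 (c - s) ^ 3) has_real_derivative - (3 * (max 0 (c - s))\<^sup>2)) (at s)"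
    using DERIV_chain2[OF has_derivative_max_0_power[of 1] l]
    by (simp add: numeral_3_eq_3 numeral_2_eq_2)
  show "((\<lambda>s::real. (max 0 (c - s))\<^sup>2) has_real_derivative - (2 * max 0 (c - s))) (at s)"
    using DERIV_chain2[OF has_derivative_max_0_power[of 0] l] by (simp add: numeral_2_eq_2)
qed

text \<open>A smoothed \<open>((s - a)\<^sub>-)\<^sup>2\<close>, convex: \<open>(a - s)\<^sup>2 + (a - s) + 1/3\<close> for \<open>s \<le> a\<close> and \<open>0\<close> for \<open>s \<ge> a + 1\<close>. Thus
  \<open>s\<^sup>2 - 2 * bend 0 s\<close> is \<open>s * \<bar>s\<bar>\<close> up to linear terms, and differences of shifted copies have linear
  growth.\<close>

definition bend :: "real \<Rightarrow> real \<Rightarrow> real" where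
  "bend a s = (max 0 (a + 1 - s) ^ 3 - max 0 (a - s) ^ 3) / 3"

definition bend' :: "real \<Rightarrow> real \<Rightarrow> real" where
  "bend' a s = (max 0 (a - s))\<^sup>2 - (max 0 (a + 1 - s))\<^sup>2"

definition bend'' :: "real \<Rightarrow> real \<Rightarrow> real" where
  "bend'' a s = 2 * (max 0 (a + 1 - s) - max 0 (a - s))"

lemma bend_deriv: "(bend a has_real_derivative bend' a s) (at s)"
  using DERIV_cdivide[OF DERIV_diff[OF has_derivative_max_0_reflected(1)[of "a + 1" s]
    has_derivative_max_0_reflected(1)[of a s]], of 3]
  by (simp add: bend_def[abs_def] bend'_def diff_divide_distrib)

lemma bend'_deriv: "(bend' a has_real_derivative bend'' a s) (at s)"
  using DERIV_diff[OF has_derivative_max_0_reflected(2)[of a s]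
    has_derivative_max_0_reflected(2)[of "a + 1" s]]
  by (simp add: bend'_def[abs_def] bend''_def)

lemma continuous_bend: "continuous_on A (bend a)" "continuous_on A (bend' a)" "continuous_on A (bend'' a)"
  unfolding bend_def bend'_def bend''_def by (intro continuous_intros; simp)+

lemma bend_nonneg: "0 \<le> bend a s"
proof -
  have "max 0 (a - s) ^ 3 \<le> max 0 (a + 1 - s) ^ 3" by (intro power_mono) auto
  then show ?thesis by (simp add: bend_def)
qed

lemma bend_left: "s \<le> a \<Longrightarrow> bend a s = (a - s)\<^sup>2 + (a - s) + 1/3"
  by (simp add: bend_def max_def power2_eq_square power3_eq_cube field_simps)

lemma bend_right: "a + 1 \<le> s \<Longrightarrow> bend a s = 0"
  by (simp add: bend_def max_def)

lemma bend_0_abs_le: "\<bar>bend 0 s\<bar> \<le> s\<^sup>2 + \<bar>s\<bar> + 1"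
proof -
  consider "s \<le> 0" | "0 \<le> s" "s \<le> 1" | "1 \<le> s" by linarith
  then show ?thesis
  proof cases
    case 2
    have "(1 - s) ^ 3 \<le> 1" using 2 by (intro power_le_one) auto
    moreover have "0 \<le> (1 - s) ^ 3" using 2 by simp
    ultimately have "\<bar>bend 0 s\<bar> \<le> 1" using 2 by (simp add: bend_def)
    also have "1 \<le> s\<^sup>2 + \<bar>s\<bar> + 1" by simp
    finally show ?thesis .
  next
    case 1
    have "0 \<le> s\<^sup>2" by simp
    moreover have "bend 0 s = s\<^sup>2 - s + 1/3" using bend_left[OF 1] by simp
    ultimately show ?thesis using 1 by linarith
  qed (auto simp: bend_right)
qed

lemma bend'_0_abs_le: "\<bar>bend' 0 s\<bar> \<le> 2 * \<bar>s\<bar> + 1"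
proof -
  consider "s \<le> 0" | "0 \<le> s" "s \<le> 1" | "1 \<le> s" by linarith
  then show ?thesis
  proof cases
    case 1 then show ?thesis by (simp add: bend'_def power2_eq_square algebra_simps)
  next
    case 2
    have "(1 - s)\<^sup>2 \<le> 1" using 2 by (intro power_le_one) auto
    then show ?thesis using 2 by (simp add: bend'_def)
  qed (auto simp: bend'_def)
qed

lemma bend_0_remainder: "\<bar>s\<^sup>2 - 2 * bend 0 s - s * \<bar>s\<bar>\<bar> \<le> 2 * \<bar>s\<bar> + 1"
proof -
  consider "s \<le> 0" | "0 \<le> s" "s \<le> 1" | "1 \<le> s" by linarith
  then show ?thesis
  proof cases
    case 1 then show ?thesis by (simp add: bend_left power2_eq_square algebra_simps)
  next
    case 2
    have "(1 - s)^3 \<le> 1" using 2 by (intro power_le_one) auto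
    moreover have "0 \<le> (1 - s)^3" using 2 by simp
    ultimately show ?thesis using 2 by (simp add: bend_def power2_eq_square)
  qed (auto simp: bend_right power2_eq_square)
qed

text \<open>With \<open>s = v + a\<close> and \<open>t = v - a\<close> this says that the derivative
  in \<open>a\<close> of the defect in \<open>bend_0_chord\<close> is nonnegative. The functions
  involved are polynomial to the left of \<open>0\<close>, between \<open>0\<close> and
  \<open>1\<close>, and zero beyond, so the positions of \<open>s\<close> and \<open>t\<close>
  relative to \<open>0\<close> and \<open>1\<close> decide.\<close>

lemma bend'_bend''_bound:
  "bend' 0 s + bend' 0 t \<le> (s + t) / 2 * (bend'' 0 s + bend'' 0 t)"
proof -
  have l: "bend' 0 x = 2 * x - 1 \<and> bend'' 0 x = 2" if "x \<le> 0" for x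
    using that by (simp add: bend'_def bend''_def power2_eq_square algebra_simps)
  have m: "bend' 0 x = - ((1 - x)\<^sup>2) \<and> bend'' 0 x = 2 * (1 - x)" if "0 \<le> x" "x \<le> 1" for x
    using that by (simp add: bend'_def bend''_def)
  have r: "bend' 0 x = 0 \<and> bend'' 0 x = 0" if "1 \<le> x" for x
    using that by (simp add: bend'_def bend''_def)
  have *: "bend' 0 s + bend' 0 t \<le> (s + t) / 2 * (bend'' 0 s + bend'' 0 t)" if ts: "t \<le> s" for s t
  proof -
    consider "s \<le> 0" | "t \<le> 0" "0 \<le> s" "s \<le> 1" | "t \<le> 0" "1 \<le> s" | "0 \<le> t" "s \<le> 1"
      | "0 \<le> t" "t \<le> 1" "1 \<le> s" | "1 \<le> t" using ts by linarith
    then show ?thesis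
    proof cases
      case 1
      then show ?thesis using l[of s] l[of t] ts by simp
    next
      case 2
      have "s * t \<le> 0" using 2 by (simp add: mult_nonneg_nonpos)
      moreover have "(s + t) / 2 * (2 * (1 - s) + 2) - (- ((1 - s)\<^sup>2) + (2 * t - 1)) = 2 - s * t"
        by (simp add: power2_eq_square field_simps)
      ultimately show ?thesis using m[of s] l[of t] 2 by simp
    next
      case 3
      then show ?thesis using r[of s] l[of t] by simp
    next
      case 4
      have "0 \<le> (s + t) * (2 - s - t)" using 4 ts by (intro mult_nonneg_nonneg) auto
      moreover have "(s + t) / 2 * (2 * (1 - s) + 2 * (1 - t)) = (s + t) * (2 - s - t)"
        by (simp add: field_simps)
      moreover have "- ((1 - s)\<^sup>2) + - ((1 - t)\<^sup>2) \<le> 0" by simp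
      moreover have "bend' 0 s = - ((1 - s)\<^sup>2)" "bend' 0 t = - ((1 - t)\<^sup>2)"
          "bend'' 0 s = 2 * (1 - s)" "bend'' 0 t = 2 * (1 - t)"
        using m[of s] m[of t] 4 ts by auto
      ultimately show ?thesis by (simp only:)
    next
      case 5
      have "0 \<le> (s + t) / 2 * (2 * (1 - t))" using 5 ts by (intro mult_nonneg_nonneg) auto
      moreover have "- ((1 - t)\<^sup>2) \<le> 0" by simp
      moreover have "bend' 0 s = 0" "bend' 0 t = - ((1 - t)\<^sup>2)"
          "bend'' 0 s = 0" "bend'' 0 t = 2 * (1 - t)"
        using r[of s] m[of t] 5 by auto
      ultimately show ?thesis by (simp only: add_0)
    next
      case 6
      then show ?thesis using r[of s] r[of t] ts by simp
    qed
  qed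
  show ?thesis using *[of s t] *[of t s] by (cases "t \<le> s") (auto simp: add.commute)
qed

text \<open>This fixes the sign of the geometric source: its integrand, with \<open>y\<close> and
  \<open>- y\<close> taken together, is a multiple of the difference of the two sides. For the
  weight \<open>s^2\<close> both sides are equal. The difference vanishes at \<open>a = 0\<close>
  and increases in \<open>a\<close>.\<close>

lemma bend_0_chord:
  assumes "0 \<le> a"
  shows "bend 0 (v + a) - bend 0 (v - a) \<le> v * (bend' 0 (v + a) - bend' 0 (v - a))"
proof -
  define D where "D a = v * (bend' 0 (v + a) - bend' 0 (v - a)) - (bend 0 (v + a) - bend 0 (v - a))" for a
  define D' where "D' a = v * (bend'' 0 (v + a) + bend'' 0 (v - a)) - (bend' 0 (v + a) + bend' 0 (v - a))" for a
  have d: "(D has_real_derivative D' x) (at x)" for x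
    unfolding D_def D'_def
    by (auto intro!: derivative_eq_intros DERIV_chain2[OF bend_deriv] DERIV_chain2[OF bend'_deriv])
  have nn: "0 \<le> D' x" for x
    using bend'_bend''_bound[of "v + x" "v - x"] by (simp add: D'_def)
  have "D 0 \<le> D a"
    by (rule DERIV_nonneg_imp_nondecreasing[OF assms]) (use d nn in blast)
  then show ?thesis by (simp add: D_def)
qed

section \<open>Weights admissible in the entropy inequality\<close>

lemma C2I:
  assumes "\<And>s. (\<psi> has_real_derivative \<psi>' s) (at s)" "\<And>s. (\<psi>' has_real_derivative \<psi>'' s) (at s)"
    and "continuous_on UNIV \<psi>''"
  shows "C2 \<psi>"
proof -
  have 1: "deriv \<psi> = \<psi>'" using assms(1) by (auto intro!: DERIV_imp_deriv)
  have 2: "deriv \<psi>' = \<psi>''" using assms(2) by (auto intro!: DERIV_imp_deriv)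
  show ?thesis using assms unfolding C2_def 1 2 by (auto simp: real_differentiable_def)
qed

lemma growth_below_2I:
  assumes "\<And>s. \<bar>\<psi> s\<bar> \<le> K * (1 + \<bar>s\<bar>)"
  shows "growth_below 2 \<psi>"
  unfolding growth_below_def
proof (rule landau_o.smallI)
  fix c :: real assume c: "c > 0"
  have "0 \<le> K" using assms[of 0] by simp
  have "norm (\<psi> s) \<le> c * norm (\<bar>s\<bar>\<^sup>2)" if s: "norm s \<ge> max 1 (2 * K / c)" for s
  proof -
    have "2 * K \<le> c * \<bar>s\<bar>" using s c by (simp add: field_simps)
    then have "2 * K * \<bar>s\<bar> \<le> c * \<bar>s\<bar> * \<bar>s\<bar>" by (intro mult_right_mono) auto
    moreover have "K * (1 + \<bar>s\<bar>) \<le> K * (2 * \<bar>s\<bar>)" using s \<open>0 \<le> K\<close> by (intro mult_left_mono) auto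
    ultimately show ?thesis using assms[of s] by (simp add: power2_eq_square)
  qed
  then show "\<forall>\<^sub>F s in at_infinity. norm (\<psi> s) \<le> c * norm (\<bar>s\<bar>\<^sup>2)"
    unfolding eventually_at_infinity by blast
qed

text \<open>To the left of both thresholds the squares cancel and the difference is
  \<open>(a - b + 1) * (a + b - 2 * s)\<close>; to the right both terms vanish; the interval in
  between is compact.\<close>

lemma bend_diff_linear_growth:
  "\<exists>K. \<forall>s. \<bar>bend a s - bend (b - 1) s\<bar> \<le> K * (1 + \<bar>s\<bar>)"
proof -
  let ?f = "\<lambda>s. bend a s - bend (b - 1) s"
  define R where "R = \<bar>a\<bar> + \<bar>b\<bar> + 1"
  have "compact (?f ` {-R..R})"
    by (intro compact_continuous_image continuous_intros continuous_bend) auto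
  then have "bounded (?f ` {-R..R})" by (rule compact_imp_bounded)
  then obtain K0 where "\<forall>x \<in> ?f ` {-R..R}. norm x \<le> K0"
    unfolding bounded_iff by (elim exE)
  then have K0: "\<bar>?f s\<bar> \<le> K0" if "s \<in> {-R..R}" for s
    using that by simp
  define K1 where "K1 = \<bar>a - b + 1\<bar> * (\<bar>a\<bar> + \<bar>b\<bar> + 2)"
  have "0 \<in> {-R..R}" by (simp add: R_def)
  from K0[OF this] have K0p: "0 \<le> K0" by linarith
  have K1p: "0 \<le> K1" by (simp add: K1_def)
  have "\<bar>?f s\<bar> \<le> (K0 + K1) * (1 + \<bar>s\<bar>)" for s
  proof -
    consider "s \<in> {-R..R}" | "s > R" | "s < -R" by force
    then show ?thesis
    proof cases
      case 1
      have "K0 * 1 \<le> (K0 + K1) * (1 + \<bar>s\<bar>)" using K0p K1p by (intro mult_mono) auto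
      then show ?thesis using K0[OF 1] by simp
    next
      case 2
      then have "?f s = 0" by (simp add: bend_right R_def)
      then show ?thesis using K0p K1p by simp
    next
      case 3
      then have "?f s = (a - b + 1) * (a + b - 2 * s)"
        by (simp add: bend_left R_def power2_eq_square algebra_simps)
      then have "\<bar>?f s\<bar> = \<bar>a - b + 1\<bar> * \<bar>a + b - 2 * s\<bar>" by (simp add: abs_mult)
      also have "\<dots> \<le> \<bar>a - b + 1\<bar> * ((\<bar>a\<bar> + \<bar>b\<bar> + 2) * (1 + \<bar>s\<bar>))"
      proof (rule mult_left_mono)
        have "0 \<le> (\<bar>a\<bar> + \<bar>b\<bar>) * \<bar>s\<bar>" by simp
        moreover have "(\<bar>a\<bar> + \<bar>b\<bar> + 2) * (1 + \<bar>s\<bar>) = (\<bar>a\<bar> + \<bar>b\<bar>) * \<bar>s\<bar> + \<bar>a\<bar> + \<bar>b\<bar> + 2 + 2 * \<bar>s\<bar>"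
          by (simp add: algebra_simps)
        ultimately show "\<bar>a + b - 2 * s\<bar> \<le> (\<bar>a\<bar> + \<bar>b\<bar> + 2) * (1 + \<bar>s\<bar>)" by linarith
      qed simp
      also have "\<dots> = K1 * (1 + \<bar>s\<bar>)" by (simp add: K1_def)
      also have "\<dots> \<le> (K0 + K1) * (1 + \<bar>s\<bar>)" using K0p by (intro mult_right_mono) auto
      finally show ?thesis .
    qed
  qed
  then show ?thesis by blast
qed

text \<open>Convexity holds because \<open>bend'' a s\<close> increases with the threshold
  \<open>a\<close>. The affine term preserves convexity and linear growth, and allows the
  combination to agree with \<open>s^2\<close> on a bounded interval.\<close>

lemma bend_diff_admissible:
  fixes \<alpha> \<beta> :: real
  assumes "b \<le> a"
  defines "\<psi> \<equiv> \<lambda>s. bend a s - bend (b - 1) s + (\<alpha> * s + \<beta>)"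
  shows "C2 \<psi>" "convex_on UNIV \<psi>" "growth_below 2 \<psi>"
proof -
  define \<psi>' where "\<psi>' s = bend' a s - bend' (b - 1) s + \<alpha>" for s
  define \<psi>'' where "\<psi>'' s = bend'' a s - bend'' (b - 1) s" for s
  have 1: "(\<psi> has_real_derivative \<psi>' s) (at s)" for s
  proof -
    have "((\<lambda>s. \<alpha> * s + \<beta>) has_real_derivative \<alpha>) (at s)"
      by (auto intro!: derivative_eq_intros)
    from DERIV_add[OF DERIV_diff[OF bend_deriv bend_deriv] this]
    show ?thesis unfolding \<psi>_def \<psi>'_def .
  qed
  have 2: "(\<psi>' has_real_derivative \<psi>'' s) (at s)" for s
  proof -
    from DERIV_add[OF DERIV_diff[OF bend'_deriv bend'_deriv] DERIV_const]
    show ?thesis unfolding \<psi>'_def[abs_def] \<psi>''_def add_0_right .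
  qed
  have 3: "continuous_on UNIV \<psi>''" unfolding \<psi>''_def[abs_def] by (rule continuous_on_diff[OF continuous_bend(3) continuous_bend(3)])
  have 4: "0 \<le> \<psi>'' s" for s
  proof -
    \<comment> \<open>In this form, a truncation of \<open>x + 1 - s\<close> to the unit interval,
      monotonicity in the threshold \<open>x\<close> is visible.\<close>
    have clip: "bend'' x s = 2 * max 0 (min 1 (x + 1 - s))" for x
      by (cases "s \<le> x"; cases "s \<le> x + 1") (simp_all add: bend''_def)
    have "max 0 (min 1 (b - 1 + 1 - s)) \<le> max 0 (min 1 (a + 1 - s))"
      using assms(1) by (intro max.mono min.mono) auto
    then show ?thesis unfolding \<psi>''_def clip by simp
  qed
  show "C2 \<psi>" by (rule C2I[where \<psi>' = \<psi>' and \<psi>'' = \<psi>'']; fact 1 2 3)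
  show "convex_on UNIV \<psi>"
    by (rule f''_ge0_imp_convex[where f' = \<psi>' and f'' = \<psi>'']) (rule 1 2 4 convex_UNIV)+
  from bend_diff_linear_growth[of a b]
  obtain K where K: "\<forall>s. \<bar>bend a s - bend (b - 1) s\<bar> \<le> K * (1 + \<bar>s\<bar>)" ..
  have "\<bar>\<psi> s\<bar> \<le> (K + (\<bar>\<alpha>\<bar> + \<bar>\<beta>\<bar>)) * (1 + \<bar>s\<bar>)" for s
  proof -
    have "\<bar>\<alpha> * s + \<beta>\<bar> \<le> \<bar>\<alpha>\<bar> * \<bar>s\<bar> + \<bar>\<beta>\<bar>" using abs_triangle_ineq[of "\<alpha> * s" \<beta>] by (simp only: abs_mult)
    moreover have "0 \<le> \<bar>\<beta>\<bar> * \<bar>s\<bar>" by simp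
    moreover have "(\<bar>\<alpha>\<bar> + \<bar>\<beta>\<bar>) * (1 + \<bar>s\<bar>) = \<bar>\<alpha>\<bar> * \<bar>s\<bar> + \<bar>\<beta>\<bar> + \<bar>\<alpha>\<bar> + \<bar>\<beta>\<bar> * \<bar>s\<bar>"
      by (simp add: algebra_simps)
    ultimately have "\<bar>\<alpha> * s + \<beta>\<bar> \<le> (\<bar>\<alpha>\<bar> + \<bar>\<beta>\<bar>) * (1 + \<bar>s\<bar>)"
      using abs_ge_zero[of \<alpha>] by linarith
    moreover have "\<bar>\<psi> s\<bar> \<le> \<bar>bend a s - bend (b - 1) s\<bar> + \<bar>\<alpha> * s + \<beta>\<bar>"
      unfolding \<psi>_def by (rule abs_triangle_ineq)
    moreover have "(K + (\<bar>\<alpha>\<bar> + \<bar>\<beta>\<bar>)) * (1 + \<bar>s\<bar>) = K * (1 + \<bar>s\<bar>) + (\<bar>\<alpha>\<bar> + \<bar>\<beta>\<bar>) * (1 + \<bar>s\<bar>)"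
      by (rule distrib_right)
    ultimately show ?thesis using K[rule_format, of s] by linarith
  qed
  then show "growth_below 2 \<psi>" by (rule growth_below_2I)
qed

section \<open>Coercivity of the entropy flux\<close>

lemma integral_symmetric:
  fixes h :: "real \<Rightarrow> real"
  assumes "continuous_on {-1..1} h"
  shows "integral {-1..1} h = integral {0..1} (\<lambda>y. h y + h (- y))"
proof -
  have i: "h integrable_on {-1..1}" by (rule integrable_continuous_real[OF assms])
  have c: "continuous_on {0..1} h" "continuous_on {0..1} (\<lambda>y. h (- y))"
    by (intro continuous_on_compose2[OF assms] continuous_intros; force)+
  have "integral {-1..1} h = integral {-1..0} h + integral {0..1} h"
    by (rule Henstock_Kurzweil_Integration.integral_combine[symmetric]) (use i in auto)
  also have "integral {-1..0} h = integral {0..1} (\<lambda>y. h (- y))"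
    using Henstock_Kurzweil_Integration.integral_reflect_real[of 1 0 "\<lambda>y. h (- y)"] by simp
  finally show ?thesis
    by (subst integral_add) (auto intro!: integrable_continuous_real c)
qed

lemma cube_sum_le: "(\<bar>x\<bar> + \<bar>y\<bar>) ^ 3 \<le> 4 * (\<bar>x\<bar> ^ 3 + \<bar>y :: real\<bar> ^ 3)"
proof -
  have "0 \<le> 3 * (\<bar>x\<bar> + \<bar>y\<bar>) * (\<bar>x\<bar> - \<bar>y\<bar>)\<^sup>2" by simp
  also have "\<dots> = 4 * (\<bar>x\<bar> ^ 3 + \<bar>y\<bar> ^ 3) - (\<bar>x\<bar> + \<bar>y\<bar>) ^ 3"
    by (simp add: power2_eq_square power3_eq_cube algebra_simps)
  finally show ?thesis by simp
qed

lemma linear_le_cube: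
  fixes \<epsilon> K :: real
  assumes "0 < \<epsilon>" "0 \<le> K"
  obtains C where "0 \<le> C" "\<And>m. 0 \<le> m \<Longrightarrow> K * m \<le> \<epsilon> * m ^ 3 + C"
proof
  show "0 \<le> K * (K / \<epsilon> + 1)" using assms by simp
  fix m :: real assume m: "0 \<le> m"
  show "K * m \<le> \<epsilon> * m ^ 3 + K * (K / \<epsilon> + 1)"
  proof (cases "K \<le> \<epsilon> * m\<^sup>2")
    case True
    then have "K * m \<le> \<epsilon> * m\<^sup>2 * m" using m by (intro mult_right_mono)
    moreover have "0 \<le> K * (K / \<epsilon> + 1)" using assms by simp
    ultimately show ?thesis by (simp add: power2_eq_square power3_eq_cube)
  next
    case False
    then have "m\<^sup>2 \<le> K / \<epsilon>" using assms by (simp add: field_simps)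
    moreover have "2 * m \<le> m\<^sup>2 + 1" using sum_squares_bound[of m 1] by simp
    ultimately have "m \<le> K / \<epsilon> + 1" using m by auto
    then have "K * m \<le> K * (K / \<epsilon> + 1)" using assms by (intro mult_left_mono)
    moreover have "0 \<le> \<epsilon> * m ^ 3" using assms m by simp
    ultimately show ?thesis by linarith
  qed
qed

text \<open>The coercivity of the flux of \<open>s * \<bar>s\<bar>\<close> at the two points
  \<open>v + a\<close> and \<open>v - a\<close>. Splitting \<open>v + \<theta> * a\<close> into
  \<open>\<theta> * (v + a)\<close> and \<open>(1 - \<theta>) * v\<close> leaves a sum of cubes, and
  a term \<open>v * (g (v + a) + g (v - a))\<close> that is nonnegative because \<open>g\<close> is
  odd and increasing.\<close>

lemma odd_square_pair:
  fixes v a \<theta> :: real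
  assumes "0 \<le> a" "0 \<le> \<theta>" "\<theta> \<le> 1"
  defines "g \<equiv> \<lambda>s::real. s * \<bar>s\<bar>"
  shows "\<theta> * (\<bar>v\<bar> ^ 3 + a ^ 3) \<le> g (v + a) * (v + \<theta> * a) + g (v - a) * (v - \<theta> * a)"
proof -
  \<comment> \<open>One of the two points has absolute value \<open>\<bar>v\<bar> + a\<close>, and
    its cube alone suffices.\<close>
  have cube: "\<bar>v\<bar> ^ 3 + a ^ 3 \<le> \<bar>v + a\<bar> ^ 3 + \<bar>v - a\<bar> ^ 3"
  proof -
    have *: "\<bar>v\<bar> ^ 3 + a ^ 3 \<le> \<bar>v + a\<bar> ^ 3 + \<bar>v - a\<bar> ^ 3" if "0 \<le> v" for v
    proof -
      have "\<bar>v\<bar> ^ 3 + a ^ 3 \<le> \<bar>v + a\<bar> ^ 3"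
        using that assms(1) by (simp add: power3_eq_cube algebra_simps)
      moreover have "0 \<le> \<bar>v - a\<bar> ^ 3" by simp
      ultimately show ?thesis by linarith
    qed
    have "\<bar>- v + a\<bar> = \<bar>v - a\<bar>" "\<bar>- v - a\<bar> = \<bar>v + a\<bar>" by auto
    then show ?thesis using *[of v] *[of "- v"] by (cases "0 \<le> v") auto
  qed
  have sgn: "0 \<le> v * (g (v + a) + g (v - a))"
  proof -
    have mono: "g x \<le> g y" if "x \<le> y" for x y
    proof (cases "0 \<le> x")
      case True then show ?thesis using that unfolding g_def by (intro mult_mono) auto
    next
      case False
      show ?thesis
      proof (cases "0 \<le> y")
        case True
        have "g x \<le> 0" using False by (simp add: g_def mult_nonpos_nonneg)
        also have "0 \<le> g y" using True by (simp add: g_def)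
        finally show ?thesis .
      next
        case y: False
        have "(- y) * (- y) \<le> (- x) * (- x)" using y that by (intro mult_mono) auto
        then show ?thesis using False y by (simp add: g_def)
      qed
    qed
    have odd: "g (- x) = - g x" for x by (simp add: g_def)
    show ?thesis
    proof (cases "0 \<le> v")
      case True
      have "g (a - v) \<le> g (v + a)" using True by (intro mono) auto
      then show ?thesis using True odd[of "v - a"] by simp
    next
      case False
      have "g (v + a) \<le> g (a - v)" using False by (intro mono) auto
      then show ?thesis using False odd[of "v - a"] by (simp add: mult_nonpos_nonpos)
    qed
  qed
  have gs: "g s * s = \<bar>s\<bar> ^ 3" for s by (cases "0 \<le> s") (simp_all add: g_def power3_eq_cube)
  have "g (v + a) * (v + \<theta> * a) + g (v - a) * (v - \<theta> * a)
      = \<theta> * (g (v + a) * (v + a) + g (v - a) * (v - a)) + (1 - \<theta>) * (v * (g (v + a) + g (v - a)))"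
    by (simp add: algebra_simps)
  then have e: "g (v + a) * (v + \<theta> * a) + g (v - a) * (v - \<theta> * a) =
      \<theta> * (\<bar>v + a\<bar> ^ 3 + \<bar>v - a\<bar> ^ 3) + (1 - \<theta>) * (v * (g (v + a) + g (v - a)))"
    unfolding gs .
  have "\<theta> * (\<bar>v\<bar> ^ 3 + a ^ 3) \<le> \<theta> * (\<bar>v + a\<bar> ^ 3 + \<bar>v - a\<bar> ^ 3)"
    by (rule mult_left_mono[OF cube assms(2)])
  moreover have "0 \<le> (1 - \<theta>) * (v * (g (v + a) + g (v - a)))"
    by (rule mult_nonneg_nonneg[OF _ sgn]) (use assms(3) in simp)
  ultimately show ?thesis unfolding e by linarith
qed

section \<open>Flux and geometric source per unit density\<close>

context exponent
begin

text \<open>The flux divided by the density, as a function of the velocity \<open>v\<close> and of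
  \<open>c\<close>, the power \<open>theta \<gamma>\<close> of the density.\<close>

definition qv :: "(real \<Rightarrow> real) \<Rightarrow> real \<Rightarrow> real \<Rightarrow> real" where
  "qv \<psi> v c = v * avg (wgt \<gamma>) \<psi> v c + theta \<gamma> * c * avg ywgt \<psi> v c"

text \<open>The coefficient of the derivative of the area in the entropy inequality, divided by the
  density: \<open>\<rho> u\<close> times the density derivative of the entropy, minus the
  flux.\<close>

definition gv :: "(real \<Rightarrow> real) \<Rightarrow> real \<Rightarrow> real \<Rightarrow> real" where
  "gv \<psi> v c = v * avg (wgtr \<gamma>) \<psi> v c - qv \<psi> v c"

lemma wgt_abs_le: "\<bar>wgt \<gamma> y\<bar> \<le> 1"
  using wgt_nonneg wgt_le_1 by simp

lemma ywgt_abs_le: "y \<in> {-1..1} \<Longrightarrow> \<bar>ywgt y\<bar> \<le> 1"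
  using mult_mono[of "\<bar>y\<bar>" 1 "\<bar>wgt \<gamma> y\<bar>" 1] wgt_abs_le[of y] by (auto simp: ywgt_def abs_mult)

text \<open>The profile is even, so the contributions of \<open>y\<close> and \<open>- y\<close> can
  be taken together; estimates of the flux become inequalities for two symmetric points.\<close>

lemma qv_integral:
  assumes "continuous_on UNIV \<psi>"
  shows "qv \<psi> v c = integral {0..1} (\<lambda>y. wgt \<gamma> y *
    (\<psi> (v + c * y) * (v + theta \<gamma> * (c * y)) + \<psi> (v - c * y) * (v - theta \<gamma> * (c * y))))"
proof -
  have "qv \<psi> v c = avg (\<lambda>y. v * wgt \<gamma> y + (theta \<gamma> * c) * ywgt y) \<psi> v c"
    unfolding qv_def by (rule avg_add_weight[symmetric]; intro continuous_wgt continuous_ywgt assms)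
  also have "\<dots> = integral {0..1} (\<lambda>y. (v * wgt \<gamma> y + (theta \<gamma> * c) * ywgt y) * \<psi> (v + c * y) +
     (v * wgt \<gamma> (-y) + (theta \<gamma> * c) * ywgt (-y)) * \<psi> (v + c * (-y)))"
    unfolding avg_def
    by (intro integral_symmetric continuous_intros continuous_wgt continuous_ywgt continuous_on_compose2[OF assms]) auto
  also have "\<dots> = integral {0..1} (\<lambda>y. wgt \<gamma> y *
    (\<psi> (v + c * y) * (v + theta \<gamma> * (c * y)) + \<psi> (v - c * y) * (v - theta \<gamma> * (c * y))))"
    by (intro Henstock_Kurzweil_Integration.integral_cong) (simp add: ywgt_def wgt_minus algebra_simps)
  finally show ?thesis .
qed

lemma qv_abs_le:
  assumes "continuous_on UNIV \<psi>" "\<And>s. \<bar>s\<bar> \<le> \<bar>v\<bar> + \<bar>c\<bar> \<Longrightarrow> \<bar>\<psi> s\<bar> \<le> b"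
  shows "\<bar>qv \<psi> v c\<bar> \<le> 2 * (\<bar>v\<bar> + \<bar>c\<bar>) * b"
proof -
  have s: "\<bar>\<psi> (v + c * y)\<bar> \<le> b" if "y \<in> {-1..1}" for y
  proof (rule assms(2))
    have "\<bar>c * y\<bar> \<le> \<bar>c\<bar>" using that by (auto simp: abs_mult mult_left_le)
    then show "\<bar>v + c * y\<bar> \<le> \<bar>v\<bar> + \<bar>c\<bar>" by linarith
  qed
  have "0 \<le> b" using s[of 0] by force
  have a: "\<bar>avg (wgt \<gamma>) \<psi> v c\<bar> \<le> 2 * 1 * b" "\<bar>avg ywgt \<psi> v c\<bar> \<le> 2 * 1 * b"
    by (rule avg_abs_le; intro continuous_wgt continuous_ywgt assms s wgt_abs_le ywgt_abs_le; assumption)+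
  have "\<bar>v * avg (wgt \<gamma>) \<psi> v c\<bar> \<le> \<bar>v\<bar> * (2 * b)"
    using a by (simp add: abs_mult mult_left_mono)
  moreover have "\<bar>theta \<gamma> * c * avg ywgt \<psi> v c\<bar> \<le> 1 * \<bar>c\<bar> * (2 * b)"
    unfolding abs_mult using a theta_bounds \<open>0 \<le> b\<close> by (intro mult_mono) auto
  ultimately show ?thesis unfolding qv_def by (simp add: algebra_simps)
qed

lemma qv_add:
  assumes "continuous_on UNIV \<psi>1" "continuous_on UNIV \<psi>2"
  shows "qv (\<lambda>s. \<psi>1 s + \<psi>2 s) v c = qv \<psi>1 v c + qv \<psi>2 v c"
  unfolding qv_def
  by (simp add: avg_add[OF continuous_wgt assms] avg_add[OF continuous_ywgt assms] algebra_simps)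

lemma qv_cmult: "qv (\<lambda>s. a * \<psi> s) v c = a * qv \<psi> v c"
  unfolding qv_def by (simp add: avg_cmult algebra_simps)

lemma qv_odd_square_ge:
  obtains c0 where "0 < c0" "\<And>v c. 0 \<le> c \<Longrightarrow> c0 * (\<bar>v\<bar> ^ 3 + c ^ 3) \<le> qv (\<lambda>s. s * \<bar>s\<bar>) v c"
proof -
  \<comment> \<open>The third moment of the profile on the half interval:
    \<open>odd_square_pair\<close> at \<open>a = c * y\<close> yields at least \<open>y ^ 3\<close>
    times the full cubic weight, because \<open>y \<le> 1\<close>.\<close>
  define k where "k = integral {0..1} (\<lambda>y. wgt \<gamma> y * y ^ 3)"
  have cont: "continuous_on {0..1} (\<lambda>y. wgt \<gamma> y * y ^ 3)"
    by (intro continuous_intros continuous_wgt)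
  have "0 \<le> k" unfolding k_def
    by (intro integral_nonneg integrable_continuous_real cont) (auto simp: wgt_nonneg)
  moreover have "k \<noteq> 0"
  proof
    assume "k = 0"
    then have "\<forall>y\<in>{0..1}. wgt \<gamma> y * y ^ 3 = 0"
      using integral_eq_0_iff[OF cont] unfolding k_def by (auto simp: wgt_nonneg)
    then have "wgt \<gamma> (1/2) * (1/2) ^ 3 = 0" by (rule bspec) simp
    then show False by (simp add: wgt_def power2_eq_square)
  qed
  ultimately have k: "0 < k" by simp
  show thesis
  proof
    show "0 < theta \<gamma> * k" using theta_bounds k by simp
    fix v c :: real assume c: "0 \<le> c"
    let ?g = "\<lambda>s::real. s * \<bar>s\<bar>"
    have cg: "continuous_on UNIV ?g" by (intro continuous_intros)
    have "theta \<gamma> * k * (\<bar>v\<bar> ^ 3 + c ^ 3) = integral {0..1} (\<lambda>y. theta \<gamma> * (\<bar>v\<bar> ^ 3 + c ^ 3) * (wgt \<gamma> y * y ^ 3))"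
      unfolding k_def by simp
    also have "\<dots> \<le> qv ?g v c"
      unfolding qv_integral[OF cg]
    proof (rule integral_le)
      fix y :: real assume y: "y \<in> {0..1}"
      have "(\<bar>v\<bar> ^ 3 + c ^ 3) * y ^ 3 \<le> \<bar>v\<bar> ^ 3 + (c * y) ^ 3"
        using y by (simp add: ring_distribs power_mult_distrib mult_left_le power_le_one)
      then have "theta \<gamma> * ((\<bar>v\<bar> ^ 3 + c ^ 3) * y ^ 3) \<le> theta \<gamma> * (\<bar>v\<bar> ^ 3 + (c * y) ^ 3)"
        using theta_bounds by (intro mult_left_mono) auto
      also have "\<dots> \<le> ?g (v + c * y) * (v + theta \<gamma> * (c * y)) + ?g (v - c * y) * (v - theta \<gamma> * (c * y))"
        using odd_square_pair[of "c * y" "theta \<gamma>" v] y c theta_bounds by simp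
      finally have "wgt \<gamma> y * (theta \<gamma> * ((\<bar>v\<bar> ^ 3 + c ^ 3) * y ^ 3)) \<le>
         wgt \<gamma> y * (?g (v + c * y) * (v + theta \<gamma> * (c * y)) + ?g (v - c * y) * (v - theta \<gamma> * (c * y)))"
        by (intro mult_left_mono wgt_nonneg)
      then show "theta \<gamma> * (\<bar>v\<bar> ^ 3 + c ^ 3) * (wgt \<gamma> y * y ^ 3) \<le>
         wgt \<gamma> y * (?g (v + c * y) * (v + theta \<gamma> * (c * y)) + ?g (v - c * y) * (v - theta \<gamma> * (c * y)))"
        by (simp add: ac_simps)
    qed (intro integrable_continuous_real continuous_intros continuous_wgt)+
    finally show "theta \<gamma> * k * (\<bar>v\<bar> ^ 3 + c ^ 3) \<le> qv ?g v c" .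
  qed
qed

text \<open>Up to a remainder of linear growth, \<open>s^2 - 2 * bend 0 s\<close> is
  \<open>s * \<bar>s\<bar>\<close>. The flux of the remainder is quadratic in
  \<open>\<bar>v\<bar> + \<bar>c\<bar>\<close>; half of the cubic term absorbs it, and
  \<open>C1\<close> is the price.\<close>

lemma flux_coercive:
  obtains c0 C1 where "0 < c0" "0 \<le> C1"
    "\<And>v c. 0 \<le> c \<Longrightarrow> c0 * (\<bar>v\<bar> ^ 3 + c ^ 3) - C1 \<le> qv (\<lambda>s. s\<^sup>2) v c - 2 * qv (bend 0) v c"
proof -
  obtain c0 where c0: "0 < c0" "\<And>v c. 0 \<le> c \<Longrightarrow> c0 * (\<bar>v\<bar> ^ 3 + c ^ 3) \<le> qv (\<lambda>s. s * \<bar>s\<bar>) v c"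
    using qv_odd_square_ge by blast

  let ?r = "\<lambda>s. s\<^sup>2 - 2 * bend 0 s - s * \<bar>s\<bar>"
  have cont: "continuous_on UNIV (\<lambda>s::real. s\<^sup>2)" "continuous_on UNIV (\<lambda>s::real. s * \<bar>s\<bar>)"
     "continuous_on UNIV ?r" "continuous_on UNIV (\<lambda>s. (-2) * bend 0 s)"
    by (intro continuous_intros continuous_bend)+
  \<comment> \<open>The eighth becomes a half after the factor \<open>4\<close> of
    \<open>cube_sum_le\<close>. The left side is the bound \<open>2 * m * (2 * m + 1)\<close> for
    the flux of the remainder.\<close>
  obtain C' where C': "0 \<le> C'" "\<And>m. 0 \<le> m \<Longrightarrow> 4 * m\<^sup>2 + 2 * m \<le> (c0 / 8) * m ^ 3 + C'"
  proof -
    obtain N where N: "N \<ge> 0" "\<And>m. 0 \<le> m \<Longrightarrow> 2 * m \<le> (c0 / 16) * m ^ 3 + N"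
      using linear_le_cube[of "c0 / 16" 2] c0(1) by auto
    define K where "K = 64 / c0"
    have sq: "4 * m\<^sup>2 \<le> c0 / 16 * m ^ 3 + 4 * K\<^sup>2" if m: "0 \<le> m" for m
    proof (cases "m \<le> K")
      case True
      then have "m\<^sup>2 \<le> K\<^sup>2" using m by (intro power_mono) auto
      moreover have "0 \<le> c0 / 16 * m ^ 3" using m c0(1) by simp
      ultimately show ?thesis by linarith
    next
      case False
      then have "4 \<le> c0 / 16 * m" using c0(1) by (simp add: K_def field_simps)
      then have "4 * m\<^sup>2 \<le> c0 / 16 * m * m\<^sup>2" by (intro mult_right_mono) auto
      moreover have "c0 / 16 * m * m\<^sup>2 = c0 / 16 * m ^ 3" by (simp add: power2_eq_square power3_eq_cube)
      moreover have "0 \<le> K\<^sup>2" by simp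
      ultimately show ?thesis by linarith
    qed
    have "4 * m\<^sup>2 + 2 * m \<le> c0 / 8 * m ^ 3 + (4 * K\<^sup>2 + N)" if m: "0 \<le> m" for m
      using N(2)[OF m] sq[OF m] by linarith
    then show thesis by (rule that[rotated]) (use N(1) in \<open>auto intro!: add_nonneg_nonneg\<close>)
  qed
  show thesis
  proof
    show "0 < c0 / 2" "0 \<le> C'" using c0 C' by auto
    fix v c :: real assume c: "0 \<le> c"
    define m where "m = \<bar>v\<bar> + \<bar>c\<bar>"
    have m0: "0 \<le> m" by (simp add: m_def)
    have "(\<lambda>s. s\<^sup>2 + (-2) * bend 0 s) = (\<lambda>s. s * \<bar>s\<bar> + ?r s)" by auto
    then have "qv (\<lambda>s. s\<^sup>2) v c + qv (\<lambda>s. (-2) * bend 0 s) v c = qv (\<lambda>s. s * \<bar>s\<bar>) v c + qv ?r v c"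
      by (simp only: qv_add[OF cont(1,4), symmetric] qv_add[OF cont(2,3), symmetric])
    then have eq: "qv (\<lambda>s. s\<^sup>2) v c - 2 * qv (bend 0) v c = qv (\<lambda>s. s * \<bar>s\<bar>) v c + qv ?r v c"
      using qv_cmult[of "-2" "bend 0" v c] by linarith
    have "\<bar>qv ?r v c\<bar> \<le> 2 * m * (2 * m + 1)"
      unfolding m_def
    proof (rule qv_abs_le[OF cont(3)])
      fix s assume "\<bar>s\<bar> \<le> \<bar>v\<bar> + \<bar>c\<bar>"
      then have "2 * \<bar>s\<bar> + 1 \<le> 2 * (\<bar>v\<bar> + \<bar>c\<bar>) + 1" by simp
      then show "\<bar>?r s\<bar> \<le> 2 * (\<bar>v\<bar> + \<bar>c\<bar>) + 1"
        by (rule order_trans[OF bend_0_remainder])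
    qed
    also have "2 * m * (2 * m + 1) = 4 * m\<^sup>2 + 2 * m" by (simp add: power2_eq_square algebra_simps)
    also have "\<dots> \<le> c0 / 8 * m ^ 3 + C'" by (rule C'(2)[OF m0])
    also have "\<dots> \<le> c0 / 8 * (4 * (\<bar>v\<bar> ^ 3 + \<bar>c\<bar> ^ 3)) + C'"
      unfolding m_def using c0(1) by (intro add_right_mono mult_left_mono cube_sum_le) simp
    also have "c0 / 8 * (4 * (\<bar>v\<bar> ^ 3 + \<bar>c\<bar> ^ 3)) = c0 / 2 * (\<bar>v\<bar> ^ 3 + c ^ 3)"
      unfolding abs_of_nonneg[OF c] by simp
    finally have "\<bar>qv ?r v c\<bar> \<le> c0 / 2 * (\<bar>v\<bar> ^ 3 + c ^ 3) + C'" .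
    then show "c0 / 2 * (\<bar>v\<bar> ^ 3 + c ^ 3) - C' \<le> qv (\<lambda>s. s\<^sup>2) v c - 2 * qv (bend 0) v c"
      unfolding eq using c0(2)[OF c, of v] by linarith
  qed
qed

text \<open>By \<open>avg_by_parts\<close>, the terms \<open>v * avg (wgtr \<gamma>) \<psi>\<close>
  and \<open>v * avg (wgt \<gamma>) \<psi>\<close> differ by a multiple of
  \<open>v * avg ywgt \<psi>'\<close>. The symmetrized form serves to find the sign of the source,
  the other form its size.\<close>

lemma gv_integral:
  assumes "\<And>s. (\<psi> has_real_derivative \<psi>' s) (at s)" "continuous_on UNIV \<psi>'"
  shows "gv \<psi> v c = theta \<gamma> * c * integral {0..1} (\<lambda>y. y * wgt \<gamma> y *
     (v * (\<psi>' (v + c * y) - \<psi>' (v - c * y)) - (\<psi> (v + c * y) - \<psi> (v - c * y))))"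
    and "gv \<psi> v c = theta \<gamma> * c * avg ywgt (\<lambda>s. v * \<psi>' s - \<psi> s) v c"
proof -
  have cpsi: "continuous_on UNIV \<psi>"
    using assms(1) by (meson DERIV_continuous continuous_at_imp_continuous_on)
  have cm: "continuous_on UNIV (\<lambda>s. v * \<psi>' s)" "continuous_on UNIV (\<lambda>s. (-1) * \<psi> s)"
    by (intro continuous_intros cpsi assms)+
  have "avg ywgt (\<lambda>s. v * \<psi>' s + (-1) * \<psi> s) v c = v * avg ywgt \<psi>' v c + (-1) * avg ywgt \<psi> v c"
    unfolding avg_add[OF continuous_ywgt cm] by (simp only: avg_cmult)
  then have F: "avg ywgt (\<lambda>s. v * \<psi>' s - \<psi> s) v c = v * avg ywgt \<psi>' v c - avg ywgt \<psi> v c" by simp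
  have "gv \<psi> v c = v * (theta \<gamma> * c * avg ywgt \<psi>' v c) - theta \<gamma> * c * avg ywgt \<psi> v c"
    unfolding gv_def qv_def avg_by_parts[OF assms] by (simp add: algebra_simps)
  then show *: "gv \<psi> v c = theta \<gamma> * c * avg ywgt (\<lambda>s. v * \<psi>' s - \<psi> s) v c"
    unfolding F by (simp add: algebra_simps)
  have "avg ywgt (\<lambda>s. v * \<psi>' s - \<psi> s) v c = integral {0..1} (\<lambda>y. ywgt y * (v * \<psi>' (v + c * y) - \<psi> (v + c * y)) +
     ywgt (- y) * (v * \<psi>' (v + c * (- y)) - \<psi> (v + c * (- y))))"
    unfolding avg_def
    by (intro integral_symmetric continuous_intros continuous_ywgt
       continuous_on_compose2[OF cpsi] continuous_on_compose2[OF assms(2)]) auto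
  also have "\<dots> = integral {0..1} (\<lambda>y. y * wgt \<gamma> y *
     (v * (\<psi>' (v + c * y) - \<psi>' (v - c * y)) - (\<psi> (v + c * y) - \<psi> (v - c * y))))"
    by (intro Henstock_Kurzweil_Integration.integral_cong) (simp add: ywgt_def wgt_minus algebra_simps)
  finally show "gv \<psi> v c = theta \<gamma> * c * integral {0..1} (\<lambda>y. y * wgt \<gamma> y *
     (v * (\<psi>' (v + c * y) - \<psi>' (v - c * y)) - (\<psi> (v + c * y) - \<psi> (v - c * y))))"
    using * by simp
qed

text \<open>The weight \<open>s^2\<close> corresponds to the energy, which has no geometric source:
  at \<open>v + c * y\<close> and \<open>v - c * y\<close> both differences in the integrand equal
  \<open>4 * v * c * y\<close>.\<close>

lemma gv_square: "gv (\<lambda>s. s\<^sup>2) v c = 0"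
proof -
  have "((\<lambda>s. s\<^sup>2) has_real_derivative 2 * s) (at s)" for s :: real
    by (auto intro!: derivative_eq_intros)
  then show ?thesis
    by (subst gv_integral(1)[where \<psi>' = "\<lambda>s. 2 * s"])
       (auto intro!: continuous_intros simp: power2_eq_square algebra_simps)
qed

lemma gv_bend_nonneg:
  assumes "0 \<le> c"
  shows "0 \<le> gv (bend 0) v c"
  unfolding gv_integral(1)[OF bend_deriv continuous_bend(2)]
proof (intro mult_nonneg_nonneg integral_nonneg)
  show "(\<lambda>y. y * wgt \<gamma> y * (v * (bend' 0 (v + c * y) - bend' 0 (v - c * y)) -
      (bend 0 (v + c * y) - bend 0 (v - c * y)))) integrable_on {0..1}"
    by (intro integrable_continuous_real continuous_intros continuous_wgt
      continuous_on_compose2[OF continuous_bend(1)[of UNIV]] continuous_on_compose2[OF continuous_bend(2)[of UNIV]]) auto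
  fix y :: real assume "y \<in> {0..1}"
  then show "0 \<le> v * (bend' 0 (v + c * y) - bend' 0 (v - c * y)) - (bend 0 (v + c * y) - bend 0 (v - c * y))"
    using bend_0_chord[of "c * y" v] assms by simp
qed (use theta_bounds assms in \<open>auto simp: wgt_nonneg\<close>)

text \<open>The source has the same cubic order as the coercive term, which is why the test function
  must grow at a rate that compensates it. The number \<open>64\<close> is a generous bound; doubled
  by the factor in front of \<open>bend 0\<close> it becomes the \<open>128\<close> of the later
  estimates.\<close>

lemma gv_bend_le:
  assumes "0 \<le> c"
  shows "gv (bend 0) v c \<le> 64 * (1 + \<bar>v\<bar> ^ 3 + c ^ 3)"
proof -
  let ?m = "\<bar>v\<bar> + \<bar>c\<bar>" and ?F = "\<lambda>s. v * bend' 0 s - bend 0 s"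
  have b: "\<bar>?F s\<bar> \<le> 3 * ?m\<^sup>2 + 2 * ?m + 1" if s: "\<bar>s\<bar> \<le> ?m" for s
  proof -
    have "\<bar>v * bend' 0 s\<bar> \<le> ?m * (2 * ?m + 1)"
      unfolding abs_mult using bend'_0_abs_le[of s] s by (intro mult_mono) auto
    moreover have "\<bar>bend 0 s\<bar> \<le> ?m\<^sup>2 + ?m + 1"
    proof -
      have "s\<^sup>2 \<le> ?m\<^sup>2" using s by (simp add: abs_le_square_iff[symmetric])
      then show ?thesis using bend_0_abs_le[of s] s by linarith
    qed
    moreover have "?m * (2 * ?m + 1) = 2 * ?m\<^sup>2 + ?m" by (simp add: power2_eq_square algebra_simps)
    moreover have "\<bar>v * bend' 0 s - bend 0 s\<bar> \<le> \<bar>v * bend' 0 s\<bar> + \<bar>bend 0 s\<bar>"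
      by (rule abs_triangle_ineq4)
    moreover have "x \<le> 3 * m\<^sup>2 + 2 * m + 1"
      if "y \<le> m * (2 * m + 1)" "z \<le> m\<^sup>2 + m + 1" "m * (2 * m + 1) = 2 * m\<^sup>2 + m" "x \<le> y + z"
      for x y z m :: real using that by linarith
    ultimately show ?thesis by blast
  qed
  have "\<bar>avg ywgt ?F v c\<bar> \<le> 2 * 1 * (3 * ?m\<^sup>2 + 2 * ?m + 1)"
  proof (rule avg_abs_le)
    fix y :: real assume y: "y \<in> {-1..1}"
    then have "\<bar>c * y\<bar> \<le> \<bar>c\<bar>" by (auto simp: abs_mult mult_left_le)
    then show "\<bar>?F (v + c * y)\<bar> \<le> 3 * ?m\<^sup>2 + 2 * ?m + 1" by (intro b) linarith
  next
    show "continuous_on UNIV ?F" by (intro continuous_intros continuous_bend)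
  qed (fact continuous_ywgt ywgt_abs_le)+
  then have avg_le: "\<bar>avg ywgt ?F v c\<bar> \<le> 2 * (3 * ?m\<^sup>2 + 2 * ?m + 1)" by simp
  have "theta \<gamma> * c * avg ywgt ?F v c \<le> \<bar>theta \<gamma> * c * avg ywgt ?F v c\<bar>" by (rule abs_ge_self)
  also have "\<dots> = theta \<gamma> * \<bar>c\<bar> * \<bar>avg ywgt ?F v c\<bar>" using theta_bounds by (simp add: abs_mult)
  also have "\<dots> \<le> 1 * ?m * (2 * (3 * ?m\<^sup>2 + 2 * ?m + 1))"
    by (intro mult_mono avg_le mult_nonneg_nonneg) (use theta_bounds in auto)
  also have "\<dots> = 6 * ?m ^ 3 + 4 * ?m\<^sup>2 + 2 * ?m" by (simp add: power2_eq_square power3_eq_cube algebra_simps)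
  also have "\<dots> \<le> 12 * (1 + ?m ^ 3)"
  proof -
    have "?m\<^sup>2 \<le> 1 + ?m ^ 3 \<and> ?m \<le> 1 + ?m ^ 3"
    proof (cases "?m \<le> 1")
      case True
      moreover from True have "?m\<^sup>2 \<le> 1" by (intro power_le_one) auto
      moreover have "0 \<le> ?m ^ 3" by simp
      ultimately show ?thesis by linarith
    next
      case False
      then have "?m ^ 2 \<le> ?m ^ 3" "?m ^ 1 \<le> ?m ^ 3" by (intro power_increasing; simp)+
      then show ?thesis by auto
    qed
    moreover have "0 \<le> ?m ^ 3" by simp
    moreover have "6 * z + 4 * y + 2 * x \<le> 12 * (1 + z)"
      if "y \<le> 1 + z \<and> x \<le> 1 + z" "0 \<le> z" for x y z :: real
      using that by (auto simp: algebra_simps)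
    ultimately show ?thesis by blast
  qed
  also have "\<dots> \<le> 12 * (1 + 4 * (\<bar>v\<bar> ^ 3 + \<bar>c\<bar> ^ 3))"
    by (intro mult_left_mono add_left_mono cube_sum_le) auto
  also have "\<dots> \<le> 64 * (1 + \<bar>v\<bar> ^ 3 + c ^ 3)" using assms by simp
  finally show ?thesis unfolding gv_integral(2)[OF bend_deriv continuous_bend(2)] .
qed

text \<open>Odd powers of \<open>c\<close> cancel in the symmetrized integrand, and what remains,
  \<open>2 * v ^ 3 + (2 + 4 * theta \<gamma>) * (v * (c * y)^2)\<close>, has a factor
  \<open>v\<close>. Near the origin of a spherical flow this flux is therefore controlled by the
  momentum, whose trace vanishes.\<close>

lemma qv_square_abs_le:
  assumes "0 \<le> c"
  shows "\<bar>qv (\<lambda>s. s\<^sup>2) v c\<bar> \<le> 8 * \<bar>v\<bar> * (v\<^sup>2 + c\<^sup>2)"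
proof -
  have "qv (\<lambda>s. s\<^sup>2) v c = integral {0..1} (\<lambda>y. wgt \<gamma> y * (2 * v ^ 3 + (2 + 4 * theta \<gamma>) * (v * (c * y)\<^sup>2)))"
    by (subst qv_integral) (auto intro!: continuous_intros Henstock_Kurzweil_Integration.integral_cong
      simp: power2_eq_square power3_eq_cube algebra_simps)
  also have "norm \<dots> \<le> (8 * \<bar>v\<bar> * (v\<^sup>2 + c\<^sup>2)) * (1 - 0)"
  proof (rule integral_bound)
    fix y :: real assume y: "y \<in> {0..1}"
    have "(c * y)\<^sup>2 \<le> c\<^sup>2" using y assms by (intro power_mono) (auto simp: mult_left_le)
    then have "(2 + 4 * theta \<gamma>) * (\<bar>v\<bar> * (c * y)\<^sup>2) \<le> 8 * (\<bar>v\<bar> * c\<^sup>2)"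
      using theta_bounds by (intro mult_mono) auto
    moreover have "\<bar>v\<bar> ^ 3 = \<bar>v\<bar> * v\<^sup>2" by (simp add: power3_eq_cube power2_eq_square)
    moreover have "\<bar>2 * v ^ 3 + (2 + 4 * theta \<gamma>) * (v * (c * y)\<^sup>2)\<bar> \<le> 2 * \<bar>v\<bar> ^ 3 + (2 + 4 * theta \<gamma>) * (\<bar>v\<bar> * (c * y)\<^sup>2)"
    proof -
      have "\<bar>(2 + 4 * theta \<gamma>) * (v * (c * y)\<^sup>2)\<bar> = (2 + 4 * theta \<gamma>) * (\<bar>v\<bar> * (c * y)\<^sup>2)"
        using theta_bounds by (simp only: abs_mult abs_power2 abs_of_nonneg)
      moreover have "\<bar>2 * v ^ 3\<bar> = 2 * \<bar>v\<bar> ^ 3" by (simp add: abs_mult power_abs)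
      ultimately show ?thesis
        using abs_triangle_ineq[of "2 * v ^ 3" "(2 + 4 * theta \<gamma>) * (v * (c * y)\<^sup>2)"] by (simp only:)
    qed
    moreover have "0 \<le> \<bar>v\<bar> * v\<^sup>2" by simp

    moreover have "x \<le> 8 * p + 8 * r" if "w \<le> 8 * r" "s = p" "x \<le> 2 * s + w" "0 \<le> p" for x w r s p :: real
      using that by linarith
    ultimately have "\<bar>2 * v ^ 3 + (2 + 4 * theta \<gamma>) * (v * (c * y)\<^sup>2)\<bar> \<le> 8 * (\<bar>v\<bar> * v\<^sup>2) + 8 * (\<bar>v\<bar> * c\<^sup>2)"
      by blast
    then have "\<bar>2 * v ^ 3 + (2 + 4 * theta \<gamma>) * (v * (c * y)\<^sup>2)\<bar> \<le> 8 * \<bar>v\<bar> * (v\<^sup>2 + c\<^sup>2)"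
      by (simp only: distrib_left mult.assoc)
    then have "\<bar>wgt \<gamma> y\<bar> * \<bar>2 * v ^ 3 + (2 + 4 * theta \<gamma>) * (v * (c * y)\<^sup>2)\<bar> \<le> 1 * (8 * \<bar>v\<bar> * (v\<^sup>2 + c\<^sup>2))"
      using wgt_abs_le by (intro mult_mono) auto
    then show "norm (wgt \<gamma> y * (2 * v ^ 3 + (2 + 4 * theta \<gamma>) * (v * (c * y)\<^sup>2))) \<le> 8 * \<bar>v\<bar> * (v\<^sup>2 + c\<^sup>2)"
      by (simp add: abs_mult)
  qed (auto intro!: continuous_intros continuous_wgt)
  finally show ?thesis by simp
qed

end

section \<open>Densities that are small relative to the cubic weight\<close>

lemma C2_deriv:
  assumes "C2 \<psi>"
  shows "(\<psi> has_real_derivative deriv \<psi> s) (at s)" "continuous_on UNIV (deriv \<psi>)"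
proof -
  have d: "\<psi> differentiable (at s)" "deriv \<psi> differentiable (at s)" for s using assms by (auto simp: C2_def)
  show "(\<psi> has_real_derivative deriv \<psi> s) (at s)"
    using d(1)[of s] by (simp add: DERIV_deriv_iff_real_differentiable)
  have "isCont (deriv \<psi>) s" for s
    using d(2)[of s] by (rule differentiable_imp_continuous_within)
  then show "continuous_on UNIV (deriv \<psi>)" by (simp add: continuous_at_imp_continuous_on)
qed

lemma growth_below_bound:
  assumes "growth_below k \<psi>" "continuous_on UNIV \<psi>" "0 < \<epsilon>"
  obtains K where "0 \<le> K" "\<And>s. \<bar>\<psi> s\<bar> \<le> \<epsilon> * \<bar>s\<bar> ^ k + K"
proof -
  have "\<forall>\<^sub>F s in at_infinity. norm (\<psi> s) \<le> \<epsilon> * norm (\<bar>s\<bar> ^ k)"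
    using assms(1,3) unfolding growth_below_def by (rule landau_o.smallD)
  then obtain b where b: "\<And>s. b \<le> norm s \<Longrightarrow> norm (\<psi> s) \<le> \<epsilon> * norm (\<bar>s\<bar> ^ k)"
    unfolding eventually_at_infinity by auto
  have "compact (\<psi> ` {-b..b})"
    by (rule compact_continuous_image[OF continuous_on_subset[OF assms(2)] compact_Icc]) simp
  then obtain B where B: "\<forall>y\<in>\<psi> ` {-b..b}. norm y \<le> B"
    using compact_imp_bounded bounded_iff by meson
  have "\<bar>\<psi> s\<bar> \<le> \<epsilon> * \<bar>s\<bar> ^ k + max 0 B" for s
  proof (cases "b \<le> \<bar>s\<bar>")
    case True
    then have "\<bar>\<psi> s\<bar> \<le> \<epsilon> * \<bar>s\<bar> ^ k" using b[of s] by simp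
    then show ?thesis by linarith
  next
    case False
    then have "s \<in> {-b..b}" by auto
    then have "\<bar>\<psi> s\<bar> \<le> B" using B by auto
    moreover have "0 \<le> \<epsilon> * \<bar>s\<bar> ^ k" using assms(3) by simp
    ultimately show ?thesis by linarith
  qed
  then show thesis by (rule that[rotated]) simp
qed

text \<open>At the Riemann invariants of a state this is the quantity \<open>c\<close>, the power
  \<open>theta \<gamma>\<close> of the density.\<close>

definition half_diff :: "real \<times> real \<Rightarrow> real" where
  "half_diff a = (fst a - snd a) / 2"

definition cubic_weight :: "real \<Rightarrow> real \<times> real \<Rightarrow> real" where
  "cubic_weight \<gamma> a = dens \<gamma> a * (\<bar>vel a\<bar> ^ 3 + \<bar>half_diff a\<bar> ^ 3)"

text \<open>Smallness relative to the cube at infinity, written with an additive constant so that it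
  holds on the whole plane.\<close>

definition subcubic :: "(real \<Rightarrow> real \<Rightarrow> real) \<Rightarrow> bool" where
  "subcubic F \<longleftrightarrow> (\<forall>\<epsilon>>0. \<exists>K. \<forall>v c. \<bar>F v c\<bar> \<le> \<epsilon> * (\<bar>v\<bar> + \<bar>c\<bar>) ^ 3 + K)"

lemma norm_state_le: "norm a \<le> 2 * (\<bar>vel a\<bar> + \<bar>half_diff a\<bar>)"
proof -
  have "norm a = norm (fst a, snd a)" by simp
  also have "\<dots> \<le> \<bar>fst a\<bar> + \<bar>snd a\<bar>" by (rule order_trans[OF norm_Pair_le]) simp
  also have "\<dots> \<le> 2 * (\<bar>vel a\<bar> + \<bar>half_diff a\<bar>)" by (simp add: vel_def half_diff_def)
  finally show ?thesis .
qed

text \<open>Fluxes carry one more power than their weight. For a weight of subquadratic growth the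
  product is subcubic, the linear term \<open>k * K * m\<close> being absorbed by half of the
  cube.\<close>

lemma linear_times_quadratic_subcubic:
  assumes "0 \<le> k" and "\<And>\<epsilon>. 0 < \<epsilon> \<Longrightarrow> \<exists>K\<ge>0. \<forall>v c. \<bar>F v c\<bar> \<le> k * (\<bar>v\<bar> + \<bar>c\<bar>) * (\<epsilon> * (\<bar>v\<bar> + \<bar>c\<bar>)\<^sup>2 + K)"
  shows "subcubic F"
  unfolding subcubic_def
proof (intro allI impI)
  fix \<epsilon> :: real assume \<epsilon>: "0 < \<epsilon>"
  define \<epsilon>' where "\<epsilon>' = \<epsilon> / (2 * (k + 1))"
  have \<epsilon>': "0 < \<epsilon>'" using \<epsilon> assms(1) by (simp add: \<epsilon>'_def)
  have k\<epsilon>: "k * \<epsilon>' \<le> \<epsilon> / 2" using \<epsilon> assms(1) by (simp add: \<epsilon>'_def field_simps)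
  obtain K where K: "0 \<le> K" "\<forall>v c. \<bar>F v c\<bar> \<le> k * (\<bar>v\<bar> + \<bar>c\<bar>) * (\<epsilon>' * (\<bar>v\<bar> + \<bar>c\<bar>)\<^sup>2 + K)"
    using assms(2)[OF \<epsilon>'] by blast
  obtain C where C: "\<And>m. 0 \<le> m \<Longrightarrow> (k * K) * m \<le> (\<epsilon> / 2) * m ^ 3 + C"
    by (rule linear_le_cube[of "\<epsilon> / 2" "k * K"]) (use \<epsilon> K assms(1) in auto)
  have "\<bar>F v c\<bar> \<le> \<epsilon> * (\<bar>v\<bar> + \<bar>c\<bar>) ^ 3 + C" for v c
  proof -
    define m where "m = \<bar>v\<bar> + \<bar>c\<bar>"
    have m: "0 \<le> m" by (simp add: m_def)
    have "\<bar>F v c\<bar> \<le> k * m * (\<epsilon>' * m\<^sup>2 + K)" using K(2) by (simp add: m_def)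
    also have "\<dots> = (k * \<epsilon>') * m ^ 3 + (k * K) * m"
      by (simp add: power2_eq_square power3_eq_cube algebra_simps)
    also have "\<dots> \<le> (\<epsilon> / 2) * m ^ 3 + ((\<epsilon> / 2) * m ^ 3 + C)"
      by (rule add_mono[OF mult_right_mono[OF k\<epsilon>] C[OF m]]) (simp add: m)
    also have "\<dots> = \<epsilon> * m ^ 3 + C" by simp
    finally show ?thesis unfolding m_def .
  qed
  then show "\<exists>K. \<forall>v c. \<bar>F v c\<bar> \<le> \<epsilon> * (\<bar>v\<bar> + \<bar>c\<bar>) ^ 3 + K" by blast
qed

section \<open>The three functions of the theorem as functions of the Riemann invariants\<close>

context exponent
begin

lemma dens_nonneg: "0 \<le> dens \<gamma> a" by (simp add: dens_def)

lemma continuous_dens: "continuous_on H_cl (dens \<gamma>)"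
  unfolding dens_def[abs_def] using theta_bounds
  by (intro continuous_on_powr' continuous_intros) (auto simp: H_cl_def)

lemma dens_powr: "a \<in> H_cl \<Longrightarrow> dens \<gamma> a powr theta \<gamma> = half_diff a"
  using theta_bounds by (simp add: dens_def half_diff_def powr_powr H_cl_def)

lemma dens_diagonal: "dens \<gamma> (s, s) = 0"
  by (simp add: dens_def)

lemma continuous_cubic_weight: "continuous_on H_cl (cubic_weight \<gamma>)"
  unfolding cubic_weight_def[abs_def] vel_def[abs_def] half_diff_def[abs_def]
  by (intro continuous_intros continuous_dens) simp_all

lemma cubic_weight_riemann:
  "cubic_weight \<gamma> (riemann \<gamma> r v) = \<bar>r\<bar> * (\<bar>v\<bar> ^ 3 + (r powr theta \<gamma>) ^ 3)"
proof -
  have "dens \<gamma> (riemann \<gamma> r v) = \<bar>r\<bar>"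
    using theta_bounds by (simp add: dens_def riemann_def powr_powr)
  then show ?thesis by (simp add: cubic_weight_def vel_def half_diff_def riemann_def)
qed

lemma riemann_H_cl: "riemann \<gamma> r v \<in> H_cl"
  by (simp add: riemann_def H_cl_def)

text \<open>The conclusions are what the passage to the limit asks of \<open>f\<close>: continuity
  up to the vacuum, value zero there, and domination at infinity by every positive multiple of the
  cubic weight.\<close>

lemma state_function:
  assumes F: "continuous_on UNIV (\<lambda>p. F (fst p) (snd p))" "subcubic F"
    and f: "\<And>a. a \<in> H_cl \<Longrightarrow> f a = dens \<gamma> a * F (vel a) (half_diff a)"
  shows "continuous_on H_cl f" "f (s, s) = 0"
    "0 < \<epsilon> \<Longrightarrow> \<exists>R. \<forall>a\<in>H_cl. R \<le> norm a \<longrightarrow> \<bar>f a\<bar> \<le> \<epsilon> * cubic_weight \<gamma> a"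
proof -
  have "continuous_on H_cl (\<lambda>a. dens \<gamma> a * F (vel a) (half_diff a))"
  proof (intro continuous_on_mult continuous_dens)
    have "continuous_on H_cl (\<lambda>a. (vel a, half_diff a))"
      unfolding vel_def half_diff_def by (intro continuous_intros) simp_all
    from continuous_on_compose2[OF F(1) this] show "continuous_on H_cl (\<lambda>a. F (vel a) (half_diff a))" by simp
  qed
  then show "continuous_on H_cl f" by (subst continuous_on_cong[OF refl f])
  show "f (s, s) = 0" using f[of "(s, s)"] by (simp add: H_cl_def dens_diagonal)
  assume \<epsilon>: "0 < \<epsilon>"
  then have \<epsilon>8: "0 < \<epsilon> / 8" by simp
  obtain K where K: "\<forall>v c. \<bar>F v c\<bar> \<le> \<epsilon> / 8 * (\<bar>v\<bar> + \<bar>c\<bar>) ^ 3 + K"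
    using F(2) \<epsilon>8 unfolding subcubic_def by blast
  \<comment> \<open>The factor \<open>2\<close> is that of \<open>norm_state_le\<close>. Beyond
    \<open>R\<close> the constant \<open>K\<close> is at most \<open>\<epsilon> / 8\<close> times
    the cube; the sum \<open>\<epsilon> / 4\<close> is what the factor \<open>4\<close> of
    \<open>cube_sum_le\<close> turns into \<open>\<epsilon>\<close>.\<close>
  define R where "R = 2 * max 1 (K / (\<epsilon> / 8))"
  have "\<bar>f a\<bar> \<le> \<epsilon> * cubic_weight \<gamma> a" if a: "a \<in> H_cl" "R \<le> norm a" for a
  proof -
    define m where "m = \<bar>vel a\<bar> + \<bar>half_diff a\<bar>"
    have "R \<le> 2 * m" using norm_state_le[of a] a(2) by (simp add: m_def)
    then have m: "1 \<le> m" "K / (\<epsilon> / 8) \<le> m" by (simp_all add: R_def)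
    have "m ^ 1 \<le> m ^ 3" using m(1) by (intro power_increasing) auto
    then have "K / (\<epsilon> / 8) \<le> m ^ 3" using m(2) by simp
    then have "K \<le> \<epsilon> / 8 * m ^ 3" using \<epsilon>8 by (simp add: pos_divide_le_eq mult.commute)
    moreover have "\<bar>F (vel a) (half_diff a)\<bar> \<le> \<epsilon> / 8 * m ^ 3 + K" using K by (simp add: m_def)
    ultimately have "\<bar>F (vel a) (half_diff a)\<bar> \<le> \<epsilon> / 4 * m ^ 3" by simp
    also have "\<dots> \<le> \<epsilon> / 4 * (4 * (\<bar>vel a\<bar> ^ 3 + \<bar>half_diff a\<bar> ^ 3))"
      unfolding m_def using \<epsilon> by (intro mult_left_mono cube_sum_le) simp
    also have "\<dots> = \<epsilon> * (\<bar>vel a\<bar> ^ 3 + \<bar>half_diff a\<bar> ^ 3)" by simp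
    finally have "\<bar>F (vel a) (half_diff a)\<bar> \<le> \<epsilon> * (\<bar>vel a\<bar> ^ 3 + \<bar>half_diff a\<bar> ^ 3)" .
    then have "dens \<gamma> a * \<bar>F (vel a) (half_diff a)\<bar> \<le> dens \<gamma> a * (\<epsilon> * (\<bar>vel a\<bar> ^ 3 + \<bar>half_diff a\<bar> ^ 3))"
      by (rule mult_left_mono[OF _ dens_nonneg])
    then show ?thesis by (simp add: f[OF a(1)] abs_mult dens_nonneg cubic_weight_def mult.left_commute)
  qed
  then show "\<exists>R. \<forall>a\<in>H_cl. R \<le> norm a \<longrightarrow> \<bar>f a\<bar> \<le> \<epsilon> * cubic_weight \<gamma> a" by blast
qed

lemma wgtr_abs_le:
  obtains k where "0 \<le> k" "\<And>y. y \<in> {-1..1} \<Longrightarrow> \<bar>wgtr \<gamma> y\<bar> \<le> k"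
proof -
  have "compact (wgtr \<gamma> ` {-1..1})" by (rule compact_continuous_image[OF continuous_wgtr compact_Icc])
  then obtain B where B: "\<forall>y\<in>wgtr \<gamma> ` {-1..1}. norm y \<le> B"
    using compact_imp_bounded bounded_iff by meson
  have "\<bar>wgtr \<gamma> y\<bar> \<le> max 0 B" if "y \<in> {-1..1}" for y
    using B that by (simp add: le_max_iff_disj)
  with max.cobounded1 show thesis by (rule that)
qed

lemma range_bound: "y \<in> {-1..1} \<Longrightarrow> \<bar>v + c * y\<bar> \<le> \<bar>v\<bar> + \<bar>c\<bar>" for y v c :: real
proof -
  assume "y \<in> {-1..1}"
  then have "\<bar>c * y\<bar> \<le> \<bar>c\<bar>" by (auto simp: abs_mult mult_left_le)
  then show ?thesis by linarith
qed

lemma continuous_qv: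
  assumes "continuous_on UNIV \<psi>"
  shows "continuous_on UNIV (\<lambda>p. qv \<psi> (fst p) (snd p))"
  unfolding qv_def
  by (intro continuous_intros continuous_avg[OF continuous_wgt assms] continuous_avg[OF continuous_ywgt assms])

lemma eta_state:
  assumes "C2 \<psi>" "growth_below 3 \<psi>"
  shows "continuous_on UNIV (\<lambda>p. avg (wgt \<gamma>) \<psi> (fst p) (snd p))" "subcubic (avg (wgt \<gamma>) \<psi>)"
    "a \<in> H_cl \<Longrightarrow> of_riemann \<gamma> (eta \<gamma> \<psi>) a = dens \<gamma> a * avg (wgt \<gamma>) \<psi> (vel a) (half_diff a)"
proof -
  have c: "continuous_on UNIV \<psi>" by (rule continuous_on_subset[OF _ subset_UNIV])
     (use C2_deriv(1)[OF assms(1)] DERIV_isCont continuous_at_imp_continuous_on in blast)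
  show "continuous_on UNIV (\<lambda>p. avg (wgt \<gamma>) \<psi> (fst p) (snd p))"
    by (rule continuous_avg[OF continuous_wgt c])
  show "a \<in> H_cl \<Longrightarrow> of_riemann \<gamma> (eta \<gamma> \<psi>) a = dens \<gamma> a * avg (wgt \<gamma>) \<psi> (vel a) (half_diff a)"
    by (simp add: of_riemann_def eta_avg[OF c] dens_powr dens_nonneg)
  show "subcubic (avg (wgt \<gamma>) \<psi>)"
    unfolding subcubic_def
  proof (intro allI impI)
    fix \<epsilon> :: real assume "0 < \<epsilon>"
    then have e: "0 < \<epsilon> / 2" by simp
    obtain K where K: "0 \<le> K" "\<And>s. \<bar>\<psi> s\<bar> \<le> \<epsilon> / 2 * \<bar>s\<bar> ^ 3 + K"
      by (rule growth_below_bound[OF assms(2) c e], rule that)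
    have "\<bar>avg (wgt \<gamma>) \<psi> v w\<bar> \<le> \<epsilon> * (\<bar>v\<bar> + \<bar>w\<bar>) ^ 3 + 2 * K" for v w
    proof -
      have "\<bar>avg (wgt \<gamma>) \<psi> v w\<bar> \<le> 2 * 1 * (\<epsilon> / 2 * (\<bar>v\<bar> + \<bar>w\<bar>) ^ 3 + K)"
      proof (rule avg_abs_le[OF continuous_wgt c wgt_abs_le])
        fix y :: real assume y: "y \<in> {-1..1}"
        have "\<bar>v + w * y\<bar> ^ 3 \<le> (\<bar>v\<bar> + \<bar>w\<bar>) ^ 3" by (rule power_mono[OF range_bound[OF y]]) simp
        then have "\<epsilon> / 2 * \<bar>v + w * y\<bar> ^ 3 \<le> \<epsilon> / 2 * (\<bar>v\<bar> + \<bar>w\<bar>) ^ 3"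
          by (rule mult_left_mono) (use e in simp)
        then show "\<bar>\<psi> (v + w * y)\<bar> \<le> \<epsilon> / 2 * (\<bar>v\<bar> + \<bar>w\<bar>) ^ 3 + K"
          using K(2)[of "v + w * y"] by linarith
      qed
      then show ?thesis by simp
    qed
    then show "\<exists>K. \<forall>v c. \<bar>avg (wgt \<gamma>) \<psi> v c\<bar> \<le> \<epsilon> * (\<bar>v\<bar> + \<bar>c\<bar>) ^ 3 + K" by blast
  qed
qed

lemma flux_state:
  assumes C2: "C2 \<psi>" and gr: "growth_below 2 \<psi>"
  shows "continuous_on UNIV (\<lambda>p. qv \<psi> (fst p) (snd p))" "subcubic (qv \<psi>)"
    "a \<in> H_cl \<Longrightarrow> of_riemann \<gamma> (q \<gamma> \<psi>) a = dens \<gamma> a * qv \<psi> (vel a) (half_diff a)"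
    "continuous_on UNIV (\<lambda>p. fst p * avg (wgtr \<gamma>) \<psi> (fst p) (snd p))"
    "subcubic (\<lambda>v c. v * avg (wgtr \<gamma>) \<psi> v c)"
    "a \<in> H_cl \<Longrightarrow> of_riemann \<gamma> (ru_eta_r \<gamma> \<psi>) a = dens \<gamma> a * (vel a * avg (wgtr \<gamma>) \<psi> (vel a) (half_diff a))"
proof -
  have c: "continuous_on UNIV \<psi>" by (rule continuous_on_subset[OF _ subset_UNIV])
     (use C2_deriv(1)[OF C2] DERIV_isCont continuous_at_imp_continuous_on in blast)
  show "continuous_on UNIV (\<lambda>p. qv \<psi> (fst p) (snd p))" by (rule continuous_qv[OF c])
  show "continuous_on UNIV (\<lambda>p. fst p * avg (wgtr \<gamma>) \<psi> (fst p) (snd p))"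
    by (intro continuous_intros continuous_avg[OF continuous_wgtr c])
  show "a \<in> H_cl \<Longrightarrow> of_riemann \<gamma> (q \<gamma> \<psi>) a = dens \<gamma> a * qv \<psi> (vel a) (half_diff a)"
    by (simp add: of_riemann_def q_avg[OF c refl] qv_def dens_powr dens_nonneg)
  show "a \<in> H_cl \<Longrightarrow> of_riemann \<gamma> (ru_eta_r \<gamma> \<psi>) a = dens \<gamma> a * (vel a * avg (wgtr \<gamma>) \<psi> (vel a) (half_diff a))"
    by (simp add: of_riemann_def ru_avg[OF C2_deriv[OF C2] refl] dens_powr dens_nonneg)
  have psi: "\<bar>\<psi> s\<bar> \<le> \<epsilon> * m\<^sup>2 + K" if "\<And>s. \<bar>\<psi> s\<bar> \<le> \<epsilon> * \<bar>s\<bar>\<^sup>2 + K" "\<bar>s\<bar> \<le> m" "0 < \<epsilon>" for s m \<epsilon> K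
  proof -
    have "\<bar>s\<bar>\<^sup>2 \<le> m\<^sup>2" by (rule power_mono[OF that(2)]) simp
    then have "\<epsilon> * \<bar>s\<bar>\<^sup>2 \<le> \<epsilon> * m\<^sup>2" by (rule mult_left_mono) (use that(3) in simp)
    then show ?thesis using that(1)[of s] by linarith
  qed
  show "subcubic (qv \<psi>)"
  proof (rule linear_times_quadratic_subcubic[of 2])
    fix \<epsilon> :: real assume e: "0 < \<epsilon>"
    obtain K where K: "0 \<le> K" "\<And>s. \<bar>\<psi> s\<bar> \<le> \<epsilon> * \<bar>s\<bar>\<^sup>2 + K"
      by (rule growth_below_bound[OF gr c e], rule that)
    have "\<bar>qv \<psi> v w\<bar> \<le> 2 * (\<bar>v\<bar> + \<bar>w\<bar>) * (\<epsilon> * (\<bar>v\<bar> + \<bar>w\<bar>)\<^sup>2 + K)" for v w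
      by (rule qv_abs_le[OF c]) (rule psi[OF K(2) _ e])
    with K(1) show "\<exists>K\<ge>0. \<forall>v c. \<bar>qv \<psi> v c\<bar> \<le> 2 * (\<bar>v\<bar> + \<bar>c\<bar>) * (\<epsilon> * (\<bar>v\<bar> + \<bar>c\<bar>)\<^sup>2 + K)" by blast
  qed simp
  obtain k where k: "0 \<le> k" "\<And>y. y \<in> {-1..1} \<Longrightarrow> \<bar>wgtr \<gamma> y\<bar> \<le> k"
    by (rule wgtr_abs_le, rule that)
  show "subcubic (\<lambda>v c. v * avg (wgtr \<gamma>) \<psi> v c)"
  proof (rule linear_times_quadratic_subcubic[of "2 * k"])
    fix \<epsilon> :: real assume e: "0 < \<epsilon>"
    obtain K where K: "0 \<le> K" "\<And>s. \<bar>\<psi> s\<bar> \<le> \<epsilon> * \<bar>s\<bar>\<^sup>2 + K"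
      by (rule growth_below_bound[OF gr c e], rule that)
    have "\<bar>v * avg (wgtr \<gamma>) \<psi> v w\<bar> \<le> 2 * k * (\<bar>v\<bar> + \<bar>w\<bar>) * (\<epsilon> * (\<bar>v\<bar> + \<bar>w\<bar>)\<^sup>2 + K)" for v w
    proof -
      have "\<bar>avg (wgtr \<gamma>) \<psi> v w\<bar> \<le> 2 * k * (\<epsilon> * (\<bar>v\<bar> + \<bar>w\<bar>)\<^sup>2 + K)"
        by (rule avg_abs_le[OF continuous_wgtr c k(2)]) (assumption, rule psi[OF K(2) range_bound e])
      then have "\<bar>v\<bar> * \<bar>avg (wgtr \<gamma>) \<psi> v w\<bar> \<le> (\<bar>v\<bar> + \<bar>w\<bar>) * (2 * k * (\<epsilon> * (\<bar>v\<bar> + \<bar>w\<bar>)\<^sup>2 + K))"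
        by (intro mult_mono) auto
      then show ?thesis by (simp add: abs_mult algebra_simps)
    qed
    with K(1) show "\<exists>K\<ge>0. \<forall>v c. \<bar>v * avg (wgtr \<gamma>) \<psi> v c\<bar> \<le> 2 * k * (\<bar>v\<bar> + \<bar>c\<bar>) * (\<epsilon> * (\<bar>v\<bar> + \<bar>c\<bar>)\<^sup>2 + K)" by blast
  qed (use k in simp)
qed

end

section \<open>Truncated moments of the Young measure\<close>

text \<open>The product topology on real functions is Hausdorff. This makes the images under
  \<open>ev\<close> of compact sets of states closed, hence Borel.\<close>

lemma closed_compact_fun:
  fixes K :: "('a \<Rightarrow> real) set"
  assumes "compact K" shows "closed K"
proof -
  have "Hausdorff_space (euclidean :: ('a \<Rightarrow> real) topology)"
    by (simp flip: euclidean_product_topology add: Hausdorff_space_product_topology Hausdorff_space_euclidean)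
  then show ?thesis
    using compactin_imp_closedin[of euclidean K] assms by (simp add: compactin_euclidean_iff flip: closed_closedin)
qed

section \<open>Truncations and the points of the compactification\<close>

definition cutoff :: "nat \<Rightarrow> real \<times> real \<Rightarrow> real" where
  "cutoff m a = max 0 (min 1 (real m + 1 - norm a))"

definition trunc :: "(real \<times> real \<Rightarrow> real) \<Rightarrow> nat \<Rightarrow> real \<times> real \<Rightarrow> real" where
  "trunc f m a = f a * cutoff m a"

lemma cutoff_bounds: "0 \<le> cutoff m a" "cutoff m a \<le> 1"
  by (auto simp: cutoff_def)

lemma cutoff_eq_1: "norm a \<le> real m \<Longrightarrow> cutoff m a = 1"
  by (simp add: cutoff_def)

lemma cutoff_eq_0: "real m + 1 \<le> norm a \<Longrightarrow> cutoff m a = 0"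
  by (simp add: cutoff_def)

lemma cutoff_mono: "m \<le> n \<Longrightarrow> cutoff m a \<le> cutoff n a"
  by (simp add: cutoff_def max.coboundedI2 min.coboundedI2)

lemma continuous_cutoff: "continuous_on A (cutoff m)"
  unfolding cutoff_def by (intro continuous_intros)

lemma closed_H_cl: "closed H_cl"
  unfolding H_cl_def by (intro closed_Collect_le continuous_intros)

lemma continuous_trunc: "continuous_on H_cl f \<Longrightarrow> continuous_on H_cl (trunc f m)"
  unfolding trunc_def[abs_def] by (intro continuous_intros continuous_cutoff)

lemma continuous_bounded_on_ball:
  assumes "continuous_on H_cl f"
  obtains B where "0 \<le> B" "\<And>a. a \<in> H_cl \<Longrightarrow> norm a \<le> R \<Longrightarrow> \<bar>f a\<bar> \<le> (B::real)"
proof -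
  have "compact (f ` (H_cl \<inter> cball 0 R))"
    by (intro compact_continuous_image continuous_on_subset[OF assms] closed_Int_compact closed_H_cl) auto
  then obtain B where "\<forall>x\<in>f ` (H_cl \<inter> cball 0 R). norm x \<le> B"
    using compact_imp_bounded bounded_iff by meson
  then show thesis by (intro that[of "max 0 B"]) (auto simp: le_max_iff_disj)
qed

lemma trunc_bounded:
  assumes "continuous_on H_cl f"
  obtains B where "0 \<le> B" "\<And>a. a \<in> H_cl \<Longrightarrow> \<bar>trunc f m a\<bar> \<le> B"
proof -
  obtain B where B: "0 \<le> B" "\<And>a. a \<in> H_cl \<Longrightarrow> norm a \<le> real m + 1 \<Longrightarrow> \<bar>f a\<bar> \<le> B"
    by (rule continuous_bounded_on_ball[OF assms, of "real m + 1"], rule that)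
  have "\<bar>trunc f m a\<bar> \<le> B" if a: "a \<in> H_cl" for a
  proof (cases "norm a \<le> real m + 1")
    case True
    have "\<bar>trunc f m a\<bar> = \<bar>f a\<bar> * cutoff m a" by (simp add: trunc_def abs_mult cutoff_bounds)
    also have "\<dots> \<le> B * 1" using B(2)[OF a True] B(1) cutoff_bounds[of m a] by (intro mult_mono)
    finally show ?thesis by simp
  next
    case False
    then show ?thesis using B(1) by (simp add: trunc_def cutoff_eq_0)
  qed
  with B(1) show thesis by (rule that)
qed

text \<open>A truncated function vanishes outside a ball, so all radial limits are zero, uniformly
  in the direction; being zero on the diagonal, it is constant there. Evaluation at the coordinate
  \<open>trunc f m\<close> is then a continuous function on the compactification that extends
  it.\<close>

lemma trunc_C_bar:
  assumes "continuous_on H_cl f" "\<And>s. f (s, s) = 0"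
  shows "trunc f m \<in> C_bar"
proof -
  obtain B where B: "\<And>a. a \<in> H_cl \<Longrightarrow> \<bar>trunc f m a\<bar> \<le> B"
    using trunc_bounded[OF assms(1)] by metis
  have "bounded (trunc f m ` H_cl)"
    unfolding bounded_iff using B by (intro exI[of _ B]) auto
  moreover have "trunc f m (s, s) = 0" for s by (simp add: trunc_def assms(2))
  moreover have "uniform_limit (sphere 0 1 \<inter> H_cl) (\<lambda>s a. trunc f m (s *\<^sub>R a)) (\<lambda>_. 0) at_top"
  proof (rule uniform_limitI)
    fix e :: real assume e: "0 < e"
    show "\<forall>\<^sub>F s in at_top. \<forall>a\<in>sphere 0 1 \<inter> H_cl. dist (trunc f m (s *\<^sub>R a)) 0 < e"
      using eventually_ge_at_top[of "real m + 1"]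
    proof eventually_elim
      case (elim s)
      have "trunc f m (s *\<^sub>R a) = 0" if "norm a = 1" for a
        using that elim by (simp add: trunc_def cutoff_eq_0)
      then show ?case using e by simp
    qed
  qed
  ultimately show ?thesis
    unfolding C_bar_def using continuous_trunc[OF assms(1)] by (auto intro!: exI[of _ "\<lambda>_. 0"])
qed

lemma continuous_ev: "continuous_on H_cl ev"
proof (rule continuous_on_coordinatewise_then_product)
  fix \<phi>
  show "continuous_on H_cl (\<lambda>a. ev a \<phi>)"
  proof (cases "\<phi> \<in> C_bar")
    case True
    then have "continuous_on H_cl \<phi>" by (simp add: C_bar_def)
    with True show ?thesis by (simp add: ev_def)
  qed (simp add: ev_def)
qed

text \<open>All functions of the ring are constant on the diagonal, so \<open>ev\<close> is constant
  there too, and the closure adds nothing to a single point.\<close>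

lemma vacuum_eq: "vacuum = {ev (0, 0)}"
proof -
  have "ev (s, s) = ev (0, 0)" for s
  proof
    show "ev (s, s) \<phi> = ev (0, 0) \<phi>" for \<phi>
    proof (cases "\<phi> \<in> C_bar")
      case True
      then obtain c where "\<forall>s. \<phi> (s, s) = c" by (auto simp: C_bar_def)
      then show ?thesis by (simp add: ev_def)
    qed (simp add: ev_def)
  qed
  then have "ev ` {a. fst a = snd a} = {ev (0, 0)}" by force
  moreover have "closed {ev (0, 0)}" by (rule closed_compact_fun) simp
  ultimately show ?thesis by (simp add: vacuum_def closure_closed)
qed

lemma ev_diagonal: "fst a = snd a \<Longrightarrow> ev a \<in> vacuum"
  unfolding vacuum_def by (intro closure_subset[THEN subsetD]) auto

text \<open>A tent function centred at \<open>a\<close> that reaches neither the diagonal nor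
  \<open>b\<close> belongs to the ring after truncation and separates the two points.\<close>

lemma ev_eq_imp:
  assumes a: "snd a < fst a" and b: "b \<in> H_cl" and "ev a = ev b"
  shows "a = b"
proof (rule ccontr)
  assume ne: "a \<noteq> b"
  \<comment> \<open>Half the gap between the two invariants bounds the distance of \<open>a\<close>
    to every point \<open>(s, s)\<close> from below.\<close>
  define r where "r = min ((fst a - snd a) / 2) (norm (b - a))"
  have r: "0 < r" using a ne by (simp add: r_def)
  define f where "f x = max 0 (r - norm (x - a))" for x
  have cf: "continuous_on H_cl f" unfolding f_def[abs_def] by (intro continuous_intros)
  have f0: "f (s, s) = 0" for s
  proof -
    have "\<bar>s - fst a\<bar> \<le> norm ((s, s) - a)" "\<bar>s - snd a\<bar> \<le> norm ((s, s) - a)"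
      by (metis fst_conv fst_diff norm_fst_le prod.collapse real_norm_def,
          metis snd_conv snd_diff norm_snd_le prod.collapse real_norm_def)
    then have "fst a - s \<le> norm ((s, s) - a)" "s - snd a \<le> norm ((s, s) - a)"
      by (simp_all add: abs_le_iff)
    moreover have "r \<le> (fst a - snd a) / 2" unfolding r_def by (rule min.cobounded1)
    ultimately have "r \<le> norm ((s, s) - a)" by (simp add: field_simps)
    then show ?thesis by (simp add: f_def)
  qed
  obtain m :: nat where m: "norm a \<le> real m" using real_arch_simple by blast
  have t: "trunc f m \<in> C_bar" by (rule trunc_C_bar[where f = f, OF cf f0])
  from fun_cong[OF assms(3), of "trunc f m"] have "trunc f m a = trunc f m b"
    using t by (simp add: ev_def)
  moreover have "trunc f m a = r" using r by (simp add: trunc_def f_def cutoff_eq_1[OF m])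
  moreover have "trunc f m b = 0" by (simp add: trunc_def f_def r_def)
  ultimately show False using r by simp
qed

lemma H_vac_eq: "H_vac = ev ` H_cl"
proof -
  have "vacuum \<subseteq> ev ` H_cl" unfolding vacuum_eq by (auto simp: H_cl_def)
  moreover have "ev a \<in> H_vac" if a: "a \<in> H_cl" for a
  proof (cases "fst a = snd a")
    case True then show ?thesis using ev_diagonal[OF True] by (simp add: H_vac_def)
  next
    case False then show ?thesis using a by (auto simp: H_vac_def H_cl_def)
  qed
  ultimately show ?thesis by (auto simp: H_vac_def H_cl_def)
qed

text \<open>Since \<open>f\<close> vanishes on the diagonal, the value zero prescribed at the vacuum
  agrees with that of \<open>f\<close>, and no case distinction is needed afterwards.\<close>

lemma on_H_vac_ev:
  assumes "a \<in> H_cl" "\<And>s. f (s, s) = 0"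
  shows "on_H_vac f (ev a) = f a"
proof (cases "fst a = snd a")
  case True
  then have "a = (fst a, fst a)" by (simp add: prod_eq_iff)
  then have "f a = 0" using assms(2) by metis
  then show ?thesis using ev_diagonal[OF True] by (simp add: on_H_vac_def)
next
  case False
  then have a: "snd a < fst a" using assms(1) by (simp add: H_cl_def)
  have "ev a \<notin> vacuum"
  proof
    assume "ev a \<in> vacuum"
    then have "ev a = ev (0, 0)" by (simp add: vacuum_eq)
    then have "a = (0, 0)" by (rule ev_eq_imp[OF a, rotated]) (simp add: H_cl_def)
    with a show False by simp
  qed
  moreover have "inj_on ev {a. fst a > snd a}"
    by (rule inj_onI, rule ev_eq_imp) (auto simp: H_cl_def)
  then have "inv_into {a. fst a > snd a} ev (ev a) = a" using a by (intro inv_into_f_f) auto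
  ultimately show ?thesis by (simp add: on_H_vac_def)
qed

text \<open>The set is a countable union of images of compact sets of states, which are compact and
  hence closed.\<close>

lemma borel_H_vac: "H_vac \<in> sets borel"
proof -
  have e: "H_vac = (\<Union>m. ev ` (H_cl \<inter> cball 0 (real m)))"
  proof -
    have "H_cl = (\<Union>m. H_cl \<inter> cball 0 (real m))" using real_arch_simple by (auto simp: mem_cball)
    then show ?thesis unfolding H_vac_eq by (metis image_UN)
  qed
  have c: "closed (ev ` (H_cl \<inter> cball 0 (real m)))" for m
    by (intro closed_compact_fun compact_continuous_image continuous_on_subset[OF continuous_ev]
       closed_Int_compact closed_H_cl) auto
  show ?thesis
    unfolding e
  proof (rule sets.countable_UN)
    show "range (\<lambda>m. ev ` (H_cl \<inter> cball 0 (real m))) \<subseteq> sets borel" using borel_closed[OF c] by auto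
  qed
qed

lemma ev_trunc:
  assumes "a \<in> H_cl" "continuous_on H_cl f" "\<And>s. f (s, s) = 0"
  shows "ev a (trunc f m) = f a * cutoff m a"
  using trunc_C_bar[where f = f, OF assms(2,3)] by (simp add: ev_def trunc_def)

lemma trunc_on_H_vac:
  assumes "\<xi> \<in> H_vac" "continuous_on H_cl f" "\<And>s. f (s, s) = 0"
  obtains a where "a \<in> H_cl" "\<xi> = ev a" "\<And>m. \<xi> (trunc f m) = f a * cutoff m a" "on_H_vac f \<xi> = f a"
proof -
  obtain a where a: "a \<in> H_cl" "\<xi> = ev a" using assms(1) unfolding H_vac_eq by (elim imageE)
  show thesis
    by (rule that[OF a]) (auto simp: a(2) ev_trunc[where f = f, OF a(1) assms(2,3)] on_H_vac_ev[where f = f, OF a(1) assms(3)])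
qed

lemma tendsto_cutoff: "(\<lambda>m. x * cutoff m a) \<longlonglongrightarrow> x"
proof (rule tendsto_eventually)
  obtain N :: nat where "norm a \<le> real N" using real_arch_simple by blast
  then show "\<forall>\<^sub>F m in sequentially. x * cutoff m a = x"
    by (intro eventually_sequentiallyI[of N]) (simp add: cutoff_eq_1)
qed

text \<open>Completeness of Lebesgue measure. It is applied to means, which are identified with
  measurable functions only outside a null set.\<close>

lemma measurable_AE_lebesgue_on:
  fixes f g :: "'a::euclidean_space \<Rightarrow> real"
  assumes D: "D \<in> sets lebesgue" and f: "f \<in> borel_measurable (lebesgue_on D)"
    and ae: "AE x in lebesgue_on D. f x = g x"
  shows "g \<in> borel_measurable (lebesgue_on D)"
proof -
  let ?f = "\<lambda>x. if x \<in> D then f x else 0" and ?g = "\<lambda>x. if x \<in> D then g x else 0"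
  have mf: "?f \<in> borel_measurable lebesgue" using f D by (simp add: borel_measurable_if)
  have ae': "AE x in lebesgue. x \<in> D \<longrightarrow> f x = g x"
    using ae D by (subst (asm) AE_restrict_space_iff) auto
  have "?g \<in> borel_measurable lebesgue"
  proof (rule measurableI)
    fix B :: "real set" assume B: "B \<in> sets borel"
    have A: "?f -` B \<inter> space lebesgue \<in> sets lebesgue" using mf B by (rule measurable_sets)
    have iff: "AE x in lebesgue. x \<in> ?f -` B \<inter> space lebesgue \<longleftrightarrow> x \<in> ?g -` B \<inter> space lebesgue"
      using ae' by eventually_elim auto
    show "?g -` B \<inter> space lebesgue \<in> sets lebesgue"
      by (rule completion.in_sets_AE[OF iff A]) simp
  qed auto
  then show ?thesis using D by (simp add: borel_measurable_if)
qed

section \<open>Moments of the Young measure as limits of truncated moments\<close>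

locale young_measure =
  fixes \<gamma> :: real and S :: "(real \<times> real) set" and z \<nu>
  assumes S: "S \<in> sets lebesgue" and gen: "generates_young_measure \<gamma> S z \<nu>"
    and z: "\<And>n p. z n p \<in> H_cl"
begin

lemma prob: "p \<in> S \<Longrightarrow> prob_space (\<nu> p)" and sets_nu: "p \<in> S \<Longrightarrow> sets (\<nu> p) = sets (restrict_space borel H_bar)"
  and AE_H_vac: "AE p in lebesgue_on S. AE \<xi> in \<nu> p. \<xi> \<in> H_vac"
  using gen by (auto simp: generates_young_measure_def)

lemma measurable_nu:
  assumes "p \<in> S" "F \<in> borel_measurable borel"
  shows "F \<in> borel_measurable (\<nu> p)"
  using measurable_restrict_space1[OF assms(2), of H_bar] sets_nu[OF assms(1)]
  by (simp cong: measurable_cong_sets)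

lemma measurable_eval: "p \<in> S \<Longrightarrow> (\<lambda>\<xi>. \<xi> \<phi>) \<in> borel_measurable (\<nu> p)"
  by (intro measurable_nu borel_measurable_continuous_onI continuous_on_product_coordinates)

text \<open>The integrand is the coordinate projection at \<open>trunc f m\<close>, the continuous
  extension of the truncated function; hence this moment falls under the defining property of the
  Young measure.\<close>

definition trunc_mean :: "(real \<times> real \<Rightarrow> real) \<Rightarrow> nat \<Rightarrow> real \<times> real \<Rightarrow> real" where
  "trunc_mean f m p = (\<integral>\<xi>. \<xi> (trunc f m) \<partial>\<nu> p)"

definition mean_integrand :: "(real \<times> real \<Rightarrow> real) \<Rightarrow> ((real \<times> real \<Rightarrow> real) \<Rightarrow> real) \<Rightarrow> real" where
  "mean_integrand f \<xi> = indicator H_vac \<xi> * on_H_vac f \<xi>"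

lemma mean_eq: "mean \<nu> f p = (\<integral>\<xi>. mean_integrand f \<xi> \<partial>\<nu> p)"
  by (simp add: mean_def mean_integrand_def set_lebesgue_integral_def)

lemma set_integrable_eq: "set_integrable (\<nu> p) H_vac (on_H_vac f) \<longleftrightarrow> integrable (\<nu> p) (mean_integrand f)"
  by (simp add: mean_integrand_def[abs_def] set_integrable_def)

lemma trunc_mean_conv:
  assumes f: "continuous_on H_cl f" "\<And>s. f (s, s) = 0"
  shows "trunc_mean f m \<in> borel_measurable (lebesgue_on S)"
    and "integrable (lebesgue_on S) g \<Longrightarrow>
      (\<lambda>n. \<integral>p. trunc f m (z n p) * g p \<partial>lebesgue_on S) \<longlonglongrightarrow> (\<integral>p. trunc_mean f m p * g p \<partial>lebesgue_on S)"
proof -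
  have c: "continuous_on H_bar (\<lambda>\<xi>. \<xi> (trunc f m))"
    by (rule continuous_on_subset[OF continuous_on_product_coordinates]) simp
  have e: "ev (z n p) (trunc f m) = trunc f m (z n p)" for n p
    using trunc_C_bar[where f = f, OF f] by (simp add: ev_def)
  have y: "(\<lambda>p. \<integral>\<xi>. \<Phi> \<xi> \<partial>\<nu> p) \<in> borel_measurable (lebesgue_on S)"
      "integrable (lebesgue_on S) g \<Longrightarrow> (\<lambda>n. \<integral>p. \<Phi> (ev (z n p)) * g p \<partial>lebesgue_on S)
             \<longlonglongrightarrow> (\<integral>p. (\<integral>\<xi>. \<Phi> \<xi> \<partial>\<nu> p) * g p \<partial>lebesgue_on S)"
    if "continuous_on H_bar \<Phi>" for \<Phi> :: "((real \<times> real \<Rightarrow> real) \<Rightarrow> real) \<Rightarrow> real" and g :: "real \<times> real \<Rightarrow> real"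
  proof -
    have "\<forall>\<Phi> :: ((real \<times> real \<Rightarrow> real) \<Rightarrow> real) \<Rightarrow> real. continuous_on H_bar \<Phi> \<longrightarrow> (\<lambda>p. \<integral>\<xi>. \<Phi> \<xi> \<partial>\<nu> p) \<in> borel_measurable (lebesgue_on S) \<and>
        (\<forall>g. integrable (lebesgue_on S) g \<longrightarrow> (\<lambda>n. \<integral>p. \<Phi> (ev (z n p)) * g p \<partial>lebesgue_on S)
             \<longlonglongrightarrow> (\<integral>p. (\<integral>\<xi>. \<Phi> \<xi> \<partial>\<nu> p) * g p \<partial>lebesgue_on S))"
      using gen unfolding generates_young_measure_def by (elim conjE)
    from this[rule_format, OF that]
    show "(\<lambda>p. \<integral>\<xi>. \<Phi> \<xi> \<partial>\<nu> p) \<in> borel_measurable (lebesgue_on S)"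
      "integrable (lebesgue_on S) g \<Longrightarrow> (\<lambda>n. \<integral>p. \<Phi> (ev (z n p)) * g p \<partial>lebesgue_on S)
             \<longlonglongrightarrow> (\<integral>p. (\<integral>\<xi>. \<Phi> \<xi> \<partial>\<nu> p) * g p \<partial>lebesgue_on S)" by simp_all
  qed
  show "trunc_mean f m \<in> borel_measurable (lebesgue_on S)"
    unfolding trunc_mean_def[abs_def] by (rule y(1)[OF c])
  have "integrable (lebesgue_on S) g \<Longrightarrow>
      (\<lambda>n. \<integral>p. ev (z n p) (trunc f m) * g p \<partial>lebesgue_on S) \<longlonglongrightarrow> (\<integral>p. trunc_mean f m p * g p \<partial>lebesgue_on S)"
    unfolding trunc_mean_def by (rule y(2)[OF c])
  then show "integrable (lebesgue_on S) g \<Longrightarrow>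
      (\<lambda>n. \<integral>p. trunc f m (z n p) * g p \<partial>lebesgue_on S) \<longlonglongrightarrow> (\<integral>p. trunc_mean f m p * g p \<partial>lebesgue_on S)"
    by (simp only: e)
qed

text \<open>The function \<open>on_H_vac f\<close> is given through an inverse of \<open>ev\<close>,
  about whose measurability nothing is known. It is the pointwise limit of coordinate projections,
  which are continuous.\<close>

lemma measurable_mean_integrand:
  assumes "p \<in> S" and f: "continuous_on H_cl f" "\<And>s. f (s, s) = 0"
  shows "mean_integrand f \<in> borel_measurable (\<nu> p)"
proof (rule borel_measurable_LIMSEQ_real)
  show "(\<lambda>\<xi>. indicator H_vac \<xi> * \<xi> (trunc f m)) \<in> borel_measurable (\<nu> p)" for m
    using borel_H_vac by (intro borel_measurable_times measurable_eval measurable_nu assms(1)) auto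
  fix \<xi> :: "(real \<times> real \<Rightarrow> real) \<Rightarrow> real"
  show "(\<lambda>m. indicator H_vac \<xi> * \<xi> (trunc f m)) \<longlonglongrightarrow> mean_integrand f \<xi>"
  proof (cases "\<xi> \<in> H_vac")
    case True
    obtain a where "a \<in> H_cl" "\<xi> = ev a" "\<And>m. \<xi> (trunc f m) = f a * cutoff m a" "on_H_vac f \<xi> = f a"
      by (rule trunc_on_H_vac[where f = f, OF True f], rule that)
    then show ?thesis using True by (simp add: mean_integrand_def tendsto_cutoff)
  qed (simp add: mean_integrand_def)
qed

text \<open>The cutoffs increase to \<open>1\<close> and \<open>W\<close> is nonnegative, so
  monotone convergence applies even when the moment of \<open>W\<close> is still allowed to be
  infinite.\<close>

lemma nn_integral_mean_integrand_SUP: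
  assumes p: "p \<in> S" "AE \<xi> in \<nu> p. \<xi> \<in> H_vac"
    and W: "continuous_on H_cl W" "\<And>s. W (s, s) = 0" "\<And>a. a \<in> H_cl \<Longrightarrow> 0 \<le> W a"
  shows "(\<integral>\<^sup>+\<xi>. ennreal (mean_integrand W \<xi>) \<partial>\<nu> p) = (SUP m. ennreal (trunc_mean W m p))"
    and "0 \<le> trunc_mean W m p" and "incseq (\<lambda>m. ennreal (trunc_mean W m p))"
proof -
  interpret prob_space "\<nu> p" by (rule prob[OF p(1)])
  let ?t = "\<lambda>m \<xi>. indicator H_vac \<xi> * \<xi> (trunc W m) :: real"
  have mt: "?t m \<in> borel_measurable (\<nu> p)" for m
    using borel_H_vac by (intro borel_measurable_times measurable_eval measurable_nu p(1)) auto
  have t0: "0 \<le> ?t m \<xi>" and tmono: "m \<le> n \<Longrightarrow> ?t m \<xi> \<le> ?t n \<xi>" and tlim: "(\<lambda>m. ?t m \<xi>) \<longlonglongrightarrow> mean_integrand W \<xi>" for m n \<xi>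
  proof -
    have "0 \<le> ?t m \<xi> \<and> (m \<le> n \<longrightarrow> ?t m \<xi> \<le> ?t n \<xi>) \<and> ((\<lambda>m. ?t m \<xi>) \<longlonglongrightarrow> mean_integrand W \<xi>)"
    proof (cases "\<xi> \<in> H_vac")
      case True
      obtain a where a: "a \<in> H_cl" "\<xi> = ev a"
          "\<And>m. \<xi> (trunc W m) = W a * cutoff m a" "on_H_vac W \<xi> = W a"
        by (rule trunc_on_H_vac[where f = W, OF True W(1,2)], rule that)
      show ?thesis using True W(3)[OF a(1)] cutoff_bounds cutoff_mono[of m n a]
        by (simp add: a(3,4) mean_integrand_def tendsto_cutoff mult_left_mono)
    qed (simp add: mean_integrand_def)
    then show "0 \<le> ?t m \<xi>" "m \<le> n \<Longrightarrow> ?t m \<xi> \<le> ?t n \<xi>" "(\<lambda>m. ?t m \<xi>) \<longlonglongrightarrow> mean_integrand W \<xi>" by auto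
  qed
  have int: "integrable (\<nu> p) (?t m)" for m
  proof -
    obtain B where B: "0 \<le> B" "\<And>a. a \<in> H_cl \<Longrightarrow> \<bar>trunc W m a\<bar> \<le> B"
      by (rule trunc_bounded[OF W(1)], rule that)
    have "\<bar>?t m \<xi>\<bar> \<le> B" for \<xi>
    proof (cases "\<xi> \<in> H_vac")
      case True
      obtain a where a: "a \<in> H_cl" "\<xi> = ev a"
          "\<And>m. \<xi> (trunc W m) = W a * cutoff m a" "on_H_vac W \<xi> = W a"
        by (rule trunc_on_H_vac[where f = W, OF True W(1,2)], rule that)
      show ?thesis using B(2)[OF a(1)] True by (simp add: trunc_def a(3))
    qed (simp add: B(1))
    then show ?thesis by (intro integrable_const_bound[where B = B] mt) auto
  qed
  have trunc_mean: "trunc_mean W m p = (\<integral>\<xi>. ?t m \<xi> \<partial>\<nu> p)" for m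
    unfolding trunc_mean_def
  proof (rule integral_cong_AE)
    show "AE \<xi> in \<nu> p. \<xi> (trunc W m) = ?t m \<xi>" using p(2) by eventually_elim simp
  qed (auto intro: mt measurable_eval[OF p(1)])
  have emm: "ennreal (trunc_mean W m p) = (\<integral>\<^sup>+\<xi>. ennreal (?t m \<xi>) \<partial>\<nu> p)" for m
    unfolding trunc_mean by (rule nn_integral_eq_integral[symmetric]) (use int t0 in auto)
  show "0 \<le> trunc_mean W m p" unfolding trunc_mean using t0 by (intro integral_nonneg_AE) auto
  show "incseq (\<lambda>m. ennreal (trunc_mean W m p))"
    unfolding emm by (intro monoI nn_integral_mono ennreal_leI tmono)
  have "(\<integral>\<^sup>+\<xi>. ennreal (mean_integrand W \<xi>) \<partial>\<nu> p) = (\<integral>\<^sup>+\<xi>. (SUP m. ennreal (?t m \<xi>)) \<partial>\<nu> p)"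
  proof (rule nn_integral_cong)
    fix \<xi>
    have "(\<lambda>m. ennreal (?t m \<xi>)) \<longlonglongrightarrow> ennreal (mean_integrand W \<xi>)" by (intro tendsto_ennrealI tlim)
    moreover have "incseq (\<lambda>m. ennreal (?t m \<xi>))" by (intro monoI ennreal_leI tmono)
    ultimately show "ennreal (mean_integrand W \<xi>) = (SUP m. ennreal (?t m \<xi>))"
      by (rule LIMSEQ_unique[OF _ LIMSEQ_SUP])
  qed
  also have "\<dots> = (SUP m. \<integral>\<^sup>+\<xi>. ennreal (?t m \<xi>) \<partial>\<nu> p)"
    using mt by (intro nn_integral_monotone_convergence_SUP) (auto intro!: monoI le_funI ennreal_leI tmono)
  finally show "(\<integral>\<^sup>+\<xi>. ennreal (mean_integrand W \<xi>) \<partial>\<nu> p) = (SUP m. ennreal (trunc_mean W m p))" unfolding emm .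
qed

text \<open>A function and its truncation differ only where the norm exceeds \<open>m\<close>, and
  there \<open>f\<close> is at most \<open>\<epsilon> * W\<close>. The truncation error of the mean
  is thus at most \<open>\<epsilon>\<close> times the mean of \<open>W\<close>.\<close>

lemma mean_approx:
  assumes p: "p \<in> S" "AE \<xi> in \<nu> p. \<xi> \<in> H_vac"
    and W: "continuous_on H_cl W" "\<And>s. W (s, s) = 0" "\<And>a. a \<in> H_cl \<Longrightarrow> 0 \<le> W a"
    and fin: "(\<integral>\<^sup>+\<xi>. ennreal (mean_integrand W \<xi>) \<partial>\<nu> p) < \<infinity>"
    and f: "continuous_on H_cl f" "\<And>s. f (s, s) = 0"
    and small: "\<And>\<epsilon>. 0 < \<epsilon> \<Longrightarrow> \<exists>R. \<forall>a\<in>H_cl. R \<le> norm a \<longrightarrow> \<bar>f a\<bar> \<le> \<epsilon> * W a"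
  shows "integrable (\<nu> p) (mean_integrand f)" "integrable (\<nu> p) (mean_integrand W)"
    and "(\<And>a. a \<in> H_cl \<Longrightarrow> real m \<le> norm a \<Longrightarrow> \<bar>f a\<bar> \<le> \<epsilon> * W a) \<Longrightarrow> 0 < \<epsilon> \<Longrightarrow>
      \<bar>trunc_mean f m p - mean \<nu> f p\<bar> \<le> \<epsilon> * mean \<nu> W p"
    and "0 \<le> mean \<nu> W p" "ennreal (mean \<nu> W p) = (\<integral>\<^sup>+\<xi>. ennreal (mean_integrand W \<xi>) \<partial>\<nu> p)"
proof -
  interpret prob_space "\<nu> p" by (rule prob[OF p(1)])
  note mW = measurable_mean_integrand[where f = W, OF p(1) W(1,2)] and mf = measurable_mean_integrand[where f = f, OF p(1) f]
  have vW: "0 \<le> mean_integrand W \<xi>" for \<xi>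
  proof (cases "\<xi> \<in> H_vac")
    case True
    obtain a where a: "a \<in> H_cl" "\<xi> = ev a"
        "\<And>m. \<xi> (trunc W m) = W a * cutoff m a" "on_H_vac W \<xi> = W a"
      by (rule trunc_on_H_vac[where f = W, OF True W(1,2)], rule that)
    show ?thesis using True W(3)[OF a(1)] by (simp add: mean_integrand_def a(4))
  qed (simp add: mean_integrand_def)
  show iW: "integrable (\<nu> p) (mean_integrand W)"
    by (rule integrableI_nonneg[OF mW]) (use vW fin in auto)
  obtain R where R: "\<And>a. a \<in> H_cl \<Longrightarrow> R \<le> norm a \<Longrightarrow> \<bar>f a\<bar> \<le> 1 * W a" using small[of 1] by auto
  obtain B where B: "0 \<le> B" "\<And>a. a \<in> H_cl \<Longrightarrow> norm a \<le> R \<Longrightarrow> \<bar>f a\<bar> \<le> B"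
    by (rule continuous_bounded_on_ball[OF f(1)], rule that)
  have vf_le: "\<bar>mean_integrand f \<xi>\<bar> \<le> B + mean_integrand W \<xi>" for \<xi>
  proof (cases "\<xi> \<in> H_vac")
    case True
    then obtain a where a: "a \<in> H_cl" "\<xi> = ev a" unfolding H_vac_eq by (elim imageE)
    have "\<bar>f a\<bar> \<le> B + W a" using R[OF a(1)] B(1) B(2)[OF a(1)] W(3)[OF a(1)] by linarith
    then show ?thesis using True
      by (simp add: mean_integrand_def a(2) on_H_vac_ev[where f = f, OF a(1) f(2)] on_H_vac_ev[where f = W, OF a(1) W(2)])
  qed (simp add: mean_integrand_def B)
  show iF: "integrable (\<nu> p) (mean_integrand f)"
  proof (rule Bochner_Integration.integrable_bound[OF _ mf])
    show "integrable (\<nu> p) (\<lambda>\<xi>. B + mean_integrand W \<xi>)" using iW by simp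
    have "norm (mean_integrand f \<xi>) \<le> norm (B + mean_integrand W \<xi>)" for \<xi>
      using vf_le[of \<xi>] vW[of \<xi>] B(1) by simp
    then show "AE \<xi> in \<nu> p. norm (mean_integrand f \<xi>) \<le> norm (B + mean_integrand W \<xi>)" by simp
  qed
  show "0 \<le> mean \<nu> W p" unfolding mean_eq using vW by (intro integral_nonneg_AE) auto
  show "ennreal (mean \<nu> W p) = (\<integral>\<^sup>+\<xi>. ennreal (mean_integrand W \<xi>) \<partial>\<nu> p)"
    unfolding mean_eq by (rule nn_integral_eq_integral[symmetric]) (use iW vW in auto)
  assume sm: "\<And>a. a \<in> H_cl \<Longrightarrow> real m \<le> norm a \<Longrightarrow> \<bar>f a\<bar> \<le> \<epsilon> * W a" and \<epsilon>: "0 < \<epsilon>"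
  let ?t = "\<lambda>\<xi>. indicator H_vac \<xi> * \<xi> (trunc f m) :: real"
  have mt: "?t \<in> borel_measurable (\<nu> p)"
    using borel_H_vac by (intro borel_measurable_times measurable_eval measurable_nu p(1)) auto
  have trunc_mean: "trunc_mean f m p = (\<integral>\<xi>. ?t \<xi> \<partial>\<nu> p)"
    unfolding trunc_mean_def
  proof (rule integral_cong_AE)
    show "AE \<xi> in \<nu> p. \<xi> (trunc f m) = ?t \<xi>" using p(2) by eventually_elim simp
  qed (auto intro: mt measurable_eval[OF p(1)])
  have le: "\<bar>?t \<xi> - mean_integrand f \<xi>\<bar> \<le> \<epsilon> * mean_integrand W \<xi> \<and> \<bar>?t \<xi>\<bar> \<le> \<bar>mean_integrand f \<xi>\<bar>" for \<xi>
  proof (cases "\<xi> \<in> H_vac")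
    case True
    then obtain a where a: "a \<in> H_cl" "\<xi> = ev a" unfolding H_vac_eq by (elim imageE)
    have eqs: "?t \<xi> = f a * cutoff m a" "mean_integrand f \<xi> = f a" "mean_integrand W \<xi> = W a"
      using True by (simp_all add: mean_integrand_def a(2) ev_trunc[where f = f, OF a(1) f] on_H_vac_ev[where f = f, OF a(1) f(2)] on_H_vac_ev[where f = W, OF a(1) W(2)])
    have abs: "\<bar>f a * cutoff m a\<bar> \<le> \<bar>f a\<bar>"
      using cutoff_bounds[of m a] by (simp add: abs_mult mult_left_le)
    have "\<bar>f a * cutoff m a - f a\<bar> \<le> \<epsilon> * W a"
    proof (cases "norm a \<le> real m")
      case True
      then show ?thesis using W(3)[OF a(1)] \<epsilon> by (simp add: cutoff_eq_1)
    next
      case False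
      have "\<bar>f a * cutoff m a - f a\<bar> = \<bar>f a\<bar> * (1 - cutoff m a)"
      proof -
        have "f a * cutoff m a - f a = - (f a * (1 - cutoff m a))" by (simp add: algebra_simps)
        moreover have "\<bar>1 - cutoff m a\<bar> = 1 - cutoff m a" using cutoff_bounds[of m a] by simp
        ultimately show ?thesis by (simp only: abs_minus_cancel abs_mult)
      qed
      also have "\<dots> \<le> \<bar>f a\<bar> * 1" using cutoff_bounds[of m a] by (intro mult_left_mono) auto
      also have "\<dots> \<le> \<epsilon> * W a" using sm[OF a(1)] False by simp
      finally show ?thesis .
    qed
    then show ?thesis using abs unfolding eqs by simp
  qed (simp add: mean_integrand_def)
  have it: "integrable (\<nu> p) ?t"
    by (rule Bochner_Integration.integrable_bound[OF iF mt]) (use le in auto)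
  have "\<bar>trunc_mean f m p - mean \<nu> f p\<bar> = norm (\<integral>\<xi>. ?t \<xi> - mean_integrand f \<xi> \<partial>\<nu> p)"
    unfolding trunc_mean mean_eq using it iF by simp
  also have "\<dots> \<le> (\<integral>\<xi>. norm (?t \<xi> - mean_integrand f \<xi>) \<partial>\<nu> p)" by (rule integral_norm_bound)
  also have "\<dots> \<le> (\<integral>\<xi>. \<epsilon> * mean_integrand W \<xi> \<partial>\<nu> p)"
    by (intro integral_mono) (use it iF iW le in auto)
  also have "\<dots> = \<epsilon> * mean \<nu> W p" by (simp add: mean_eq)
  finally show "\<bar>trunc_mean f m p - mean \<nu> f p\<bar> \<le> \<epsilon> * mean \<nu> W p" .
qed

end

section \<open>Weak limits under a uniform moment bound\<close>

lemma measurable_continuous_H_cl: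
  assumes "continuous_on H_cl f" "Z \<in> borel_measurable M" "\<And>p. Z p \<in> H_cl"
  shows "(\<lambda>p. f (Z p) :: real) \<in> borel_measurable M"
proof -
  have "Z \<in> M \<rightarrow>\<^sub>M restrict_space borel H_cl"
    using assms(2,3) by (intro measurable_restrict_space2) auto
  from measurable_compose[OF this borel_measurable_continuous_on_restrict[OF assms(1)]] show ?thesis .
qed

context young_measure
begin

lemma trunc_mean_abs_le:
  assumes p: "p \<in> S" "AE \<xi> in \<nu> p. \<xi> \<in> H_vac"
    and f: "continuous_on H_cl f" "\<And>s. f (s, s) = 0" and B: "\<And>a. a \<in> H_cl \<Longrightarrow> \<bar>trunc f m a\<bar> \<le> B"
  shows "\<bar>trunc_mean f m p\<bar> \<le> B"
proof -
  interpret prob_space "\<nu> p" by (rule prob[OF p(1)])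
  have le: "AE \<xi> in \<nu> p. norm (\<xi> (trunc f m)) \<le> B"
    using p(2)
  proof eventually_elim
    case (elim \<xi>)
    then obtain a where "a \<in> H_cl" "\<xi> = ev a" unfolding H_vac_eq by (elim imageE)
    then show ?case using B[of a] trunc_C_bar[where f = f, OF f] by (simp add: ev_def)
  qed
  have i: "integrable (\<nu> p) (\<lambda>\<xi>. \<xi> (trunc f m))"
    by (rule integrable_const_bound[OF le measurable_eval[OF p(1)]])
  have "norm (trunc_mean f m p) \<le> (\<integral>\<xi>. norm (\<xi> (trunc f m)) \<partial>\<nu> p)"
    unfolding trunc_mean_def by (rule integral_norm_bound)
  also have "\<dots> \<le> (\<integral>\<xi>. B \<partial>\<nu> p)"
    by (rule integral_mono_AE[OF integrable_norm[OF i] integrable_const le])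
  finally show ?thesis by (simp add: prob_space)
qed

section \<open>Passage to the limit on a set of finite measure\<close>

context
  fixes D :: "(real \<times> real) set" and a :: "real \<times> real \<Rightarrow> real" and an :: "nat \<Rightarrow> real \<times> real \<Rightarrow> real"
    and amax C :: real and W f :: "real \<times> real \<Rightarrow> real"
  assumes D: "D \<in> lmeasurable" "D \<subseteq> S"
    and a: "a \<in> borel_measurable (lebesgue_on D)" "\<And>p. p \<in> D \<Longrightarrow> 0 < a p" "\<And>p. p \<in> D \<Longrightarrow> a p \<le> amax"
    and an: "\<And>n. 1 \<le> n \<Longrightarrow> an n \<in> borel_measurable (lebesgue_on D)"
      "\<And>n p. 1 \<le> n \<Longrightarrow> p \<in> D \<Longrightarrow> a p \<le> an n p" "\<And>n p. 1 \<le> n \<Longrightarrow> p \<in> D \<Longrightarrow> an n p \<le> amax"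
      "uniform_limit D an a sequentially"
    and zm: "\<And>n. 1 \<le> n \<Longrightarrow> z n \<in> borel_measurable (lebesgue_on D)"
    and W: "continuous_on H_cl W" "\<And>s. W (s, s) = 0" "\<And>a. a \<in> H_cl \<Longrightarrow> 0 \<le> W a"
    and bound: "\<And>n. 1 \<le> n \<Longrightarrow> (\<integral>\<^sup>+p. ennreal (W (z n p) * an n p) \<partial>lebesgue_on D) \<le> ennreal C"
    and C: "0 \<le> C"
    and f: "continuous_on H_cl f" "\<And>s. f (s, s) = 0"
    and small: "\<And>\<epsilon>. 0 < \<epsilon> \<Longrightarrow> \<exists>R. \<forall>a\<in>H_cl. R \<le> norm a \<longrightarrow> \<bar>f a\<bar> \<le> \<epsilon> * W a"
begin

lemma Dsets: "D \<in> sets lebesgue" using D(1) by blast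

lemma finite_D: "finite_measure (lebesgue_on D)" by (rule finite_measure_lebesgue_on[OF D(1)])

lemma on_D:
  shows "F \<in> borel_measurable (lebesgue_on S) \<Longrightarrow> F \<in> borel_measurable (lebesgue_on D)"
    and "(AE p in lebesgue_on S. P p) \<Longrightarrow> AE p in lebesgue_on D. P p"
proof -
  show "F \<in> borel_measurable (lebesgue_on S) \<Longrightarrow> F \<in> borel_measurable (lebesgue_on D)"
    by (rule measurable_restrict_mono[OF _ D(2)])
  assume "AE p in lebesgue_on S. P p"
  then have "AE p in lebesgue. p \<in> S \<longrightarrow> P p" using S by (subst (asm) AE_restrict_space_iff) auto
  then have "AE p in lebesgue. p \<in> D \<longrightarrow> P p" by eventually_elim (use D(2) in auto)
  then show "AE p in lebesgue_on D. P p" using Dsets by (subst AE_restrict_space_iff) auto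
qed

text \<open>The test function is extended by zero from \<open>D\<close> to \<open>S\<close>.\<close>

lemma young_on_D:
  assumes F: "continuous_on H_cl F" "\<And>s. F (s, s) = 0" and g: "integrable (lebesgue_on D) g"
  shows "(\<lambda>n. \<integral>p. trunc F m (z n p) * g p \<partial>lebesgue_on D) \<longlonglongrightarrow> (\<integral>p. trunc_mean F m p * g p \<partial>lebesgue_on D)"
proof -
  have conv: "(\<integral>p. h p * (indicator D p * g p) \<partial>lebesgue_on S) = (\<integral>p. h p * g p \<partial>lebesgue_on D)" for h
  proof -
    have "(\<integral>p. h p * (indicator D p * g p) \<partial>lebesgue_on S) =
        (\<integral>p. indicator S p *\<^sub>R (h p * (indicator D p * g p)) \<partial>lebesgue)"
      using S by (subst integral_restrict_space) auto
    also have "\<dots> = (\<integral>p. indicator D p *\<^sub>R (h p * g p) \<partial>lebesgue)"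
      using D(2) by (intro Bochner_Integration.integral_cong refl) (auto simp: indicator_def)
    also have "\<dots> = (\<integral>p. h p * g p \<partial>lebesgue_on D)"
      using Dsets by (subst integral_restrict_space) auto
    finally show ?thesis .
  qed
  have "integrable lebesgue (\<lambda>p. indicator D p *\<^sub>R g p)"
    using g Dsets by (subst (asm) integrable_restrict_space) auto
  moreover have "(\<lambda>p. indicator D p *\<^sub>R g p) = (\<lambda>p. indicator S p *\<^sub>R (indicator D p * g p))"
    using D(2) by (auto simp: indicator_def fun_eq_iff)
  ultimately have "integrable (lebesgue_on S) (\<lambda>p. indicator D p * g p)"
    using S by (subst integrable_restrict_space) auto
  from trunc_mean_conv(2)[where f = F and m = m, OF F this] show ?thesis unfolding conv .
qed

lemma integrable_bounded_a:
  assumes "g \<in> borel_measurable (lebesgue_on D)" "AE p in lebesgue_on D. \<bar>g p\<bar> \<le> Cg"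
  shows "integrable (lebesgue_on D) (\<lambda>p. a p * g p)"
proof (rule finite_measure.integrable_const_bound[OF finite_D])
  have "AE p in lebesgue_on D. p \<in> D" by (rule AE_I2) simp
  with assms(2) show "AE p in lebesgue_on D. norm (a p * g p) \<le> amax * Cg"
  proof eventually_elim
    case (elim p)
    then have "0 < a p" "a p \<le> amax" using a by auto
    then show ?case using elim unfolding real_norm_def abs_mult by (intro mult_mono) auto
  qed
qed (intro borel_measurable_times a assms)

text \<open>Lower semicontinuity. The integral of the truncated \<open>W\<close> converges, and it
  is bounded by \<open>C\<close> because \<open>a\<close> lies below every \<open>an n\<close>. As
  the truncation is removed, monotone convergence passes the bound to the full moment;
  \<open>a\<close> being positive, this moment is finite almost everywhere.\<close>

lemma good_points:
  "AE p in lebesgue_on D. p \<in> S \<and> p \<in> D \<and> (AE \<xi> in \<nu> p. \<xi> \<in> H_vac) \<and> (\<integral>\<^sup>+\<xi>. ennreal (mean_integrand W \<xi>) \<partial>\<nu> p) < \<infinity>"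
  and mean_W_bound: "(\<integral>\<^sup>+p. ennreal (mean \<nu> W p * a p) \<partial>lebesgue_on D) \<le> ennreal C"
proof -
  have pD: "AE p in lebesgue_on D. p \<in> D" by (rule AE_I2) simp
  have pS: "AE p in lebesgue_on D. p \<in> D \<and> p \<in> S \<and> (AE \<xi> in \<nu> p. \<xi> \<in> H_vac)"
    using on_D(2)[OF AE_H_vac] pD by eventually_elim (use D(2) in auto)
  have inc: "AE p in lebesgue_on D. ennreal (trunc_mean W m p) * ennreal (a p) \<le> ennreal (trunc_mean W (Suc m) p) * ennreal (a p)" for m
    using pS
  proof eventually_elim
    case (elim p)
    then have "incseq (\<lambda>m. ennreal (trunc_mean W m p))"
      using nn_integral_mean_integrand_SUP(3)[where W = W and p = p] W by blast
    from incseq_SucD[OF this, of m] show ?case by (intro mult_right_mono) auto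
  qed
  have mmm: "trunc_mean W m \<in> borel_measurable (lebesgue_on D)" for m
    by (rule on_D(1)[OF trunc_mean_conv(1)[where f = W, OF W(1,2)]])
  have le: "(\<integral>\<^sup>+p. ennreal (trunc_mean W m p) * ennreal (a p) \<partial>lebesgue_on D) \<le> ennreal C" for m
  proof -
    obtain B where B: "0 \<le> B" "\<And>a. a \<in> H_cl \<Longrightarrow> \<bar>trunc W m a\<bar> \<le> B"
      by (rule trunc_bounded[OF W(1)], rule that)
    have bd: "AE p in lebesgue_on D. 0 \<le> trunc_mean W m p \<and> \<bar>trunc_mean W m p\<bar> \<le> B"
      using pS
    proof eventually_elim
      case (elim p)
      then show ?case
        using nn_integral_mean_integrand_SUP(2)[where W = W and p = p and m = m] W
          trunc_mean_abs_le[where p = p and f = W and m = m and B = B] B(2) by blast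
    qed
    have i1: "integrable (lebesgue_on D) (\<lambda>p. a p * trunc_mean W m p)"
      by (rule integrable_bounded_a[where Cg = B, OF mmm]) (rule eventually_mono[OF bd], blast)
    have ia: "integrable (lebesgue_on D) a"
      using integrable_bounded_a[of "\<lambda>_. 1" 1] by simp
    have "(\<lambda>n. \<integral>p. trunc W m (z n p) * a p \<partial>lebesgue_on D) \<longlonglongrightarrow> (\<integral>p. trunc_mean W m p * a p \<partial>lebesgue_on D)"
      by (rule young_on_D[OF W(1,2) ia])
    moreover have "(\<integral>p. trunc W m (z n p) * a p \<partial>lebesgue_on D) \<le> C" if n: "1 \<le> n" for n
    proof -
      have t: "0 \<le> trunc W m (z n p)" "trunc W m (z n p) \<le> W (z n p)" for p
        using W(3)[OF z] cutoff_bounds[of m "z n p"] by (auto simp: trunc_def mult_left_le)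
      have "ennreal (\<integral>p. trunc W m (z n p) * a p \<partial>lebesgue_on D) =
          (\<integral>\<^sup>+p. ennreal (trunc W m (z n p) * a p) \<partial>lebesgue_on D)"
      proof (rule nn_integral_eq_integral[symmetric])
        have "(\<lambda>p. trunc W m (z n p)) \<in> borel_measurable (lebesgue_on D)"
          by (rule measurable_continuous_H_cl[OF continuous_trunc[OF W(1)] zm[OF n] z])
        then have "integrable (lebesgue_on D) (\<lambda>p. a p * trunc W m (z n p))"
          by (rule integrable_bounded_a[where Cg = B]) (intro AE_I2 B(2) z)
        then show "integrable (lebesgue_on D) (\<lambda>p. trunc W m (z n p) * a p)" by (simp add: mult.commute)
        show "AE p in lebesgue_on D. 0 \<le> trunc W m (z n p) * a p"
          using pD by eventually_elim (intro mult_nonneg_nonneg t less_imp_le a)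
      qed
      also have "\<dots> \<le> (\<integral>\<^sup>+p. ennreal (W (z n p) * an n p) \<partial>lebesgue_on D)"
      proof (rule nn_integral_mono_AE)
        show "AE p in lebesgue_on D. ennreal (trunc W m (z n p) * a p) \<le> ennreal (W (z n p) * an n p)"
          using pD
        proof eventually_elim
          case (elim p)
          show ?case
            using t[of p] a(2)[OF elim] an(2)[OF n elim] by (intro ennreal_leI mult_mono) auto
        qed
      qed
      also have "\<dots> \<le> ennreal C" by (rule bound[OF n])
      finally show ?thesis using C by simp
    qed
    ultimately have "(\<integral>p. trunc_mean W m p * a p \<partial>lebesgue_on D) \<le> C"
      by (intro LIMSEQ_le_const2) auto
    moreover have "(\<integral>\<^sup>+p. ennreal (trunc_mean W m p) * ennreal (a p) \<partial>lebesgue_on D) = ennreal (\<integral>p. trunc_mean W m p * a p \<partial>lebesgue_on D)"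
    proof -
      have "(\<integral>\<^sup>+p. ennreal (trunc_mean W m p) * ennreal (a p) \<partial>lebesgue_on D) = (\<integral>\<^sup>+p. ennreal (trunc_mean W m p * a p) \<partial>lebesgue_on D)"
      proof (rule nn_integral_cong_AE)
        show "AE p in lebesgue_on D. ennreal (trunc_mean W m p) * ennreal (a p) = ennreal (trunc_mean W m p * a p)"
          using bd pD by eventually_elim (simp add: ennreal_mult less_imp_le a(2))
      qed
      also have "\<dots> = ennreal (\<integral>p. trunc_mean W m p * a p \<partial>lebesgue_on D)"
      proof (rule nn_integral_eq_integral)
        show "integrable (lebesgue_on D) (\<lambda>p. trunc_mean W m p * a p)" using i1 by (simp add: mult.commute)
        show "AE p in lebesgue_on D. 0 \<le> trunc_mean W m p * a p"
          using bd pD by eventually_elim (simp add: less_imp_le a(2))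
      qed
      finally show ?thesis .
    qed
    ultimately show ?thesis by (simp add: ennreal_leI)
  qed
  have meas: "(\<lambda>p. ennreal (trunc_mean W m p) * ennreal (a p)) \<in> borel_measurable (lebesgue_on D)" for m
    using mmm a(1) by measurable
  have sup: "(\<integral>\<^sup>+p. (SUP m. ennreal (trunc_mean W m p) * ennreal (a p)) \<partial>lebesgue_on D) \<le> ennreal C"
    by (subst nn_integral_monotone_convergence_SUP_AE[where f = "\<lambda>m p. ennreal (trunc_mean W m p) * ennreal (a p)", OF inc meas])
      (rule SUP_least, rule le)
  then have "(\<integral>\<^sup>+p. (SUP m. ennreal (trunc_mean W m p) * ennreal (a p)) \<partial>lebesgue_on D) \<noteq> \<infinity>"
    using le_less_trans[OF _ ennreal_less_top] by fastforce
  then have fin: "AE p in lebesgue_on D. (SUP m. ennreal (trunc_mean W m p) * ennreal (a p)) \<noteq> \<infinity>"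
    by (intro nn_integral_PInf_AE borel_measurable_SUP meas) auto
  show good: "AE p in lebesgue_on D. p \<in> S \<and> p \<in> D \<and> (AE \<xi> in \<nu> p. \<xi> \<in> H_vac) \<and> (\<integral>\<^sup>+\<xi>. ennreal (mean_integrand W \<xi>) \<partial>\<nu> p) < \<infinity>"
    using fin pS
  proof eventually_elim
    case (elim p)
    then have p: "p \<in> D" "p \<in> S" "AE \<xi> in \<nu> p. \<xi> \<in> H_vac" by auto
    define X where "X = (SUP m. ennreal (trunc_mean W m p))"
    have "X * ennreal (a p) \<noteq> \<infinity>"
      using elim(1) unfolding X_def by (simp add: SUP_mult_right_ennreal)
    then have "X \<noteq> \<infinity>"
      using a(2)[OF p(1)] by (auto simp: ennreal_top_mult)
    then have "(SUP m. ennreal (trunc_mean W m p)) < \<infinity>" unfolding X_def[symmetric] by (simp add: less_top)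
    then show ?case using p nn_integral_mean_integrand_SUP(1)[where W = W, OF p(2,3) W] by simp
  qed
  have "(\<integral>\<^sup>+p. ennreal (mean \<nu> W p * a p) \<partial>lebesgue_on D) =
      (\<integral>\<^sup>+p. (SUP m. ennreal (trunc_mean W m p) * ennreal (a p)) \<partial>lebesgue_on D)"
  proof (rule nn_integral_cong_AE)
    show "AE p in lebesgue_on D. ennreal (mean \<nu> W p * a p) = (SUP m. ennreal (trunc_mean W m p) * ennreal (a p))"
      using good
    proof eventually_elim
      case (elim p)
      then have p: "p \<in> D" "p \<in> S" "AE \<xi> in \<nu> p. \<xi> \<in> H_vac" "(\<integral>\<^sup>+\<xi>. ennreal (mean_integrand W \<xi>) \<partial>\<nu> p) < \<infinity>" by auto
      note m = mean_approx[where f = f and W = W, OF p(2,3) W p(4) f small]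
      have "ennreal (mean \<nu> W p * a p) = ennreal (mean \<nu> W p) * ennreal (a p)"
        using m(4) a(2)[OF p(1)] by (intro ennreal_mult) auto
      also have "ennreal (mean \<nu> W p) = (SUP m. ennreal (trunc_mean W m p))"
        using m(5) nn_integral_mean_integrand_SUP(1)[where W = W, OF p(2,3) W] by simp
      finally show ?case by (simp add: SUP_mult_right_ennreal)
    qed
  qed
  with sup show "(\<integral>\<^sup>+p. ennreal (mean \<nu> W p * a p) \<partial>lebesgue_on D) \<le> ennreal C" by simp
qed

lemma mean_integrable_AE: "AE p in lebesgue_on D. integrable (\<nu> p) (mean_integrand f)"
  using good_points
proof eventually_elim
  case (elim p)
  then have p: "p \<in> S" "AE \<xi> in \<nu> p. \<xi> \<in> H_vac" "(\<integral>\<^sup>+\<xi>. ennreal (mean_integrand W \<xi>) \<partial>\<nu> p) < \<infinity>" by auto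
  show ?case by (rule mean_approx(1)[where f = f and W = W, OF p(1,2) W p(3) f small])
qed

lemma small_nat:
  assumes "0 < \<epsilon>"
  obtains m :: nat where "\<And>a k. m \<le> k \<Longrightarrow> a \<in> H_cl \<Longrightarrow> real k \<le> norm a \<Longrightarrow> \<bar>f a\<bar> \<le> \<epsilon> * W a"
proof -
  obtain R where R: "\<forall>a\<in>H_cl. R \<le> norm a \<longrightarrow> \<bar>f a\<bar> \<le> \<epsilon> * W a" using small[OF assms] by blast
  obtain m :: nat where "R \<le> real m" using real_arch_simple by blast
  then have "\<bar>f a\<bar> \<le> \<epsilon> * W a" if "m \<le> k" "a \<in> H_cl" "real k \<le> norm a" for a k
    using R that by (meson of_nat_le_iff order_trans)
  then show thesis by (rule that)
qed

lemma trunc_mean_mean_AE: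
  assumes "0 < \<epsilon>"
  obtains m where "\<And>k. m \<le> k \<Longrightarrow> AE p in lebesgue_on D. \<bar>trunc_mean f k p - mean \<nu> f p\<bar> \<le> \<epsilon> * mean \<nu> W p \<and> 0 \<le> mean \<nu> W p"
    "\<And>a k. m \<le> k \<Longrightarrow> a \<in> H_cl \<Longrightarrow> real k \<le> norm a \<Longrightarrow> \<bar>f a\<bar> \<le> \<epsilon> * W a"
proof -
  obtain m :: nat where m: "\<And>a k. m \<le> k \<Longrightarrow> a \<in> H_cl \<Longrightarrow> real k \<le> norm a \<Longrightarrow> \<bar>f a\<bar> \<le> \<epsilon> * W a"
    by (rule small_nat[OF assms], rule that)
  have "AE p in lebesgue_on D. \<bar>trunc_mean f k p - mean \<nu> f p\<bar> \<le> \<epsilon> * mean \<nu> W p \<and> 0 \<le> mean \<nu> W p" if "m \<le> k" for k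
    using good_points
  proof eventually_elim
    case (elim p)
    then have p: "p \<in> S" "AE \<xi> in \<nu> p. \<xi> \<in> H_vac" "(\<integral>\<^sup>+\<xi>. ennreal (mean_integrand W \<xi>) \<partial>\<nu> p) < \<infinity>" by auto
    show ?case
      using mean_approx(3)[where f = f and W = W and m = k and \<epsilon> = \<epsilon>, OF p(1,2) W p(3) f small m[OF that] assms]
        mean_approx(4)[where f = f and W = W, OF p(1,2) W p(3) f small] by simp
  qed
  then show thesis using m by (rule that)
qed

text \<open>Almost everywhere the mean is the limit of truncated means. The error is at most
  \<open>mean \<nu> W p\<close> divided by \<open>Suc j\<close> from an index on that depends on
  \<open>j\<close> but not on the point, so the exceptional sets for all \<open>j\<close> can be
  united.\<close>

lemma measurable_mean: "mean \<nu> f \<in> borel_measurable (lebesgue_on D)"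
proof (rule measurable_AE_lebesgue_on[OF Dsets])
  have mmm: "trunc_mean f m \<in> borel_measurable (lebesgue_on D)" for m
    by (rule on_D(1)[OF trunc_mean_conv(1)[where f = f, OF f]])
  show "(\<lambda>p. lim (\<lambda>m. trunc_mean f m p)) \<in> borel_measurable (lebesgue_on D)"
    by (rule borel_measurable_lim_metric[OF mmm])
  have "AE p in lebesgue_on D. \<forall>j::nat. \<exists>m. \<forall>k\<ge>m. \<bar>trunc_mean f k p - mean \<nu> f p\<bar> \<le> inverse (Suc j) * mean \<nu> W p"
    unfolding AE_all_countable
  proof
    fix j :: nat
    have j: "0 < inverse (real (Suc j))" by simp
    obtain m where m: "\<And>k. m \<le> k \<Longrightarrow> AE p in lebesgue_on D. \<bar>trunc_mean f k p - mean \<nu> f p\<bar> \<le> inverse (Suc j) * mean \<nu> W p \<and> 0 \<le> mean \<nu> W p"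
      by (rule trunc_mean_mean_AE[OF j], rule that)
    then have "AE p in lebesgue_on D. \<forall>k. m \<le> k \<longrightarrow> \<bar>trunc_mean f k p - mean \<nu> f p\<bar> \<le> inverse (Suc j) * mean \<nu> W p \<and> 0 \<le> mean \<nu> W p"
      unfolding AE_all_countable by (intro allI) (simp add: AE_impI)
    then show "AE p in lebesgue_on D. \<exists>m. \<forall>k\<ge>m. \<bar>trunc_mean f k p - mean \<nu> f p\<bar> \<le> inverse (Suc j) * mean \<nu> W p"
      by eventually_elim blast
  qed
  then show "AE p in lebesgue_on D. lim (\<lambda>m. trunc_mean f m p) = mean \<nu> f p"
  proof eventually_elim
    case (elim p)
    have "(\<lambda>m. trunc_mean f m p) \<longlonglongrightarrow> mean \<nu> f p"
    proof (rule LIMSEQ_I)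
      fix r :: real assume r: "0 < r"
      have "(\<lambda>j. inverse (real (Suc j)) * mean \<nu> W p) \<longlonglongrightarrow> 0 * mean \<nu> W p"
        by (intro tendsto_mult LIMSEQ_inverse_real_of_nat tendsto_const)
      then have "\<forall>\<^sub>F j in sequentially. inverse (real (Suc j)) * mean \<nu> W p < r"
        using r by (intro order_tendstoD(2)) simp_all
      then obtain j where j: "inverse (real (Suc j)) * mean \<nu> W p < r"
        by (meson eventually_happens sequentially_bot)
      obtain m where "\<forall>k\<ge>m. \<bar>trunc_mean f k p - mean \<nu> f p\<bar> \<le> inverse (Suc j) * mean \<nu> W p"
        using elim by blast
      then show "\<exists>no. \<forall>n\<ge>no. norm (trunc_mean f n p - mean \<nu> f p) < r"
        using j by (intro exI[of _ m]) (auto intro: le_less_trans)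
    qed
    then show ?case by (rule limI)
  qed
qed

lemma integrable_mean_W: "integrable (lebesgue_on D) (\<lambda>p. mean \<nu> W p * a p)"
  and integral_mean_W: "(\<integral>p. mean \<nu> W p * a p \<partial>lebesgue_on D) \<le> C"
proof -
  have nn: "AE p in lebesgue_on D. 0 \<le> mean \<nu> W p * a p"
    using good_points
  proof eventually_elim
    case (elim p)
    then have p: "p \<in> S" "p \<in> D" "AE \<xi> in \<nu> p. \<xi> \<in> H_vac" "(\<integral>\<^sup>+\<xi>. ennreal (mean_integrand W \<xi>) \<partial>\<nu> p) < \<infinity>" by auto
    show ?case using mean_approx(4)[where f = f and W = W, OF p(1,3) W p(4) f small] a(2)[OF p(2)] by simp
  qed
  have mW: "mean \<nu> W \<in> borel_measurable (lebesgue_on D)"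
  proof (rule measurable_AE_lebesgue_on[OF Dsets])
    \<comment> \<open>The supremum of the truncated moments is a measurable version of the mean of
      \<open>W\<close>, which is itself a Bochner integral with default value zero off the good
      points.\<close>
    show "(\<lambda>p. enn2real (SUP m. ennreal (trunc_mean W m p))) \<in> borel_measurable (lebesgue_on D)"
      using on_D(1)[OF trunc_mean_conv(1)[where f = W, OF W(1,2)]] by measurable
    show "AE p in lebesgue_on D. enn2real (SUP m. ennreal (trunc_mean W m p)) = mean \<nu> W p"
      using good_points
    proof eventually_elim
      case (elim p)
      then have p: "p \<in> S" "p \<in> D" "AE \<xi> in \<nu> p. \<xi> \<in> H_vac" "(\<integral>\<^sup>+\<xi>. ennreal (mean_integrand W \<xi>) \<partial>\<nu> p) < \<infinity>" by auto
      note m = mean_approx[where f = f and W = W, OF p(1,3) W p(4) f small]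
      have "ennreal (mean \<nu> W p) = (SUP m. ennreal (trunc_mean W m p))"
        using m(5) nn_integral_mean_integrand_SUP(1)[where W = W, OF p(1,3) W] by simp
      then show ?case using m(4) by (metis enn2real_ennreal)
    qed
  qed
  show i: "integrable (lebesgue_on D) (\<lambda>p. mean \<nu> W p * a p)"
    using nn le_less_trans[OF mean_W_bound ennreal_less_top]
    by (intro integrableI_nonneg borel_measurable_times mW a(1)) auto
  have "ennreal (\<integral>p. mean \<nu> W p * a p \<partial>lebesgue_on D) \<le> ennreal C"
    using mean_W_bound by (subst nn_integral_eq_integral[symmetric, OF i nn]) simp
  then show "(\<integral>p. mean \<nu> W p * a p \<partial>lebesgue_on D) \<le> C" using C by simp
qed

lemma integrable_W:
  assumes n: "1 \<le> n"
  shows "integrable (lebesgue_on D) (\<lambda>p. W (z n p) * an n p)"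
    and "(\<integral>p. W (z n p) * an n p \<partial>lebesgue_on D) \<le> C"
proof -
  have nn: "AE p in lebesgue_on D. 0 \<le> W (z n p) * an n p"
  proof (rule AE_I2)
    fix p assume "p \<in> space (lebesgue_on D)"
    then have "p \<in> D" by simp
    then have "0 \<le> an n p" using a(2)[of p] an(2)[OF n, of p] by linarith
    then show "0 \<le> W (z n p) * an n p" using W(3)[OF z] by simp
  qed
  show i: "integrable (lebesgue_on D) (\<lambda>p. W (z n p) * an n p)"
    using nn le_less_trans[OF bound[OF n] ennreal_less_top]
    by (intro integrableI_nonneg borel_measurable_times an(1)[OF n] measurable_continuous_H_cl[OF W(1) zm[OF n] z]) auto
  have "ennreal (\<integral>p. W (z n p) * an n p \<partial>lebesgue_on D) \<le> ennreal C"
    using bound[OF n] by (subst nn_integral_eq_integral[symmetric, OF i nn]) simp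
  then show "(\<integral>p. W (z n p) * an n p \<partial>lebesgue_on D) \<le> C" using C by simp
qed

lemma integrable_an: "1 \<le> n \<Longrightarrow> integrable (lebesgue_on D) (an n)"
proof (rule finite_measure.integrable_const_bound[OF finite_D])
  assume n: "1 \<le> n"
  show "AE p in lebesgue_on D. norm (an n p) \<le> amax"
  proof (rule AE_I2)
    fix p assume "p \<in> space (lebesgue_on D)"
    then have "p \<in> D" by simp
    then show "norm (an n p) \<le> amax" using a(2)[of p] an(2)[OF n, of p] an(3)[OF n, of p] by simp
  qed
qed (rule an(1))

lemma integrable_f:
  assumes n: "1 \<le> n"
  shows "integrable (lebesgue_on D) (\<lambda>p. f (z n p) * an n p)"
proof -
  obtain m :: nat where m: "\<And>a k. m \<le> k \<Longrightarrow> a \<in> H_cl \<Longrightarrow> real k \<le> norm a \<Longrightarrow> \<bar>f a\<bar> \<le> 1 * W a"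
    by (rule small_nat[OF zero_less_one], rule that)
  obtain B where B: "0 \<le> B" "\<And>a. a \<in> H_cl \<Longrightarrow> norm a \<le> real m \<Longrightarrow> \<bar>f a\<bar> \<le> B"
    by (rule continuous_bounded_on_ball[OF f(1), of "real m"], rule that)
  show ?thesis
  proof (rule Bochner_Integration.integrable_bound)
    show "integrable (lebesgue_on D) (\<lambda>p. B * an n p + W (z n p) * an n p)"
      by (intro Bochner_Integration.integrable_add integrable_mult_right integrable_an integrable_W n)
    show "(\<lambda>p. f (z n p) * an n p) \<in> borel_measurable (lebesgue_on D)"
      by (intro borel_measurable_times an(1)[OF n] measurable_continuous_H_cl[OF f(1) zm[OF n] z])
    show "AE p in lebesgue_on D. norm (f (z n p) * an n p) \<le> norm (B * an n p + W (z n p) * an n p)"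
    proof (rule AE_I2)
      fix p assume "p \<in> space (lebesgue_on D)"
      then have "p \<in> D" by simp
      then have an0: "0 \<le> an n p" using a(2)[of p] an(2)[OF n, of p] by linarith
      have W0: "0 \<le> W (z n p)" by (rule W(3)[OF z])
      have "\<bar>f (z n p)\<bar> \<le> B + W (z n p)"
      proof (cases "norm (z n p) \<le> real m")
        case True
        then show ?thesis using B(2)[OF z, of n p] W0 by linarith
      next
        case False
        then show ?thesis using m[OF order_refl z, of n p] B(1) by linarith
      qed
      then have "\<bar>f (z n p)\<bar> * an n p \<le> (B + W (z n p)) * an n p" using an0 by (rule mult_right_mono)
      moreover have "0 \<le> (B + W (z n p)) * an n p" using an0 W0 B(1) by simp
      ultimately show "norm (f (z n p) * an n p) \<le> norm (B * an n p + W (z n p) * an n p)"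
        using an0 by (simp add: abs_mult distrib_right)
    qed
  qed
qed

lemma integrable_mean: "integrable (lebesgue_on D) (\<lambda>p. mean \<nu> f p * a p)"
proof -
  obtain m where m: "\<And>k. m \<le> k \<Longrightarrow> AE p in lebesgue_on D. \<bar>trunc_mean f k p - mean \<nu> f p\<bar> \<le> 1 * mean \<nu> W p \<and> 0 \<le> mean \<nu> W p"
    by (rule trunc_mean_mean_AE[OF zero_less_one], rule that)
  obtain B where B: "0 \<le> B" "\<And>a. a \<in> H_cl \<Longrightarrow> \<bar>trunc f m a\<bar> \<le> B"
    by (rule trunc_bounded[OF f(1)], rule that)
  show ?thesis
  proof (rule Bochner_Integration.integrable_bound)
    show "integrable (lebesgue_on D) (\<lambda>p. a p * B + mean \<nu> W p * a p)"
      by (intro Bochner_Integration.integrable_add integrable_mean_W integrable_bounded_a[where Cg = "\<bar>B\<bar>"]) auto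
    show "(\<lambda>p. mean \<nu> f p * a p) \<in> borel_measurable (lebesgue_on D)"
      by (intro borel_measurable_times a(1) measurable_mean)
    show "AE p in lebesgue_on D. norm (mean \<nu> f p * a p) \<le> norm (a p * B + mean \<nu> W p * a p)"
      using m[OF order_refl] good_points
    proof eventually_elim
      case (elim p)
      then have p: "p \<in> S" "p \<in> D" "AE \<xi> in \<nu> p. \<xi> \<in> H_vac" by auto
      have "\<bar>trunc_mean f m p\<bar> \<le> B"
        by (rule trunc_mean_abs_le[where f = f, OF p(1,3) f B(2)])
      then have "\<bar>mean \<nu> f p\<bar> \<le> B + mean \<nu> W p" using elim(1) by linarith
      then have "\<bar>mean \<nu> f p\<bar> * a p \<le> (B + mean \<nu> W p) * a p"
        using a(2)[OF p(2)] by (intro mult_right_mono) auto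
      moreover have "0 \<le> (B + mean \<nu> W p) * a p" using a(2)[OF p(2)] elim(1) B(1) by simp
      ultimately show ?case using a(2)[OF p(2)] by (simp add: abs_mult algebra_simps)
    qed
  qed
qed

text \<open>Three errors: the tail and the change from \<open>an n\<close> to \<open>a\<close> for
  finite \<open>n\<close>, the convergence of the truncated functions, and the tail in the limit.
  Both tails are controlled by the same bound \<open>C\<close> on the cubic weight.\<close>

lemma weak_convergence:
  assumes g: "g \<in> borel_measurable (lebesgue_on D)" "AE p in lebesgue_on D. \<bar>g p\<bar> \<le> Cg"
  shows "(\<lambda>n. \<integral>p. f (z n p) * an n p * g p \<partial>lebesgue_on D) \<longlonglongrightarrow> (\<integral>p. mean \<nu> f p * a p * g p \<partial>lebesgue_on D)"
proof (rule LIMSEQ_I)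
  fix e :: real assume e: "0 < e"
  define G where "G = \<bar>Cg\<bar> + 1"
  have G: "0 < G" by (simp add: G_def)
  have gG: "AE p in lebesgue_on D. \<bar>g p\<bar> \<le> G" using g(2) by eventually_elim (simp add: G_def)
  \<comment> \<open>The allowance is a quarter of \<open>e\<close> for each of the two tails. The
    added \<open>1\<close> keeps the denominator positive when \<open>C\<close> is zero.\<close>
  define \<epsilon> where "\<epsilon> = e / (4 * G * (C + 1))"
  have \<epsilon>: "0 < \<epsilon>" using e G C by (simp add: \<epsilon>_def)
  have \<epsilon>C: "\<epsilon> * C * G \<le> e / 4"
  proof -
    have "\<epsilon> * C * G \<le> \<epsilon> * (C + 1) * G" using \<epsilon> G by (intro mult_right_mono mult_left_mono) auto
    also have "\<dots> = e / 4" using G C by (simp add: \<epsilon>_def)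
    finally show ?thesis .
  qed
  obtain m where m: "\<And>k. m \<le> k \<Longrightarrow> AE p in lebesgue_on D. \<bar>trunc_mean f k p - mean \<nu> f p\<bar> \<le> \<epsilon> * mean \<nu> W p \<and> 0 \<le> mean \<nu> W p"
    "\<And>a k. m \<le> k \<Longrightarrow> a \<in> H_cl \<Longrightarrow> real k \<le> norm a \<Longrightarrow> \<bar>f a\<bar> \<le> \<epsilon> * W a"
    by (rule trunc_mean_mean_AE[OF \<epsilon>], rule that)
  obtain B where B: "0 \<le> B" "\<And>a. a \<in> H_cl \<Longrightarrow> \<bar>trunc f m a\<bar> \<le> B"
    by (rule trunc_bounded[OF f(1)], rule that)
  define vol where "vol = measure (lebesgue_on D) D"
  have vol: "0 \<le> vol" by (simp add: vol_def)
  \<comment> \<open>The tolerance for \<open>an n - a\<close>, which is multiplied by the truncated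
    function (at most \<open>B\<close>), by the test function (at most \<open>G\<close>) and by the
    volume of \<open>D\<close>.\<close>
  define \<delta> where "\<delta> = e / (4 * G * (B + 1) * (vol + 1))"
  have \<delta>: "0 < \<delta>" using e G B vol by (simp add: \<delta>_def)
  have \<delta>B: "B * \<delta> * vol * G \<le> e / 4"
  proof -
    have "B * \<delta> * vol * G \<le> (B + 1) * \<delta> * (vol + 1) * G"
      using \<delta> G B vol by (intro mult_mono mult_nonneg_nonneg) auto
    also have "\<dots> = e / 4"
    proof -
      have "x * (e / (4 * G * x * y)) * y * G = e / 4" if "0 < x" "0 < y" for x y
        using that G by simp
      from this[of "B + 1" "vol + 1"] B(1) vol show ?thesis unfolding \<delta>_def by (simp only: add_nonneg_pos zero_less_one)
    qed
    finally show ?thesis .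
  qed
  have gint: "integrable (lebesgue_on D) (\<lambda>p. F p * g p)" if "integrable (lebesgue_on D) F" for F
  proof (rule Bochner_Integration.integrable_bound)
    show "integrable (lebesgue_on D) (\<lambda>p. G * F p)" using that by simp
    show "(\<lambda>p. F p * g p) \<in> borel_measurable (lebesgue_on D)" using that g(1) by measurable
    show "AE p in lebesgue_on D. norm (F p * g p) \<le> norm (G * F p)"
      using gG
    proof eventually_elim
      case (elim p)
      then show ?case using G mult_left_mono[OF elim, of "\<bar>F p\<bar>"] by (simp add: abs_mult mult.commute)
    qed
  qed
  have gbound: "\<bar>(\<integral>p. F p * g p \<partial>lebesgue_on D)\<bar> \<le> x * G"
    if F: "integrable (lebesgue_on D) F" "integrable (lebesgue_on D) F'" "AE p in lebesgue_on D. \<bar>F p\<bar> \<le> F' p"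
      "(\<integral>p. F' p \<partial>lebesgue_on D) \<le> x" for F F' x
  proof -
    have "\<bar>(\<integral>p. F p * g p \<partial>lebesgue_on D)\<bar> \<le> (\<integral>p. \<bar>F p * g p\<bar> \<partial>lebesgue_on D)"
      using integral_norm_bound[of "lebesgue_on D" "\<lambda>p. F p * g p"] by simp
    also have "\<dots> \<le> (\<integral>p. F' p * G \<partial>lebesgue_on D)"
    proof (rule integral_mono_AE)
      show "AE p in lebesgue_on D. \<bar>F p * g p\<bar> \<le> F' p * G"
        using F(3) gG by eventually_elim (simp add: abs_mult mult_mono)
    qed (use gint[OF F(1)] F(2) in simp_all)
    also have "\<dots> = (\<integral>p. F' p \<partial>lebesgue_on D) * G" by simp
    also have "\<dots> \<le> x * G" using F(4) G by (intro mult_right_mono) auto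
    finally show ?thesis .
  qed
  have ag: "integrable (lebesgue_on D) (\<lambda>p. a p * g p)" by (rule integrable_bounded_a[OF g])
  have ai: "integrable (lebesgue_on D) a" using integrable_bounded_a[of "\<lambda>_. 1" 1] by simp
  have pD: "AE p in lebesgue_on D. p \<in> D" by (rule AE_I2) simp
  have mma: "integrable (lebesgue_on D) (\<lambda>p. trunc_mean f m p * a p)"
  proof -
    have "AE p in lebesgue_on D. \<bar>trunc_mean f m p\<bar> \<le> B"
      using good_points
    proof eventually_elim
      case (elim p)
      then have p: "p \<in> S" "AE \<xi> in \<nu> p. \<xi> \<in> H_vac" by auto
      show ?case by (rule trunc_mean_abs_le[where f = f, OF p f B(2)])
    qed
    from integrable_bounded_a[OF on_D(1)[OF trunc_mean_conv(1)[where f = f, OF f]] this]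
    show ?thesis by (simp add: mult.commute)
  qed
  have lim_part: "\<bar>(\<integral>p. (trunc_mean f m p * a p - mean \<nu> f p * a p) * g p \<partial>lebesgue_on D)\<bar> \<le> (\<epsilon> * C) * G"
  proof (rule gbound[where F' = "\<lambda>p. \<epsilon> * (mean \<nu> W p * a p)"])
    show "integrable (lebesgue_on D) (\<lambda>p. trunc_mean f m p * a p - mean \<nu> f p * a p)"
      by (intro Bochner_Integration.integrable_diff mma integrable_mean)
    show "integrable (lebesgue_on D) (\<lambda>p. \<epsilon> * (mean \<nu> W p * a p))"
      by (intro integrable_mult_right integrable_mean_W)
    show "AE p in lebesgue_on D. \<bar>trunc_mean f m p * a p - mean \<nu> f p * a p\<bar> \<le> \<epsilon> * (mean \<nu> W p * a p)"
      using m(1)[OF order_refl] pD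
    proof eventually_elim
      case (elim p)
      have "\<bar>trunc_mean f m p - mean \<nu> f p\<bar> * a p \<le> (\<epsilon> * mean \<nu> W p) * a p"
        using elim a(2) by (intro mult_right_mono) (auto simp: less_imp_le)
      moreover have "trunc_mean f m p * a p - mean \<nu> f p * a p = (trunc_mean f m p - mean \<nu> f p) * a p" by (simp add: algebra_simps)
      ultimately show ?case using a(2)[OF elim(2)] by (simp add: abs_mult mult.assoc)
    qed
    show "(\<integral>p. \<epsilon> * (mean \<nu> W p * a p) \<partial>lebesgue_on D) \<le> \<epsilon> * C"
      using integral_mean_W \<epsilon> by simp
  qed
  have "(\<lambda>n. \<integral>p. trunc f m (z n p) * (a p * g p) \<partial>lebesgue_on D) \<longlonglongrightarrow> (\<integral>p. trunc_mean f m p * (a p * g p) \<partial>lebesgue_on D)"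
    by (rule young_on_D[where F = f, OF f ag])
  then have ev1: "\<forall>\<^sub>F n in sequentially. \<bar>(\<integral>p. trunc f m (z n p) * (a p * g p) \<partial>lebesgue_on D) - (\<integral>p. trunc_mean f m p * (a p * g p) \<partial>lebesgue_on D)\<bar> < e / 4"
    using e by (auto dest: tendstoD[of _ _ _ "e / 4"] simp: dist_real_def)
  have ev2: "\<forall>\<^sub>F n in sequentially. \<forall>p\<in>D. dist (an n p) (a p) < \<delta>"
    using an(4) \<delta> unfolding uniform_limit_iff by blast
  have fin: "norm ((\<integral>p. f (z n p) * an n p * g p \<partial>lebesgue_on D) - (\<integral>p. mean \<nu> f p * a p * g p \<partial>lebesgue_on D)) < e"
    if n: "1 \<le> n" and n1: "\<bar>(\<integral>p. trunc f m (z n p) * (a p * g p) \<partial>lebesgue_on D) - (\<integral>p. trunc_mean f m p * (a p * g p) \<partial>lebesgue_on D)\<bar> < e / 4"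
      and n2: "\<forall>p\<in>D. dist (an n p) (a p) < \<delta>" for n
  proof -
    have tm: "(\<lambda>p. trunc f m (z n p)) \<in> borel_measurable (lebesgue_on D)"
      by (rule measurable_continuous_H_cl[OF continuous_trunc[OF f(1)] zm[OF n] z])
    have ta: "integrable (lebesgue_on D) (\<lambda>p. trunc f m (z n p) * a p)"
    proof -
      have "integrable (lebesgue_on D) (\<lambda>p. a p * trunc f m (z n p))"
        by (rule integrable_bounded_a[where Cg = B, OF tm]) (intro AE_I2 B(2) z)
      then show ?thesis by (simp add: mult.commute)
    qed
    have n_part: "\<bar>(\<integral>p. (f (z n p) * an n p - trunc f m (z n p) * a p) * g p \<partial>lebesgue_on D)\<bar> \<le> (\<epsilon> * C + B * \<delta> * vol) * G"
    proof (rule gbound[where F' = "\<lambda>p. \<epsilon> * (W (z n p) * an n p) + B * \<delta>"])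
      interpret finite_measure "lebesgue_on D" by (rule finite_D)
      show "integrable (lebesgue_on D) (\<lambda>p. f (z n p) * an n p - trunc f m (z n p) * a p)"
        by (intro Bochner_Integration.integrable_diff integrable_f n ta)
      show "integrable (lebesgue_on D) (\<lambda>p. \<epsilon> * (W (z n p) * an n p) + B * \<delta>)"
        by (intro Bochner_Integration.integrable_add integrable_mult_right integrable_W n integrable_const)
      show "(\<integral>p. \<epsilon> * (W (z n p) * an n p) + B * \<delta> \<partial>lebesgue_on D) \<le> \<epsilon> * C + B * \<delta> * vol"
        using integrable_W[OF n] \<epsilon> by (simp add: vol_def mult.commute)
      show "AE p in lebesgue_on D. \<bar>f (z n p) * an n p - trunc f m (z n p) * a p\<bar> \<le> \<epsilon> * (W (z n p) * an n p) + B * \<delta>"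
        using pD
      proof eventually_elim
        case (elim p)
        have an0: "0 \<le> an n p" using a(2)[OF elim] an(2)[OF n elim] by linarith
        have W0: "0 \<le> W (z n p)" by (rule W(3)[OF z])
        have c: "\<bar>f (z n p) - trunc f m (z n p)\<bar> \<le> \<epsilon> * W (z n p)"
        proof (cases "norm (z n p) \<le> real m")
          case True
          then show ?thesis using W0 \<epsilon> by (simp add: trunc_def cutoff_eq_1)
        next
          case False
          have "f (z n p) - trunc f m (z n p) = f (z n p) * (1 - cutoff m (z n p))" by (simp add: trunc_def algebra_simps)
          then have "\<bar>f (z n p) - trunc f m (z n p)\<bar> = \<bar>f (z n p)\<bar> * (1 - cutoff m (z n p))"
            using cutoff_bounds[of m "z n p"] by (simp add: abs_mult)
          also have "\<dots> \<le> \<bar>f (z n p)\<bar>" using cutoff_bounds[of m "z n p"] by (simp add: mult_left_le)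
          also have "\<dots> \<le> \<epsilon> * W (z n p)" using m(2)[OF order_refl z, of n p] False by simp
          finally show ?thesis .
        qed
        have "\<bar>f (z n p) - trunc f m (z n p)\<bar> * an n p \<le> (\<epsilon> * W (z n p)) * an n p"
          by (rule mult_right_mono[OF c an0])
        moreover have "\<bar>trunc f m (z n p)\<bar> * \<bar>an n p - a p\<bar> \<le> B * \<delta>"
          using B(2)[OF z, of n p] n2 elim B(1) by (intro mult_mono) (auto simp: dist_real_def less_imp_le)
        moreover have "\<bar>f (z n p) * an n p - trunc f m (z n p) * a p\<bar> \<le>
            \<bar>(f (z n p) - trunc f m (z n p)) * an n p\<bar> + \<bar>trunc f m (z n p) * (an n p - a p)\<bar>"
          by (rule order_trans[OF _ abs_triangle_ineq]) (simp add: algebra_simps)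
        ultimately show ?case using an0 by (simp add: abs_mult mult.assoc)
      qed
    qed
    have e1: "(\<integral>p. f (z n p) * an n p * g p \<partial>lebesgue_on D) - (\<integral>p. trunc f m (z n p) * (a p * g p) \<partial>lebesgue_on D) =
       (\<integral>p. (f (z n p) * an n p - trunc f m (z n p) * a p) * g p \<partial>lebesgue_on D)"
      using gint[OF integrable_f[OF n]] gint[OF ta]
      by (simp add: left_diff_distrib mult.assoc)
    have e2: "(\<integral>p. trunc_mean f m p * (a p * g p) \<partial>lebesgue_on D) - (\<integral>p. mean \<nu> f p * a p * g p \<partial>lebesgue_on D) =
       (\<integral>p. (trunc_mean f m p * a p - mean \<nu> f p * a p) * g p \<partial>lebesgue_on D)"
      using gint[OF mma] gint[OF integrable_mean]
      by (simp add: left_diff_distrib mult.assoc)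
    have "(\<epsilon> * C + B * \<delta> * vol) * G \<le> e / 2" using \<epsilon>C \<delta>B by (simp add: distrib_right)
    with n_part have np: "\<bar>(\<integral>p. (f (z n p) * an n p - trunc f m (z n p) * a p) * g p \<partial>lebesgue_on D)\<bar> \<le> e / 2"
      by (rule order_trans)
    have lp: "\<bar>(\<integral>p. (trunc_mean f m p * a p - mean \<nu> f p * a p) * g p \<partial>lebesgue_on D)\<bar> \<le> e / 4"
      by (rule order_trans[OF lim_part \<epsilon>C])
    have tri: "\<bar>x - w\<bar> < e" if "\<bar>x - y\<bar> \<le> e / 2" "\<bar>y - z'\<bar> < e / 4" "\<bar>z' - w\<bar> \<le> e / 4" for x y z' w :: real
      using that e by linarith
    show ?thesis
      unfolding real_norm_def
      by (rule tri[OF np[folded e1] n1 lp[folded e2]])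
  qed
  from ev1 ev2 eventually_ge_at_top[of 1]
  have "\<forall>\<^sub>F n in sequentially. norm ((\<integral>p. f (z n p) * an n p * g p \<partial>lebesgue_on D) - (\<integral>p. mean \<nu> f p * a p * g p \<partial>lebesgue_on D)) < e"
    by eventually_elim (rule fin)
  then show "\<exists>no. \<forall>n\<ge>no. norm ((\<integral>p. f (z n p) * an n p * g p \<partial>lebesgue_on D) - (\<integral>p. mean \<nu> f p * a p * g p \<partial>lebesgue_on D)) < e"
    by (simp add: eventually_sequentially)
qed

end

end

section \<open>Smooth cutoff functions\<close>

text \<open>The derivative is existentially quantified, so closure under sums, products,
  compositions and reciprocals follows by induction from the differentiation rules.\<close>

fun smooth_upto :: "nat \<Rightarrow> (real \<Rightarrow> real) \<Rightarrow> bool" where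
  "smooth_upto 0 f \<longleftrightarrow> continuous_on UNIV f"
| "smooth_upto (Suc k) f \<longleftrightarrow> (\<exists>f'. (\<forall>x. (f has_real_derivative f' x) (at x)) \<and> smooth_upto k f')"

definition smooth :: "(real \<Rightarrow> real) \<Rightarrow> bool" where
  "smooth f \<longleftrightarrow> (\<forall>k. smooth_upto k f)"

lemma continuous_on_DERIV:
  fixes f :: "real \<Rightarrow> real"
  assumes "\<And>x. (f has_real_derivative f' x) (at x)"
  shows "continuous_on A f"
  using assms DERIV_isCont by (blast intro: continuous_at_imp_continuous_on)

lemma smooth_upto_continuous: "smooth_upto k f \<Longrightarrow> continuous_on UNIV f"
proof (cases k)
  case (Suc n)
  assume "smooth_upto k f"
  then obtain f' where "\<forall>x. (f has_real_derivative f' x) (at x)" using Suc by auto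
  then show ?thesis by (intro continuous_on_DERIV[of f f']) simp
qed simp

lemma smooth_upto_lower: "smooth_upto (Suc k) f \<Longrightarrow> smooth_upto k f"
proof (induction k arbitrary: f)
  case 0
  then show ?case using smooth_upto_continuous[of "Suc 0" f] by simp
next
  case (Suc k)
  then obtain f' where "\<forall>x. (f has_real_derivative f' x) (at x)" "smooth_upto (Suc k) f'"
    by (simp only: smooth_upto.simps(2)[of "Suc k"]) blast
  then show ?case using Suc.IH[of f'] by (auto simp only: smooth_upto.simps(2))
qed

lemma smooth_deriv:
  assumes "smooth f"
  shows "(f has_real_derivative deriv f x) (at x)" "smooth (deriv f)"
proof -
  have *: "(\<forall>x. (f has_real_derivative deriv f x) (at x)) \<and> smooth_upto k (deriv f)" for k
  proof -
    have "smooth_upto (Suc k) f" using assms by (simp only: smooth_def)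
    then obtain f' where f': "\<forall>x. (f has_real_derivative f' x) (at x)" "smooth_upto k f'" by auto
    have "deriv f = f'" using f'(1) by (auto intro!: DERIV_imp_deriv)
    then show ?thesis using f' by simp
  qed
  show "(f has_real_derivative deriv f x) (at x)" "smooth (deriv f)"
    using * by (auto simp: smooth_def)
qed

lemma smooth_continuous: "smooth f \<Longrightarrow> continuous_on A f"
  using smooth_upto_continuous[of 0 f] continuous_on_subset[of UNIV f A] by (simp only: smooth_def) auto

lemma smoothI_deriv:
  assumes "\<And>x. (f has_real_derivative f' x) (at x)" "smooth f'"
  shows "smooth f"
  unfolding smooth_def
proof
  fix k
  show "smooth_upto k f"
  proof (cases k)
    case 0
    then show ?thesis using continuous_on_DERIV[OF assms(1)] by simp
  next
    case (Suc j)
    then show ?thesis using assms by (auto simp: smooth_def)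
  qed
qed

lemma smooth_upto_const: "smooth_upto k (\<lambda>_. c)"
  by (induction k arbitrary: c) (auto intro!: exI[of _ "\<lambda>_. 0"])

lemma smooth_const: "smooth (\<lambda>_. c)"
  by (simp add: smooth_def smooth_upto_const)

lemma smooth_upto_add: "smooth_upto k f \<Longrightarrow> smooth_upto k g \<Longrightarrow> smooth_upto k (\<lambda>x. f x + g x)"
proof (induction k arbitrary: f g)
  case (Suc k)
  then obtain f' g' where "\<forall>x. (f has_real_derivative f' x) (at x)" "smooth_upto k f'"
    "\<forall>x. (g has_real_derivative g' x) (at x)" "smooth_upto k g'" by auto
  then show ?case
    unfolding smooth_upto.simps
    by (intro exI[of _ "\<lambda>x. f' x + g' x"] conjI allI DERIV_add Suc.IH) simp_all
qed (simp add: continuous_on_add)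

lemma smooth_upto_mult: "smooth_upto k f \<Longrightarrow> smooth_upto k g \<Longrightarrow> smooth_upto k (\<lambda>x. f x * g x)"
proof (induction k arbitrary: f g)
  case (Suc k)
  then obtain f' g' where *: "\<forall>x. (f has_real_derivative f' x) (at x)" "smooth_upto k f'"
    "\<forall>x. (g has_real_derivative g' x) (at x)" "smooth_upto k g'" by auto
  have "smooth_upto k f" "smooth_upto k g" using Suc.prems by (blast intro: smooth_upto_lower)+
  then have "smooth_upto k (\<lambda>x. f' x * g x + g' x * f x)"
    by (intro smooth_upto_add[OF Suc.IH[OF *(2)] Suc.IH[OF *(4)]])
  moreover have "((\<lambda>x. f x * g x) has_real_derivative f' x * g x + g' x * f x) (at x)" for x
    using * by (intro DERIV_mult) simp_all
  ultimately show ?case unfolding smooth_upto.simps by (intro exI conjI allI)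
qed (simp add: continuous_on_mult)

lemma smooth_add: "smooth f \<Longrightarrow> smooth g \<Longrightarrow> smooth (\<lambda>x. f x + g x)"
  by (simp add: smooth_def smooth_upto_add)

lemma smooth_mult: "smooth f \<Longrightarrow> smooth g \<Longrightarrow> smooth (\<lambda>x. f x * g x)"
  by (simp add: smooth_def smooth_upto_mult)

lemma smooth_upto_affine: "smooth_upto k f \<Longrightarrow> smooth_upto k (\<lambda>x. f (a * x + b))"
proof (induction k arbitrary: f)
  case 0
  then show ?case by (auto intro!: continuous_intros continuous_on_compose2[of UNIV f])
next
  case (Suc k)
  then obtain f' where *: "\<forall>x. (f has_real_derivative f' x) (at x)" "smooth_upto k f'" by auto
  have "((\<lambda>x. f (a * x + b)) has_real_derivative f' (a * x + b) * a) (at x)" for x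
  proof -
    have "((\<lambda>x. a * x + b) has_real_derivative a) (at x)" by (auto intro!: derivative_eq_intros)
    from DERIV_chain2[OF *(1)[rule_format] this] show ?thesis .
  qed
  moreover have "smooth_upto k (\<lambda>x. f' (a * x + b) * a)"
    by (rule smooth_upto_mult[OF Suc.IH[OF *(2)] smooth_upto_const])
  ultimately show ?case unfolding smooth_upto.simps by (intro exI conjI allI)
qed

lemma smooth_affine: "smooth f \<Longrightarrow> smooth (\<lambda>x. f (a * x + b))"
  by (simp add: smooth_def smooth_upto_affine)

lemma smooth_upto_exp: "smooth_upto k f \<Longrightarrow> smooth_upto k (\<lambda>x. exp (f x))"
proof (induction k arbitrary: f)
  case 0
  then show ?case by (auto intro!: continuous_intros)
next
  case (Suc k)
  then obtain f' where *: "\<forall>x. (f has_real_derivative f' x) (at x)" "smooth_upto k f'" by auto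
  have "((\<lambda>x. exp (f x)) has_real_derivative exp (f x) * f' x) (at x)" for x
    by (rule DERIV_chain2[OF DERIV_exp]) (simp add: *)
  moreover have "smooth_upto k (\<lambda>x. exp (f x) * f' x)"
    by (rule smooth_upto_mult[OF Suc.IH[OF smooth_upto_lower[OF Suc.prems]] *(2)])
  ultimately show ?case unfolding smooth_upto.simps by (intro exI conjI allI)
qed

lemma smooth_exp: "smooth f \<Longrightarrow> smooth (\<lambda>x. exp (f x))"
  by (simp add: smooth_def smooth_upto_exp)

lemma smooth_upto_inverse:
  "smooth_upto k f \<Longrightarrow> (\<And>x. f x \<noteq> 0) \<Longrightarrow> smooth_upto k (\<lambda>x. inverse (f x))"
proof (induction k arbitrary: f)
  case 0
  then show ?case by (auto intro!: continuous_intros)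
next
  case (Suc k)
  then obtain f' where *: "\<forall>x. (f has_real_derivative f' x) (at x)" "smooth_upto k f'" by auto
  have "((\<lambda>x. inverse (f x)) has_real_derivative (- 1) * (inverse (f x) * f' x * inverse (f x))) (at x)" for x
    using DERIV_inverse'[of f "f' x" x UNIV] * Suc.prems(2)[of x] by simp
  moreover have "smooth_upto k (\<lambda>x. (- 1) * (inverse (f x) * f' x * inverse (f x)))"
  proof -
    have inv: "smooth_upto k (\<lambda>x. inverse (f x))"
      by (rule Suc.IH[OF smooth_upto_lower[OF Suc.prems(1)] Suc.prems(2)])
    show ?thesis
      by (rule smooth_upto_mult[OF smooth_upto_const smooth_upto_mult[OF smooth_upto_mult[OF inv *(2)] inv]])
  qed
  ultimately show ?case unfolding smooth_upto.simps by (intro exI conjI allI)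
qed

lemma smooth_inverse: "smooth f \<Longrightarrow> (\<And>x. f x \<noteq> 0) \<Longrightarrow> smooth (\<lambda>x. inverse (f x))"
  by (simp add: smooth_def smooth_upto_inverse)

lemma smooth_ident: "smooth (\<lambda>x. x)"
  by (rule smoothI_deriv[OF DERIV_ident smooth_const])

lemma smooth_power:
  assumes "smooth f"
  shows "smooth (\<lambda>x. f x ^ n)"
proof (induction n)
  case (Suc n)
  show ?case unfolding power_Suc by (rule smooth_mult[OF assms Suc])
qed (simp add: smooth_const)

lemma smooth_sum: "finite I \<Longrightarrow> (\<And>i. i \<in> I \<Longrightarrow> smooth (f i)) \<Longrightarrow> smooth (\<lambda>x. \<Sum>i\<in>I. f i x)"
proof (induction I rule: finite_induct)
  case (insert i I)
  have "smooth (\<lambda>x. f i x + (\<Sum>i\<in>I. f i x))" by (rule smooth_add) (use insert in simp_all)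
  with insert show ?case by simp
qed (simp add: smooth_const)

section \<open>A smooth step function\<close>

definition flat :: "real poly \<Rightarrow> real \<Rightarrow> real" where
  "flat p x = (if 0 < x then poly p (1 / x) * exp (- (1 / x)) else 0)"

lemma poly_exp_tendsto_0: "((\<lambda>y::real. poly p y * exp (- y)) \<longlongrightarrow> 0) at_top"
proof -
  have "((\<lambda>y::real. \<Sum>i\<le>degree p. coeff p i * (y ^ i / exp y)) \<longlongrightarrow> (\<Sum>i\<le>degree p. coeff p i * 0)) at_top"
    by (intro tendsto_sum tendsto_mult tendsto_const tendsto_power_div_exp_0)
  moreover have "(\<lambda>y::real. poly p y * exp (- y)) = (\<lambda>y. \<Sum>i\<le>degree p. coeff p i * (y ^ i / exp y))"
    by (simp add: poly_altdef sum_distrib_right exp_minus divide_inverse mult.assoc)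
  ultimately show ?thesis by simp
qed

lemma isCont_flat_0: "isCont (flat p) 0"
proof -
  have "((\<lambda>x::real. poly p (inverse x) * exp (- (inverse x))) \<longlongrightarrow> 0) (at_right 0)"
    by (rule filterlim_compose[OF poly_exp_tendsto_0 filterlim_inverse_at_top_right])
  then have "(flat p \<longlongrightarrow> 0) (at_right 0)"
  proof (rule Lim_transform_eventually)
    show "\<forall>\<^sub>F x in at_right 0. poly p (inverse x) * exp (- (inverse x)) = flat p x"
      using eventually_at_right_less[of "0::real"]
      by eventually_elim (simp add: flat_def inverse_eq_divide)
  qed
  moreover have "(flat p \<longlongrightarrow> 0) (at_left 0)"
  proof (rule tendsto_eventually)
    have "\<forall>\<^sub>F x in at_left (0::real). x < 0" by (simp add: eventually_at_filter)
    then show "\<forall>\<^sub>F x in at_left 0. flat p x = 0" by eventually_elim (simp add: flat_def)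
  qed
  ultimately have "(flat p \<longlongrightarrow> 0) (at 0)" by (simp add: filterlim_split_at)
  then show ?thesis by (simp add: isCont_def flat_def)
qed

text \<open>In the variable \<open>y = 1 / x\<close> the derivative in \<open>x\<close> is
  \<open>- y^2\<close> times that in \<open>y\<close>, so \<open>p\<close> is replaced by
  \<open>y^2 * (p - p')\<close> and the class is closed under differentiation. At the origin,
  division by \<open>x\<close> raises the degree of \<open>p\<close> by one, and the slope function
  is again of this class.\<close>

lemma flat_deriv: "(flat p has_real_derivative flat ([:0, 0, 1:] * (p - pderiv p)) x) (at x)"
proof -
  consider "x = 0" | "x < 0" | "0 < x" by linarith
  then show ?thesis
  proof cases
    case 1
    have "flat p z - flat p 0 = flat (pCons 0 p) z * (z - 0)" for z
      by (simp add: flat_def)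
    then have "(flat p has_real_derivative flat (pCons 0 p) 0) (at 0)"
      unfolding CARAT_DERIV using isCont_flat_0 by blast
    then show ?thesis using 1 by (simp add: flat_def)
  next
    case 2
    have "\<forall>\<^sub>F z in nhds x. z \<in> {..<0}" by (rule eventually_nhds_in_open) (use 2 in auto)
    then have "\<forall>\<^sub>F z in nhds x. flat p z = 0" by eventually_elim (simp add: flat_def)
    then have "(flat p has_real_derivative 0) (at x)"
      using DERIV_cong_ev[OF refl _ refl, of "flat p" "\<lambda>_. 0" x 0] by simp
    then show ?thesis using 2 by (simp add: flat_def)
  next
    case 3
    have "\<forall>\<^sub>F z in nhds x. z \<in> {0<..}" by (rule eventually_nhds_in_open) (use 3 in auto)
    then have ev: "\<forall>\<^sub>F z in nhds x. flat p z = poly p (1 / z) * exp (- (1 / z))"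
      by eventually_elim (simp add: flat_def)
    have inv: "((\<lambda>z. 1 / z) has_real_derivative - (1 / x\<^sup>2)) (at x)"
      using 3 by (auto intro!: derivative_eq_intros simp: power2_eq_square)
    have "((\<lambda>z. poly p (1 / z) * exp (- (1 / z))) has_real_derivative
        (poly (pderiv p) (1 / x) * (- (1 / x\<^sup>2))) * exp (- (1 / x)) +
        (exp (- (1 / x)) * (- (- (1 / x\<^sup>2)))) * poly p (1 / x)) (at x)"
      by (intro DERIV_mult DERIV_chain2[OF poly_DERIV inv] DERIV_chain2[OF DERIV_exp DERIV_minus[OF inv]])
    moreover have "(poly (pderiv p) (1 / x) * (- (1 / x\<^sup>2))) * exp (- (1 / x)) +
        (exp (- (1 / x)) * (- (- (1 / x\<^sup>2)))) * poly p (1 / x) = flat ([:0, 0, 1:] * (p - pderiv p)) x"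
      using 3 by (simp add: flat_def algebra_simps power2_eq_square)
    ultimately have "((\<lambda>z. poly p (1 / z) * exp (- (1 / z))) has_real_derivative flat ([:0, 0, 1:] * (p - pderiv p)) x) (at x)"
      by simp
    then show ?thesis using DERIV_cong_ev[OF refl ev refl] by blast
  qed
qed

lemma smooth_flat: "smooth (flat p)"
proof -
  have "smooth_upto k (flat p)" for k p
  proof (induction k arbitrary: p)
    case 0
    then show ?case using continuous_on_DERIV[OF flat_deriv] by simp
  next
    case (Suc k)
    then show ?case unfolding smooth_upto.simps
      by (intro exI[of _ "flat ([:0, 0, 1:] * (p - pderiv p))"] conjI allI flat_deriv)
  qed
  then show ?thesis by (simp add: smooth_def)
qed

definition step :: "real \<Rightarrow> real" where
  "step x = flat 1 x * inverse (flat 1 x + flat 1 (1 - x))"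

lemma flat_1: "0 < x \<Longrightarrow> 0 < flat 1 x" "x \<le> 0 \<Longrightarrow> flat 1 x = 0" "0 \<le> flat 1 x"
  by (auto simp: flat_def)

lemma step_denominator: "0 < flat 1 x + flat 1 (1 - x)"
  using flat_1(1)[of x] flat_1(1)[of "1 - x"] flat_1(3)[of x] flat_1(3)[of "1 - x"]
  by (cases "0 < x") (simp_all add: add_pos_nonneg add_nonneg_pos)

lemma flat_reflected: "smooth (\<lambda>x. flat 1 (1 - x))"
  using smooth_affine[OF smooth_flat, of 1 "-1" 1] by simp

lemma smooth_step: "smooth step"
  unfolding step_def[abs_def]
  by (rule smooth_mult[OF smooth_flat smooth_inverse[OF smooth_add[OF smooth_flat flat_reflected]]])
    (rule less_imp_neq[OF step_denominator, symmetric])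

lemma step_0: "x \<le> 0 \<Longrightarrow> step x = 0"
  by (simp add: step_def flat_1)

lemma step_1: "1 \<le> x \<Longrightarrow> step x = 1"
  using flat_1(1)[of x] by (simp add: step_def flat_1(2))

lemma step_bounds: "0 \<le> step x" "step x \<le> 1"
  using step_denominator[of x] flat_1(3)[of x] flat_1(3)[of "1 - x"]
  by (auto simp: step_def divide_simps simp flip: divide_inverse)

lemma flat_1_mono: "x \<le> y \<Longrightarrow> flat 1 x \<le> flat 1 y"
  by (auto simp: flat_def frac_le)

lemma step_mono: "x \<le> y \<Longrightarrow> step x \<le> step y"
proof -
  assume xy: "x \<le> y"
  have m: "flat 1 x * flat 1 (1 - y) \<le> flat 1 y * flat 1 (1 - x)"
    using xy by (intro mult_mono flat_1_mono flat_1(3)) auto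
  have "flat 1 x * (flat 1 y + flat 1 (1 - y)) \<le> flat 1 y * (flat 1 x + flat 1 (1 - x))"
    using m by (simp add: algebra_simps)
  then show ?thesis
    using step_denominator[of x] step_denominator[of y]
    by (simp add: step_def divide_simps flip: divide_inverse)
qed

lemma step_deriv_nonneg: "0 \<le> deriv step x"
proof (rule ccontr)
  assume "\<not> 0 \<le> deriv step x"
  then have "deriv step x < 0" by simp
  from DERIV_neg_dec_right[OF smooth_deriv(1)[OF smooth_step] this]
  obtain d where "0 < d" "\<And>h. 0 < h \<Longrightarrow> h < d \<Longrightarrow> step (x + h) < step x" by auto
  from this(2)[of "d / 2"] this(1) have "step (x + d / 2) < step x" by simp
  with step_mono[of x "x + d / 2"] \<open>0 < d\<close> show False by simp
qed

lemma step_deriv_0: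
  assumes "x < 0 \<or> 1 < x" shows "deriv step x = 0"
proof -
  have "\<forall>\<^sub>F z in nhds x. step z = step x"
  proof (cases "x < 0")
    case True
    have "\<forall>\<^sub>F z in nhds x. z \<in> {..<0}" by (rule eventually_nhds_in_open) (use True in auto)
    then show ?thesis by eventually_elim (use True in \<open>simp add: step_0\<close>)
  next
    case False
    have "\<forall>\<^sub>F z in nhds x. z \<in> {1<..}" by (rule eventually_nhds_in_open) (use False assms in auto)
    then show ?thesis by eventually_elim (use False assms in \<open>simp add: step_1\<close>)
  qed
  then have "(step has_real_derivative 0) (at x)"
    using DERIV_cong_ev[OF refl _ refl, of step "\<lambda>_. step x" x 0] by simp
  then show ?thesis by (rule DERIV_imp_deriv)
qed

lemma step_deriv_bounded:
  obtains C where "0 < C" "\<And>x. \<bar>deriv step x\<bar> \<le> C"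
proof -
  have "compact (deriv step ` {0..1})"
    by (intro compact_continuous_image smooth_continuous smooth_deriv smooth_step) auto
  then obtain B where B: "\<forall>y\<in>deriv step ` {0..1}. norm y \<le> B"
    using compact_imp_bounded bounded_iff by meson
  have "\<bar>deriv step x\<bar> \<le> max 1 B" for x
  proof (cases "x < 0 \<or> 1 < x")
    case False
    then have "\<bar>deriv step x\<bar> \<le> B" using B by auto
    then show ?thesis by simp
  qed (simp add: step_deriv_0)
  then show thesis by (intro that[of "max 1 B"]) auto
qed

section \<open>Test functions of product form\<close>

lemma differentiable_tensor:
  assumes "(\<tau> has_real_derivative \<tau>') (at (fst p))" "(h has_real_derivative h') (at (snd p))"
  shows "(\<lambda>p. \<tau> (fst p) * h (snd p)) differentiable (at p)"
proof -
  have "(\<lambda>p. \<tau> (fst p)) differentiable (at p)" "(\<lambda>p. h (snd p)) differentiable (at p)"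
    using has_derivative_compose[OF has_derivative_fst[OF has_derivative_ident] assms(1)[unfolded has_field_derivative_def]]
      has_derivative_compose[OF has_derivative_snd[OF has_derivative_ident] assms(2)[unfolded has_field_derivative_def]]
    unfolding differentiable_def by blast+
  then show ?thesis by (rule differentiable_mult)
qed

lemma d_tensor:
  assumes "smooth \<tau>" "smooth h"
  shows "d_t (\<lambda>p. \<tau> (fst p) * h (snd p)) = (\<lambda>p. deriv \<tau> (fst p) * h (snd p))"
    and "d_x (\<lambda>p. \<tau> (fst p) * h (snd p)) = (\<lambda>p. \<tau> (fst p) * deriv h (snd p))"
proof -
  have "deriv (\<lambda>s. \<tau> s * h x) t = deriv \<tau> t * h x" for t x
    by (intro DERIV_imp_deriv DERIV_cmult_right smooth_deriv assms)
  then show "d_t (\<lambda>p. \<tau> (fst p) * h (snd p)) = (\<lambda>p. deriv \<tau> (fst p) * h (snd p))"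
    by (auto simp: d_t_def)
  have "deriv (\<lambda>y. \<tau> t * h y) x = \<tau> t * deriv h x" for t x
    by (intro DERIV_imp_deriv DERIV_cmult smooth_deriv assms)
  then show "d_x (\<lambda>p. \<tau> (fst p) * h (snd p)) = (\<lambda>p. \<tau> (fst p) * deriv h (snd p))"
    by (auto simp: d_x_def)
qed

lemma Ck_tensor: "smooth \<tau> \<Longrightarrow> smooth h \<Longrightarrow> Ck k (\<lambda>p. \<tau> (fst p) * h (snd p))"
proof (induction k arbitrary: \<tau> h)
  case 0
  have "continuous_on UNIV \<tau>" "continuous_on UNIV h" using 0 by (auto intro: smooth_continuous)
  then show ?case
    by (auto intro!: continuous_intros continuous_on_compose2[of UNIV \<tau>] continuous_on_compose2[of UNIV h])
next
  case (Suc k)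
  have "(\<lambda>p. \<tau> (fst p) * h (snd p)) differentiable (at p)" for p
    by (rule differentiable_tensor[OF smooth_deriv(1)[OF Suc.prems(1)] smooth_deriv(1)[OF Suc.prems(2)]])
  then show ?case
    using Suc.IH[OF smooth_deriv(2)[OF Suc.prems(1)] Suc.prems(2)]
      Suc.IH[OF Suc.prems(1) smooth_deriv(2)[OF Suc.prems(2)]]
    by (simp add: d_tensor[OF Suc.prems])
qed

lemma test_function_tensor:
  assumes "smooth \<tau>" "smooth h"
    and "\<And>t. t \<notin> {t0..t1} \<Longrightarrow> \<tau> t = 0" "\<And>x. x \<notin> {a..b} \<Longrightarrow> h x = 0" "{a..b} \<subseteq> \<Omega>"
  shows "test_function \<Omega> (\<lambda>p. \<tau> (fst p) * h (snd p))"
  unfolding test_function_def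
proof (intro conjI allI impI exI[of _ "{t0..t1} \<times> {a..b}"])
  show "compact ({t0..t1} \<times> {a..b})" by (intro compact_Times compact_Icc)
  show "{t0..t1} \<times> {a..b} \<subseteq> UNIV \<times> \<Omega>" using assms(5) by auto
  fix p assume "p \<notin> {t0..t1} \<times> {a..b}"
  then have "fst p \<notin> {t0..t1} \<or> snd p \<notin> {a..b}" by (auto simp: mem_Times_iff)
  then show "\<tau> (fst p) * h (snd p) = 0" using assms(3,4) by (elim disjE) simp_all
qed (rule Ck_tensor[OF assms(1,2)])

text \<open>The function \<open>h\<close> is the exponential of a primitive of a function slightly
  above \<open>b x + 1 / (1 + x^2)\<close>. The rate \<open>b\<close> pays for the geometric source;
  the surplus \<open>1 / (1 + x^2)\<close> is positive, hence leaves a weight in front of the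
  coercive term, and integrable, hence keeps \<open>h\<close> bounded independently of
  \<open>R\<close>. Since \<open>b\<close> is merely continuous and test functions are smooth, the
  rate is a polynomial approximation.\<close>

lemma exp_weight:
  fixes b :: "real \<Rightarrow> real"
  assumes b: "continuous_on UNIV b" "\<And>x. 0 \<le> b x" and \<beta>: "integral {-R..R} b \<le> \<beta>" and R: "1 \<le> R"
  obtains h where "smooth h" "\<And>x. x \<in> {-R..R} \<Longrightarrow> 1 \<le> h x"
    "\<And>x. x \<in> {-R..R} \<Longrightarrow> h x \<le> exp (\<beta> + 8)"
    "\<And>x. x \<in> {-R..R} \<Longrightarrow> b x * h x + 1 / (1 + x\<^sup>2) \<le> deriv h x"
    "\<And>x. x \<in> {-R..R} \<Longrightarrow> deriv h x \<le> (b x + 3) * h x"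
proof -
  \<comment> \<open>The shift by \<open>1 / R\<close>, equal to the accuracy of the approximation,
    puts the polynomial above \<open>b x + 1 / (1 + x^2)\<close>. The excess is at most
    \<open>2 / R\<close>, whose integral over the interval is \<open>4\<close>.\<close>
  let ?c = "\<lambda>x. b x + 1 / (1 + x\<^sup>2) + 1 / R"
  have pos: "1 + x\<^sup>2 \<noteq> 0" for x :: real by (metis add_pos_nonneg less_irrefl zero_less_one zero_le_power2)
  have cc: "continuous_on A ?c" for A
    using pos by (intro continuous_intros continuous_on_subset[OF b(1)]) auto
  obtain p where p: "real_polynomial_function p" "\<And>x. x \<in> {-R..R} \<Longrightarrow> \<bar>?c x - p x\<bar> < 1 / R"
    using Stone_Weierstrass_real_polynomial_function[OF compact_Icc cc, of "1 / R" "-R" R] R by auto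
  obtain a n where a: "p = (\<lambda>x. \<Sum>i\<le>n. a i * x ^ i)"
    using p(1) real_polynomial_function_iff_sum by blast
  define P where "P x = (\<Sum>i\<le>n. a i * x ^ (Suc i) / real (Suc i))" for x
  have dP: "(P has_real_derivative p x) (at x)" for x
    unfolding P_def[abs_def] a
  proof (rule DERIV_sum)
    show "((\<lambda>x. a i * x ^ Suc i / real (Suc i)) has_real_derivative a i * x ^ i) (at x)" for i
      using DERIV_cdivide[OF DERIV_cmult[OF DERIV_pow[of "Suc i" x UNIV]], of "a i" "real (Suc i)"]
      by (simp del: of_nat_Suc)
  qed
  have sp: "smooth p" unfolding a
    by (rule smooth_sum[OF finite_atMost smooth_mult[OF smooth_const smooth_power[OF smooth_ident]]])
  define h where "h x = exp (P x + - P (-R))" for x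
  have sP: "smooth P" by (rule smoothI_deriv[OF dP sp])
  have sh: "smooth h" unfolding h_def[abs_def] by (rule smooth_exp[OF smooth_add[OF sP smooth_const]])
  have dh: "deriv h x = p x * h x" for x
  proof (rule DERIV_imp_deriv)
    have "((\<lambda>x. P x + - P (-R)) has_real_derivative p x) (at x)"
      using DERIV_add[OF dP DERIV_const[of "- P (-R)"]] by simp
    from DERIV_chain2[OF DERIV_exp this] show "(h has_real_derivative p x * h x) (at x)"
      by (simp add: h_def[abs_def] mult.commute)
  qed
  have plo: "b x + 1 / (1 + x\<^sup>2) \<le> p x" and phi: "p x \<le> b x + 1 / (1 + x\<^sup>2) + 2 / R" if "x \<in> {-R..R}" for x
    using p(2)[OF that] by (simp_all add: abs_less_iff)
  have inv: "0 \<le> 1 / (1 + x\<^sup>2)" "1 / (1 + x\<^sup>2) \<le> 1" for x :: real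
    by (simp_all add: divide_le_eq add_pos_nonneg)
  have p0: "0 \<le> p x" if "x \<in> {-R..R}" for x using plo[OF that] b(2)[of x] inv[of x] by linarith
  have Pmono: "P x \<le> P y" if "-R \<le> x" "x \<le> y" "y \<le> R" for x y
    by (rule DERIV_nonneg_imp_nondecreasing[OF that(2)]) (use dP p0 that in \<open>meson atLeastAtMost_iff order_trans\<close>)
  have "(p has_integral (P R - P (-R))) {-R..R}"
    using R dP by (intro fundamental_theorem_of_calculus)
      (simp_all add: has_field_derivative_at_within flip: has_real_derivative_iff_has_vector_derivative)
  then have PR: "P R - P (-R) = integral {-R..R} p" by (simp add: integral_unique)
  have arc: "((\<lambda>x. 1 / (1 + x\<^sup>2)) has_integral (arctan R - arctan (-R))) {-R..R}"
  proof (rule fundamental_theorem_of_calculus)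
    fix x :: real
    show "(arctan has_vector_derivative 1 / (1 + x\<^sup>2)) (at x within {-R..R})"
      using DERIV_arctan[of x]
      by (simp add: has_field_derivative_at_within inverse_eq_divide flip: has_real_derivative_iff_has_vector_derivative)
  qed (use R in simp)
  have arcle: "arctan R - arctan (-R) \<le> 4"
    using arctan_bounded[of R] pi_less_4 by (simp add: arctan_minus)
  have ib: "(b has_integral integral {-R..R} b) {-R..R}"
    by (intro integrable_integral integrable_continuous_real continuous_on_subset[OF b(1)]) auto
  have ic: "((\<lambda>_. 2 / R) has_integral 4) {-R..R}"
    using has_integral_const_real[of "2 / R" "-R" R] R by (simp add: content_real)
  have "integral {-R..R} p \<le> integral {-R..R} b + (arctan R - arctan (-R)) + 4"
    by (rule has_integral_le[OF _ has_integral_add[OF has_integral_add[OF ib arc] ic]])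
      (use \<open>(p has_integral (P R - P (-R))) {-R..R}\<close> PR phi in auto)
  \<comment> \<open>The \<open>8\<close> is \<open>4\<close> from the excess of the polynomial and
    \<open>4\<close> as a bound for the increment of the arc tangent, which is less than
    \<open>pi\<close>.\<close>
  then have PRle: "P R - P (-R) \<le> \<beta> + 8" using PR \<beta> arcle by linarith
  show thesis
  proof (rule that[OF sh])
    fix x assume x: "x \<in> {-R..R}"
    have "P (-R) \<le> P x" "P x \<le> P R" using Pmono[of "-R" x] Pmono[of x R] x by auto
    then show h1: "1 \<le> h x" and "h x \<le> exp (\<beta> + 8)" using PRle by (simp_all add: h_def)
    have "(b x + 1 / (1 + x\<^sup>2)) * h x \<le> p x * h x" using plo[OF x] h1 by (intro mult_right_mono) auto
    moreover have "1 / (1 + x\<^sup>2) * 1 \<le> 1 / (1 + x\<^sup>2) * h x" using inv[of x] h1 by (intro mult_left_mono) auto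
    ultimately show "b x * h x + 1 / (1 + x\<^sup>2) \<le> deriv h x" unfolding dh by (simp add: distrib_right)
    have "2 / R \<le> 2" using R by (simp add: divide_le_eq)
    then have "p x \<le> b x + 3" using phi[OF x] inv[of x] by linarith
    then show "deriv h x \<le> (b x + 3) * h x" unfolding dh using h1 by (intro mult_right_mono) auto
  qed
qed

section \<open>The localized entropy inequality\<close>

text \<open>Tonelli for the completed product measure: \<open>F\<close> is replaced by a Borel
  function that agrees with it almost everywhere, and then for almost every \<open>t\<close> the
  slices agree almost everywhere as well.\<close>

lemma nn_integral_lebesgue_prod_le:
  fixes F :: "real \<times> real \<Rightarrow> ennreal"
  assumes F: "F \<in> borel_measurable lebesgue"
    and le: "AE t in lborel. (\<integral>\<^sup>+x. F (t, x) \<partial>lebesgue) \<le> \<phi> t"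
  shows "(\<integral>\<^sup>+p. F p \<partial>lebesgue) \<le> (\<integral>\<^sup>+t. \<phi> t \<partial>lborel)"
proof -
  obtain F' where F': "F' \<in> borel_measurable lborel" "AE p in lborel. F p = F' p"
    using completion_ex_borel_measurable[OF F] by blast
  have Fp: "F' \<in> borel_measurable (lborel \<Otimes>\<^sub>M lborel)" using F'(1) by (simp add: lborel_prod)
  have "AE p in lborel \<Otimes>\<^sub>M lborel. F p = F' p" unfolding lborel_prod by (rule F'(2))
  then have ae: "AE t in lborel. AE x in lborel. F (t, x) = F' (t, x)"
    by (rule lborel_pair.AE_pair)
  have "(\<integral>\<^sup>+p. F p \<partial>lebesgue) = (\<integral>\<^sup>+p. F' p \<partial>lborel)"
    unfolding nn_integral_completion by (rule nn_integral_cong_AE[OF F'(2)])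
  also have "\<dots> = (\<integral>\<^sup>+p. F' p \<partial>(lborel \<Otimes>\<^sub>M lborel))" by (simp add: lborel_prod)
  also have "\<dots> = (\<integral>\<^sup>+t. (\<integral>\<^sup>+x. F' (t, x) \<partial>lborel) \<partial>lborel)"
    by (rule lborel.nn_integral_fst[OF Fp, symmetric])
  also have "\<dots> \<le> (\<integral>\<^sup>+t. \<phi> t \<partial>lborel)"
  proof (rule nn_integral_mono_AE)
    show "AE t in lborel. (\<integral>\<^sup>+x. F' (t, x) \<partial>lborel) \<le> \<phi> t"
      using le ae
    proof eventually_elim
      case (elim t)
      have "(\<integral>\<^sup>+x. F' (t, x) \<partial>lborel) = (\<integral>\<^sup>+x. F (t, x) \<partial>lborel)"
        by (rule nn_integral_cong_AE) (use elim(2) in eventually_elim, simp)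
      then show ?case using elim(1) by (simp add: nn_integral_completion)
    qed
  qed
  finally show ?thesis .
qed

section \<open>Entropies along bounded solutions\<close>

context exponent
begin

text \<open>Since \<^const>\<open>powr\<close> is even in its base, the absolute value makes the formulas for the
  entropies valid for all real \<open>r\<close>.\<close>

definition st :: "(real \<Rightarrow> real \<Rightarrow> real) \<Rightarrow> real \<Rightarrow> real \<Rightarrow> real" where
  "st F r v = \<bar>r\<bar> * F v (r powr theta \<gamma>)"

definition etav :: "(real \<Rightarrow> real) \<Rightarrow> real \<Rightarrow> real \<Rightarrow> real" where
  "etav = avg (wgt \<gamma>)"

lemma continuous_powr_theta: "continuous_on UNIV (\<lambda>r. r powr theta \<gamma>)"
proof -
  have eq: "(\<lambda>r::real. r powr theta \<gamma>) = (\<lambda>r. \<bar>r\<bar> powr theta \<gamma>)"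
    by (auto simp: abs_real_def uminus_powr_eq)
  have "continuous_on UNIV (\<lambda>r::real. \<bar>r\<bar> powr theta \<gamma>)"
    using theta_bounds by (intro continuous_on_powr' continuous_intros) auto
  then show ?thesis unfolding eq .
qed

lemma continuous_st:
  assumes "continuous_on UNIV (\<lambda>p. F (fst p) (snd p))"
  shows "continuous_on UNIV (\<lambda>p. st F (fst p) (snd p))"
proof -
  have "continuous_on UNIV (\<lambda>p :: real \<times> real. (snd p, fst p powr theta \<gamma>))"
    by (intro continuous_intros continuous_on_compose2[OF continuous_powr_theta]) auto
  from continuous_on_compose2[OF assms this]
  have "continuous_on UNIV (\<lambda>p :: real \<times> real. F (snd p) (fst p powr theta \<gamma>))" by simp
  then show ?thesis unfolding st_def by (intro continuous_intros)
qed

lemma measurable_st: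
  assumes "continuous_on UNIV (\<lambda>p. F (fst p) (snd p))" "\<rho> \<in> borel_measurable M" "u \<in> borel_measurable M"
  shows "(\<lambda>p. st F (\<rho> p) (u p)) \<in> borel_measurable M"
proof -
  have "(\<lambda>p. (\<rho> p, u p)) \<in> borel_measurable M" using assms(2,3) by (rule borel_measurable_Pair)
  from measurable_compose[OF this borel_measurable_continuous_onI[OF continuous_st[OF assms(1)]]]
  show ?thesis by simp
qed

text \<open>The factor \<open>\<bar>r\<bar>\<close> is kept in the bound: the area is not integrable
  over unbounded regions in general, whereas density times area is, by conservation of mass.\<close>

lemma st_bounded:
  assumes "continuous_on UNIV (\<lambda>p. F (fst p) (snd p))"
  obtains B where "0 \<le> B" "\<And>r v. \<bar>r\<bar> \<le> M \<Longrightarrow> \<bar>v\<bar> \<le> M \<Longrightarrow> \<bar>st F r v\<bar> \<le> B * \<bar>r\<bar>"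
proof -
  have "compact ((\<lambda>p. F (fst p) (snd p)) ` ({-M..M} \<times> {0..M powr theta \<gamma>}))"
    by (intro compact_continuous_image continuous_on_subset[OF assms] compact_Times compact_Icc subset_UNIV)
  then obtain B where B: "\<forall>y\<in>(\<lambda>p. F (fst p) (snd p)) ` ({-M..M} \<times> {0..M powr theta \<gamma>}). norm y \<le> B"
    using compact_imp_bounded bounded_iff by meson
  have "\<bar>st F r v\<bar> \<le> max 0 B * \<bar>r\<bar>" if rv: "\<bar>r\<bar> \<le> M" "\<bar>v\<bar> \<le> M" for r v
  proof -
    have "r powr theta \<gamma> = \<bar>r\<bar> powr theta \<gamma>" by (auto simp: abs_real_def uminus_powr_eq)
    also have "\<dots> \<le> M powr theta \<gamma>" using rv theta_bounds by (intro powr_mono2) auto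
    finally have "(v, r powr theta \<gamma>) \<in> {-M..M} \<times> {0..M powr theta \<gamma>}" using rv(2) by auto
    then have "\<bar>F v (r powr theta \<gamma>)\<bar> \<le> B" using B by force
    then have "\<bar>F v (r powr theta \<gamma>)\<bar> * \<bar>r\<bar> \<le> max 0 B * \<bar>r\<bar>" by (intro mult_right_mono) auto
    then show ?thesis by (simp add: st_def abs_mult mult.commute)
  qed
  with max.cobounded1 show thesis by (rule that)
qed

text \<open>The two entropies of the argument. Only their values on the range of a bounded solution
  matter, so both are replaced by convex functions of linear growth.\<close>

lemma truncated_entropies:
  assumes "0 \<le> M"
  obtains \<psi>1 \<psi>2 where
    "C2 \<psi>1" "convex_on UNIV \<psi>1" "growth_below 2 \<psi>1" "\<And>s. \<bar>s\<bar> \<le> M \<Longrightarrow> \<psi>1 s = bend 0 s"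
    "C2 \<psi>2" "convex_on UNIV \<psi>2" "growth_below 2 \<psi>2" "\<And>s. \<bar>s\<bar> \<le> M \<Longrightarrow> \<psi>2 s = s\<^sup>2"
proof -
  let ?\<psi>1 = "\<lambda>s. bend 0 s - bend (- M - 1) s + (0 * s + 0)"
  \<comment> \<open>To the left of \<open>M\<close>, \<open>bend M s\<close> is
    \<open>s^2 - (2 * M + 1) * s + (M^2 + M + 1/3)\<close>; the affine term removes everything but
    the square, and the second \<open>bend\<close> vanishes on the range.\<close>
  let ?\<psi>2 = "\<lambda>s. bend M s - bend (- M - 1) s + ((2 * M + 1) * s + - (M\<^sup>2 + M + 1/3))"
  have 1: "?\<psi>1 s = bend 0 s" if "\<bar>s\<bar> \<le> M" for s
    using that by (simp add: bend_right)
  have 2: "?\<psi>2 s = s\<^sup>2" if "\<bar>s\<bar> \<le> M" for s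
  proof -
    have "bend M s = (M - s)\<^sup>2 + (M - s) + 1/3" using that by (intro bend_left) simp
    moreover have "bend (- M - 1) s = 0" using that by (intro bend_right) simp
    ultimately show ?thesis by (simp add: power2_eq_square algebra_simps)
  qed
  have M: "- M \<le> 0" "- M \<le> M" using assms by auto
  show thesis
    by (rule that[OF bend_diff_admissible[OF M(1), of 0 0] 1 bend_diff_admissible[OF M(2), of "2 * M + 1" "- (M\<^sup>2 + M + 1/3)"] 2])
qed

text \<open>All averages at \<open>(v, c)\<close> see the weight only between \<open>v - c\<close>
  and \<open>v + c\<close>. Applied with both weights equal, it turns the entropy functions of any
  weight into the form \<open>st\<close>.\<close>

lemma entropy_functions_local:
  assumes C2: "C2 \<psi>" and cont: "continuous_on UNIV \<psi>0" and eq: "\<And>s. \<bar>s\<bar> \<le> M \<Longrightarrow> \<psi> s = \<psi>0 s"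
    and rv: "\<bar>v\<bar> + r powr theta \<gamma> \<le> M"
  shows "eta \<gamma> \<psi> r v = st (etav \<psi>0) r v"
    and "q \<gamma> \<psi> r v = st (qv \<psi>0) r v"
    and "ru_eta_r \<gamma> \<psi> r v - q \<gamma> \<psi> r v = st (gv \<psi>0) r v"
proof -
  have c: "continuous_on UNIV \<psi>" by (rule continuous_on_subset[OF _ subset_UNIV])
     (use C2_deriv(1)[OF C2] DERIV_isCont continuous_at_imp_continuous_on in blast)
  let ?c = "r powr theta \<gamma>"
  have a: "avg \<kappa> \<psi> v ?c = avg \<kappa> \<psi>0 v ?c" for \<kappa>
  proof (rule avg_cong)
    fix y :: real assume "y \<in> {-1..1}"
    from range_bound[OF this, of v ?c] rv show "\<psi> (v + ?c * y) = \<psi>0 (v + ?c * y)"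
      by (intro eq) simp
  qed
  show "eta \<gamma> \<psi> r v = st (etav \<psi>0) r v" by (simp add: eta_avg[OF c] a st_def etav_def)
  show q: "q \<gamma> \<psi> r v = st (qv \<psi>0) r v" by (simp add: q_avg[OF c refl] a st_def qv_def)
  show "ru_eta_r \<gamma> \<psi> r v - q \<gamma> \<psi> r v = st (gv \<psi>0) r v"
    by (simp add: q ru_avg[OF C2_deriv[OF C2] refl] a st_def gv_def right_diff_distrib)
qed

text \<open>Both entropies are nonnegative, which fixes the sign of the term with the time
  derivative of the test function, and at most quadratic, so that mass and energy bound their
  initial values.\<close>

lemma etav_bounds:
  assumes "0 \<le> c"
  shows "0 \<le> etav (bend 0) v c" "0 \<le> etav (\<lambda>s. s\<^sup>2) v c"
    "etav (bend 0) v c \<le> 8 * (1 + v\<^sup>2 + c\<^sup>2)" "etav (\<lambda>s. s\<^sup>2) v c \<le> 8 * (1 + v\<^sup>2 + c\<^sup>2)"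
proof -
  have c2: "continuous_on UNIV (\<lambda>s::real. s\<^sup>2)" by (intro continuous_intros)
  show "0 \<le> etav (bend 0) v c" "0 \<le> etav (\<lambda>s. s\<^sup>2) v c"
    unfolding etav_def avg_def
    by (rule integral_nonneg[OF avg_integrable[OF continuous_wgt continuous_bend(1)]],
        simp add: wgt_nonneg bend_nonneg,
        rule integral_nonneg[OF avg_integrable[OF continuous_wgt c2]],
        simp add: wgt_nonneg)
  define m where "m = \<bar>v\<bar> + \<bar>c\<bar>"
  have m2: "m\<^sup>2 \<le> 2 * (v\<^sup>2 + c\<^sup>2)"
  proof -
    have "0 \<le> (\<bar>v\<bar> - \<bar>c\<bar>)\<^sup>2" by simp
    then show ?thesis by (simp add: m_def power2_eq_square algebra_simps)
  qed
  have mm: "m \<le> (m\<^sup>2 + 1) / 2"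
  proof -
    have "0 \<le> (m - 1)\<^sup>2" by simp
    then show ?thesis by (simp add: power2_eq_square algebra_simps)
  qed
  have s2: "s\<^sup>2 \<le> m\<^sup>2" if "\<bar>s\<bar> \<le> m" for s
    using power_mono[OF that, of 2] by simp
  have b: "bend 0 s \<le> m\<^sup>2 + m + 1" if "\<bar>s\<bar> \<le> m" for s
    using bend_0_abs_le[of s] s2[OF that] that by linarith
  have "\<bar>etav (bend 0) v c\<bar> \<le> 2 * 1 * (m\<^sup>2 + m + 1)"
    unfolding etav_def
  proof (rule avg_abs_le[OF continuous_wgt continuous_bend(1) wgt_abs_le])
    fix y :: real assume "y \<in> {-1..1}"
    then show "\<bar>bend 0 (v + c * y)\<bar> \<le> m\<^sup>2 + m + 1"
      using b[of "v + c * y"] range_bound[of y v c] by (simp add: m_def bend_nonneg)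
  qed
  then show "etav (bend 0) v c \<le> 8 * (1 + v\<^sup>2 + c\<^sup>2)" using m2 mm by simp
  have "\<bar>etav (\<lambda>s. s\<^sup>2) v c\<bar> \<le> 2 * 1 * m\<^sup>2"
    unfolding etav_def
  proof (rule avg_abs_le[OF continuous_wgt c2 wgt_abs_le])
    fix y :: real assume "y \<in> {-1..1}"
    then show "\<bar>(v + c * y)\<^sup>2\<bar> \<le> m\<^sup>2"
      using s2[of "v + c * y"] range_bound[of y v c] by (simp add: m_def)
  qed
  then show "etav (\<lambda>s. s\<^sup>2) v c \<le> 8 * (1 + v\<^sup>2 + c\<^sup>2)" using m2 by simp
qed

lemma continuous_etav: "continuous_on UNIV \<psi> \<Longrightarrow> continuous_on UNIV (\<lambda>p. etav \<psi> (fst p) (snd p))"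
  unfolding etav_def by (rule continuous_avg[OF continuous_wgt])

lemma continuous_gv:
  assumes "continuous_on UNIV \<psi>"
  shows "continuous_on UNIV (\<lambda>p. gv \<psi> (fst p) (snd p))"
  unfolding gv_def
  by (intro continuous_intros continuous_avg[OF continuous_wgtr assms] continuous_qv[OF assms])

end

text \<open>The factor \<open>\<beta>\<close> is continuous on \<open>S\<close> only and may be
  unbounded near a missing boundary; a compact support inside \<open>S\<close> keeps away from
  it.\<close>

lemma integrable_times_compact_support:
  fixes G \<beta> :: "real \<times> real \<Rightarrow> real"
  assumes S: "S \<in> sets lebesgue" and G: "G \<in> borel_measurable (lebesgue_on S)" "AE p in lebesgue_on S. \<bar>G p\<bar> \<le> C"
    and K: "compact K" "K \<subseteq> S" and \<beta>: "continuous_on S \<beta>" "\<And>p. p \<in> S \<Longrightarrow> p \<notin> K \<Longrightarrow> \<beta> p = 0"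
  shows "integrable (lebesgue_on S) (\<lambda>p. G p * \<beta> p)"
proof -
  have "compact (\<beta> ` K)" by (rule compact_continuous_image[OF continuous_on_subset[OF \<beta>(1) K(2)] K(1)])
  then obtain B where B: "\<forall>y\<in>\<beta> ` K. norm y \<le> B"
    using compact_imp_bounded bounded_iff by meson
  have bm: "\<beta> \<in> borel_measurable (lebesgue_on S)"
    by (rule continuous_imp_measurable_on_sets_lebesgue[OF \<beta>(1) S])
  have Kl: "K \<in> sets lebesgue" using K(1) by (simp add: compact_imp_closed)
  have "integrable (lebesgue_on S) (\<lambda>p. indicator K p * (\<bar>C\<bar> * max 0 B) :: real)"
  proof -
    have "integrable lebesgue (\<lambda>p. indicator K p *\<^sub>R (\<bar>C\<bar> * max 0 B))"
      using lmeasurable_compact[OF K(1)] by (intro integrable_scaleR_left) (auto simp: fmeasurable_def)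
    moreover have "(\<lambda>p. indicator K p *\<^sub>R (\<bar>C\<bar> * max 0 B)) = (\<lambda>p. indicator S p *\<^sub>R (indicator K p * (\<bar>C\<bar> * max 0 B)))"
      using K(2) by (auto simp: indicator_def fun_eq_iff)
    ultimately have "integrable lebesgue (\<lambda>p. indicator S p *\<^sub>R (indicator K p * (\<bar>C\<bar> * max 0 B)))"
      by (simp only:)
    moreover have "S \<inter> space lebesgue \<in> sets lebesgue" using S by simp
    ultimately show ?thesis by (simp only: integrable_restrict_space)
  qed
  then show ?thesis
  proof (rule Bochner_Integration.integrable_bound)
    show "(\<lambda>p. G p * \<beta> p) \<in> borel_measurable (lebesgue_on S)" using G(1) bm by (rule borel_measurable_times)
    have "AE p in lebesgue_on S. p \<in> S" by (rule AE_I2) simp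
    with G(2) show "AE p in lebesgue_on S. norm (G p * \<beta> p) \<le> norm (indicator K p * (\<bar>C\<bar> * max 0 B) :: real)"
    proof eventually_elim
      case (elim p)
      show ?case
      proof (cases "p \<in> K")
        case True
        then have "\<bar>\<beta> p\<bar> \<le> max 0 B" using B by (simp add: le_max_iff_disj)
        moreover have "\<bar>G p\<bar> \<le> \<bar>C\<bar>" using elim(1) by simp
        ultimately have "\<bar>G p\<bar> * \<bar>\<beta> p\<bar> \<le> \<bar>C\<bar> * max 0 B" by (intro mult_mono) auto
        then show ?thesis using True by (simp add: abs_mult)
      next
        case False
        then show ?thesis using \<beta>(2)[OF elim(2)] by simp
      qed
    qed
  qed
qed

text \<open>The term with \<open>\<tau>'\<close> has a sign; the flux terms with \<open>h'\<close>
  combine to \<open>2 * Q1 - Q2\<close>, bounded through coercivity; the source is harmless where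
  \<open>B'\<close> is nonnegative and is otherwise at most \<open>128 * n * h * (1 + W)\<close>,
  where \<open>128\<close> is twice the \<open>64\<close> in the bound of \<open>G\<close>. The
  function \<open>\<delta>\<close> is what the source leaves of the coercive term,
  \<open>\<kappa>\<close> collects the lower order, and the terms with the derivative of the cutoff
  \<open>g\<close> are kept as errors.\<close>

lemma energy_pointwise:
  fixes r :: real
  assumes nonneg: "0 \<le> r" "0 \<le> \<tau>" "\<tau>' \<le> 0" "0 \<le> B" "0 \<le> g" "0 \<le> h" "0 \<le> k" "0 \<le> h'" "0 \<le> E1" "0 \<le> E2" "0 \<le> W"
    and n: "0 \<le> n" "- B' \<le> n" and G: "0 \<le> G" "G \<le> 64 * (1 + W)"
    and Q: "c0 * W - C1 \<le> Q2 - 2 * Q1"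
    and \<delta>: "\<delta> * B \<le> c0 * h' * B - 128 * n * h" and \<kappa>: "C1 * h' * B + 128 * n * h \<le> \<kappa> * B"
  shows "2 * (r * E1 * (B * (\<tau>' * (h * g))) + r * Q1 * (B * (\<tau> * (h' * g + g' * h))) - r * G * (B' * (\<tau> * (h * g))))
      + (r * E2 * (B * (\<tau>' * (k * g))) + r * Q2 * (B * (\<tau> * (- h' * g + g' * k))))
    \<le> - (r * W * (\<delta> * g * \<tau> * B)) + \<kappa> * (r * (g * \<tau> * B)) + r * \<bar>2 * Q1\<bar> * (h * \<bar>g'\<bar> * \<tau> * B) + r * \<bar>Q2\<bar> * (k * \<bar>g'\<bar> * \<tau> * B)"
proof -
  define a where "a = r * \<tau> * g"
  have a: "0 \<le> a" using nonneg by (simp add: a_def)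
  have t1: "(r * B * g * (2 * E1 * h + E2 * k)) * \<tau>' \<le> 0"
    using nonneg by (intro mult_nonneg_nonpos mult_nonneg_nonneg add_nonneg_nonneg) auto
  have "(h' * B) * (2 * Q1 - Q2) \<le> (h' * B) * (C1 - c0 * W)"
    using nonneg Q by (intro mult_left_mono) auto
  moreover have "(2 * G * h) * (- B') \<le> (2 * G * h) * n"
    using nonneg G n by (intro mult_left_mono) auto
  moreover have "G * (2 * h * n) \<le> (64 * (1 + W)) * (2 * h * n)"
    using nonneg G n by (intro mult_right_mono) auto
  moreover have "W * (\<delta> * B) \<le> W * (c0 * h' * B - 128 * n * h)"
    using nonneg \<delta> by (intro mult_left_mono) auto
  ultimately have "(h' * B) * (2 * Q1 - Q2) + (2 * G * h) * (- B') \<le> - (W * (\<delta> * B)) + \<kappa> * B"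
    using \<kappa> by (simp add: algebra_simps)
  then have t2: "a * ((h' * B) * (2 * Q1 - Q2) + (2 * G * h) * (- B')) \<le> a * (- (W * (\<delta> * B)) + \<kappa> * B)"
    by (rule mult_left_mono[OF _ a])
  have t3: "(r * \<tau> * B) * ((2 * Q1) * h * g' + Q2 * k * g') \<le> (r * \<tau> * B) * (\<bar>2 * Q1\<bar> * h * \<bar>g'\<bar> + \<bar>Q2\<bar> * k * \<bar>g'\<bar>)"
  proof (rule mult_left_mono)
    have "(2 * Q1) * h * g' \<le> \<bar>(2 * Q1) * h * g'\<bar>" "Q2 * k * g' \<le> \<bar>Q2 * k * g'\<bar>" by (rule abs_ge_self)+
    then show "(2 * Q1) * h * g' + Q2 * k * g' \<le> \<bar>2 * Q1\<bar> * h * \<bar>g'\<bar> + \<bar>Q2\<bar> * k * \<bar>g'\<bar>"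
      using nonneg by (simp add: abs_mult)
  qed (use nonneg in simp)
  have "2 * (r * E1 * (B * (\<tau>' * (h * g))) + r * Q1 * (B * (\<tau> * (h' * g + g' * h))) - r * G * (B' * (\<tau> * (h * g))))
      + (r * E2 * (B * (\<tau>' * (k * g))) + r * Q2 * (B * (\<tau> * (- h' * g + g' * k)))) =
    (r * B * g * (2 * E1 * h + E2 * k)) * \<tau>' + a * ((h' * B) * (2 * Q1 - Q2) + (2 * G * h) * (- B'))
      + (r * \<tau> * B) * ((2 * Q1) * h * g' + Q2 * k * g')"
    by (simp add: a_def algebra_simps)
  also have "\<dots> \<le> 0 + a * (- (W * (\<delta> * B)) + \<kappa> * B) + (r * \<tau> * B) * (\<bar>2 * Q1\<bar> * h * \<bar>g'\<bar> + \<bar>Q2\<bar> * k * \<bar>g'\<bar>)"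
    by (intro add_mono t1 t2 t3)
  also have "\<dots> = - (r * W * (\<delta> * g * \<tau> * B)) + \<kappa> * (r * (g * \<tau> * B)) + r * \<bar>2 * Q1\<bar> * (h * \<bar>g'\<bar> * \<tau> * B) + r * \<bar>Q2\<bar> * (k * \<bar>g'\<bar> * \<tau> * B)"
    by (simp add: a_def algebra_simps)
  finally show ?thesis .
qed

lemma deriv_zero_outside:
  fixes g :: "real \<Rightarrow> real"
  assumes "\<And>x. x \<notin> {a..b} \<Longrightarrow> g x = 0" "x \<notin> {a..b}"
  shows "deriv g x = 0"
proof -
  have "open (- {a..b})" by (simp add: open_Compl)
  then have "\<forall>\<^sub>F y in nhds x. y \<in> - {a..b}" by (rule eventually_nhds_in_open) (use assms(2) in simp)
  then have "\<forall>\<^sub>F y in nhds x. g y = 0" by eventually_elim (use assms(1) in simp)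
  then have "(g has_real_derivative 0) (at x)"
    using DERIV_cong_ev[OF refl _ refl, of g "\<lambda>_. 0" x 0] by simp
  then show ?thesis by (rule DERIV_imp_deriv)
qed

lemma deriv_mult_smooth:
  "smooth f \<Longrightarrow> smooth g \<Longrightarrow> deriv (\<lambda>x. f x * g x) x = deriv f x * g x + deriv g x * f x"
  by (rule DERIV_imp_deriv[OF DERIV_mult[OF smooth_deriv(1) smooth_deriv(1)]])

section \<open>The two entropy inequalities combined\<close>

context exponent
begin

definition cubic :: "real \<Rightarrow> real \<Rightarrow> real" where
  "cubic v c = \<bar>v\<bar> ^ 3 + \<bar>c\<bar> ^ 3"

lemma continuous_cubic: "continuous_on UNIV (\<lambda>p. cubic (fst p) (snd p))"
  unfolding cubic_def by (intro continuous_intros)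

text \<open>The sum of the inequality for \<open>2 * bend 0\<close> tested with \<open>\<tau> h g\<close> and of that for the square tested
  with \<open>\<tau> k g\<close>: as \<open>k' = - h'\<close>, the fluxes combine to the coercive \<open>- h' (q\<^sub>s\<^sub>q - 2 q\<^sub>b)\<close>. The geometric source of
  the first has a sign where \<open>A' \<ge> 0\<close>, and is bounded by the cubic weight elsewhere;
  that of the second is zero.\<close>

lemma energy_inequality:
  fixes B :: "real \<Rightarrow> real"
  defines "S \<equiv> \<lambda>\<Omega>. {0::real..} \<times> \<Omega>"
  assumes \<Omega>: "S \<Omega> \<in> sets lebesgue"
    and B: "continuous_on \<Omega> B" "continuous_on \<Omega> (deriv B)" "\<And>x. x \<in> \<Omega> \<Longrightarrow> 0 < B x"
    and meas: "\<rho> \<in> borel_measurable (lebesgue_on (S \<Omega>))" "u \<in> borel_measurable (lebesgue_on (S \<Omega>))"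
    and M0: "0 \<le> M0" "AE p in lebesgue_on (S \<Omega>). \<bar>\<rho> p\<bar> \<le> M0 \<and> \<bar>u p\<bar> \<le> M0"
    and \<Omega>s: "\<Omega> \<in> sets lebesgue"
    and measi: "\<rho>i \<in> borel_measurable (lebesgue_on \<Omega>)" "ui \<in> borel_measurable (lebesgue_on \<Omega>)"
    and init: "AE x in lebesgue_on \<Omega>. \<bar>\<rho>i x\<bar> \<le> M0 \<and> \<bar>ui x\<bar> \<le> M0"
    and sol: "entropy_solution \<gamma> \<Omega> B \<rho>i ui \<rho> u"
    and \<tau>: "smooth \<tau>" "\<And>t. 0 \<le> \<tau> t" "\<And>t. 0 \<le> t \<Longrightarrow> deriv \<tau> t \<le> 0" "\<And>t. t \<notin> {-T..T} \<Longrightarrow> \<tau> t = 0"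
    and g: "smooth g" "\<And>x. 0 \<le> g x" "\<And>x. x \<notin> {x0..x1} \<Longrightarrow> g x = 0" "{x0..x1} \<subseteq> \<Omega>"
    and h: "smooth h" "\<And>x. x \<in> {x0..x1} \<Longrightarrow> 0 \<le> h x" "\<And>x. x \<in> {x0..x1} \<Longrightarrow> 0 \<le> deriv h x"
    and k: "smooth k" "\<And>x. x \<in> {x0..x1} \<Longrightarrow> 0 \<le> k x" "\<And>x. deriv k x = - deriv h x"
    and c0: "\<And>v c. 0 \<le> c \<Longrightarrow> c0 * (\<bar>v\<bar> ^ 3 + c ^ 3) - C1 \<le> qv (\<lambda>s. s\<^sup>2) v c - 2 * qv (bend 0) v c"
    and \<delta>: "continuous_on \<Omega> \<delta>"
      "\<And>x. x \<in> {x0..x1} \<Longrightarrow> \<delta> x * B x \<le> c0 * deriv h x * B x - 128 * neg_part (deriv B x) * h x"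
    and \<kappa>: "\<And>x. x \<in> {x0..x1} \<Longrightarrow> C1 * deriv h x * B x + 128 * neg_part (deriv B x) * h x \<le> \<kappa> * B x"
  shows "(\<integral>p. st cubic (\<rho> p) (u p) * (\<delta> (snd p) * g (snd p) * \<tau> (fst p) * B (snd p)) \<partial>lebesgue_on (S \<Omega>))
    \<le> \<kappa> * (\<integral>p. st (\<lambda>v c. 1) (\<rho> p) (u p) * (g (snd p) * \<tau> (fst p) * B (snd p)) \<partial>lebesgue_on (S \<Omega>))
      + (\<integral>p. st (\<lambda>v c. \<bar>2 * qv (bend 0) v c\<bar>) (\<rho> p) (u p) * (h (snd p) * \<bar>deriv g (snd p)\<bar> * \<tau> (fst p) * B (snd p)) \<partial>lebesgue_on (S \<Omega>))
      + (\<integral>p. st (\<lambda>v c. \<bar>qv (\<lambda>s. s\<^sup>2) v c\<bar>) (\<rho> p) (u p) * (k (snd p) * \<bar>deriv g (snd p)\<bar> * \<tau> (fst p) * B (snd p)) \<partial>lebesgue_on (S \<Omega>))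
      + (2 * (\<integral>x. st (etav (bend 0)) (\<rho>i x) (ui x) * (B x * (\<tau> 0 * (h x * g x))) \<partial>lebesgue_on \<Omega>)
         + (\<integral>x. st (etav (\<lambda>s. s\<^sup>2)) (\<rho>i x) (ui x) * (B x * (\<tau> 0 * (k x * g x))) \<partial>lebesgue_on \<Omega>))"
    (is "?LHS \<le> \<kappa> * ?R1 + ?R2 + ?R3 + (2 * ?J1 + ?J2)")
    and "integrable (lebesgue_on (S \<Omega>)) (\<lambda>p. st cubic (\<rho> p) (u p) * (\<delta> (snd p) * g (snd p) * \<tau> (fst p) * B (snd p)))"
proof -
  \<comment> \<open>Both Riemann invariants of the solution and of its initial data lie between
    \<open>- M\<close> and \<open>M\<close>.\<close>
  define M where "M = M0 + M0 powr theta \<gamma>"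
  have M: "0 \<le> M" using M0 by (simp add: M_def)
  have range: "\<bar>v\<bar> + r powr theta \<gamma> \<le> M" if "\<bar>r\<bar> \<le> M0" "\<bar>v\<bar> \<le> M0" for r v
  proof -
    have "r powr theta \<gamma> = \<bar>r\<bar> powr theta \<gamma>" by (auto simp: abs_real_def uminus_powr_eq)
    also have "\<dots> \<le> M0 powr theta \<gamma>" using that theta_bounds by (intro powr_mono2) auto
    finally show ?thesis using that(2) by (simp add: M_def)
  qed
  obtain \<psi>1 \<psi>2 where \<psi>1: "C2 \<psi>1" "convex_on UNIV \<psi>1" "growth_below 2 \<psi>1" "\<And>s. \<bar>s\<bar> \<le> M \<Longrightarrow> \<psi>1 s = bend 0 s"
    and \<psi>2: "C2 \<psi>2" "convex_on UNIV \<psi>2" "growth_below 2 \<psi>2" "\<And>s. \<bar>s\<bar> \<le> M \<Longrightarrow> \<psi>2 s = s\<^sup>2"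
    by (rule truncated_entropies[OF M], rule that)
  have sq: "continuous_on UNIV (\<lambda>s::real. s\<^sup>2)" by (intro continuous_intros)
  have c\<psi>: "continuous_on UNIV \<psi>" if "C2 \<psi>" for \<psi>
    using C2_deriv(1)[OF that] DERIV_isCont continuous_at_imp_continuous_on by blast
  have loc1: "eta \<gamma> \<psi>1 r v = st (etav (bend 0)) r v" "q \<gamma> \<psi>1 r v = st (qv (bend 0)) r v"
      "ru_eta_r \<gamma> \<psi>1 r v - q \<gamma> \<psi>1 r v = st (gv (bend 0)) r v" if "\<bar>v\<bar> + r powr theta \<gamma> \<le> M" for r v
    by (rule entropy_functions_local[OF \<psi>1(1) continuous_bend(1) \<psi>1(4) that]; assumption)+
  have loc2: "eta \<gamma> \<psi>2 r v = st (etav (\<lambda>s. s\<^sup>2)) r v" "q \<gamma> \<psi>2 r v = st (qv (\<lambda>s. s\<^sup>2)) r v"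
      "ru_eta_r \<gamma> \<psi>2 r v - q \<gamma> \<psi>2 r v = st (gv (\<lambda>s. s\<^sup>2)) r v" if "\<bar>v\<bar> + r powr theta \<gamma> \<le> M" for r v
    by (rule entropy_functions_local[OF \<psi>2(1) sq \<psi>2(4) that]; assumption)+
  \<comment> \<open>The formulas are applied to a weight in place of its own local replacement, so
    the agreement required on the range is trivial.\<close>
  have glob: "eta \<gamma> \<psi> r v = st (etav \<psi>) r v" "q \<gamma> \<psi> r v = st (qv \<psi>) r v"
      "ru_eta_r \<gamma> \<psi> r v - q \<gamma> \<psi> r v = st (gv \<psi>) r v" if "C2 \<psi>" for \<psi> r v
    using entropy_functions_local[OF that c\<psi>[OF that] refl order_refl] by simp_all
  have ru: "ru_eta_r \<gamma> \<psi> r v = st (gv \<psi>) r v + st (qv \<psi>) r v" if "C2 \<psi>" for \<psi> r v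
    using glob(3)[OF that, of r v] glob(2)[OF that, of r v] by simp
  let ?S = "S \<Omega>" and ?K = "{0..T} \<times> {x0..x1}"
  have K: "compact ?K" "?K \<subseteq> ?S" using g(4) by (auto simp: S_def intro: compact_Times)
  have int: "integrable (lebesgue_on ?S) (\<lambda>p. st F (\<rho> p) (u p) * \<beta> p)"
    if F: "continuous_on UNIV (\<lambda>p. F (fst p) (snd p))" and \<beta>: "continuous_on ?S \<beta>"
      "\<And>p. p \<in> ?S \<Longrightarrow> p \<notin> ?K \<Longrightarrow> \<beta> p = 0" for F \<beta>
  proof -
    obtain C where C: "0 \<le> C" "\<And>r v. \<bar>r\<bar> \<le> M0 \<Longrightarrow> \<bar>v\<bar> \<le> M0 \<Longrightarrow> \<bar>st F r v\<bar> \<le> C * \<bar>r\<bar>"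
      by (rule st_bounded[OF F], rule that)
    have "AE p in lebesgue_on ?S. \<bar>st F (\<rho> p) (u p)\<bar> \<le> C * M0"
      using M0(2)
    proof eventually_elim
      case (elim p)
      then have "\<bar>st F (\<rho> p) (u p)\<bar> \<le> C * \<bar>\<rho> p\<bar>" using C(2) by blast
      also have "\<dots> \<le> C * M0" using elim C(1) by (intro mult_left_mono) auto
      finally show ?case .
    qed
    from integrable_times_compact_support[OF \<Omega> measurable_st[OF F meas] this K \<beta>] show ?thesis .
  qed
  have out: "fst p \<notin> {-T..T} \<or> snd p \<notin> {x0..x1}" if "p \<in> ?S" "p \<notin> ?K" for p
    using that by (auto simp: S_def mem_Times_iff)
  have cont: "continuous_on ?S (\<lambda>p. f (fst p))" if "continuous_on {0..} f" for f :: "real \<Rightarrow> real"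
    by (rule continuous_on_compose2[OF that]) (auto intro!: continuous_intros simp: S_def)
  have cont\<Omega>: "continuous_on ?S (\<lambda>p. f (snd p))" if "continuous_on \<Omega> f" for f :: "real \<Rightarrow> real"
    by (rule continuous_on_compose2[OF that]) (auto intro!: continuous_intros simp: S_def)
  note conts = cont[OF smooth_continuous[OF \<tau>(1)]] cont[OF smooth_continuous[OF smooth_deriv(2)[OF \<tau>(1)]]]
    cont\<Omega>[OF smooth_continuous[OF g(1)]] cont\<Omega>[OF smooth_continuous[OF smooth_deriv(2)[OF g(1)]]]
    cont\<Omega>[OF smooth_continuous[OF h(1)]] cont\<Omega>[OF smooth_continuous[OF smooth_deriv(2)[OF h(1)]]]
    cont\<Omega>[OF smooth_continuous[OF k(1)]] cont\<Omega>[OF smooth_continuous[OF smooth_deriv(2)[OF k(1)]]]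
    cont\<Omega>[OF B(1)] cont\<Omega>[OF B(2)] cont\<Omega>[OF \<delta>(1)]
  have \<tau>0: "\<tau> t = 0" "deriv \<tau> t = 0" if "t \<notin> {-T..T}" for t
    using \<tau>(4)[OF that] deriv_zero_outside[OF \<tau>(4) that] by simp_all
  have g0: "g x = 0" "deriv g x = 0" if "x \<notin> {x0..x1}" for x
    using g(3)[OF that] deriv_zero_outside[OF g(3) that] by simp_all
  have van: "a1 * (\<tau> (fst p) * a2) = 0 \<and> a1 * (deriv \<tau> (fst p) * a2) = 0 \<or>
     (g (snd p) = 0 \<and> deriv g (snd p) = 0)" if "p \<in> ?S" "p \<notin> ?K" for p a1 a2
    using out[OF that] \<tau>0[of "fst p"] g0[of "snd p"] by auto
  let ?X = "\<lambda>\<psi> w p. st (etav \<psi>) (\<rho> p) (u p) * (B (snd p) * (deriv \<tau> (fst p) * (w (snd p) * g (snd p))))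
        + st (qv \<psi>) (\<rho> p) (u p) * (B (snd p) * (\<tau> (fst p) * (deriv w (snd p) * g (snd p) + deriv g (snd p) * w (snd p))))
        - st (gv \<psi>) (\<rho> p) (u p) * (deriv B (snd p) * (\<tau> (fst p) * (w (snd p) * g (snd p))))"
  have ent: "0 \<le> (\<integral>p. ?X \<psi> w p \<partial>lebesgue_on ?S)
      + (\<integral>x. st (etav \<psi>) (\<rho>i x) (ui x) * (B x * (\<tau> 0 * (w x * g x))) \<partial>lebesgue_on \<Omega>)"
    and inte: "integrable (lebesgue_on ?S) (?X \<psi> w)"
    if \<psi>: "C2 \<psi>" "convex_on UNIV \<psi>" "growth_below 2 \<psi>" and w: "smooth w" "\<And>x. x \<in> {x0..x1} \<Longrightarrow> 0 \<le> w x" for \<psi> w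
  proof -
    have swg: "smooth (\<lambda>x. w x * g x)" by (rule smooth_mult[OF w(1) g(1)])
    have test: "test_function \<Omega> (\<lambda>p. \<tau> (fst p) * (w (snd p) * g (snd p)))"
      using test_function_tensor[OF \<tau>(1) swg \<tau>(4) _ g(4)] g(3) by simp
    have nn: "0 \<le> \<tau> (fst p) * (w (snd p) * g (snd p))" for p
    proof (cases "snd p \<in> {x0..x1}")
      case True
      then show ?thesis using w(2) g(2) \<tau>(2) by (intro mult_nonneg_nonneg)
    qed (simp add: g(3))
    have "0 \<le> (\<integral>p. eta \<gamma> \<psi> (\<rho> p) (u p) * B (snd p) * d_t (\<lambda>p. \<tau> (fst p) * (w (snd p) * g (snd p))) p
                + q \<gamma> \<psi> (\<rho> p) (u p) * B (snd p) * d_x (\<lambda>p. \<tau> (fst p) * (w (snd p) * g (snd p))) p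
                - (ru_eta_r \<gamma> \<psi> (\<rho> p) (u p) - q \<gamma> \<psi> (\<rho> p) (u p)) * deriv B (snd p) * (\<tau> (fst p) * (w (snd p) * g (snd p)))
              \<partial>lebesgue_on ({0..} \<times> \<Omega>))
            + (\<integral>x. eta \<gamma> \<psi> (\<rho>i x) (ui x) * B x * (\<tau> (fst (0::real, x)) * (w (snd (0::real, x)) * g (snd (0::real, x)))) \<partial>lebesgue_on \<Omega>)"
      using sol \<psi> test nn unfolding entropy_solution_def by blast
    then show "0 \<le> (\<integral>p. ?X \<psi> w p \<partial>lebesgue_on ?S)
      + (\<integral>x. st (etav \<psi>) (\<rho>i x) (ui x) * (B x * (\<tau> 0 * (w x * g x))) \<partial>lebesgue_on \<Omega>)"
      unfolding d_tensor[OF \<tau>(1) swg] deriv_mult_smooth[OF w(1) g(1)] ru[OF \<psi>(1)] glob(1,2)[OF \<psi>(1)] S_def fst_conv snd_conv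
      by (simp only: mult.assoc add_diff_cancel_right')
    note cw = cont\<Omega>[OF smooth_continuous[OF w(1)]] cont\<Omega>[OF smooth_continuous[OF smooth_deriv(2)[OF w(1)]]]
    show "integrable (lebesgue_on ?S) (?X \<psi> w)"
    proof (intro Bochner_Integration.integrable_add Bochner_Integration.integrable_diff int)
      fix p assume "p \<in> ?S" "p \<notin> ?K"
      note v = van[OF this]
      show "B (snd p) * (deriv \<tau> (fst p) * (w (snd p) * g (snd p))) = 0"
        using v[of "B (snd p)" "w (snd p) * g (snd p)"] by auto
      show "deriv B (snd p) * (\<tau> (fst p) * (w (snd p) * g (snd p))) = 0"
        using v[of "deriv B (snd p)" "w (snd p) * g (snd p)"] by auto
      show "B (snd p) * (\<tau> (fst p) * (deriv w (snd p) * g (snd p) + deriv g (snd p) * w (snd p))) = 0"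
        using v[of "B (snd p)" "deriv w (snd p) * g (snd p) + deriv g (snd p) * w (snd p)"] by auto
    qed (intro continuous_intros conts cw continuous_etav continuous_qv continuous_gv c\<psi> \<psi>(1))+
  qed
  note e1 = ent[OF \<psi>1(1-3) h(1,2)] and i1 = inte[OF \<psi>1(1-3) h(1,2)]
  note e2 = ent[OF \<psi>2(1-3) k(1,2)] and i2 = inte[OF \<psi>2(1-3) k(1,2)]
  let ?w = "\<lambda>p. \<delta> (snd p) * g (snd p) * \<tau> (fst p) * B (snd p)"
  let ?b1 = "\<lambda>p. g (snd p) * \<tau> (fst p) * B (snd p)"
  let ?b2 = "\<lambda>p. h (snd p) * \<bar>deriv g (snd p)\<bar> * \<tau> (fst p) * B (snd p)"
  let ?b3 = "\<lambda>p. k (snd p) * \<bar>deriv g (snd p)\<bar> * \<tau> (fst p) * B (snd p)"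
  have zero: "?w p = 0 \<and> ?b1 p = 0 \<and> ?b2 p = 0 \<and> ?b3 p = 0" if "p \<in> ?S" "p \<notin> ?K" for p
    using van[OF that, of 1 1] by auto
  show iW: "integrable (lebesgue_on ?S) (\<lambda>p. st cubic (\<rho> p) (u p) * ?w p)"
    by (rule int[OF continuous_cubic]) (intro continuous_intros conts, use zero in blast)
  have j1: "integrable (lebesgue_on ?S) (\<lambda>p. st (\<lambda>v c. 1) (\<rho> p) (u p) * ?b1 p)"
    by (rule int) (intro continuous_intros conts, intro continuous_intros conts, use zero in blast)
  have j2: "integrable (lebesgue_on ?S) (\<lambda>p. st (\<lambda>v c. \<bar>2 * qv (bend 0) v c\<bar>) (\<rho> p) (u p) * ?b2 p)"
    by (rule int) (intro continuous_intros continuous_qv continuous_bend(1), intro continuous_intros conts, use zero in blast)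
  have j3: "integrable (lebesgue_on ?S) (\<lambda>p. st (\<lambda>v c. \<bar>qv (\<lambda>s. s\<^sup>2) v c\<bar>) (\<rho> p) (u p) * ?b3 p)"
    by (rule int) (intro continuous_intros continuous_qv sq, intro continuous_intros conts, use zero in blast)
  let ?Z = "\<lambda>p. - (st cubic (\<rho> p) (u p) * ?w p) + \<kappa> * (st (\<lambda>v c. 1) (\<rho> p) (u p) * ?b1 p)
      + st (\<lambda>v c. \<bar>2 * qv (bend 0) v c\<bar>) (\<rho> p) (u p) * ?b2 p + st (\<lambda>v c. \<bar>qv (\<lambda>s. s\<^sup>2) v c\<bar>) (\<rho> p) (u p) * ?b3 p"
  have "AE p in lebesgue_on ?S. p \<in> ?S" by (rule AE_I2) simp
  with M0(2) have le: "AE p in lebesgue_on ?S. 2 * ?X \<psi>1 h p + ?X \<psi>2 k p \<le> ?Z p"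
  proof eventually_elim
    case (elim p)
    have t0: "0 \<le> fst p" and x\<Omega>: "snd p \<in> \<Omega>" using elim(2) by (auto simp: S_def)
    have rg: "\<bar>u p\<bar> + \<rho> p powr theta \<gamma> \<le> M" using elim(1) by (intro range) auto
    have "st (gv (\<lambda>s. s\<^sup>2)) (\<rho> p) (u p) = 0" by (simp add: st_def gv_square)
    then have gv0: "st (gv \<psi>2) (\<rho> p) (u p) = 0"
      by (rule trans[OF trans[OF glob(3)[OF \<psi>2(1), symmetric] loc2(3)[OF rg]]])
    have eqs: "st (etav \<psi>1) (\<rho> p) (u p) = st (etav (bend 0)) (\<rho> p) (u p)"
      "st (qv \<psi>1) (\<rho> p) (u p) = st (qv (bend 0)) (\<rho> p) (u p)"
      "st (gv \<psi>1) (\<rho> p) (u p) = st (gv (bend 0)) (\<rho> p) (u p)"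
      "st (etav \<psi>2) (\<rho> p) (u p) = st (etav (\<lambda>s. s\<^sup>2)) (\<rho> p) (u p)"
      "st (qv \<psi>2) (\<rho> p) (u p) = st (qv (\<lambda>s. s\<^sup>2)) (\<rho> p) (u p)"
      "st (gv \<psi>2) (\<rho> p) (u p) = 0"
      by (fact trans[OF glob(1)[OF \<psi>1(1), symmetric] loc1(1)[OF rg]]
            trans[OF glob(2)[OF \<psi>1(1), symmetric] loc1(2)[OF rg]]
            trans[OF glob(3)[OF \<psi>1(1), symmetric] loc1(3)[OF rg]]
            trans[OF glob(1)[OF \<psi>2(1), symmetric] loc2(1)[OF rg]]
            trans[OF glob(2)[OF \<psi>2(1), symmetric] loc2(2)[OF rg]] gv0)+
    show ?case
    proof (cases "snd p \<in> {x0..x1}")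
      case False
      then show ?thesis by (simp add: g0)
    next
      case True
      let ?c = "\<rho> p powr theta \<gamma>"
      have c: "0 \<le> ?c" by simp
      have np: "0 \<le> neg_part (deriv B (snd p))" "- deriv B (snd p) \<le> neg_part (deriv B (snd p))"
        by (simp_all add: neg_part_def)
      have W: "0 \<le> cubic (u p) ?c" by (simp add: cubic_def)
      have G: "gv (bend 0) (u p) ?c \<le> 64 * (1 + cubic (u p) ?c)"
        using gv_bend_le[OF c, of "u p"] by (simp add: cubic_def)
      have Q: "c0 * cubic (u p) ?c - C1 \<le> qv (\<lambda>s. s\<^sup>2) (u p) ?c - 2 * qv (bend 0) (u p) ?c"
        using c0[OF c, of "u p"] by (simp add: cubic_def)
      from energy_pointwise[where g' = "deriv g (snd p)",
          OF abs_ge_zero[of "\<rho> p"] \<tau>(2)[of "fst p"] \<tau>(3)[OF t0] less_imp_le[OF B(3)[OF x\<Omega>]] g(2)[of "snd p"]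
          h(2)[OF True] k(2)[OF True] h(3)[OF True] etav_bounds(1)[OF c, of "u p"] etav_bounds(2)[OF c, of "u p"]
          W np gv_bend_nonneg[OF c, of "u p"] G Q \<delta>(2)[OF True] \<kappa>[OF True]]
      show ?thesis unfolding eqs k(3) unfolding st_def by (simp only: mult_zero_left diff_zero mult_1_right)
    qed
  qed
  note a1 = Bochner_Integration.integrable_minus[OF iW] and a2 = integrable_mult_right[OF j1, of \<kappa>]
  note a12 = Bochner_Integration.integrable_add[OF a1 a2]
  note a123 = Bochner_Integration.integrable_add[OF a12 j2]
  have "2 * (\<integral>p. ?X \<psi>1 h p \<partial>lebesgue_on ?S) + (\<integral>p. ?X \<psi>2 k p \<partial>lebesgue_on ?S)
      = (\<integral>p. 2 * ?X \<psi>1 h p + ?X \<psi>2 k p \<partial>lebesgue_on ?S)"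
    by (simp only: Bochner_Integration.integral_add[OF integrable_mult_right[OF i1, of 2] i2] integral_mult_right_zero)
  also have "\<dots> \<le> (\<integral>p. ?Z p \<partial>lebesgue_on ?S)"
    by (rule integral_mono_AE[OF Bochner_Integration.integrable_add[OF integrable_mult_right[OF i1] i2]
          Bochner_Integration.integrable_add[OF a123 j3] le])
  also have "\<dots> = - ?LHS + \<kappa> * ?R1 + ?R2 + ?R3"
  proof -

    show ?thesis
      unfolding Bochner_Integration.integral_add[OF a123 j3] Bochner_Integration.integral_add[OF a12 j2]
        Bochner_Integration.integral_add[OF a1 a2] by simp
  qed
  finally have main: "2 * (\<integral>p. ?X \<psi>1 h p \<partial>lebesgue_on ?S) + (\<integral>p. ?X \<psi>2 k p \<partial>lebesgue_on ?S) \<le> - ?LHS + \<kappa> * ?R1 + ?R2 + ?R3" .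
  \<comment> \<open>The initial data obey the same sup bound, hence the truncated weights can be
    replaced by \<open>bend 0\<close> and the square in the initial terms too; from here on the
    bound no longer appears.\<close>
  have J: "(\<integral>x. st (etav \<psi>) (\<rho>i x) (ui x) * (B x * (\<tau> 0 * (w x * g x))) \<partial>lebesgue_on \<Omega>) =
      (\<integral>x. st (etav \<psi>0) (\<rho>i x) (ui x) * (B x * (\<tau> 0 * (w x * g x))) \<partial>lebesgue_on \<Omega>)"
    if eq: "\<And>r v. \<bar>v\<bar> + r powr theta \<gamma> \<le> M \<Longrightarrow> st (etav \<psi>) r v = st (etav \<psi>0) r v"
      and c: "continuous_on UNIV \<psi>" "continuous_on UNIV \<psi>0" and w: "smooth w" for \<psi> \<psi>0 w
  proof (rule integral_cong_AE)
    have "(\<lambda>x. B x * (\<tau> 0 * (w x * g x))) \<in> borel_measurable (lebesgue_on \<Omega>)"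
      by (intro continuous_imp_measurable_on_sets_lebesgue[OF _ \<Omega>s] continuous_intros B(1) smooth_continuous w g(1))
    note m = borel_measurable_times[OF measurable_st[OF continuous_etav measi] this]
    show "(\<lambda>x. st (etav \<psi>) (\<rho>i x) (ui x) * (B x * (\<tau> 0 * (w x * g x)))) \<in> borel_measurable (lebesgue_on \<Omega>)"
      "(\<lambda>x. st (etav \<psi>0) (\<rho>i x) (ui x) * (B x * (\<tau> 0 * (w x * g x)))) \<in> borel_measurable (lebesgue_on \<Omega>)"
      by (rule m[OF c(1)], rule m[OF c(2)])
    show "AE x in lebesgue_on \<Omega>. st (etav \<psi>) (\<rho>i x) (ui x) * (B x * (\<tau> 0 * (w x * g x))) =
        st (etav \<psi>0) (\<rho>i x) (ui x) * (B x * (\<tau> 0 * (w x * g x)))"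
      using init by eventually_elim (simp add: eq[OF range])
  qed
  have J1: "(\<integral>x. st (etav \<psi>1) (\<rho>i x) (ui x) * (B x * (\<tau> 0 * (h x * g x))) \<partial>lebesgue_on \<Omega>) = ?J1"
    by (rule J[OF _ c\<psi>[OF \<psi>1(1)] continuous_bend(1) h(1)]) (use loc1(1) glob(1)[OF \<psi>1(1)] in simp)
  have J2: "(\<integral>x. st (etav \<psi>2) (\<rho>i x) (ui x) * (B x * (\<tau> 0 * (k x * g x))) \<partial>lebesgue_on \<Omega>) = ?J2"
    by (rule J[OF _ c\<psi>[OF \<psi>2(1)] sq k(1)]) (use loc2(1) glob(1)[OF \<psi>2(1)] in simp)
  show "?LHS \<le> \<kappa> * ?R1 + ?R2 + ?R3 + (2 * ?J1 + ?J2)"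
    using main e1 e2 unfolding J1 J2 by linarith
qed

end

section \<open>Removal of the spatial cutoff\<close>

definition plateau :: "real \<Rightarrow> real \<Rightarrow> real" where
  "plateau R x = step (2 + - x / R) * step (2 + x / R)"

lemma smooth_step_affine: "smooth (\<lambda>x. step (a * x + b))"
  by (rule smooth_affine[OF smooth_step])

lemma deriv_step_affine: "((\<lambda>x. step (a * x + b)) has_real_derivative deriv step (a * x + b) * a) (at x)"
proof (rule DERIV_chain2[OF smooth_deriv(1)[OF smooth_step]])
  show "((\<lambda>x. a * x + b) has_real_derivative a) (at x)" by (auto intro!: derivative_eq_intros)
qed

lemma plateau_eq: "plateau R x = step ((- 1 / R) * x + 2) * step ((1 / R) * x + 2)"
  by (simp add: plateau_def add.commute)

lemma smooth_plateau: "smooth (plateau R)"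
  unfolding plateau_eq[abs_def] by (rule smooth_mult[OF smooth_step_affine smooth_step_affine])

lemma plateau_bounds: "0 \<le> plateau R x" "plateau R x \<le> 1"
  using step_bounds mult_le_one[of "step (2 + - x / R)" "step (2 + x / R)"] by (simp_all add: plateau_def)

lemma plateau_1: "0 < R \<Longrightarrow> \<bar>x\<bar> \<le> R \<Longrightarrow> plateau R x = 1"
  by (simp add: plateau_def step_1 field_simps abs_le_iff)

lemma plateau_0: "0 < R \<Longrightarrow> x \<notin> {-(2*R)..2*R} \<Longrightarrow> plateau R x = 0"
proof -
  assume R: "0 < R" and "x \<notin> {-(2*R)..2*R}"
  then consider "x < - (2 * R)" | "2 * R < x" by force
  then show ?thesis
  proof cases
    case 1
    then have "2 + x / R \<le> 0" using R by (simp add: field_simps)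
    then show ?thesis by (simp add: plateau_def step_0)
  next
    case 2
    then have "2 + - x / R \<le> 0" using R by (simp add: field_simps)
    then show ?thesis by (simp add: plateau_def step_0)
  qed
qed

lemma plateau_deriv:
  "deriv (plateau R) x = deriv step (2 + - x / R) * (- 1 / R) * step (2 + x / R) + deriv step (2 + x / R) * (1 / R) * step (2 + - x / R)"
proof (rule DERIV_imp_deriv)
  show "(plateau R has_real_derivative deriv step (2 + - x / R) * (- 1 / R) * step (2 + x / R) + deriv step (2 + x / R) * (1 / R) * step (2 + - x / R)) (at x)"
    unfolding plateau_eq[abs_def]
    using DERIV_mult[OF deriv_step_affine[of "- 1 / R" 2 x] deriv_step_affine[of "1 / R" 2 x]]
    by (simp add: add.commute)
qed

text \<open>The plateau also serves as the cutoff in time, where only \<open>t \<ge> 0\<close>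
  matters and the entropy itself has to enter with a sign.\<close>

lemma plateau_deriv_nonpos:
  assumes "0 < R" "0 \<le> x"
  shows "deriv (plateau R) x \<le> 0"
proof -
  have "1 < 2 + x / R" using assms by (simp add: add_pos_nonneg)
  then have "deriv step (2 + x / R) = 0" by (simp add: step_deriv_0)
  then show ?thesis
    unfolding plateau_deriv using assms step_deriv_nonneg[of "2 + - x / R"] step_bounds(1)[of "2 + x / R"]
    by (simp add: mult_nonneg_nonneg)
qed

lemma plateau_deriv_abs_le:
  assumes C: "\<And>x. \<bar>deriv step x\<bar> \<le> C" and R: "0 < R"
  shows "\<bar>deriv (plateau R) x\<bar> \<le> 2 * C / R"
proof -
  have "\<bar>deriv step y * s * step z\<bar> \<le> C * \<bar>s\<bar>" for y s z
  proof -
    have "(\<bar>deriv step y\<bar> * \<bar>s\<bar>) * \<bar>step z\<bar> \<le> (C * \<bar>s\<bar>) * 1"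
      using C[of y] step_bounds[of z] by (intro mult_mono mult_right_mono) (auto intro: order_trans[OF abs_ge_zero])
    then show ?thesis by (simp add: abs_mult)
  qed
  from this[of "2 + - x / R" "- 1 / R" "2 + x / R"] this[of "2 + x / R" "1 / R" "2 + - x / R"]
  have "\<bar>deriv (plateau R) x\<bar> \<le> C * \<bar>- 1 / R\<bar> + C * \<bar>1 / R\<bar>"
    unfolding plateau_deriv by (intro order_trans[OF abs_triangle_ineq add_mono])
  also have "\<dots> = 2 * C / R" using R by simp
  finally show ?thesis .
qed

lemma integral_le_of_nn_integral:
  fixes f :: "'a \<Rightarrow> real"
  assumes "f \<in> borel_measurable M" "AE x in M. 0 \<le> f x" "(\<integral>\<^sup>+x. ennreal (f x) \<partial>M) \<le> ennreal c" "0 \<le> c"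
  shows "integral\<^sup>L M f \<le> c"
proof -
  have "integral\<^sup>L M f = enn2real (\<integral>\<^sup>+x. ennreal (f x) \<partial>M)"
    by (rule integral_eq_nn_integral[OF assms(1,2)])
  also have "\<dots> \<le> enn2real (ennreal c)" by (rule enn2real_mono[OF assms(3)]) simp
  finally show ?thesis using assms(4) by simp
qed

context exponent
begin

text \<open>Multiplied by the density, this is the mass density plus multiples of the kinetic and
  the internal energy, as \<open>1 + 2 * theta \<gamma> = \<gamma>\<close>.\<close>

definition quad :: "real \<Rightarrow> real \<Rightarrow> real" where
  "quad v c = 1 + v\<^sup>2 + c\<^sup>2"

lemma continuous_quad: "continuous_on UNIV (\<lambda>p. quad (fst p) (snd p))"
  unfolding quad_def by (intro continuous_intros)

lemma initial_term_le:
  assumes \<Omega>: "\<Omega> \<in> sets lebesgue" and \<psi>: "continuous_on UNIV \<psi>"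
    and ev: "\<And>v c. 0 \<le> c \<Longrightarrow> 0 \<le> etav \<psi> v c" "\<And>v c. 0 \<le> c \<Longrightarrow> etav \<psi> v c \<le> 8 * (1 + v\<^sup>2 + c\<^sup>2)"
    and meas: "\<rho>i \<in> borel_measurable (lebesgue_on \<Omega>)" "ui \<in> borel_measurable (lebesgue_on \<Omega>)"
    and B: "continuous_on \<Omega> B" "\<And>x. x \<in> \<Omega> \<Longrightarrow> 0 < B x"
    and w: "continuous_on \<Omega> w" "\<And>x. x \<in> \<Omega> \<Longrightarrow> 0 \<le> w x" "\<And>x. x \<in> \<Omega> \<Longrightarrow> w x \<le> Hm" "0 \<le> Hm"
    and I0: "(\<integral>\<^sup>+x. ennreal (st quad (\<rho>i x) (ui x) * B x) \<partial>lebesgue_on \<Omega>) \<le> ennreal I0" "0 \<le> I0"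
  shows "(\<integral>x. st (etav \<psi>) (\<rho>i x) (ui x) * (B x * w x) \<partial>lebesgue_on \<Omega>) \<le> 8 * Hm * I0"
proof (rule integral_le_of_nn_integral)
  have "(\<lambda>x. B x * w x) \<in> borel_measurable (lebesgue_on \<Omega>)"
    by (intro continuous_imp_measurable_on_sets_lebesgue[OF _ \<Omega>] continuous_intros B(1) w(1))
  then show "(\<lambda>x. st (etav \<psi>) (\<rho>i x) (ui x) * (B x * w x)) \<in> borel_measurable (lebesgue_on \<Omega>)"
    by (rule borel_measurable_times[OF measurable_st[OF continuous_etav[OF \<psi>] meas]])
  have qm: "(\<lambda>x. st quad (\<rho>i x) (ui x) * B x) \<in> borel_measurable (lebesgue_on \<Omega>)"
    by (rule borel_measurable_times[OF measurable_st[OF continuous_quad meas] continuous_imp_measurable_on_sets_lebesgue[OF B(1) \<Omega>]])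
  have pos: "0 \<le> st (etav \<psi>) r v" "st (etav \<psi>) r v \<le> 8 * st quad r v" for r v
    using mult_left_mono[OF ev(2)[of "r powr theta \<gamma>" v], of "\<bar>r\<bar>"] ev(1)[of "r powr theta \<gamma>" v]
    by (simp_all add: st_def quad_def algebra_simps)
  have x\<Omega>: "AE x in lebesgue_on \<Omega>. x \<in> \<Omega>" by (rule AE_I2) simp
  then show "AE x in lebesgue_on \<Omega>. 0 \<le> st (etav \<psi>) (\<rho>i x) (ui x) * (B x * w x)"
    by eventually_elim (intro mult_nonneg_nonneg pos less_imp_le[OF B(2)] w(2))
  have "(\<integral>\<^sup>+x. ennreal (st (etav \<psi>) (\<rho>i x) (ui x) * (B x * w x)) \<partial>lebesgue_on \<Omega>)
      \<le> (\<integral>\<^sup>+x. ennreal (8 * Hm) * ennreal (st quad (\<rho>i x) (ui x) * B x) \<partial>lebesgue_on \<Omega>)"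
  proof (rule nn_integral_mono_AE)
    show "AE x in lebesgue_on \<Omega>. ennreal (st (etav \<psi>) (\<rho>i x) (ui x) * (B x * w x)) \<le> ennreal (8 * Hm) * ennreal (st quad (\<rho>i x) (ui x) * B x)"
      using x\<Omega>
    proof eventually_elim
      case (elim x)
      have q0: "0 \<le> st quad (\<rho>i x) (ui x)" using pos[of "\<rho>i x" "ui x"] by linarith
      have "st (etav \<psi>) (\<rho>i x) (ui x) * (B x * w x) \<le> (8 * st quad (\<rho>i x) (ui x)) * (B x * Hm)"
        by (intro mult_mono mult_left_mono pos w(3) elim mult_nonneg_nonneg less_imp_le[OF B(2)[OF elim]] w(2)) (use q0 in simp_all)
      also have "\<dots> = (8 * Hm) * (st quad (\<rho>i x) (ui x) * B x)" by simp
      finally have "ennreal (st (etav \<psi>) (\<rho>i x) (ui x) * (B x * w x)) \<le> ennreal ((8 * Hm) * (st quad (\<rho>i x) (ui x) * B x))"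
        by (rule ennreal_leI)
      also have "\<dots> = ennreal (8 * Hm) * ennreal (st quad (\<rho>i x) (ui x) * B x)"
        using w(4) q0 B(2)[OF elim] by (intro ennreal_mult) auto
      finally show ?case .
    qed
  qed
  also have "\<dots> = ennreal (8 * Hm) * (\<integral>\<^sup>+x. ennreal (st quad (\<rho>i x) (ui x) * B x) \<partial>lebesgue_on \<Omega>)"
    by (rule nn_integral_cmult) (use qm in measurable)
  also have "\<dots> \<le> ennreal (8 * Hm) * ennreal I0" by (rule mult_left_mono[OF I0(1)]) simp
  also have "\<dots> = ennreal (8 * Hm * I0)" using w(4) I0(2) by (simp add: ennreal_mult)
  finally show "(\<integral>\<^sup>+x. ennreal (st (etav \<psi>) (\<rho>i x) (ui x) * (B x * w x)) \<partial>lebesgue_on \<Omega>) \<le> ennreal (8 * Hm * I0)" .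
  show "0 \<le> 8 * Hm * I0" using w(4) I0(2) by simp
qed

text \<open>The cutoffs \<open>g m\<close> increase the region to all of \<open>\<Omega>\<close>,
  Fatou's lemma recovers the full integral on the left, and the two error terms vanish by
  assumption. The number \<open>24\<close> is \<open>8\<close> for each of the three initial
  entropies, that of \<open>bend 0\<close> counting twice. The test functions may depend on
  \<open>m\<close>, since in the nozzle they are built on growing intervals; the bounds
  \<open>Hm\<close>, \<open>\<delta>\<close> and \<open>\<kappa>\<close> may not.\<close>

lemma higher_integrability_limit:
  fixes B \<delta> :: "real \<Rightarrow> real" and g h k :: "nat \<Rightarrow> real \<Rightarrow> real"
  assumes \<Omega>: "\<Omega> \<in> sets lebesgue" and S: "S = {0::real..} \<times> \<Omega>" "S \<in> sets lebesgue"
    and B: "continuous_on \<Omega> B" "continuous_on \<Omega> (deriv B)" "\<And>x. x \<in> \<Omega> \<Longrightarrow> 0 < B x"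
    and meas: "\<rho> \<in> borel_measurable (lebesgue_on S)" "u \<in> borel_measurable (lebesgue_on S)"
    and Mb: "0 \<le> Mb" "AE p in lebesgue_on S. \<bar>\<rho> p\<bar> \<le> Mb \<and> \<bar>u p\<bar> \<le> Mb"
    and measi: "\<rho>i \<in> borel_measurable (lebesgue_on \<Omega>)" "ui \<in> borel_measurable (lebesgue_on \<Omega>)"
    and init: "AE x in lebesgue_on \<Omega>. \<bar>\<rho>i x\<bar> \<le> Mb \<and> \<bar>ui x\<bar> \<le> Mb"
    and sol: "entropy_solution \<gamma> \<Omega> B \<rho>i ui \<rho> u"
    and T: "0 < T"
    and g: "\<And>m. smooth (g m)" "\<And>m x. 0 \<le> g m x" "\<And>m x. g m x \<le> 1" "\<And>m x. x \<notin> {xl m..xr m} \<Longrightarrow> g m x = 0" "\<And>m. {xl m..xr m} \<subseteq> \<Omega>"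
      "\<And>x. x \<in> \<Omega> \<Longrightarrow> (\<lambda>m. g m x) \<longlonglongrightarrow> 1"
    and h: "\<And>m. smooth (h m)" "\<And>m x. x \<in> {xl m..xr m} \<Longrightarrow> 0 \<le> h m x" "\<And>m x. x \<in> {xl m..xr m} \<Longrightarrow> h m x \<le> Hm" "\<And>m x. x \<in> {xl m..xr m} \<Longrightarrow> 0 \<le> deriv (h m) x"
    and k: "\<And>m. smooth (k m)" "\<And>m x. x \<in> {xl m..xr m} \<Longrightarrow> 0 \<le> k m x" "\<And>m x. x \<in> {xl m..xr m} \<Longrightarrow> k m x \<le> Hm" "\<And>m x. deriv (k m) x = - deriv (h m) x"
    and Hm: "0 \<le> Hm"
    and c0: "\<And>v c. 0 \<le> c \<Longrightarrow> c0 * (\<bar>v\<bar> ^ 3 + c ^ 3) - C1 \<le> qv (\<lambda>s. s\<^sup>2) v c - 2 * qv (bend 0) v c"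
    and \<delta>: "continuous_on \<Omega> \<delta>" "\<And>x. x \<in> \<Omega> \<Longrightarrow> 0 \<le> \<delta> x"
      "\<And>m x. x \<in> {xl m..xr m} \<Longrightarrow> \<delta> x * B x \<le> c0 * deriv (h m) x * B x - 128 * neg_part (deriv B x) * h m x"
    and \<kappa>: "0 \<le> \<kappa>" "\<And>m x. x \<in> {xl m..xr m} \<Longrightarrow> C1 * deriv (h m) x * B x + 128 * neg_part (deriv B x) * h m x \<le> \<kappa> * B x"
    and I0: "(\<integral>\<^sup>+x. ennreal (st quad (\<rho>i x) (ui x) * B x) \<partial>lebesgue_on \<Omega>) \<le> ennreal I0" "0 \<le> I0"
    and R1: "\<And>m. (\<integral>p. st (\<lambda>v c. 1) (\<rho> p) (u p) * (g m (snd p) * plateau T (fst p) * B (snd p)) \<partial>lebesgue_on S) \<le> r1"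
    and err: "(\<lambda>m. (\<integral>p. st (\<lambda>v c. \<bar>2 * qv (bend 0) v c\<bar>) (\<rho> p) (u p) * (h m (snd p) * \<bar>deriv (g m) (snd p)\<bar> * plateau T (fst p) * B (snd p)) \<partial>lebesgue_on S)) \<longlonglongrightarrow> 0"
      "(\<lambda>m. (\<integral>p. st (\<lambda>v c. \<bar>qv (\<lambda>s. s\<^sup>2) v c\<bar>) (\<rho> p) (u p) * (k m (snd p) * \<bar>deriv (g m) (snd p)\<bar> * plateau T (fst p) * B (snd p)) \<partial>lebesgue_on S)) \<longlonglongrightarrow> 0"
  shows "(\<integral>\<^sup>+p. ennreal (st cubic (\<rho> p) (u p) * (\<delta> (snd p) * plateau T (fst p) * B (snd p))) \<partial>lebesgue_on S) \<le> ennreal (\<kappa> * r1 + 24 * Hm * I0)"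
proof -
  let ?e = "\<lambda>m. (\<integral>p. st (\<lambda>v c. \<bar>2 * qv (bend 0) v c\<bar>) (\<rho> p) (u p) * (h m (snd p) * \<bar>deriv (g m) (snd p)\<bar> * plateau T (fst p) * B (snd p)) \<partial>lebesgue_on S)
    + (\<integral>p. st (\<lambda>v c. \<bar>qv (\<lambda>s. s\<^sup>2) v c\<bar>) (\<rho> p) (u p) * (k m (snd p) * \<bar>deriv (g m) (snd p)\<bar> * plateau T (fst p) * B (snd p)) \<partial>lebesgue_on S)"
  have e0: "?e \<longlonglongrightarrow> 0" using tendsto_add[OF err] by simp
  have sq: "continuous_on UNIV (\<lambda>s::real. s\<^sup>2)" by (intro continuous_intros)
  have pl0: "plateau T t = 0" if "t \<notin> {-(2*T)..2*T}" for t by (rule plateau_0[OF T that])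
  have pT: "plateau T 0 = 1" by (rule plateau_1) (use T in auto)
  have J: "(\<integral>x. st (etav \<psi>) (\<rho>i x) (ui x) * (B x * (plateau T 0 * (w x * g m x))) \<partial>lebesgue_on \<Omega>) \<le> 8 * Hm * I0"
    if \<psi>: "continuous_on UNIV \<psi>" "\<And>v c. 0 \<le> c \<Longrightarrow> 0 \<le> etav \<psi> v c" "\<And>v c. 0 \<le> c \<Longrightarrow> etav \<psi> v c \<le> 8 * (1 + v\<^sup>2 + c\<^sup>2)"
      and w: "smooth w" "\<And>x. x \<in> {xl m..xr m} \<Longrightarrow> 0 \<le> w x" "\<And>x. x \<in> {xl m..xr m} \<Longrightarrow> w x \<le> Hm" for \<psi> w m
  proof (rule initial_term_le[OF \<Omega> \<psi> measi B(1,3) _ _ _ Hm I0])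
    show "continuous_on \<Omega> (\<lambda>x. plateau T 0 * (w x * g m x))"
      by (intro continuous_intros smooth_continuous w(1) g(1))
    fix x
    have "0 \<le> w x * g m x \<and> w x * g m x \<le> Hm"
    proof (cases "x \<in> {xl m..xr m}")
      case True
      have "w x * g m x \<le> Hm * 1" using w(2,3)[OF True] g(2,3)[of m x] Hm by (intro mult_mono) auto
      then show ?thesis using w(2)[OF True] g(2)[of m x] by simp
    next
      case False then show ?thesis using Hm by (simp add: g(4))
    qed
    then show "0 \<le> plateau T 0 * (w x * g m x)" "plateau T 0 * (w x * g m x) \<le> Hm" by (simp_all add: pT)
  qed
  let ?f = "\<lambda>m p. st cubic (\<rho> p) (u p) * (\<delta> (snd p) * g m (snd p) * plateau T (fst p) * B (snd p))"
  have main: "integral\<^sup>L (lebesgue_on S) (?f m) \<le> \<kappa> * r1 + 24 * Hm * I0 + ?e m" "integrable (lebesgue_on S) (?f m)" for m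
  proof -
    have S': "{0::real..} \<times> \<Omega> \<in> sets lebesgue" using S by simp
    have a: "integral\<^sup>L (lebesgue_on S) (?f m) \<le> \<kappa> * (\<integral>p. st (\<lambda>v c. 1) (\<rho> p) (u p) * (g m (snd p) * plateau T (fst p) * B (snd p)) \<partial>lebesgue_on S)
      + (\<integral>p. st (\<lambda>v c. \<bar>2 * qv (bend 0) v c\<bar>) (\<rho> p) (u p) * (h m (snd p) * \<bar>deriv (g m) (snd p)\<bar> * plateau T (fst p) * B (snd p)) \<partial>lebesgue_on S)
      + (\<integral>p. st (\<lambda>v c. \<bar>qv (\<lambda>s. s\<^sup>2) v c\<bar>) (\<rho> p) (u p) * (k m (snd p) * \<bar>deriv (g m) (snd p)\<bar> * plateau T (fst p) * B (snd p)) \<partial>lebesgue_on S)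
      + (2 * (\<integral>x. st (etav (bend 0)) (\<rho>i x) (ui x) * (B x * (plateau T 0 * (h m x * g m x))) \<partial>lebesgue_on \<Omega>)
         + (\<integral>x. st (etav (\<lambda>s. s\<^sup>2)) (\<rho>i x) (ui x) * (B x * (plateau T 0 * (k m x * g m x))) \<partial>lebesgue_on \<Omega>))"
      and b: "integrable (lebesgue_on S) (?f m)"
      unfolding S(1)
      by (rule energy_inequality[OF S' B meas[unfolded S(1)] Mb(1) Mb(2)[unfolded S(1)] \<Omega> measi init sol
          smooth_plateau plateau_bounds(1) plateau_deriv_nonpos[OF T] pl0 g(1,2,4,5) h(1,2,4) k(1,2,4) c0 \<delta>(1,3) \<kappa>(2)]; assumption)+
    have "\<kappa> * (\<integral>p. st (\<lambda>v c. 1) (\<rho> p) (u p) * (g m (snd p) * plateau T (fst p) * B (snd p)) \<partial>lebesgue_on S) \<le> \<kappa> * r1"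
      by (rule mult_left_mono[OF R1 \<kappa>(1)])
    moreover have "(\<integral>x. st (etav (bend 0)) (\<rho>i x) (ui x) * (B x * (plateau T 0 * (h m x * g m x))) \<partial>lebesgue_on \<Omega>) \<le> 8 * Hm * I0"
      by (rule J[OF continuous_bend(1) etav_bounds(1,3) h(1-3)]; assumption)
    moreover have "(\<integral>x. st (etav (\<lambda>s. s\<^sup>2)) (\<rho>i x) (ui x) * (B x * (plateau T 0 * (k m x * g m x))) \<partial>lebesgue_on \<Omega>) \<le> 8 * Hm * I0"
      by (rule J[OF sq etav_bounds(2,4) k(1-3)]; assumption)
    ultimately show "integral\<^sup>L (lebesgue_on S) (?f m) \<le> \<kappa> * r1 + 24 * Hm * I0 + ?e m" using a by linarith
    show "integrable (lebesgue_on S) (?f m)" by (rule b)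
  qed
  have W0: "0 \<le> st cubic r v" for r v by (simp add: st_def cubic_def)
  have pS: "p \<in> S \<Longrightarrow> snd p \<in> \<Omega>" for p using S(1) by auto
  have f0: "0 \<le> ?f m p" if "p \<in> S" for m p
    by (intro mult_nonneg_nonneg W0 \<delta>(2) g(2) plateau_bounds less_imp_le[OF B(3)] pS that)
  have fm: "(\<lambda>p. ennreal (?f m p)) \<in> borel_measurable (lebesgue_on S)" for m
    using borel_measurable_integrable[OF main(2)[of m]] by measurable
  have "(\<integral>\<^sup>+p. ennreal (st cubic (\<rho> p) (u p) * (\<delta> (snd p) * plateau T (fst p) * B (snd p))) \<partial>lebesgue_on S)
      = (\<integral>\<^sup>+p. liminf (\<lambda>m. ennreal (?f m p)) \<partial>lebesgue_on S)"
  proof (rule nn_integral_cong)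
    fix p assume "p \<in> space (lebesgue_on S)"
    then have x: "snd p \<in> \<Omega>" using pS by simp
    have "(\<lambda>m. ?f m p) \<longlonglongrightarrow> st cubic (\<rho> p) (u p) * (\<delta> (snd p) * 1 * plateau T (fst p) * B (snd p))"
      by (intro tendsto_intros g(6) x)
    then have "(\<lambda>m. ennreal (?f m p)) \<longlonglongrightarrow> ennreal (st cubic (\<rho> p) (u p) * (\<delta> (snd p) * plateau T (fst p) * B (snd p)))"
      by (intro tendsto_ennrealI) simp
    from lim_imp_Liminf[OF _ this]
    show "ennreal (st cubic (\<rho> p) (u p) * (\<delta> (snd p) * plateau T (fst p) * B (snd p))) = liminf (\<lambda>m. ennreal (?f m p))"
      by simp
  qed
  also have "\<dots> \<le> liminf (\<lambda>m. \<integral>\<^sup>+p. ennreal (?f m p) \<partial>lebesgue_on S)"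
    by (rule nn_integral_liminf[OF fm])
  also have "\<dots> \<le> liminf (\<lambda>m. ennreal (\<kappa> * r1 + 24 * Hm * I0 + ?e m))"
  proof (rule Liminf_mono[OF always_eventually[OF allI]])
    fix m
    have "(\<integral>\<^sup>+p. ennreal (?f m p) \<partial>lebesgue_on S) = ennreal (integral\<^sup>L (lebesgue_on S) (?f m))"
      by (rule nn_integral_eq_integral[OF main(2)]) (rule AE_I2, use f0 in simp)
    also have "\<dots> \<le> ennreal (\<kappa> * r1 + 24 * Hm * I0 + ?e m)" by (rule ennreal_leI[OF main(1)])
    finally show "(\<integral>\<^sup>+p. ennreal (?f m p) \<partial>lebesgue_on S) \<le> ennreal (\<kappa> * r1 + 24 * Hm * I0 + ?e m)" .
  qed
  also have "\<dots> = ennreal (\<kappa> * r1 + 24 * Hm * I0 + 0)"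
    by (rule lim_imp_Liminf[OF _ tendsto_ennrealI[OF tendsto_add[OF tendsto_const e0]]]) simp
  finally show ?thesis by simp
qed

end

section \<open>Nozzle flow\<close>

lemma nn_integral_lebesgue_on_subset_le:
  assumes S: "S \<in> sets lebesgue" and D: "D \<in> sets lebesgue" "D \<subseteq> S"
    and fm: "f \<in> borel_measurable (lebesgue_on S)"
    and f: "(\<integral>\<^sup>+p. ennreal (f p) \<partial>lebesgue_on S) \<le> ennreal K" and d0: "0 < d0" "0 \<le> K"
    and le: "\<And>p. p \<in> D \<Longrightarrow> d0 * w p \<le> f p"
  shows "(\<integral>\<^sup>+p. ennreal (w p) \<partial>lebesgue_on D) \<le> ennreal (K / d0)"
proof -
  have "(\<integral>\<^sup>+p. ennreal (w p) \<partial>lebesgue_on D) = (\<integral>\<^sup>+p. ennreal (w p) * indicator D p \<partial>lebesgue)"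
    using D(1) by (subst nn_integral_restrict_space) auto
  also have "\<dots> \<le> (\<integral>\<^sup>+p. ennreal (1 / d0) * (ennreal (f p) * indicator S p) \<partial>lebesgue)"
  proof (rule nn_integral_mono)
    fix p
    show "ennreal (w p) * indicator D p \<le> ennreal (1 / d0) * (ennreal (f p) * indicator S p)"
    proof (cases "p \<in> D")
      case True
      have "w p \<le> (1 / d0) * f p" using le[OF True] d0(1) by (simp add: field_simps)
      then have "ennreal (w p) \<le> ennreal ((1 / d0) * f p)" by (rule ennreal_leI)
      also have "\<dots> = ennreal (1 / d0) * ennreal (f p)" using d0(1) by (intro ennreal_mult') simp
      finally show ?thesis using True D(2) by (auto simp: indicator_def)
    qed simp
  qed
  also have "\<dots> = (\<integral>\<^sup>+p. (ennreal (1 / d0) * ennreal (f p)) * indicator S p \<partial>lebesgue)"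
    by (simp only: mult.assoc)
  also have "\<dots> = (\<integral>\<^sup>+p. ennreal (1 / d0) * ennreal (f p) \<partial>lebesgue_on S)"
    using S by (subst nn_integral_restrict_space) auto
  also have "\<dots> = ennreal (1 / d0) * (\<integral>\<^sup>+p. ennreal (f p) \<partial>lebesgue_on S)"
    by (rule nn_integral_cmult) (use fm in measurable)
  also have "\<dots> \<le> ennreal (1 / d0) * ennreal K" by (rule mult_left_mono[OF f]) simp
  also have "\<dots> = ennreal (K / d0)" using d0 by (simp flip: ennreal_mult)
  finally show ?thesis .
qed

lemma measurable_time_indicator:
  "(\<lambda>p :: real \<times> real. indicator {0..T} (fst p) :: ennreal) \<in> borel_measurable (lebesgue_on S)"
proof -
  have "(\<lambda>p :: real \<times> real. indicator {0..T} (fst p) :: ennreal) \<in> borel_measurable borel"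
    by (rule measurable_compose[of fst borel borel]) (auto intro!: borel_measurable_continuous_onI continuous_intros)
  then have "(\<lambda>p :: real \<times> real. indicator {0..T} (fst p) :: ennreal) \<in> borel_measurable lebesgue"
    by (simp add: measurable_completion)
  then show ?thesis by (rule measurable_restrict_space1)
qed

text \<open>Conservation of mass integrated over a finite time interval. It bounds the lower order
  term and makes the cutoff errors integrable over the unbounded domain.\<close>

lemma mass_spacetime:
  fixes \<rho> :: "real \<times> real \<Rightarrow> real"
  assumes \<Omega>: "\<Omega> \<in> sets lebesgue" and S: "S = {0::real..} \<times> \<Omega>" "S \<in> sets lebesgue"
    and B: "continuous_on \<Omega> B" and meas: "\<rho> \<in> borel_measurable (lebesgue_on S)"
    and pos: "AE p in lebesgue_on S. 0 \<le> \<rho> p"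
    and mass: "AE t in lebesgue_on {0..}. mass \<Omega> B (\<lambda>x. \<rho> (t, x)) \<le> ennreal m" and T: "0 \<le> T"
  shows "(\<integral>\<^sup>+p. ennreal (\<bar>\<rho> p\<bar> * B (snd p)) * indicator {0..T} (fst p) \<partial>lebesgue_on S) \<le> ennreal (T * m)"
proof -
  have Bm: "(\<lambda>p. B (snd p)) \<in> borel_measurable (lebesgue_on S)"
  proof (rule continuous_imp_measurable_on_sets_lebesgue[OF _ S(2)])
    show "continuous_on S (\<lambda>p. B (snd p))"
      by (rule continuous_on_compose2[OF B]) (auto intro!: continuous_intros simp: S(1))
  qed
  let ?Fa = "\<lambda>p. ennreal (\<rho> p * B (snd p)) * indicator {0..T} (fst p)"
  let ?F = "\<lambda>p. ?Fa p * indicator S p"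
  have F0: "?Fa \<in> borel_measurable (lebesgue_on S)"
    using borel_measurable_times[OF meas Bm] measurable_time_indicator[of T S] by measurable
  have F: "?F \<in> borel_measurable lebesgue"
    using F0 S(2) by (subst (asm) borel_measurable_restrict_space_iff_ennreal) auto
  have ae: "AE t in lborel. (\<integral>\<^sup>+x. ?F (t, x) \<partial>lebesgue) \<le> ennreal m * indicator {0..T} t"
  proof -
    have "AE t in lebesgue. t \<in> {0..} \<longrightarrow> mass \<Omega> B (\<lambda>x. \<rho> (t, x)) \<le> ennreal m"
      using mass by (subst (asm) AE_restrict_space_iff) auto
    then have "AE t in lborel. t \<in> {0..} \<longrightarrow> mass \<Omega> B (\<lambda>x. \<rho> (t, x)) \<le> ennreal m"
      by (simp add: AE_completion_iff)
    then show ?thesis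
    proof eventually_elim
      case (elim t)
      show ?case
      proof (cases "t \<in> {0..T}")
        case True
        have "(\<integral>\<^sup>+x. ?F (t, x) \<partial>lebesgue) = (\<integral>\<^sup>+x. ennreal (\<rho> (t, x) * B x) * indicator \<Omega> x \<partial>lebesgue)"
          using True by (intro nn_integral_cong) (auto simp: S(1) indicator_def)
        also have "\<dots> = mass \<Omega> B (\<lambda>x. \<rho> (t, x))"
          unfolding mass_def using \<Omega> by (subst nn_integral_restrict_space) auto
        finally show ?thesis using elim True by simp
      qed simp
    qed
  qed
  have "(\<integral>\<^sup>+p. ennreal (\<bar>\<rho> p\<bar> * B (snd p)) * indicator {0..T} (fst p) \<partial>lebesgue_on S) = (\<integral>\<^sup>+p. ?Fa p \<partial>lebesgue_on S)"
    by (rule nn_integral_cong_AE) (use pos in eventually_elim, simp)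
  also have "\<dots> = (\<integral>\<^sup>+p. ?F p \<partial>lebesgue)" using S(2) by (subst nn_integral_restrict_space) auto
  also have "\<dots> \<le> (\<integral>\<^sup>+t. ennreal m * indicator {0..T} t \<partial>lborel)"
    by (rule nn_integral_lebesgue_prod_le[OF F ae])
  also have "\<dots> = ennreal m * ennreal T" using T by (simp add: nn_integral_cmult_indicator)
  also have "\<dots> = ennreal (T * m)" using T by (simp add: ennreal_mult' mult.commute)
  finally show ?thesis .
qed

context exponent
begin

text \<open>Once a state function is at most a multiple of the density, the mass in space-time
  bounds its integral. The factor \<open>Cn\<close> may depend on the sup norm of the
  solution.\<close>

lemma st_integral_le:
  fixes S :: "(real \<times> real) set" and T :: real
  assumes S: "S \<in> sets lebesgue"
    and F: "continuous_on UNIV (\<lambda>p. F (fst p) (snd p))" "\<And>v c. 0 \<le> F v c"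
    and meas: "\<rho> \<in> borel_measurable (lebesgue_on S)" "u \<in> borel_measurable (lebesgue_on S)"
    and bd: "AE p in lebesgue_on S. st F (\<rho> p) (u p) \<le> Cn * \<bar>\<rho> p\<bar>" "0 \<le> Cn"
    and \<beta>: "\<beta> \<in> borel_measurable (lebesgue_on S)" "\<And>p. p \<in> S \<Longrightarrow> 0 \<le> \<beta> p"
      "\<And>p. p \<in> S \<Longrightarrow> \<beta> p \<le> b * (B (snd p) * indicator {0..T} (fst p))" "0 \<le> b"
    and m: "(\<integral>\<^sup>+p. ennreal (\<bar>\<rho> p\<bar> * B (snd p)) * indicator {0..T} (fst p) \<partial>lebesgue_on S) \<le> ennreal R" "0 \<le> R"
    and Bm: "(\<lambda>p. B (snd p)) \<in> borel_measurable (lebesgue_on S)"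
  shows "(\<integral>p. st F (\<rho> p) (u p) * \<beta> p \<partial>lebesgue_on S) \<le> Cn * b * R"
    and "0 \<le> (\<integral>p. st F (\<rho> p) (u p) * \<beta> p \<partial>lebesgue_on S)"
    and "integrable (lebesgue_on S) (\<lambda>p. st F (\<rho> p) (u p) * \<beta> p)"
proof -
  have F0: "0 \<le> st F r v" for r v by (simp add: st_def F(2))
  have fm: "(\<lambda>p. st F (\<rho> p) (u p) * \<beta> p) \<in> borel_measurable (lebesgue_on S)"
    by (rule borel_measurable_times[OF measurable_st[OF F(1) meas] \<beta>(1)])
  have pS: "AE p in lebesgue_on S. p \<in> S" by (rule AE_I2) simp
  then have nn: "AE p in lebesgue_on S. 0 \<le> st F (\<rho> p) (u p) * \<beta> p"
    by eventually_elim (intro mult_nonneg_nonneg F0 \<beta>(2))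
  have "(\<integral>\<^sup>+p. ennreal (st F (\<rho> p) (u p) * \<beta> p) \<partial>lebesgue_on S)
      \<le> (\<integral>\<^sup>+p. ennreal (Cn * b) * (ennreal (\<bar>\<rho> p\<bar> * B (snd p)) * indicator {0..T} (fst p)) \<partial>lebesgue_on S)"
  proof (rule nn_integral_mono_AE)
    show "AE p in lebesgue_on S. ennreal (st F (\<rho> p) (u p) * \<beta> p) \<le> ennreal (Cn * b) * (ennreal (\<bar>\<rho> p\<bar> * B (snd p)) * indicator {0..T} (fst p))"
      using pS bd(1)
    proof eventually_elim
      case (elim p)
      have "st F (\<rho> p) (u p) * \<beta> p \<le> (Cn * \<bar>\<rho> p\<bar>) * (b * (B (snd p) * indicator {0..T} (fst p)))"
        by (intro mult_mono elim(2) \<beta>(2,3)[OF elim(1)] F0) (use bd(2) in simp)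
      also have "\<dots> = (Cn * b) * ((\<bar>\<rho> p\<bar> * B (snd p)) * indicator {0..T} (fst p))" by simp
      finally have "ennreal (st F (\<rho> p) (u p) * \<beta> p) \<le> ennreal ((Cn * b) * ((\<bar>\<rho> p\<bar> * B (snd p)) * indicator {0..T} (fst p)))"
        by (rule ennreal_leI)
      also have "\<dots> = ennreal (Cn * b) * ennreal ((\<bar>\<rho> p\<bar> * B (snd p)) * indicator {0..T} (fst p))"
        using bd(2) \<beta>(4) by (intro ennreal_mult') simp
      also have "ennreal ((\<bar>\<rho> p\<bar> * B (snd p)) * indicator {0..T} (fst p)) = ennreal (\<bar>\<rho> p\<bar> * B (snd p)) * indicator {0..T} (fst p)"
        by (simp add: indicator_def)
      finally show ?case .
    qed
  qed
  also have "\<dots> = ennreal (Cn * b) * (\<integral>\<^sup>+p. ennreal (\<bar>\<rho> p\<bar> * B (snd p)) * indicator {0..T} (fst p) \<partial>lebesgue_on S)"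
  proof (rule nn_integral_cmult)
    have "(\<lambda>p. ennreal (\<bar>\<rho> p\<bar> * B (snd p))) \<in> borel_measurable (lebesgue_on S)"
      using borel_measurable_times[OF borel_measurable_abs[OF meas(1)] Bm] by measurable
    then show "(\<lambda>p. ennreal (\<bar>\<rho> p\<bar> * B (snd p)) * indicator {0..T} (fst p)) \<in> borel_measurable (lebesgue_on S)"
      using measurable_time_indicator[of T S] by measurable
  qed
  also have "\<dots> \<le> ennreal (Cn * b) * ennreal R" by (rule mult_left_mono[OF m(1)]) simp
  also have "\<dots> = ennreal (Cn * b * R)" using bd(2) \<beta>(4) m(2) by (simp add: ennreal_mult)
  finally have le: "(\<integral>\<^sup>+p. ennreal (st F (\<rho> p) (u p) * \<beta> p) \<partial>lebesgue_on S) \<le> ennreal (Cn * b * R)" .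
  show "(\<integral>p. st F (\<rho> p) (u p) * \<beta> p \<partial>lebesgue_on S) \<le> Cn * b * R"
    by (rule integral_le_of_nn_integral[OF fm nn le]) (use bd(2) \<beta>(4) m(2) in simp)
  show "0 \<le> (\<integral>p. st F (\<rho> p) (u p) * \<beta> p \<partial>lebesgue_on S)" by (rule integral_nonneg_AE[OF nn])
  show "integrable (lebesgue_on S) (\<lambda>p. st F (\<rho> p) (u p) * \<beta> p)"
    by (rule integrableI_nonneg[OF fm nn]) (use le_less_trans[OF le ennreal_less_top] in simp)
qed

text \<open>Only \<open>m\<close> and \<open>I0\<close> are parameters. The sup bound is
  existential, so that no constant chosen before the solution can depend on it.\<close>

definition bounded_solution ::
  "real set \<Rightarrow> (real \<Rightarrow> real) \<Rightarrow> real \<Rightarrow> real \<Rightarrow> (real \<Rightarrow> real) \<Rightarrow> (real \<Rightarrow> real) \<Rightarrow>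
   (real \<times> real \<Rightarrow> real) \<Rightarrow> (real \<times> real \<Rightarrow> real) \<Rightarrow> bool" where
  "bounded_solution \<Omega> B m I0 \<rho>i ui \<rho> u \<longleftrightarrow>
     \<rho> \<in> borel_measurable (lebesgue_on ({0..} \<times> \<Omega>)) \<and> u \<in> borel_measurable (lebesgue_on ({0..} \<times> \<Omega>)) \<and>
     (AE p in lebesgue_on ({0..} \<times> \<Omega>). 0 \<le> \<rho> p) \<and>
     (\<exists>M0\<ge>0. (AE p in lebesgue_on ({0..} \<times> \<Omega>). \<bar>\<rho> p\<bar> \<le> M0 \<and> \<bar>u p\<bar> \<le> M0) \<and>
        (AE x in lebesgue_on \<Omega>. \<bar>\<rho>i x\<bar> \<le> M0 \<and> \<bar>ui x\<bar> \<le> M0)) \<and>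
     \<rho>i \<in> borel_measurable (lebesgue_on \<Omega>) \<and> ui \<in> borel_measurable (lebesgue_on \<Omega>) \<and>
     entropy_solution \<gamma> \<Omega> B \<rho>i ui \<rho> u \<and>
     (AE t in lebesgue_on {0..}. mass \<Omega> B (\<lambda>x. \<rho> (t, x)) \<le> ennreal m) \<and>
     (\<integral>\<^sup>+x. ennreal (st quad (\<rho>i x) (ui x) * B x) \<partial>lebesgue_on \<Omega>) \<le> ennreal I0"

lemma bounded_solutionD:
  assumes "bounded_solution \<Omega> B m I0 \<rho>i ui \<rho> u"
  shows "\<rho> \<in> borel_measurable (lebesgue_on ({0..} \<times> \<Omega>))"
    and "u \<in> borel_measurable (lebesgue_on ({0..} \<times> \<Omega>))"
    and "AE p in lebesgue_on ({0..} \<times> \<Omega>). 0 \<le> \<rho> p"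
    and "\<exists>M0\<ge>0. (AE p in lebesgue_on ({0..} \<times> \<Omega>). \<bar>\<rho> p\<bar> \<le> M0 \<and> \<bar>u p\<bar> \<le> M0) \<and>
        (AE x in lebesgue_on \<Omega>. \<bar>\<rho>i x\<bar> \<le> M0 \<and> \<bar>ui x\<bar> \<le> M0)"
    and "\<rho>i \<in> borel_measurable (lebesgue_on \<Omega>)"
    and "ui \<in> borel_measurable (lebesgue_on \<Omega>)"
    and "entropy_solution \<gamma> \<Omega> B \<rho>i ui \<rho> u"
    and "AE t in lebesgue_on {0..}. mass \<Omega> B (\<lambda>x. \<rho> (t, x)) \<le> ennreal m"
    and "(\<integral>\<^sup>+x. ennreal (st quad (\<rho>i x) (ui x) * B x) \<partial>lebesgue_on \<Omega>) \<le> ennreal I0"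
proof -
  note good = assms[unfolded bounded_solution_def]
  show "\<rho> \<in> borel_measurable (lebesgue_on ({0..} \<times> \<Omega>))" by (rule good[THEN conjunct1])
  show "u \<in> borel_measurable (lebesgue_on ({0..} \<times> \<Omega>))" by (rule good[THEN conjunct2, THEN conjunct1])
  show "AE p in lebesgue_on ({0..} \<times> \<Omega>). 0 \<le> \<rho> p" by (rule good[THEN conjunct2, THEN conjunct2, THEN conjunct1])
  show "\<exists>M0\<ge>0. (AE p in lebesgue_on ({0..} \<times> \<Omega>). \<bar>\<rho> p\<bar> \<le> M0 \<and> \<bar>u p\<bar> \<le> M0) \<and>
        (AE x in lebesgue_on \<Omega>. \<bar>\<rho>i x\<bar> \<le> M0 \<and> \<bar>ui x\<bar> \<le> M0)" by (rule good[THEN conjunct2, THEN conjunct2, THEN conjunct2, THEN conjunct1])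
  show "\<rho>i \<in> borel_measurable (lebesgue_on \<Omega>)" by (rule good[THEN conjunct2, THEN conjunct2, THEN conjunct2, THEN conjunct2, THEN conjunct1])
  show "ui \<in> borel_measurable (lebesgue_on \<Omega>)" by (rule good[THEN conjunct2, THEN conjunct2, THEN conjunct2, THEN conjunct2, THEN conjunct2, THEN conjunct1])
  show "entropy_solution \<gamma> \<Omega> B \<rho>i ui \<rho> u" by (rule good[THEN conjunct2, THEN conjunct2, THEN conjunct2, THEN conjunct2, THEN conjunct2, THEN conjunct2, THEN conjunct1])
  show "AE t in lebesgue_on {0..}. mass \<Omega> B (\<lambda>x. \<rho> (t, x)) \<le> ennreal m" by (rule good[THEN conjunct2, THEN conjunct2, THEN conjunct2, THEN conjunct2, THEN conjunct2, THEN conjunct2, THEN conjunct2, THEN conjunct1])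
  show "(\<integral>\<^sup>+x. ennreal (st quad (\<rho>i x) (ui x) * B x) \<partial>lebesgue_on \<Omega>) \<le> ennreal I0" by (rule good[THEN conjunct2, THEN conjunct2, THEN conjunct2, THEN conjunct2, THEN conjunct2, THEN conjunct2, THEN conjunct2, THEN conjunct2])
qed

lemma st_AE_bound:
  assumes "continuous_on UNIV (\<lambda>p. F (fst p) (snd p))" "\<And>v c. 0 \<le> F v c"
    and "AE p in M. \<bar>\<rho> p\<bar> \<le> M0 \<and> \<bar>u p\<bar> \<le> M0"
  obtains Cn where "0 \<le> Cn" "AE p in M. st F (\<rho> p) (u p) \<le> Cn * \<bar>\<rho> p\<bar>"
proof -
  obtain C where C: "0 \<le> C" "\<And>r v. \<bar>r\<bar> \<le> M0 \<Longrightarrow> \<bar>v\<bar> \<le> M0 \<Longrightarrow> \<bar>st F r v\<bar> \<le> C * \<bar>r\<bar>"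
    by (rule st_bounded[OF assms(1)], rule that)
  have "AE p in M. st F (\<rho> p) (u p) \<le> C * \<bar>\<rho> p\<bar>"
    using assms(3)
  proof eventually_elim
    case (elim p)
    then show ?case using C(2)[of "\<rho> p" "u p"] by linarith
  qed
  with C(1) show thesis by (rule that)
qed

lemma continuous_flux_abs:
  "continuous_on UNIV (\<lambda>p. \<bar>2 * qv (bend 0) (fst p) (snd p)\<bar>)"
  "continuous_on UNIV (\<lambda>p. \<bar>qv (\<lambda>s. s\<^sup>2) (fst p) (snd p)\<bar>)"
proof -
  have sq: "continuous_on UNIV (\<lambda>s::real. s\<^sup>2)" by (intro continuous_intros)
  show "continuous_on UNIV (\<lambda>p. \<bar>2 * qv (bend 0) (fst p) (snd p)\<bar>)"
    by (intro continuous_intros continuous_qv continuous_bend(1))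
  show "continuous_on UNIV (\<lambda>p. \<bar>qv (\<lambda>s. s\<^sup>2) (fst p) (snd p)\<bar>)"
    by (intro continuous_intros continuous_qv sq)
qed

text \<open>The constant is fixed before the solution and depends on \<open>m\<close> and
  \<open>I0\<close> only, besides the geometry and the region. The second test function is a
  constant minus the first; both are bounded because the negative part of the derivative of the area
  is integrable.\<close>

lemma nozzle_bound:
  assumes A: "continuous_on UNIV A" "continuous_on UNIV (deriv A)" "\<And>x. lo \<le> A x" "0 < lo"
    and nm: "\<And>x. neg_part (deriv A x) \<le> nmax" "\<And>R. 0 \<le> R \<Longrightarrow> integral {-R..R} (\<lambda>x. neg_part (deriv A x)) \<le> nint"
    and m: "0 \<le> m" and I0: "0 \<le> I0" and T: "0 < T" and L: "0 \<le> L"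
  obtains C where "0 \<le> C"
    "\<And>\<rho>i ui \<rho> u. bounded_solution UNIV A m I0 \<rho>i ui \<rho> u \<Longrightarrow>
      (\<integral>\<^sup>+p. ennreal (st cubic (\<rho> p) (u p) * A (snd p)) \<partial>lebesgue_on ({0..T} \<times> {-L..L})) \<le> ennreal C"
proof -
  obtain c0 C1 where c0: "0 < c0" and C1: "0 \<le> C1"
    and co: "\<And>v c. 0 \<le> c \<Longrightarrow> c0 * (\<bar>v\<bar> ^ 3 + c ^ 3) - C1 \<le> qv (\<lambda>s. s\<^sup>2) v c - 2 * qv (bend 0) v c"
    by (rule flux_coercive, rule that)
  let ?n = "\<lambda>x. neg_part (deriv A x)"
  have n0: "0 \<le> ?n x" for x by (simp add: neg_part_def)
  have nmax0: "0 \<le> nmax" using n0[of 0] nm(1)[of 0] by linarith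
  have Apos: "0 < A x" for x using A(3)[of x] A(4) by linarith
  \<comment> \<open>With this rate, \<open>c0 * b x * A x * h\<close> equals the bound
    \<open>128 * n * h\<close> for the source, which the growth of \<open>h\<close> therefore
    cancels exactly.\<close>
  define b where "b x = 128 / c0 * (?n x / A x)" for x
  have cn: "continuous_on UNIV ?n" unfolding neg_part_def by (intro continuous_intros A(2))
  have b: "continuous_on UNIV b" "\<And>x. 0 \<le> b x"
  proof -
    show "continuous_on UNIV b" unfolding b_def[abs_def]
      by (intro continuous_intros cn A(1)) (use Apos in \<open>auto simp: less_imp_neq[THEN not_sym]\<close>)
    show "0 \<le> b x" for x using n0[of x] Apos[of x] c0 by (simp add: b_def)
  qed
  have nA: "?n x / A x \<le> ?n x / lo" for x
    using n0[of x] A(3)[of x] A(4) by (intro divide_left_mono mult_pos_pos Apos) auto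
  define \<beta> where "\<beta> = 128 / c0 / lo * nint"
  have bint: "integral {-R..R} b \<le> \<beta>" if R: "0 \<le> R" for R
  proof -
    have "integral {-R..R} b \<le> integral {-R..R} (\<lambda>x. 128 / c0 / lo * ?n x)"
    proof (rule integral_le)
      show "b integrable_on {-R..R}" by (intro integrable_continuous_real continuous_on_subset[OF b(1)]) auto
      show "(\<lambda>x. 128 / c0 / lo * ?n x) integrable_on {-R..R}"
        by (intro integrable_continuous_real continuous_intros continuous_on_subset[OF cn]) auto
      fix x
      have "128 / c0 * (?n x / A x) \<le> 128 / c0 * (?n x / lo)" using nA c0 by (intro mult_left_mono) auto
      then show "b x \<le> 128 / c0 / lo * ?n x" by (simp add: b_def)
    qed
    also have "\<dots> = 128 / c0 / lo * integral {-R..R} ?n" by simp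
    also have "\<dots> \<le> \<beta>" unfolding \<beta>_def using nm(2)[OF R] c0 A(4) by (intro mult_left_mono) auto
    finally show ?thesis .
  qed
  define bmax where "bmax = 128 / c0 * (nmax / lo)"
  have bmax: "b x \<le> bmax" for x
  proof -
    have "?n x / A x \<le> nmax / lo"
      using nA[of x] divide_right_mono[OF nm(1)[of x], of lo] A(4) by linarith
    then show ?thesis unfolding b_def bmax_def using c0 by (intro mult_left_mono) auto
  qed
  have bmax0: "0 \<le> bmax" using b(2)[of 0] bmax[of 0] by linarith
  define Hm where "Hm = exp (\<beta> + 8)"
  \<comment> \<open>The cutoff \<open>plateau (real m + 1)\<close> lives on this interval, so the
    exponential weight is needed on it and nowhere else.\<close>
  define r where "r m = 2 * (real m + 1)" for m
  have r1: "1 \<le> r m" "0 \<le> r m" for m by (simp_all add: r_def)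
  have "\<exists>h. smooth h \<and> (\<forall>x\<in>{- r m..r m}. 1 \<le> h x \<and> h x \<le> Hm \<and> b x * h x + 1 / (1 + x\<^sup>2) \<le> deriv h x \<and> deriv h x \<le> (b x + 3) * h x)" for m
  proof -
    obtain h where "smooth h" "\<And>x. x \<in> {- r m..r m} \<Longrightarrow> 1 \<le> h x"
        "\<And>x. x \<in> {- r m..r m} \<Longrightarrow> h x \<le> exp (\<beta> + 8)"
        "\<And>x. x \<in> {- r m..r m} \<Longrightarrow> b x * h x + 1 / (1 + x\<^sup>2) \<le> deriv h x"
        "\<And>x. x \<in> {- r m..r m} \<Longrightarrow> deriv h x \<le> (b x + 3) * h x"
      by (rule exp_weight[OF b bint[OF r1(2)] r1(1)], rule that)
    then show ?thesis unfolding Hm_def by (intro exI[of _ h]) simp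
  qed
  then obtain h where h: "\<And>m. smooth (h m)"
    and hx: "\<And>m x. x \<in> {- r m..r m} \<Longrightarrow> 1 \<le> h m x \<and> h m x \<le> Hm \<and> b x * h m x + 1 / (1 + x\<^sup>2) \<le> deriv (h m) x \<and> deriv (h m) x \<le> (b x + 3) * h m x"
    by metis
  define k where "k m x = Hm + (-1) * h m x" for m x
  have ks: "smooth (k m)" for m unfolding k_def[abs_def]
    by (rule smooth_add[OF smooth_const smooth_mult[OF smooth_const h]])
  have kd: "deriv (k m) x = - deriv (h m) x" for m x
    unfolding k_def[abs_def]
    using DERIV_add[OF DERIV_const[of Hm] DERIV_cmult[OF smooth_deriv(1)[OF h[of m], of x], of "-1"]]
    by (intro DERIV_imp_deriv) simp
  define g where "g m = plateau (real m + 1)" for m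
  have hd0: "0 \<le> deriv (h m) x" if "x \<in> {- r m..r m}" for m x
  proof -
    have "0 \<le> b x * h m x" using hx[OF that] b(2)[of x] by simp
    moreover have "0 \<le> 1 / (1 + x\<^sup>2)" by simp
    ultimately show ?thesis using hx[OF that] by linarith
  qed
  \<comment> \<open>The two summands bound \<open>C1 * deriv h\<close> through
    \<open>deriv h \<le> (b + 3) * h\<close>, and the source through
    \<open>neg_part (deriv A x) \<le> (nmax / lo) * A x\<close>.\<close>
  define \<kappa> where "\<kappa> = C1 * ((bmax + 3) * Hm) + 128 * (nmax / lo) * Hm"
  have Hm: "0 \<le> Hm" by (simp add: Hm_def)
  have \<kappa>0: "0 \<le> \<kappa>" unfolding \<kappa>_def using C1 bmax0 Hm nmax0 A(4) by simp
  have \<kappa>: "C1 * deriv (h m) x * A x + 128 * ?n x * h m x \<le> \<kappa> * A x" if x: "x \<in> {- r m..r m}" for m x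
  proof -
    have "deriv (h m) x \<le> (b x + 3) * h m x" using hx[OF x] by blast
    also have "\<dots> \<le> (bmax + 3) * Hm" using hx[OF x] bmax[of x] bmax0 by (intro mult_mono) auto
    finally have "C1 * deriv (h m) x \<le> C1 * ((bmax + 3) * Hm)" using C1 by (rule mult_left_mono)
    then have 1: "C1 * deriv (h m) x * A x \<le> C1 * ((bmax + 3) * Hm) * A x"
      using Apos[of x] by (intro mult_right_mono) auto
    have "?n x \<le> (nmax / lo) * A x"
    proof -
      have "?n x \<le> nmax" by (rule nm(1))
      also have "\<dots> = (nmax / lo) * lo" using A(4) by simp
      also have "\<dots> \<le> (nmax / lo) * A x" using A(3)[of x] A(4) nmax0 by (intro mult_left_mono) auto
      finally show ?thesis .
    qed
    then have "?n x * h m x \<le> ((nmax / lo) * A x) * Hm"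
      using hx[OF x] n0[of x] by (intro mult_mono) auto
    then have "128 * (?n x * h m x) \<le> 128 * (((nmax / lo) * A x) * Hm)" by (rule mult_left_mono) simp
    moreover have "128 * (?n x * h m x) = 128 * ?n x * h m x" by simp
    moreover have "128 * (((nmax / lo) * A x) * Hm) = 128 * (nmax / lo) * Hm * A x" by simp
    ultimately have 2: "128 * ?n x * h m x \<le> 128 * (nmax / lo) * Hm * A x" by linarith
    show ?thesis using add_mono[OF 1 2] by (simp only: \<kappa>_def distrib_right)
  qed
  \<comment> \<open>The surplus \<open>1 / (1 + x^2)\<close> in the growth of \<open>h\<close>,
    times the coercivity constant: what is left after the source is paid for.\<close>
  define \<delta> where "\<delta> x = c0 / (1 + x\<^sup>2)" for x :: real
  have sq1: "0 < 1 + x\<^sup>2" for x :: real by (simp add: add_pos_nonneg)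
  have \<delta>c: "continuous_on UNIV \<delta>" unfolding \<delta>_def[abs_def]
    by (intro continuous_intros) (use sq1 in \<open>auto simp: less_imp_neq[THEN not_sym]\<close>)
  have \<delta>0: "0 \<le> \<delta> x" for x using c0 sq1[of x] by (simp add: \<delta>_def)
  have \<delta>: "\<delta> x * A x \<le> c0 * deriv (h m) x * A x - 128 * ?n x * h m x" if x: "x \<in> {- r m..r m}" for m x
  proof -
    have "(b x * h m x + 1 / (1 + x\<^sup>2)) * (c0 * A x) \<le> deriv (h m) x * (c0 * A x)"
      using hx[OF x] c0 Apos[of x] by (intro mult_right_mono) auto
    moreover have "b x * h m x * (c0 * A x) = 128 * ?n x * h m x"
      using c0 Apos[of x] by (simp add: b_def)
    moreover have "(b x * h m x + 1 / (1 + x\<^sup>2)) * (c0 * A x) = b x * h m x * (c0 * A x) + \<delta> x * A x"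
      by (simp add: \<delta>_def distrib_right)
    moreover have "deriv (h m) x * (c0 * A x) = c0 * deriv (h m) x * A x" by simp
    ultimately show ?thesis by linarith
  qed
  define R where "R = 2 * T * m"
  have R0: "0 \<le> R" using T m by (simp add: R_def)
  define K where "K = \<kappa> * R + 24 * Hm * I0"
  have K0: "0 \<le> K" using \<kappa>0 R0 Hm I0 by (simp add: K_def)
  define d0 where "d0 = c0 / (1 + L\<^sup>2)"
  have d0: "0 < d0" using c0 sq1[of L] by (simp add: d0_def)
  obtain Cs where Cs: "0 < Cs" "\<And>x. \<bar>deriv step x\<bar> \<le> Cs" by (rule step_deriv_bounded, rule that)
  let ?S = "{0::real..} \<times> (UNIV :: real set)"
  have S: "?S \<in> sets lebesgue"
  proof -
    have "closed ?S" by (intro closed_Times) auto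
    then show ?thesis by simp
  qed
  show thesis
  proof (rule that[of "K / d0"])
    show "0 \<le> K / d0" using K0 d0 by simp
    fix \<rho>i ui \<rho> u assume good: "bounded_solution UNIV A m I0 \<rho>i ui \<rho> u"
    obtain M0 where M0: "0 \<le> M0" "AE p in lebesgue_on ?S. \<bar>\<rho> p\<bar> \<le> M0 \<and> \<bar>u p\<bar> \<le> M0"
        "AE x in lebesgue_on UNIV. \<bar>\<rho>i x\<bar> \<le> M0 \<and> \<bar>ui x\<bar> \<le> M0"
      using bounded_solutionD(4)[OF good] by blast
    note D = bounded_solutionD[OF good]
    note meas = D(1,2) and pos = D(3) and measi = D(5,6) and sol = D(7) and mass = D(8) and I = D(9)
    have U: "(UNIV :: real set) \<in> sets lebesgue" by simp
    have mst: "(\<integral>\<^sup>+p. ennreal (\<bar>\<rho> p\<bar> * A (snd p)) * indicator {0..2 * T} (fst p) \<partial>lebesgue_on ?S) \<le> ennreal R"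
      unfolding R_def by (rule mass_spacetime[OF U refl S A(1) meas(1) pos mass]) (use T in simp)
    have Am: "(\<lambda>p. A (snd p)) \<in> borel_measurable (lebesgue_on ?S)"
    proof (rule continuous_imp_measurable_on_sets_lebesgue[OF _ S])
      show "continuous_on ?S (\<lambda>p. A (snd p))"
        by (rule continuous_on_compose2[OF A(1) continuous_on_snd[OF continuous_on_id]]) simp
    qed
    have wm: "(\<lambda>p. w (snd p) * plateau T (fst p) * A (snd p)) \<in> borel_measurable (lebesgue_on ?S)"
      if "continuous_on UNIV w" for w
    proof (rule continuous_imp_measurable_on_sets_lebesgue[OF _ S])
      have 1: "continuous_on ?S (\<lambda>p. w (snd p))"
        by (rule continuous_on_compose2[OF that continuous_on_snd[OF continuous_on_id]]) simp
      have 2: "continuous_on ?S (\<lambda>p. A (snd p))"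
        by (rule continuous_on_compose2[OF A(1) continuous_on_snd[OF continuous_on_id]]) simp
      have 3: "continuous_on ?S (\<lambda>p. plateau T (fst p))"
        by (rule continuous_on_compose2[OF smooth_continuous[OF smooth_plateau, of UNIV] continuous_on_fst[OF continuous_on_id]]) simp
      show "continuous_on ?S (\<lambda>p. w (snd p) * plateau T (fst p) * A (snd p))"
        by (rule continuous_on_mult[OF continuous_on_mult[OF 1 3] 2])
    qed
    have wle: "w (snd p) * plateau T (fst p) * A (snd p) \<le> c * (A (snd p) * indicator {0..2 * T} (fst p))"
      if "0 \<le> w (snd p)" "w (snd p) \<le> c" "p \<in> ?S" for w c p
    proof (cases "fst p \<in> {0..2 * T}")
      case True
      have "w (snd p) * plateau T (fst p) \<le> c * 1"
        using that plateau_bounds[of T "fst p"] by (intro mult_mono) auto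
      then have "w (snd p) * plateau T (fst p) * A (snd p) \<le> c * 1 * A (snd p)"
        using Apos[of "snd p"] by (intro mult_right_mono) auto
      then show ?thesis using True by simp
    next
      case False
      then have "fst p \<notin> {-(2*T)..2*T}" using that(3) by auto
      then show ?thesis using False by (simp add: plateau_0[OF T])
    qed
    have w0: "0 \<le> w (snd p) * plateau T (fst p) * A (snd p)" if "0 \<le> w (snd p)" for w p
      using that plateau_bounds[of T "fst p"] Apos[of "snd p"] by (intro mult_nonneg_nonneg) auto
    have R1: "(\<integral>p. st (\<lambda>v c. 1) (\<rho> p) (u p) * (g m' (snd p) * plateau T (fst p) * A (snd p)) \<partial>lebesgue_on ?S) \<le> R" for m'
    proof -
      have "(\<integral>p. st (\<lambda>v c. 1) (\<rho> p) (u p) * (g m' (snd p) * plateau T (fst p) * A (snd p)) \<partial>lebesgue_on ?S) \<le> 1 * 1 * R"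
        by (rule st_integral_le(1)[OF S _ _ meas _ _ wm w0 wle _ mst R0 Am])
          (auto simp: st_def g_def plateau_bounds intro: smooth_continuous smooth_plateau)
      then show ?thesis by simp
    qed
    \<comment> \<open>The derivative of the cutoff is of order \<open>1 / (m' + 1)\<close>, and
      density times area is integrable over the time interval. The factor \<open>Cn\<close> depends
      on the solution, but the limit is taken with the solution fixed.\<close>
    have err: "(\<lambda>m'. (\<integral>p. st F (\<rho> p) (u p) * (w m' (snd p) * \<bar>deriv (g m') (snd p)\<bar> * plateau T (fst p) * A (snd p)) \<partial>lebesgue_on ?S)) \<longlonglongrightarrow> 0"
      if F: "continuous_on UNIV (\<lambda>p. F (fst p) (snd p))" "\<And>v c. 0 \<le> F v c"
        and w: "\<And>m. smooth (w m)" "\<And>m x. x \<in> {- r m..r m} \<Longrightarrow> 0 \<le> w m x" "\<And>m x. x \<in> {- r m..r m} \<Longrightarrow> w m x \<le> Hm" for F w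
    proof -
      obtain Cn where Cn: "0 \<le> Cn" "AE p in lebesgue_on ?S. st F (\<rho> p) (u p) \<le> Cn * \<bar>\<rho> p\<bar>"
        by (rule st_AE_bound[OF F M0(2)], rule that)
      have wg: "0 \<le> w m' x * \<bar>deriv (g m') x\<bar> \<and> w m' x * \<bar>deriv (g m') x\<bar> \<le> Hm * (2 * Cs / (real m' + 1))" for m' x
      proof (cases "x \<in> {- r m'..r m'}")
        case True
        have "\<bar>deriv (g m') x\<bar> \<le> 2 * Cs / (real m' + 1)"
          unfolding g_def by (rule plateau_deriv_abs_le[OF Cs(2)]) simp
        then show ?thesis using w(2,3)[OF True] by (intro conjI mult_nonneg_nonneg mult_mono) auto
      next
        case False
        have z: "g m' y = 0" if "y \<notin> {- r m'..r m'}" for y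
          unfolding g_def by (rule plateau_0) (use that in \<open>auto simp: r_def\<close>)
        have "deriv (g m') x = 0" by (rule deriv_zero_outside[OF z False])
        then show ?thesis using Hm Cs(1) by simp
      qed
      have bounds: "(\<integral>p. st F (\<rho> p) (u p) * (w m' (snd p) * \<bar>deriv (g m') (snd p)\<bar> * plateau T (fst p) * A (snd p)) \<partial>lebesgue_on ?S) \<le> Cn * (Hm * (2 * Cs / (real m' + 1))) * R"
        "0 \<le> (\<integral>p. st F (\<rho> p) (u p) * (w m' (snd p) * \<bar>deriv (g m') (snd p)\<bar> * plateau T (fst p) * A (snd p)) \<partial>lebesgue_on ?S)" for m'
      proof -
        have cw: "continuous_on UNIV (\<lambda>x. w m' x * \<bar>deriv (g m') x\<bar>)"
          unfolding g_def by (intro continuous_intros smooth_continuous w(1) smooth_deriv(2) smooth_plateau)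
        have c0': "0 \<le> Hm * (2 * Cs / (real m' + 1))" using Hm Cs(1) by simp
        note * = st_integral_le[OF S F meas Cn(2,1) wm[OF cw] w0[of "\<lambda>x. w m' x * \<bar>deriv (g m') x\<bar>"] wle[of "\<lambda>x. w m' x * \<bar>deriv (g m') x\<bar>"] c0' mst R0 Am]
        show "(\<integral>p. st F (\<rho> p) (u p) * (w m' (snd p) * \<bar>deriv (g m') (snd p)\<bar> * plateau T (fst p) * A (snd p)) \<partial>lebesgue_on ?S) \<le> Cn * (Hm * (2 * Cs / (real m' + 1))) * R"
          by (rule *(1)) (use wg in auto)
        show "0 \<le> (\<integral>p. st F (\<rho> p) (u p) * (w m' (snd p) * \<bar>deriv (g m') (snd p)\<bar> * plateau T (fst p) * A (snd p)) \<partial>lebesgue_on ?S)"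
          by (rule *(2)) (use wg in auto)
      qed
      have "(\<lambda>m'. Cn * (Hm * (2 * Cs * inverse (real (Suc m')))) * R) \<longlonglongrightarrow> Cn * (Hm * (2 * Cs * 0)) * R"
        by (intro tendsto_intros LIMSEQ_inverse_real_of_nat)
      then have lim: "(\<lambda>m'. Cn * (Hm * (2 * Cs / (real m' + 1))) * R) \<longlonglongrightarrow> 0"
        by (simp add: divide_inverse add.commute)
      show ?thesis
        by (rule tendsto_sandwich[OF _ _ tendsto_const lim]) (use bounds in \<open>auto intro: always_eventually\<close>)
    qed
    have hb: "0 \<le> h m' x" "h m' x \<le> Hm" "0 \<le> k m' x" "k m' x \<le> Hm" if "x \<in> {- r m'..r m'}" for m' x
      using hx[OF that] by (simp_all add: k_def)
    have gz: "g m' x = 0" if "x \<notin> {- r m'..r m'}" for m' x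
      unfolding g_def by (rule plateau_0) (use that in \<open>auto simp: r_def\<close>)
    have glim: "(\<lambda>m'. g m' x) \<longlonglongrightarrow> 1" for x
    proof (rule tendsto_eventually)
      obtain N :: nat where "\<bar>x\<bar> \<le> real N" using real_arch_simple by blast
      then show "\<forall>\<^sub>F m' in sequentially. g m' x = 1"
        by (intro eventually_sequentiallyI[of N]) (simp add: g_def plateau_1)
    qed
    have fin: "(\<integral>\<^sup>+p. ennreal (st cubic (\<rho> p) (u p) * (\<delta> (snd p) * plateau T (fst p) * A (snd p))) \<partial>lebesgue_on ?S) \<le> ennreal K"
      unfolding K_def
      by (rule higher_integrability_limit[where g = g and h = h and k = k and xl = "\<lambda>m. - r m" and xr = r and Hm = Hm and \<delta> = \<delta> and \<kappa> = \<kappa> and Mb = M0,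
          OF U refl S A(1,2) Apos meas M0(1,2) measi M0(3) sol T _ _ _ gz _ glim h hb(1,2) hd0 ks hb(3,4) kd Hm co \<delta>c \<delta>0 \<delta> \<kappa>0 \<kappa> I I0 R1
            err[OF continuous_flux_abs(1) _ h hb(1,2)] err[OF continuous_flux_abs(2) _ ks hb(3,4)]])
        (auto simp: g_def plateau_bounds smooth_plateau)
    show "(\<integral>\<^sup>+p. ennreal (st cubic (\<rho> p) (u p) * A (snd p)) \<partial>lebesgue_on ({0..T} \<times> {-L..L})) \<le> ennreal (K / d0)"
    proof (rule nn_integral_lebesgue_on_subset_le[OF S _ _ _ fin d0 K0])
      show "(\<lambda>p. st cubic (\<rho> p) (u p) * (\<delta> (snd p) * plateau T (fst p) * A (snd p))) \<in> borel_measurable (lebesgue_on ?S)"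
        by (rule borel_measurable_times[OF measurable_st[OF continuous_cubic meas] wm[OF \<delta>c]])
      show "{0..T} \<times> {-L..L} \<subseteq> ?S" by (rule Sigma_mono) auto
      have "closed ({0..T} \<times> {-L..L})" by (intro closed_Times) auto
      then show "{0..T} \<times> {-L..L} \<in> sets lebesgue" by simp
      fix p assume p: "p \<in> {0..T} \<times> {-L..L}"
      have "(snd p)\<^sup>2 \<le> L\<^sup>2" using p by (intro abs_le_square_iff[THEN iffD1]) auto
      then have "d0 \<le> \<delta> (snd p)"
        unfolding d0_def \<delta>_def using c0 sq1 by (intro divide_left_mono mult_pos_pos) auto
      moreover have "plateau T (fst p) = 1" by (rule plateau_1[OF T]) (use p in auto)
      moreover have "0 \<le> st cubic (\<rho> p) (u p) * A (snd p)" using Apos[of "snd p"] by (simp add: st_def cubic_def)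
      ultimately show "d0 * (st cubic (\<rho> p) (u p) * A (snd p)) \<le> st cubic (\<rho> p) (u p) * (\<delta> (snd p) * plateau T (fst p) * A (snd p))"
        using mult_right_mono[of d0 "\<delta> (snd p)" "st cubic (\<rho> p) (u p) * A (snd p)"] by (simp add: mult.commute mult.left_commute)
    qed
  qed
qed

end

section \<open>Spherical symmetry\<close>

definition annulus :: "real \<Rightarrow> real \<Rightarrow> real" where
  "annulus N x = step (N * x + -1) * plateau N x"

lemma smooth_annulus: "smooth (annulus N)"
  unfolding annulus_def[abs_def] by (rule smooth_mult[OF smooth_step_affine smooth_plateau])

lemma annulus_bounds: "0 \<le> annulus N x" "annulus N x \<le> 1"
  using step_bounds[of "N * x + -1"] plateau_bounds[of N x] mult_le_one[of "step (N * x + -1)" "plateau N x"]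
  by (simp_all add: annulus_def)

lemma annulus_0:
  assumes "0 < N" "x \<notin> {1 / N..2 * N}"
  shows "annulus N x = 0"
proof (cases "x < 1 / N")
  case True
  then have "N * x + -1 \<le> 0" using assms(1) by (simp add: field_simps)
  then show ?thesis by (simp add: annulus_def step_0)
next
  case False
  then have "x \<notin> {-(2*N)..2*N}" using assms by auto
  then show ?thesis using assms(1) by (simp add: annulus_def plateau_0)
qed

lemma annulus_1: "0 < N \<Longrightarrow> 2 \<le> N * x \<Longrightarrow> \<bar>x\<bar> \<le> N \<Longrightarrow> annulus N x = 1"
  by (simp add: annulus_def step_1 plateau_1)

text \<open>The slope is small on the outer transition but of order \<open>N\<close> on the inner
  one, near the origin; the inner transition is what requires the boundary condition. It ends at
  \<open>2 / N\<close>; with \<open>3 / N\<close> the points beyond are strictly outside.\<close>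

lemma annulus_deriv_abs_le:
  assumes C: "\<And>x. \<bar>deriv step x\<bar> \<le> C" and N: "0 < N"
  shows "\<bar>deriv (annulus N) x\<bar> \<le> N * C * indicator {..<3 / N} x + 2 * C / N"
proof -
  have "(annulus N has_real_derivative deriv step (N * x + -1) * N * plateau N x + deriv (plateau N) x * step (N * x + -1)) (at x)"
    unfolding annulus_def[abs_def]
    by (rule DERIV_mult[OF deriv_step_affine smooth_deriv(1)[OF smooth_plateau]])
  then have eq: "deriv (annulus N) x = deriv step (N * x + -1) * N * plateau N x + deriv (plateau N) x * step (N * x + -1)"
    by (rule DERIV_imp_deriv)
  have C0: "0 \<le> C" using C[of 0] by linarith
  have 1: "\<bar>deriv step (N * x + -1) * N * plateau N x\<bar> \<le> N * C * indicator {..<3 / N} x"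
  proof (cases "x < 3 / N")
    case True
    have "(\<bar>deriv step (N * x + -1)\<bar> * N) * plateau N x \<le> (C * N) * 1"
      using C[of "N * x + -1"] N plateau_bounds[of N x] C0 by (intro mult_mono mult_right_mono) auto
    then show ?thesis using True N plateau_bounds[of N x] by (simp add: abs_mult mult.commute)
  next
    case False
    then have "1 < N * x + -1" using N by (simp add: field_simps)
    then have "deriv step (N * x + -1) = 0" by (intro step_deriv_0) simp
    then show ?thesis using False by simp
  qed
  have "\<bar>deriv (plateau N) x\<bar> * step (N * x + -1) \<le> (2 * C / N) * 1"
    using plateau_deriv_abs_le[OF C N, of x] step_bounds[of "N * x + -1"] by (intro mult_mono) auto
  then have 2: "\<bar>deriv (plateau N) x * step (N * x + -1)\<bar> \<le> 2 * C / N"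
    using step_bounds[of "N * x + -1"] by (simp add: abs_mult)
  show ?thesis unfolding eq by (rule order_trans[OF abs_triangle_ineq add_mono[OF 1 2]])
qed

lemma half_strip_lebesgue: "{0::real..} \<times> {0::real<..} \<in> sets lebesgue"
proof -
  have "closed ({0::real..} \<times> (UNIV :: real set))" by (intro closed_Times) auto
  moreover have "open ((UNIV :: real set) \<times> {0::real<..})" by (intro open_Times) auto
  ultimately have "({0::real..} \<times> (UNIV :: real set)) \<inter> (UNIV \<times> {0::real<..}) \<in> sets lebesgue"
    by (intro sets.Int) simp_all
  moreover have "({0::real..} \<times> (UNIV :: real set)) \<inter> (UNIV \<times> {0::real<..}) = {0::real..} \<times> {0::real<..}" by auto
  ultimately show ?thesis by simp
qed

lemma strip_lebesgue: "{0..T::real} \<times> {0<..<e::real} \<in> sets lebesgue"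
proof -
  have "closed ({0..T} \<times> (UNIV :: real set))" by (intro closed_Times) auto
  moreover have "open ((UNIV :: real set) \<times> {0<..<e})" by (intro open_Times) auto
  ultimately have "({0..T} \<times> (UNIV :: real set)) \<inter> (UNIV \<times> {0<..<e}) \<in> sets lebesgue"
    by (intro sets.Int) simp_all
  moreover have "({0..T} \<times> (UNIV :: real set)) \<inter> (UNIV \<times> {0<..<e}) = {0..T} \<times> {0<..<e}" by auto
  ultimately show ?thesis by simp
qed

lemma integral_lebesgue_on_indicator:
  fixes f :: "real \<times> real \<Rightarrow> real"
  assumes "S \<in> sets lebesgue" "D \<in> sets lebesgue" "D \<subseteq> S"
  shows "(\<integral>p. f p * indicator D p \<partial>lebesgue_on S) = (\<integral>p. f p \<partial>lebesgue_on D)"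
proof -
  have "(\<integral>p. f p * indicator D p \<partial>lebesgue_on S) = (\<integral>p. indicator S p *\<^sub>R (f p * indicator D p) \<partial>lebesgue)"
    using assms by (subst integral_restrict_space) auto
  also have "\<dots> = (\<integral>p. indicator D p *\<^sub>R f p \<partial>lebesgue)"
    by (rule Bochner_Integration.integral_cong) (use assms(3) in \<open>auto simp: indicator_def\<close>)
  also have "\<dots> = (\<integral>p. f p \<partial>lebesgue_on D)"
    using assms by (subst integral_restrict_space) auto
  finally show ?thesis .
qed

context exponent
begin

text \<open>As the area is increasing, the geometric source has a good sign and no exponential
  growth is needed. The difficulty is the inner transition of the cutoff: \<open>h\<close> vanishes
  linearly at the origin and compensates the slope, while \<open>k\<close> does not, and there the
  flux of \<open>s^2\<close> is compared with the momentum. The statement holds for every increasing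
  area, so that it covers all approximate geometries at once.\<close>

lemma spherical_bound:
  assumes m: "0 \<le> m" and I0: "0 \<le> I0" and T: "0 < T" and L: "0 \<le> L"
  obtains C where "0 \<le> C"
    "\<And>B \<rho>i ui \<rho> u. \<lbrakk>continuous_on {0<..} B; continuous_on {0<..} (deriv B);
        \<forall>x>0. 0 < B x; \<forall>x>0. 0 \<le> deriv B x;
        bounded_solution {0<..} B m I0 \<rho>i ui \<rho> u; vanishes_at_origin (\<lambda>p. \<rho> p * u p * B (snd p))\<rbrakk> \<Longrightarrow>
      (\<integral>\<^sup>+p. ennreal (st cubic (\<rho> p) (u p) * B (snd p)) \<partial>lebesgue_on ({0..T} \<times> ({-L..L} \<inter> {0<..}))) \<le> ennreal C"
proof -
  obtain c0 C1 where c0: "0 < c0" and C1: "0 \<le> C1"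
    and co: "\<And>v c. 0 \<le> c \<Longrightarrow> c0 * (\<bar>v\<bar> ^ 3 + c ^ 3) - C1 \<le> qv (\<lambda>s. s\<^sup>2) v c - 2 * qv (bend 0) v c"
    by (rule flux_coercive, rule that)
  define N where "N m' = real m' + 1" for m' :: nat
  have N: "0 < N m'" "1 \<le> N m'" for m' by (simp_all add: N_def)
  define g where "g m' = annulus (N m')" for m'
  \<comment> \<open>The derivatives of \<open>h\<close> and \<open>k\<close> are opposite, both
    functions lie between \<open>0\<close> and \<open>1\<close>, and \<open>h x \<le> x\<close>. On
    a bounded interval the derivative of \<open>h\<close> is bounded below, which is all that
    coercivity needs.\<close>
  define h where "h x = 1 + (-1) * exp ((-1) * x + 0)" for x :: real
  define k where "k x = exp ((-1) * x + 0)" for x :: real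
  have se: "smooth (\<lambda>x. exp ((-1) * x + 0))" by (rule smooth_affine[OF smooth_exp[OF smooth_ident]])
  have hs: "smooth h" unfolding h_def[abs_def] by (rule smooth_add[OF smooth_const smooth_mult[OF smooth_const se]])
  have ks: "smooth k" unfolding k_def[abs_def] by (rule se)
  have hd: "deriv h x = exp (- x)" for x
    unfolding h_def[abs_def] by (rule DERIV_imp_deriv) (auto intro!: derivative_eq_intros)
  have kd: "deriv k x = - deriv h x" for x
    unfolding hd unfolding k_def[abs_def] by (rule DERIV_imp_deriv) (auto intro!: derivative_eq_intros)
  have hb: "0 \<le> h x" "h x \<le> 1" "h x \<le> x" "0 \<le> k x" "k x \<le> 1" if "0 < x" for x
    using that exp_ge_add_one_self[of "- x"] by (simp_all add: h_def k_def)
  define \<delta> where "\<delta> x = c0 * exp (- x)" for x :: real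
  have \<delta>c: "continuous_on A \<delta>" for A unfolding \<delta>_def[abs_def] by (intro continuous_intros)
  have \<delta>0: "0 \<le> \<delta> x" for x using c0 by (simp add: \<delta>_def)
  define R where "R = 2 * T * m"
  have R0: "0 \<le> R" using T m by (simp add: R_def)
  define K where "K = C1 * R + 24 * 1 * I0"
  have K0: "0 \<le> K" using C1 R0 I0 by (simp add: K_def)
  define d0 where "d0 = c0 * exp (- L)"
  have d0: "0 < d0" using c0 by (simp add: d0_def)
  obtain Cs where Cs: "0 < Cs" "\<And>x. \<bar>deriv step x\<bar> \<le> Cs" by (rule step_deriv_bounded, rule that)
  let ?O = "{0::real<..}"
  let ?S = "{0::real..} \<times> ?O"
  have S: "?S \<in> sets lebesgue" by (rule half_strip_lebesgue)
  show thesis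
  proof (rule that[of "K / d0"])
    show "0 \<le> K / d0" using K0 d0 by simp
    fix B \<rho>i ui \<rho> u
    assume Bc: "continuous_on ?O B" "continuous_on ?O (deriv B)" and Bp': "\<forall>x>0. 0 < B x" "\<forall>x>0. 0 \<le> deriv B x"
      and good: "bounded_solution ?O B m I0 \<rho>i ui \<rho> u" and van: "vanishes_at_origin (\<lambda>p. \<rho> p * u p * B (snd p))"
    note Bp = Bp'(1)[rule_format] Bp'(2)[rule_format]
    have np: "neg_part (deriv B x) = 0" if "0 < x" for x using Bp(2)[OF that] by (simp add: neg_part_def)
    obtain M0 where M0: "0 \<le> M0" "AE p in lebesgue_on ?S. \<bar>\<rho> p\<bar> \<le> M0 \<and> \<bar>u p\<bar> \<le> M0"
        "AE x in lebesgue_on ?O. \<bar>\<rho>i x\<bar> \<le> M0 \<and> \<bar>ui x\<bar> \<le> M0"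
      using bounded_solutionD(4)[OF good] by blast
    note D = bounded_solutionD[OF good]
    note meas = D(1,2) and pos = D(3) and measi = D(5,6) and sol = D(7) and mass = D(8) and I = D(9)
    have U: "?O \<in> sets lebesgue" by simp
    have mst: "(\<integral>\<^sup>+p. ennreal (\<bar>\<rho> p\<bar> * B (snd p)) * indicator {0..2 * T} (fst p) \<partial>lebesgue_on ?S) \<le> ennreal R"
      unfolding R_def by (rule mass_spacetime[OF U refl S Bc(1) meas(1) pos mass]) (use T in simp)
    have cB: "continuous_on ?S (\<lambda>p. B (snd p))"
      by (rule continuous_on_compose2[OF Bc(1) continuous_on_snd[OF continuous_on_id]]) auto
    have Am: "(\<lambda>p. B (snd p)) \<in> borel_measurable (lebesgue_on ?S)"
      by (rule continuous_imp_measurable_on_sets_lebesgue[OF cB S])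
    have wm: "(\<lambda>p. w (snd p) * plateau T (fst p) * B (snd p)) \<in> borel_measurable (lebesgue_on ?S)"
      if "continuous_on UNIV w" for w
    proof (rule continuous_imp_measurable_on_sets_lebesgue[OF _ S])
      have 1: "continuous_on ?S (\<lambda>p. w (snd p))"
        by (rule continuous_on_compose2[OF that continuous_on_snd[OF continuous_on_id]]) simp
      have 3: "continuous_on ?S (\<lambda>p. plateau T (fst p))"
        by (rule continuous_on_compose2[OF smooth_continuous[OF smooth_plateau, of UNIV] continuous_on_fst[OF continuous_on_id]]) simp
      show "continuous_on ?S (\<lambda>p. w (snd p) * plateau T (fst p) * B (snd p))"
        by (rule continuous_on_mult[OF continuous_on_mult[OF 1 3] cB])
    qed
    have tb: "plateau T (fst p) * B (snd p) \<le> B (snd p) * indicator {0..2 * T} (fst p)" "0 \<le> plateau T (fst p) * B (snd p)"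
      if "p \<in> ?S" for p
    proof -
      have Bpos: "0 < B (snd p)" using that by (intro Bp(1)) auto
      show "0 \<le> plateau T (fst p) * B (snd p)" using Bpos plateau_bounds[of T "fst p"] by simp
      show "plateau T (fst p) * B (snd p) \<le> B (snd p) * indicator {0..2 * T} (fst p)"
      proof (cases "fst p \<in> {0..2 * T}")
        case True
        then show ?thesis using Bpos plateau_bounds[of T "fst p"] by simp
      next
        case False
        then have "fst p \<notin> {-(2*T)..2*T}" using that by auto
        then show ?thesis using False by (simp add: plateau_0[OF T])
      qed
    qed
    have w0: "0 \<le> w (snd p) * plateau T (fst p) * B (snd p)" if "0 \<le> w (snd p)" "p \<in> ?S" for w p
      using mult_nonneg_nonneg[OF that(1) tb(2)[OF that(2)]] by (simp add: mult.assoc)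
    have wle: "w (snd p) * plateau T (fst p) * B (snd p) \<le> c * (B (snd p) * indicator {0..2 * T} (fst p))"
      if "0 \<le> w (snd p)" "w (snd p) \<le> c" "p \<in> ?S" for w c p
    proof -
      have "w (snd p) * (plateau T (fst p) * B (snd p)) \<le> c * (B (snd p) * indicator {0..2 * T} (fst p))"
        by (rule mult_mono[OF that(2) tb(1)[OF that(3)] _ tb(2)[OF that(3)]]) (use that(1,2) in linarith)
      then show ?thesis by (simp add: mult.assoc)
    qed
    have R1: "(\<integral>p. st (\<lambda>v c. 1) (\<rho> p) (u p) * (g m' (snd p) * plateau T (fst p) * B (snd p)) \<partial>lebesgue_on ?S) \<le> R" for m'
    proof -
      have "(\<integral>p. st (\<lambda>v c. 1) (\<rho> p) (u p) * (g m' (snd p) * plateau T (fst p) * B (snd p)) \<partial>lebesgue_on ?S) \<le> 1 * 1 * R"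
        by (rule st_integral_le(1)[OF S _ _ meas _ _ wm w0 wle _ mst R0 Am])
          (auto simp: st_def g_def annulus_bounds intro: smooth_continuous smooth_annulus)
      then show ?thesis by simp
    qed
    have dg: "\<bar>deriv (g m') x\<bar> \<le> N m' * Cs * indicator {..<3 / N m'} x + 2 * Cs / N m'" for m' x
      unfolding g_def by (rule annulus_deriv_abs_le[OF Cs(2) N(1)])
    have cdg: "continuous_on UNIV (\<lambda>x. w x * \<bar>deriv (g m') x\<bar>)" if "smooth w" for w m'
      unfolding g_def by (intro continuous_intros smooth_continuous that smooth_deriv(2) smooth_annulus)
    have Ninv: "(\<lambda>m'. c / N m') \<longlonglongrightarrow> 0" for c
    proof -
      have "(\<lambda>m'. c * inverse (real (Suc m'))) \<longlonglongrightarrow> c * 0" by (intro tendsto_intros LIMSEQ_inverse_real_of_nat)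
      then show ?thesis by (simp add: N_def divide_inverse add.commute)
    qed
    have pS: "AE p in lebesgue_on ?S. p \<in> ?S" by (rule AE_I2) simp
    let ?F1 = "\<lambda>v c. \<bar>2 * qv (bend 0) v c\<bar>"
    \<comment> \<open>Dominated convergence: at a fixed point the inner transition is eventually to
      the left, and the product of \<open>h\<close> with the slope stays bounded.\<close>
    have err1: "(\<lambda>m'. (\<integral>p. st ?F1 (\<rho> p) (u p) * (h (snd p) * \<bar>deriv (g m') (snd p)\<bar> * plateau T (fst p) * B (snd p)) \<partial>lebesgue_on ?S)) \<longlonglongrightarrow> 0"
    proof -
      obtain Cn where Cn: "0 \<le> Cn" "AE p in lebesgue_on ?S. st ?F1 (\<rho> p) (u p) \<le> Cn * \<bar>\<rho> p\<bar>"
        by (rule st_AE_bound[OF continuous_flux_abs(1) _ M0(2)], simp, rule that)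
      \<comment> \<open>On the inner transition \<open>h x * N\<close> is at most
        \<open>x * N \<le> 3\<close>; the outer one adds at most \<open>2 * Cs\<close>.\<close>
      have hg: "0 \<le> h x * \<bar>deriv (g m') x\<bar>" "h x * \<bar>deriv (g m') x\<bar> \<le> 5 * Cs" if "0 < x" for x m'
      proof -
        show "0 \<le> h x * \<bar>deriv (g m') x\<bar>" using hb(1)[OF that] by simp
        have "h x * \<bar>deriv (g m') x\<bar> \<le> h x * (N m' * Cs * indicator {..<3 / N m'} x + 2 * Cs / N m')"
          by (rule mult_left_mono[OF dg hb(1)[OF that]])
        also have "\<dots> = h x * N m' * indicator {..<3 / N m'} x * Cs + h x * (2 * Cs / N m')" by (simp add: algebra_simps)
        also have "\<dots> \<le> 3 * Cs + 1 * (2 * Cs)"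
        proof (rule add_mono)
          have "h x * N m' * indicator {..<3 / N m'} x \<le> 3"
          proof (cases "x < 3 / N m'")
            case True
            have "h x * N m' \<le> x * N m'" using hb(3)[OF that] N[of m'] by (intro mult_right_mono) auto
            also have "\<dots> \<le> 3" using True N[of m'] by (simp add: field_simps)
            finally show ?thesis using True by simp
          qed simp
          then show "h x * N m' * indicator {..<3 / N m'} x * Cs \<le> 3 * Cs" using Cs(1) by (intro mult_right_mono) auto
          have "2 * Cs / N m' \<le> 2 * Cs / 1" using Cs(1) N[of m'] by (intro divide_left_mono) auto
          then show "h x * (2 * Cs / N m') \<le> 1 * (2 * Cs)"
            using hb[OF that] Cs(1) N[of m'] by (intro mult_mono) auto
        qed
        finally show "h x * \<bar>deriv (g m') x\<bar> \<le> 5 * Cs" by simp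
      qed
      have hlim: "(\<lambda>m'. h x * \<bar>deriv (g m') x\<bar>) \<longlonglongrightarrow> 0" if x: "0 < x" for x
      proof (rule tendsto_sandwich[OF _ _ tendsto_const Ninv[of "2 * Cs"]])
        show "\<forall>\<^sub>F m' in sequentially. 0 \<le> h x * \<bar>deriv (g m') x\<bar>" by (intro always_eventually allI hg(1) x)
        obtain n where n: "3 / x \<le> real n" using real_arch_simple by blast
        show "\<forall>\<^sub>F m' in sequentially. h x * \<bar>deriv (g m') x\<bar> \<le> 2 * Cs / N m'"
        proof (rule eventually_sequentiallyI[of n])
          fix m' assume "n \<le> m'"
          then have "3 / x \<le> N m'" using n by (simp add: N_def)
          then have "\<not> x < 3 / N m'" using x N[of m'] by (simp add: field_simps)
          then have "\<bar>deriv (g m') x\<bar> \<le> 2 * Cs / N m'" using dg[of m' x] by simp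
          then have "h x * \<bar>deriv (g m') x\<bar> \<le> 1 * (2 * Cs / N m')" using hb[OF x] by (intro mult_mono) auto
          then show "h x * \<bar>deriv (g m') x\<bar> \<le> 2 * Cs / N m'" by simp
        qed
      qed
      have F1m: "(\<lambda>p. st ?F1 (\<rho> p) (u p)) \<in> borel_measurable (lebesgue_on ?S)"
        by (rule measurable_st[OF continuous_flux_abs(1) meas])
      have c5: "continuous_on UNIV (\<lambda>x::real. 5 * Cs)" by (rule continuous_on_const)
      have int: "integrable (lebesgue_on ?S) (\<lambda>p. st ?F1 (\<rho> p) (u p) * (5 * Cs * plateau T (fst p) * B (snd p)))"
        by (rule st_integral_le(3)[where b = "5 * Cs", OF S continuous_flux_abs(1) _ meas Cn(2,1) wm[OF c5] w0[of "\<lambda>x. 5 * Cs"] wle[of "\<lambda>x. 5 * Cs"] _ mst R0 Am])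
          (use Cs(1) in simp_all)
      have "(\<lambda>m'. (\<integral>p. st ?F1 (\<rho> p) (u p) * (h (snd p) * \<bar>deriv (g m') (snd p)\<bar> * plateau T (fst p) * B (snd p)) \<partial>lebesgue_on ?S)) \<longlonglongrightarrow> (\<integral>p. 0 \<partial>lebesgue_on ?S)"
      proof (rule integral_dominated_convergence[OF _ _ int])
        show "(\<lambda>p. st ?F1 (\<rho> p) (u p) * (h (snd p) * \<bar>deriv (g m') (snd p)\<bar> * plateau T (fst p) * B (snd p))) \<in> borel_measurable (lebesgue_on ?S)" for m'
          by (rule borel_measurable_times[OF F1m wm[OF cdg[OF hs]]])
        show "AE p in lebesgue_on ?S. (\<lambda>m'. st ?F1 (\<rho> p) (u p) * (h (snd p) * \<bar>deriv (g m') (snd p)\<bar> * plateau T (fst p) * B (snd p))) \<longlonglongrightarrow> 0"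
        proof (rule AE_I2)
          fix p assume "p \<in> space (lebesgue_on ?S)"
          then have "0 < snd p" by auto
          from hlim[OF this] have "(\<lambda>m'. st ?F1 (\<rho> p) (u p) * (h (snd p) * \<bar>deriv (g m') (snd p)\<bar> * plateau T (fst p) * B (snd p))) \<longlonglongrightarrow> st ?F1 (\<rho> p) (u p) * (0 * plateau T (fst p) * B (snd p))"
            by (intro tendsto_mult tendsto_const)
          then show "(\<lambda>m'. st ?F1 (\<rho> p) (u p) * (h (snd p) * \<bar>deriv (g m') (snd p)\<bar> * plateau T (fst p) * B (snd p))) \<longlonglongrightarrow> 0" by simp
        qed
        show "AE p in lebesgue_on ?S. norm (st ?F1 (\<rho> p) (u p) * (h (snd p) * \<bar>deriv (g m') (snd p)\<bar> * plateau T (fst p) * B (snd p))) \<le> st ?F1 (\<rho> p) (u p) * (5 * Cs * plateau T (fst p) * B (snd p))" for m'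
        proof (rule AE_I2)
          fix p assume "p \<in> space (lebesgue_on ?S)"
          then have p: "p \<in> ?S" "0 < snd p" by auto
          have s0: "0 \<le> st ?F1 (\<rho> p) (u p)" by (simp add: st_def)
          have "(h (snd p) * \<bar>deriv (g m') (snd p)\<bar>) * (plateau T (fst p) * B (snd p)) \<le> (5 * Cs) * (plateau T (fst p) * B (snd p))"
            by (rule mult_right_mono[OF hg(2)[OF p(2)] tb(2)[OF p(1)]])
          then have "st ?F1 (\<rho> p) (u p) * (h (snd p) * \<bar>deriv (g m') (snd p)\<bar> * plateau T (fst p) * B (snd p)) \<le> st ?F1 (\<rho> p) (u p) * (5 * Cs * plateau T (fst p) * B (snd p))"
            using s0 by (intro mult_left_mono) (simp_all add: mult.assoc)
          moreover have "0 \<le> st ?F1 (\<rho> p) (u p) * (h (snd p) * \<bar>deriv (g m') (snd p)\<bar> * plateau T (fst p) * B (snd p))"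
            using mult_nonneg_nonneg[OF s0 mult_nonneg_nonneg[OF hg(1)[OF p(2)] tb(2)[OF p(1)]]] by (simp only: mult.assoc)
          ultimately show "norm (st ?F1 (\<rho> p) (u p) * (h (snd p) * \<bar>deriv (g m') (snd p)\<bar> * plateau T (fst p) * B (snd p))) \<le> st ?F1 (\<rho> p) (u p) * (5 * Cs * plateau T (fst p) * B (snd p))"
            by simp
        qed
      qed simp
      then show ?thesis by simp
    qed
    let ?Fb = "\<lambda>v c. \<bar>qv (\<lambda>s. s\<^sup>2) v c\<bar>"
    let ?m = "\<lambda>p. \<rho> p * u p * B (snd p)"
    \<comment> \<open>Here \<open>k\<close> is close to \<open>1\<close> near the origin, so
      smallness has to come from the flux: it is at most \<open>8 * \<bar>v\<bar>\<close> times a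
      quadratic factor, which the fixed solution bounds, and leaves the momentum.\<close>
    have err2: "(\<lambda>m'. (\<integral>p. st ?Fb (\<rho> p) (u p) * (k (snd p) * \<bar>deriv (g m') (snd p)\<bar> * plateau T (fst p) * B (snd p)) \<partial>lebesgue_on ?S)) \<longlonglongrightarrow> 0"
    proof -
      obtain Cn where Cn: "0 \<le> Cn" "AE p in lebesgue_on ?S. st ?Fb (\<rho> p) (u p) \<le> Cn * \<bar>\<rho> p\<bar>"
        by (rule st_AE_bound[OF continuous_flux_abs(2) _ M0(2)], simp, rule that)
      have c2: "continuous_on UNIV (\<lambda>p :: real \<times> real. (fst p)\<^sup>2 + (snd p)\<^sup>2)" by (intro continuous_intros)
      obtain Cq where Cq: "0 \<le> Cq" "AE p in lebesgue_on ?S. st (\<lambda>v c. v\<^sup>2 + c\<^sup>2) (\<rho> p) (u p) \<le> Cq * \<bar>\<rho> p\<bar>"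
        by (rule st_AE_bound[OF c2 _ M0(2)], simp, rule that)
      \<comment> \<open>The region of the inner transition during the support of the time cutoff, of
        the form used in \<open>vanishes_at_origin\<close> with \<open>3 / N m'\<close> for the
        width.\<close>
      let ?D = "\<lambda>m'. {0..2 * T} \<times> {0<..<3 / N m'}"
      define c where "c m' = 8 * Cq * N m' * Cs" for m'
      have c0': "0 \<le> c m'" for m' using Cq(1) N[of m'] Cs(1) by (simp add: c_def)
      have mm: "?m \<in> borel_measurable (lebesgue_on ?S)"
        by (rule borel_measurable_times[OF borel_measurable_times[OF meas] Am])
      have Dm: "?D m' \<in> sets lebesgue" for m' by (rule strip_lebesgue)
      have DS: "?D m' \<subseteq> ?S" for m' by auto
      have indm: "(\<lambda>p. indicator (?D m') p :: real) \<in> borel_measurable (lebesgue_on ?S)" for m'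
        by (rule measurable_restrict_space1) (use Dm in simp)
      have am: "(\<lambda>p. \<bar>?m p\<bar> * indicator (?D m') p) \<in> borel_measurable (lebesgue_on ?S)" for m'
        by (rule borel_measurable_times[OF borel_measurable_abs[OF mm] indm])
      have ai: "integrable (lebesgue_on ?S) (\<lambda>p. \<bar>?m p\<bar> * indicator (?D m') p)" for m'
      proof (rule integrableI_nonneg[OF am])
        show "AE p in lebesgue_on ?S. 0 \<le> \<bar>?m p\<bar> * indicator (?D m') p" by (rule AE_I2) simp
        have Fm: "(\<lambda>p. ennreal (\<bar>\<rho> p\<bar> * B (snd p)) * indicator {0..2 * T} (fst p)) \<in> borel_measurable (lebesgue_on ?S)"
        proof -
          have "(\<lambda>p. ennreal (\<bar>\<rho> p\<bar> * B (snd p))) \<in> borel_measurable (lebesgue_on ?S)"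
            using borel_measurable_times[OF borel_measurable_abs[OF meas(1)] Am] by measurable
          then show ?thesis using measurable_time_indicator[of "2 * T" ?S] by measurable
        qed
        have "(\<integral>\<^sup>+p. ennreal (\<bar>?m p\<bar> * indicator (?D m') p) \<partial>lebesgue_on ?S)
            \<le> (\<integral>\<^sup>+p. ennreal M0 * (ennreal (\<bar>\<rho> p\<bar> * B (snd p)) * indicator {0..2 * T} (fst p)) \<partial>lebesgue_on ?S)"
        proof (rule nn_integral_mono_AE)
          show "AE p in lebesgue_on ?S. ennreal (\<bar>?m p\<bar> * indicator (?D m') p) \<le> ennreal M0 * (ennreal (\<bar>\<rho> p\<bar> * B (snd p)) * indicator {0..2 * T} (fst p))"
            using M0(2) pS
          proof eventually_elim
            case (elim p)
            show ?case
            proof (cases "p \<in> ?D m'")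
              case True
              have B0: "0 < B (snd p)" using elim(2) by (intro Bp(1)) auto
              have "\<bar>u p\<bar> * (\<bar>\<rho> p\<bar> * B (snd p)) \<le> M0 * (\<bar>\<rho> p\<bar> * B (snd p))"
                using elim(1) B0 by (intro mult_right_mono) auto
              then have "\<bar>?m p\<bar> \<le> M0 * (\<bar>\<rho> p\<bar> * B (snd p))" using B0 by (simp add: abs_mult mult.assoc mult.left_commute)
              then have "ennreal \<bar>?m p\<bar> \<le> ennreal (M0 * (\<bar>\<rho> p\<bar> * B (snd p)))" by (rule ennreal_leI)
              also have "\<dots> = ennreal M0 * ennreal (\<bar>\<rho> p\<bar> * B (snd p))" by (rule ennreal_mult'[OF M0(1)])
              moreover have "fst p \<in> {0..2 * T}" using True by auto
              ultimately show ?thesis using True by simp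
            qed simp
          qed
        qed
        also have "\<dots> = ennreal M0 * (\<integral>\<^sup>+p. (ennreal (\<bar>\<rho> p\<bar> * B (snd p)) * indicator {0..2 * T} (fst p)) \<partial>lebesgue_on ?S)"
          by (rule nn_integral_cmult[OF Fm])
        also have "\<dots> \<le> ennreal M0 * ennreal R" by (rule mult_left_mono[OF mst]) simp
        also have "\<dots> < \<infinity>" by (simp flip: ennreal_mult'' add: R0)
        finally show "(\<integral>\<^sup>+p. ennreal (\<bar>?m p\<bar> * indicator (?D m') p) \<partial>lebesgue_on ?S) < \<infinity>" .
      qed
      let ?far = "\<lambda>m' p. st ?Fb (\<rho> p) (u p) * (2 * Cs / N m' * plateau T (fst p) * B (snd p))"
      have e0: "0 \<le> 2 * Cs / N m'" for m' using Cs(1) N[of m'] by simp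
      have cc: "continuous_on UNIV (\<lambda>x::real. 2 * Cs / N m')" for m' by (rule continuous_on_const)
      have far: "(\<integral>p. ?far m' p \<partial>lebesgue_on ?S) \<le> Cn * (2 * Cs / N m') * R" "integrable (lebesgue_on ?S) (?far m')" for m'
      proof -
        note * = st_integral_le[where b = "2 * Cs / N m'", OF S continuous_flux_abs(2) _ meas Cn(2,1) wm[OF cc[of m']] w0[of "\<lambda>x. 2 * Cs / N m'"] wle[of "\<lambda>x. 2 * Cs / N m'"] e0 mst R0 Am]
        show "(\<integral>p. ?far m' p \<partial>lebesgue_on ?S) \<le> Cn * (2 * Cs / N m') * R" by (rule *(1)) (use e0 in simp_all)
        show "integrable (lebesgue_on ?S) (?far m')" by (rule *(3)) (use e0 in simp_all)
      qed
      let ?G = "\<lambda>m' p. st ?Fb (\<rho> p) (u p) * (k (snd p) * \<bar>deriv (g m') (snd p)\<bar> * plateau T (fst p) * B (snd p))"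
      have nn: "0 \<le> ?G m' p" if "p \<in> ?S" for m' p
      proof -
        have "0 < snd p" using that by auto
        from hb(4)[OF this] have "0 \<le> k (snd p) * \<bar>deriv (g m') (snd p)\<bar>" by simp
        from w0[of "\<lambda>x. k x * \<bar>deriv (g m') x\<bar>", OF this that] show ?thesis by (simp add: st_def)
      qed
      have ptw: "AE p in lebesgue_on ?S. ?G m' p \<le> c m' * (\<bar>?m p\<bar> * indicator (?D m') p) + ?far m' p" for m'
        using Cq(2) pS
      proof eventually_elim
        case (elim p)
        have x: "0 < snd p" using elim(2) by auto
        have B0: "0 < B (snd p)" by (rule Bp(1)[OF x])
        let ?s = "st ?Fb (\<rho> p) (u p)" and ?b = "plateau T (fst p) * B (snd p)"
        have s0: "0 \<le> ?s" by (simp add: st_def)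
        have "k (snd p) * \<bar>deriv (g m') (snd p)\<bar> \<le> 1 * (N m' * Cs * indicator {..<3 / N m'} (snd p) + 2 * Cs / N m')"
          using hb[OF x] dg[of m' "snd p"] by (intro mult_mono) auto
        then have "k (snd p) * \<bar>deriv (g m') (snd p)\<bar> * ?b \<le> (N m' * Cs * indicator {..<3 / N m'} (snd p) + 2 * Cs / N m') * ?b"
          using tb(2)[OF elim(2)] by (intro mult_right_mono) auto
        then have "?s * (k (snd p) * \<bar>deriv (g m') (snd p)\<bar> * ?b) \<le> ?s * ((N m' * Cs * indicator {..<3 / N m'} (snd p) + 2 * Cs / N m') * ?b)"
          by (rule mult_left_mono[OF _ s0])
        moreover have "?s * (k (snd p) * \<bar>deriv (g m') (snd p)\<bar> * ?b) = ?G m' p" by (simp add: mult.assoc)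
        moreover have "?s * ((N m' * Cs * indicator {..<3 / N m'} (snd p) + 2 * Cs / N m') * ?b) = ?s * (N m' * Cs * indicator {..<3 / N m'} (snd p) * ?b) + ?far m' p"
          by (simp only: distrib_right distrib_left mult.assoc)
        moreover have "?s * (N m' * Cs * indicator {..<3 / N m'} (snd p) * ?b) \<le> c m' * (\<bar>?m p\<bar> * indicator (?D m') p)"
        proof (cases "snd p < 3 / N m' \<and> fst p \<le> 2 * T")
          case True
          then have pD: "p \<in> ?D m'" using elim(2) x by (cases p) auto
          let ?c = "\<rho> p powr theta \<gamma>"
          have "?s \<le> \<bar>\<rho> p\<bar> * (8 * \<bar>u p\<bar> * ((u p)\<^sup>2 + ?c\<^sup>2))"
            unfolding st_def by (intro mult_left_mono qv_square_abs_le) auto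
          also have "\<dots> = 8 * \<bar>u p\<bar> * st (\<lambda>v c. v\<^sup>2 + c\<^sup>2) (\<rho> p) (u p)" by (simp add: st_def)
          also have "\<dots> \<le> 8 * \<bar>u p\<bar> * (Cq * \<bar>\<rho> p\<bar>)" by (rule mult_left_mono[OF elim(1)]) simp
          finally have s: "?s \<le> 8 * \<bar>u p\<bar> * (Cq * \<bar>\<rho> p\<bar>)" .
          have "?b \<le> 1 * B (snd p)" by (rule mult_right_mono[OF plateau_bounds(2) less_imp_le[OF B0]])
          then have "?b \<le> B (snd p)" by simp
          then have "N m' * Cs * ?b \<le> N m' * Cs * B (snd p)" using N[of m'] Cs(1) by (intro mult_left_mono) auto
          then have "?s * (N m' * Cs * ?b) \<le> (8 * \<bar>u p\<bar> * (Cq * \<bar>\<rho> p\<bar>)) * (N m' * Cs * B (snd p))"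
            using s s0 tb(2)[OF elim(2)] N[of m'] Cs(1) Cq(1) by (intro mult_mono) auto
          also have "\<dots> = c m' * \<bar>?m p\<bar>" using B0 by (simp add: c_def abs_mult)
          finally show ?thesis using True pD by simp
        next
          case False
          have "indicator {..<3 / N m'} (snd p) * ?b = 0"
          proof (cases "snd p < 3 / N m'")
            case True
            then have "fst p \<notin> {-(2*T)..2*T}" using False by auto
            then show ?thesis by (simp add: plateau_0[OF T])
          qed simp
          then have "N m' * Cs * indicator {..<3 / N m'} (snd p) * ?b = 0" by (simp only: mult.assoc mult_zero_right)
          then have "?s * (N m' * Cs * indicator {..<3 / N m'} (snd p) * ?b) = 0" by (simp only: mult_zero_right)
          moreover have "0 \<le> c m' * (\<bar>?m p\<bar> * indicator (?D m') p)" by (rule mult_nonneg_nonneg[OF c0']) simp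
          ultimately show ?thesis by linarith
        qed
        ultimately show ?case by linarith
      qed
      \<comment> \<open>The slope \<open>N m'\<close> is three times the reciprocal of the width
        \<open>3 / N m'\<close>, so that \<open>8\<close> becomes \<open>24\<close> and the first
        term is a multiple of the average that the boundary condition sends to zero.\<close>
      have up: "integral\<^sup>L (lebesgue_on ?S) (?G m') \<le> 24 * Cq * Cs * (1 / (3 / N m') * (\<integral>p. \<bar>?m p\<bar> \<partial>lebesgue_on (?D m'))) + Cn * R * (2 * Cs / N m')" for m'
      proof -
        have "integral\<^sup>L (lebesgue_on ?S) (?G m') \<le> (\<integral>p. c m' * (\<bar>?m p\<bar> * indicator (?D m') p) + ?far m' p \<partial>lebesgue_on ?S)"
        proof (rule integral_mono_AE'[OF _ ptw])
          show "integrable (lebesgue_on ?S) (\<lambda>p. c m' * (\<bar>?m p\<bar> * indicator (?D m') p) + ?far m' p)"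
            by (rule Bochner_Integration.integrable_add[OF integrable_mult_right[OF ai] far(2)])
          show "AE p in lebesgue_on ?S. 0 \<le> c m' * (\<bar>?m p\<bar> * indicator (?D m') p) + ?far m' p"
            using pS ptw[of m']
          proof eventually_elim
            case (elim p)
            show ?case by (rule order_trans[OF nn[OF elim(1)] elim(2)])
          qed
        qed
        also have "\<dots> = (\<integral>p. c m' * (\<bar>?m p\<bar> * indicator (?D m') p) \<partial>lebesgue_on ?S) + (\<integral>p. ?far m' p \<partial>lebesgue_on ?S)"
          by (rule Bochner_Integration.integral_add[OF integrable_mult_right[OF ai] far(2)])
        also have "(\<integral>p. c m' * (\<bar>?m p\<bar> * indicator (?D m') p) \<partial>lebesgue_on ?S) = c m' * (\<integral>p. \<bar>?m p\<bar> * indicator (?D m') p \<partial>lebesgue_on ?S)"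
          by (rule Bochner_Integration.integral_mult_right_zero)
        also have "(\<integral>p. \<bar>?m p\<bar> * indicator (?D m') p \<partial>lebesgue_on ?S) = (\<integral>p. \<bar>?m p\<bar> \<partial>lebesgue_on (?D m'))"
          by (rule integral_lebesgue_on_indicator[OF S Dm DS])
        finally have "integral\<^sup>L (lebesgue_on ?S) (?G m') \<le> c m' * (\<integral>p. \<bar>?m p\<bar> \<partial>lebesgue_on (?D m')) + (\<integral>p. ?far m' p \<partial>lebesgue_on ?S)" .
        moreover have "c m' * (\<integral>p. \<bar>?m p\<bar> \<partial>lebesgue_on (?D m')) = 24 * Cq * Cs * (1 / (3 / N m') * (\<integral>p. \<bar>?m p\<bar> \<partial>lebesgue_on (?D m')))"
          by (simp add: c_def)
        moreover have "Cn * (2 * Cs / N m') * R = Cn * R * (2 * Cs / N m')" by simp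
        ultimately show ?thesis using far(1)[of m'] by linarith
      qed
      have T2: "0 < 2 * T" using T by simp
      have "N m' \<noteq> 0" for m' using N(1)[of m'] by simp
      then have "filterlim (\<lambda>m'. 3 / N m') (at_right 0) sequentially"
        unfolding filterlim_at using Ninv[of 3] N(1) by (intro conjI always_eventually) auto
      from filterlim_compose[OF van[unfolded vanishes_at_origin_def, rule_format, OF T2] this]
      have "(\<lambda>m'. 1 / (3 / N m') * (\<integral>p. \<bar>?m p\<bar> \<partial>lebesgue_on (?D m'))) \<longlonglongrightarrow> 0" .
      then have "(\<lambda>m'. 24 * Cq * Cs * (1 / (3 / N m') * (\<integral>p. \<bar>?m p\<bar> \<partial>lebesgue_on (?D m'))) + Cn * R * (2 * Cs / N m')) \<longlonglongrightarrow> 24 * Cq * Cs * 0 + Cn * R * 0"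
        by (intro tendsto_add tendsto_mult tendsto_const Ninv)
      then have lim: "(\<lambda>m'. 24 * Cq * Cs * (1 / (3 / N m') * (\<integral>p. \<bar>?m p\<bar> \<partial>lebesgue_on (?D m'))) + Cn * R * (2 * Cs / N m')) \<longlonglongrightarrow> 0"
        by (simp only: mult_zero_right add_0_right)
      have low: "0 \<le> integral\<^sup>L (lebesgue_on ?S) (?G m')" for m'
        by (rule integral_nonneg_AE) (use pS in eventually_elim, rule nn)
      show ?thesis
        by (rule tendsto_sandwich[OF always_eventually[OF allI[OF low]] always_eventually[OF allI[OF up]] tendsto_const lim])
    qed
    have gz: "g m' x = 0" if "x \<notin> {1 / N m'..2 * N m'}" for m' x
      unfolding g_def by (rule annulus_0[OF N(1) that])
    have sub: "{1 / N m'..2 * N m'} \<subseteq> ?O" for m' using N[of m'] by (auto intro: less_le_trans[of 0 "1 / N m'"])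
    have xpos: "0 < x" if "x \<in> {1 / N m'..2 * N m'}" for m' x using sub[of m'] that by auto
    have glim: "(\<lambda>m'. g m' x) \<longlonglongrightarrow> 1" if "x \<in> ?O" for x
    proof (rule tendsto_eventually)
      obtain n :: nat where n: "max x (2 / x) \<le> real n" using real_arch_simple by blast
      show "\<forall>\<^sub>F m' in sequentially. g m' x = 1"
      proof (rule eventually_sequentiallyI[of n])
        fix m' assume "n \<le> m'"
        then have "x \<le> N m'" "2 / x \<le> N m'" using n by (auto simp: N_def)
        then show "g m' x = 1" unfolding g_def using that N[of m'] by (intro annulus_1) (simp_all add: field_simps)
      qed
    qed
    have hd0: "0 \<le> deriv h x" for x by (simp add: hd)
    have \<delta>': "\<delta> x * B x \<le> c0 * deriv h x * B x - 128 * neg_part (deriv B x) * h x" if "0 < x" for x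
      using np[OF that] by (simp add: \<delta>_def hd)
    have \<kappa>': "C1 * deriv h x * B x + 128 * neg_part (deriv B x) * h x \<le> C1 * B x" if "0 < x" for x
    proof -
      have "deriv h x * B x \<le> 1 * B x" using that Bp(1)[OF that] by (intro mult_right_mono) (auto simp: hd)
      then have "C1 * (deriv h x * B x) \<le> C1 * B x" using C1 mult_left_mono[of "deriv h x * B x" "B x" C1] by simp
      then show ?thesis using np[OF that] by (simp add: mult.assoc)
    qed
    have fin: "(\<integral>\<^sup>+p. ennreal (st cubic (\<rho> p) (u p) * (\<delta> (snd p) * plateau T (fst p) * B (snd p))) \<partial>lebesgue_on ?S) \<le> ennreal K"
      unfolding K_def
      by (rule higher_integrability_limit[where g = g and h = "\<lambda>m. h" and k = "\<lambda>m. k" and xl = "\<lambda>m. 1 / N m" and xr = "\<lambda>m. 2 * N m" and Hm = 1 and \<delta> = \<delta> and \<kappa> = C1 and Mb = M0,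
          OF U refl S Bc Bp(1) meas M0(1,2) measi M0(3) sol T _ _ _ gz sub glim hs hb(1)[OF xpos] hb(2)[OF xpos] hd0 ks hb(4)[OF xpos] hb(5)[OF xpos] kd _ co \<delta>c \<delta>0 \<delta>'[OF xpos] C1 \<kappa>'[OF xpos] I I0 R1
            err1 err2])
        (auto simp: g_def annulus_bounds smooth_annulus)
    have Dsub: "{0..T} \<times> ({-L..L} \<inter> ?O) \<subseteq> ?S" by (rule Sigma_mono) auto
    show "(\<integral>\<^sup>+p. ennreal (st cubic (\<rho> p) (u p) * B (snd p)) \<partial>lebesgue_on ({0..T} \<times> ({-L..L} \<inter> ?O))) \<le> ennreal (K / d0)"
    proof (rule nn_integral_lebesgue_on_subset_le[OF S _ Dsub _ fin d0 K0])
      show "(\<lambda>p. st cubic (\<rho> p) (u p) * (\<delta> (snd p) * plateau T (fst p) * B (snd p))) \<in> borel_measurable (lebesgue_on ?S)"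
        by (rule borel_measurable_times[OF measurable_st[OF continuous_cubic meas] wm[OF \<delta>c]])
      have "closed ({0..T} \<times> {-L..L})" by (intro closed_Times) auto
      then have "({0..T} \<times> {-L..L}) \<inter> ?S \<in> sets lebesgue" using S by (intro sets.Int) simp_all
      moreover have "({0..T} \<times> {-L..L}) \<inter> ?S = {0..T} \<times> ({-L..L} \<inter> ?O)" by auto
      ultimately show "{0..T} \<times> ({-L..L} \<inter> ?O) \<in> sets lebesgue" by simp
      fix p assume p: "p \<in> {0..T} \<times> ({-L..L} \<inter> ?O)"
      then have x: "0 < snd p" "snd p \<le> L" by auto
      have "d0 \<le> \<delta> (snd p)" using c0 x by (simp add: d0_def \<delta>_def)
      moreover have "plateau T (fst p) = 1" by (rule plateau_1[OF T]) (use p in auto)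
      moreover have "0 \<le> st cubic (\<rho> p) (u p) * B (snd p)" using Bp(1)[OF x(1)] by (simp add: st_def cubic_def)
      ultimately show "d0 * (st cubic (\<rho> p) (u p) * B (snd p)) \<le> st cubic (\<rho> p) (u p) * (\<delta> (snd p) * plateau T (fst p) * B (snd p))"
        using mult_right_mono[of d0 "\<delta> (snd p)" "st cubic (\<rho> p) (u p) * B (snd p)"] by (simp add: mult.commute mult.left_commute)
    qed
  qed
qed

end

section \<open>Uniform higher integrability\<close>

lemma Omega_lebesgue: "Omega G \<in> sets lebesgue"
  by (cases G) auto

lemma continuous_area: "admissible G \<Longrightarrow> continuous_on (Omega G) (area G)"
  unfolding admissible_def
  by (intro continuous_at_imp_continuous_on ballI differentiable_imp_continuous_within) blast

lemma area_pos: "admissible G \<Longrightarrow> x \<in> Omega G \<Longrightarrow> 0 < area G x"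
  by (cases G) (auto simp: admissible_def intro: less_le_trans)

lemma area_n_DERIV:
  assumes "G = Spherical \<alpha>" "0 < x"
  shows "(area_n G n has_real_derivative \<alpha> * (x + 1 / real n) powr (\<alpha> - 1)) (at x)"
proof -
  have p: "0 < x + 1 / real n" using assms(2) by (simp add: add_pos_nonneg)
  have d: "((\<lambda>x. x + 1 / real n) has_real_derivative 1) (at x)" by (auto intro!: derivative_eq_intros)
  have "((\<lambda>x. (x + 1 / real n) powr \<alpha>) has_real_derivative \<alpha> * (x + 1 / real n) powr (\<alpha> - 1) * 1) (at x)"
    by (rule DERIV_chain2[OF has_real_derivative_powr[OF p] d])
  moreover have "area_n G n = (\<lambda>x. (x + 1 / real n) powr \<alpha>)" using assms(1) by (simp add: fun_eq_iff)
  ultimately show ?thesis by simp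
qed

lemma area_n_deriv:
  assumes "admissible G" "G = Spherical \<alpha>"
  shows "continuous_on {0<..} (deriv (area_n G n))" "0 < x \<Longrightarrow> 0 \<le> deriv (area_n G n) x"
proof -
  have d: "deriv (area_n G n) x = \<alpha> * (x + 1 / real n) powr (\<alpha> - 1)" if "0 < x" for x
    by (rule DERIV_imp_deriv[OF area_n_DERIV[OF assms(2) that]])
  have \<alpha>: "0 < \<alpha>" using assms by (simp add: admissible_def)
  show "0 \<le> deriv (area_n G n) x" if "0 < x" using \<alpha> by (simp add: d[OF that])
  have "continuous_on {0<..} (\<lambda>x. \<alpha> * (x + 1 / real n) powr (\<alpha> - 1))"
  proof (intro continuous_intros ballI)
    fix x :: real assume "x \<in> {0<..}"
    then have "0 < x + 1 / real n" by (simp add: add_pos_nonneg)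
    then show "x + 1 / real n \<noteq> 0" by simp
  qed
  then show "continuous_on {0<..} (deriv (area_n G n))"
    by (rule continuous_on_eq) (simp add: d)
qed

lemma continuous_area_n: "admissible G \<Longrightarrow> continuous_on (Omega G) (area_n G n)"
proof (cases G)
  case (Nozzle A)
  assume "admissible G"
  from continuous_area[OF this] show ?thesis using Nozzle by simp
next
  case (Spherical \<alpha>)
  then show ?thesis
    by (intro continuous_at_imp_continuous_on ballI DERIV_isCont[OF area_n_DERIV[OF Spherical]]) simp
qed

text \<open>In spherical symmetry the shift enlarges the area. This order is what the lower
  semicontinuity of the cubic moment rests on.\<close>

lemma area_le_area_n: "admissible G \<Longrightarrow> x \<in> Omega G \<Longrightarrow> area G x \<le> area_n G n x"
  by (cases G) (auto simp: admissible_def intro!: powr_mono2)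

lemma area_n_bounded:
  assumes "admissible G"
  obtains b where "0 \<le> b" "\<And>n x. 1 \<le> n \<Longrightarrow> x \<in> Omega G \<Longrightarrow> \<bar>x\<bar> \<le> L \<Longrightarrow> area_n G n x \<le> b"
proof (cases G)
  case (Nozzle A)
  then obtain lo hi where "0 < lo" "lo < hi" "\<And>x. A x \<le> hi"
    using assms by (auto simp: admissible_def)
  then show ?thesis using Nozzle by (intro that[of hi]) auto
next
  case (Spherical \<alpha>)
  then have \<alpha>: "0 < \<alpha>" using assms by (simp add: admissible_def)
  have "(x + 1 / real n) powr \<alpha> \<le> (\<bar>L\<bar> + 1) powr \<alpha>" if "1 \<le> n" "0 < x" "\<bar>x\<bar> \<le> L" for n x
  proof -
    have "1 / real n \<le> 1" using that(1) by simp
    then have "x + 1 / real n \<le> \<bar>L\<bar> + 1" using that(3) by linarith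
    then show ?thesis using that \<alpha> by (intro powr_mono2) (auto simp del: One_nat_def)
  qed
  then show ?thesis using Spherical by (intro that[of "(\<bar>L\<bar> + 1) powr \<alpha>"]) auto
qed

text \<open>For \<open>\<alpha> < 1\<close> the power has infinite slope at the origin, so
  uniformity is drawn from uniform continuity on a compact interval that contains \<open>0\<close>
  and all shifted points.\<close>

lemma uniform_limit_area_n:
  assumes "admissible G" "X \<subseteq> {x \<in> Omega G. \<bar>x\<bar> \<le> L}"
  shows "uniform_limit X (area_n G) (area G) sequentially"
proof (cases G)
  case (Nozzle A)
  then have "area_n G n = area G" for n by (simp add: fun_eq_iff)
  then show ?thesis by (intro uniform_limitI) simp
next
  case (Spherical \<alpha>)
  then have \<alpha>: "0 < \<alpha>" using assms by (simp add: admissible_def)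
  have "continuous_on {0..\<bar>L\<bar> + 1} (\<lambda>x::real. x powr \<alpha>)"
    using \<alpha> by (intro continuous_on_powr' continuous_intros) auto
  then have uc: "uniformly_continuous_on {0..\<bar>L\<bar> + 1} (\<lambda>x::real. x powr \<alpha>)"
    by (rule compact_uniformly_continuous) simp
  show ?thesis
  proof (rule uniform_limitI)
    fix e :: real assume "0 < e"
    with uc obtain d where d: "0 < d" and dd: "\<And>x x'. x \<in> {0..\<bar>L\<bar> + 1} \<Longrightarrow> x' \<in> {0..\<bar>L\<bar> + 1} \<Longrightarrow> dist x' x < d \<Longrightarrow> dist (x' powr \<alpha>) (x powr \<alpha>) < e"
      unfolding uniformly_continuous_on_def by meson
    obtain n0 :: nat where n0: "1 / d < real n0" using reals_Archimedean2 by blast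
    show "\<forall>\<^sub>F n in sequentially. \<forall>x\<in>X. dist (area_n G n x) (area G x) < e"
    proof (rule eventually_sequentiallyI[of "max 1 n0"], rule ballI)
      fix n x assume n: "max 1 n0 \<le> n" and "x \<in> X"
      then have x: "0 < x" "x \<le> \<bar>L\<bar>" using assms(2) Spherical by auto
      have "1 / d < real n" using n n0 by linarith
      then have "1 / real n < d" using d n by (simp add: field_simps)
      moreover have "1 / real n \<le> 1" using n by simp
      ultimately have "dist ((x + 1 / real n) powr \<alpha>) (x powr \<alpha>) < e"
        using x by (intro dd) (auto simp: dist_real_def)
      then show "dist (area_n G n x) (area G x) < e" using Spherical by simp
    qed
  qed
qed

text \<open>The set where the bound fails is open and null, hence empty. It upgrades the essential
  bound on the negative part of the derivative of the nozzle area.\<close>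

lemma AE_le_continuous_imp_le:
  fixes f :: "real \<Rightarrow> real"
  assumes f: "continuous_on UNIV f" and ae: "AE x in lebesgue. f x \<le> C"
  shows "f x \<le> C"
proof -
  have op: "open {x. C < f x}"
    by (rule open_Collect_less[OF continuous_on_const f])
  have "{x \<in> space lebesgue. \<not> f x \<le> C} = {x. C < f x}" by auto
  moreover have "{x. C < f x} \<in> sets lebesgue" using op by simp
  ultimately have "{x. C < f x} \<in> null_sets lebesgue"
    using ae AE_iff_null[of lebesgue "\<lambda>x. f x \<le> C"] by simp
  then have "{x. C < f x} = {}"
    using open_not_negligible[OF op] by (auto simp: negligible_iff_null_sets)
  then show ?thesis using not_le by blast
qed

section \<open>From the hypotheses to a bound uniform in the sequence\<close>

context exponent
begin

text \<open>The quantities \<open>m\<close> and \<open>I0\<close> come from the limiting data: the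
  mass is prescribed and conserved, and the initial energy is at most twice that of the
  limit.\<close>

lemma approximate_bounded_solution:
  assumes G: "admissible G" and fin: "finite_energy_data \<gamma> G \<rho>0 u0"
    and ad: "approximate_data \<gamma> G \<rho>0 u0 \<rho>i ui" and as: "approximate_solutions \<gamma> G \<rho>i ui \<rho> u"
  obtains m I0 where "0 \<le> m" "0 \<le> I0"
    "\<And>n. 1 \<le> n \<Longrightarrow> bounded_solution (Omega G) (area_n G n) m I0 (\<rho>i n) (ui n) (\<rho> n) (u n)"
proof -
  let ?M = "mass (Omega G) (area G) \<rho>0" and ?E = "energy \<gamma> (Omega G) (area G) \<rho>0 u0"
  have M: "?M = ennreal (enn2real ?M)" and E: "?E = ennreal (enn2real ?E)"
    using fin by (simp_all add: finite_energy_data_def)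
  \<comment> \<open>The first summand turns half of \<open>\<rho> v^2\<close> into the whole, the
    second turns the internal energy into at least \<open>\<rho> powr \<gamma>\<close>.\<close>
  define k where "k = 2 + (\<gamma> - 1) / kappa \<gamma>"
  have kp: "0 < kappa \<gamma>" using gamma_gt by (simp add: kappa_def theta_def)
  have k: "2 \<le> k" using kp gamma_gt by (simp add: k_def)
  have k': "1 \<le> k * (kappa \<gamma> / (\<gamma> - 1))"
  proof -
    have "((\<gamma> - 1) / kappa \<gamma>) * (kappa \<gamma> / (\<gamma> - 1)) \<le> k * (kappa \<gamma> / (\<gamma> - 1))"
      using kp gamma_gt by (intro mult_right_mono) (auto simp: k_def)
    then show ?thesis using kp gamma_gt by simp
  qed
  define I0 where "I0 = enn2real ?M + k * (2 * enn2real ?E)"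
  have I0: "0 \<le> I0" using k by (simp add: I0_def)
  show thesis
  proof (rule that[of "enn2real ?M" I0])
    show "0 \<le> enn2real ?M" "0 \<le> I0" using I0 by simp_all
    fix n :: nat assume n: "1 \<le> n"
    let ?O = "Omega G" and ?B = "area_n G n"
    let ?S = "{0..} \<times> ?O"
    have d: "\<rho>i n \<in> borel_measurable (lebesgue_on ?O)" "ui n \<in> borel_measurable (lebesgue_on ?O)"
      "AE x in lebesgue_on ?O. 0 \<le> \<rho>i n x"
      "\<exists>C. AE x in lebesgue_on ?O. \<bar>\<rho>i n x\<bar> \<le> C \<and> \<bar>ui n x\<bar> \<le> C"
      "mass ?O ?B (\<rho>i n) = ?M" "energy \<gamma> ?O ?B (\<rho>i n) (ui n) \<le> 2 * ?E"
      using ad n unfolding approximate_data_def by simp_all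
    have s: "\<rho> n \<in> borel_measurable (lebesgue_on ?S)" "u n \<in> borel_measurable (lebesgue_on ?S)"
      "AE p in lebesgue_on ?S. 0 \<le> \<rho> n p" "entropy_solution \<gamma> ?O ?B (\<rho>i n) (ui n) (\<rho> n) (u n)"
      "\<exists>C. AE p in lebesgue_on ?S. \<bar>\<rho> n p\<bar> \<le> C \<and> \<bar>u n p\<bar> \<le> C"
      "AE t in lebesgue_on {0..}. mass ?O ?B (\<lambda>x. \<rho> n (t, x)) = mass ?O ?B (\<rho>i n)"
      using as n unfolding approximate_solutions_def spacetime_def by simp_all
    obtain Ca where Ca: "AE x in lebesgue_on ?O. \<bar>\<rho>i n x\<bar> \<le> Ca \<and> \<bar>ui n x\<bar> \<le> Ca" using d(4) by (rule exE)
    obtain Cb where Cb: "AE p in lebesgue_on ?S. \<bar>\<rho> n p\<bar> \<le> Cb \<and> \<bar>u n p\<bar> \<le> Cb" using s(5) by (rule exE)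
    define M0 where "M0 = max 0 (max Ca Cb)"
    have M0: "0 \<le> M0" by (simp add: M0_def)
    have 1: "AE p in lebesgue_on ?S. \<bar>\<rho> n p\<bar> \<le> M0 \<and> \<bar>u n p\<bar> \<le> M0"
      using Cb by eventually_elim (auto simp: M0_def)
    have 2: "AE x in lebesgue_on ?O. \<bar>\<rho>i n x\<bar> \<le> M0 \<and> \<bar>ui n x\<bar> \<le> M0"
      using Ca by eventually_elim (auto simp: M0_def)
    have 3: "AE t in lebesgue_on {0..}. mass ?O ?B (\<lambda>x. \<rho> n (t, x)) \<le> ennreal (enn2real ?M)"
      using s(6) by eventually_elim (use d(5) M in simp)
    have Bm: "?B \<in> borel_measurable (lebesgue_on ?O)"
      by (rule continuous_imp_measurable_on_sets_lebesgue[OF continuous_area_n[OF G] Omega_lebesgue])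
    let ?e = "\<lambda>x. (1/2 * \<rho>i n x * (ui n x)\<^sup>2 + internal_energy \<gamma> (\<rho>i n x)) * ?B x"
    have m1: "(\<lambda>x. \<rho>i n x * ?B x) \<in> borel_measurable (lebesgue_on ?O)" using d(1) Bm by measurable
    have m2: "?e \<in> borel_measurable (lebesgue_on ?O)"
      unfolding internal_energy_def using d(1,2) Bm by measurable
    have xO: "AE x in lebesgue_on ?O. x \<in> ?O" by (rule AE_I2) simp
    have "(\<integral>\<^sup>+x. ennreal (st quad (\<rho>i n x) (ui n x) * ?B x) \<partial>lebesgue_on ?O)
        \<le> (\<integral>\<^sup>+x. ennreal (\<rho>i n x * ?B x) + ennreal k * ennreal (?e x) \<partial>lebesgue_on ?O)"
    proof (rule nn_integral_mono_AE)
      show "AE x in lebesgue_on ?O. ennreal (st quad (\<rho>i n x) (ui n x) * ?B x) \<le> ennreal (\<rho>i n x * ?B x) + ennreal k * ennreal (?e x)"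
        using d(3) xO
      proof eventually_elim
        case (elim x)
        let ?r = "\<rho>i n x" and ?v = "ui n x"
        have B0: "0 \<le> ?B x" using area_pos[OF G elim(2)] area_le_area_n[OF G elim(2), of n] by linarith
        have "(?r powr theta \<gamma>)\<^sup>2 = ?r powr (\<gamma> - 1)"
          by (simp add: theta_def power2_eq_square flip: powr_add)
        moreover have "?r * ?r powr (\<gamma> - 1) = ?r powr \<gamma>"
          using elim(1) powr_add[of ?r 1 "\<gamma> - 1"] by simp
        ultimately have sq: "st quad ?r ?v = ?r + ?r * ?v\<^sup>2 + ?r powr \<gamma>"
          using elim(1) by (simp add: st_def quad_def distrib_left)
        have a: "?r * ?v\<^sup>2 \<le> k * (1/2 * ?r * ?v\<^sup>2)"
          using mult_right_mono[OF k, of "1/2 * ?r * ?v\<^sup>2"] elim(1) by simp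
        have b: "?r powr \<gamma> \<le> k * internal_energy \<gamma> ?r"
          using mult_right_mono[OF k', of "?r powr \<gamma>"] by (simp add: internal_energy_def mult.assoc)
        have e0: "0 \<le> 1/2 * ?r * ?v\<^sup>2 + internal_energy \<gamma> ?r"
          using elim(1) kp gamma_gt by (simp add: internal_energy_def)
        have "st quad ?r ?v \<le> ?r + k * (1/2 * ?r * ?v\<^sup>2 + internal_energy \<gamma> ?r)"
          unfolding sq distrib_left[of k] using a b by linarith
        then have "st quad ?r ?v * ?B x \<le> (?r + k * (1/2 * ?r * ?v\<^sup>2 + internal_energy \<gamma> ?r)) * ?B x"
          by (rule mult_right_mono[OF _ B0])
        then have "st quad ?r ?v * ?B x \<le> ?r * ?B x + k * ?e x"
          unfolding distrib_right[of ?r] by (simp only: mult.assoc)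
        then have "ennreal (st quad ?r ?v * ?B x) \<le> ennreal (?r * ?B x + k * ?e x)" by (rule ennreal_leI)
        also have "\<dots> = ennreal (?r * ?B x) + ennreal (k * ?e x)"
          using elim(1) B0 e0 k by (intro ennreal_plus) auto
        also have "ennreal (k * ?e x) = ennreal k * ennreal (?e x)"
          using k by (intro ennreal_mult') simp
        finally show ?case .
      qed
    qed
    also have "\<dots> = (\<integral>\<^sup>+x. ennreal (\<rho>i n x * ?B x) \<partial>lebesgue_on ?O) + (\<integral>\<^sup>+x. ennreal k * ennreal (?e x) \<partial>lebesgue_on ?O)"
      by (rule nn_integral_add) (use m1 m2 in measurable)
    also have "(\<integral>\<^sup>+x. ennreal k * ennreal (?e x) \<partial>lebesgue_on ?O) = ennreal k * energy \<gamma> ?O ?B (\<rho>i n) (ui n)"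
      unfolding energy_def by (rule nn_integral_cmult) (use m2 in measurable)
    also have "(\<integral>\<^sup>+x. ennreal (\<rho>i n x * ?B x) \<partial>lebesgue_on ?O) = ?M"
      using d(5) by (simp add: mass_def)
    also have "?M + ennreal k * energy \<gamma> ?O ?B (\<rho>i n) (ui n) \<le> ?M + ennreal k * (2 * ?E)"
      by (intro add_left_mono mult_left_mono d(6)) simp
    also have "\<dots> = ennreal I0"
    proof -
      have "2 * ?E = ennreal (2 * enn2real ?E)" by (subst E) (simp add: ennreal_mult)
      then have "ennreal k * (2 * ?E) = ennreal (k * (2 * enn2real ?E))" using k by (simp add: ennreal_mult)
      then have "?M + ennreal k * (2 * ?E) = ennreal (enn2real ?M) + ennreal (k * (2 * enn2real ?E))" using M by simp
      also have "\<dots> = ennreal I0" unfolding I0_def by (rule ennreal_plus[symmetric]) (use k in simp_all)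
      finally show ?thesis .
    qed
    finally have 4: "(\<integral>\<^sup>+x. ennreal (st quad (\<rho>i n x) (ui n x) * ?B x) \<partial>lebesgue_on ?O) \<le> ennreal I0" .
    show "bounded_solution ?O ?B (enn2real ?M) I0 (\<rho>i n) (ui n) (\<rho> n) (u n)"
      unfolding bounded_solution_def
      by (intro conjI exI[of _ M0] s(1-4) d(1,2) M0 1 2 3 4)
  qed
qed

text \<open>In the nozzle the area does not depend on \<open>n\<close>; in spherical symmetry
  \<open>spherical_bound\<close> is uniform over all increasing areas. In both cases one constant
  serves the whole sequence.\<close>

lemma uniform_cubic_bound:
  assumes G: "admissible G" and fin: "finite_energy_data \<gamma> G \<rho>0 u0"
    and ad: "approximate_data \<gamma> G \<rho>0 u0 \<rho>i ui" and as: "approximate_solutions \<gamma> G \<rho>i ui \<rho> u"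
    and T: "0 < T" and L: "0 \<le> L"
  obtains C where "0 \<le> C"
    "\<And>n. 1 \<le> n \<Longrightarrow> (\<integral>\<^sup>+p. ennreal (st cubic (\<rho> n p) (u n p) * area_n G n (snd p)) \<partial>lebesgue_on ({0..T} \<times> ({-L..L} \<inter> Omega G))) \<le> ennreal C"
proof -
  obtain m I0 where mI: "0 \<le> m" "0 \<le> I0"
    and good: "\<And>n. 1 \<le> n \<Longrightarrow> bounded_solution (Omega G) (area_n G n) m I0 (\<rho>i n) (ui n) (\<rho> n) (u n)"
    by (rule approximate_bounded_solution[OF G fin ad as], rule that)
  show thesis
  proof (cases G)
    case (Nozzle A)
    obtain lo hi where lo: "0 < lo" "\<And>x. lo \<le> A x" using G Nozzle by (auto simp: admissible_def)
    have Ac: "continuous_on UNIV A" using continuous_area[OF G] Nozzle by simp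
    have aA: "area (Nozzle A) = A" by (simp add: fun_eq_iff)
    have A': "continuous_on UNIV (deriv A)"
      and ni: "integrable (lebesgue_on UNIV) (\<lambda>x. neg_part (deriv A x))"
      and nb: "\<exists>C. AE x in lebesgue_on UNIV. neg_part (deriv A x) \<le> C"
      using G unfolding Nozzle admissible_def aA Omega.simps by simp_all
    have nc: "continuous_on X (\<lambda>x. neg_part (deriv A x))" for X
      unfolding neg_part_def by (intro continuous_intros continuous_on_subset[OF A']) simp
    have n0: "0 \<le> neg_part b" for b by (simp add: neg_part_def)
    obtain nmax where "AE x in lebesgue_on UNIV. neg_part (deriv A x) \<le> nmax" using nb by (rule exE)
    then have "AE x in lebesgue. neg_part (deriv A x) \<le> nmax" by (subst (asm) AE_restrict_space_iff) simp_all
    from AE_le_continuous_imp_le[OF nc this] have nmax: "neg_part (deriv A x) \<le> nmax" for x .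
    have niU: "(\<lambda>x. neg_part (deriv A x)) integrable_on UNIV"
      by (rule integrable_on_lebesgue_on[OF ni]) simp
    \<comment> \<open>The integral over the line bounds those over all intervals, so the exponential
      weight is bounded independently of the interval on which it is built.\<close>
    have nint: "integral {-R..R} (\<lambda>x. neg_part (deriv A x)) \<le> integral UNIV (\<lambda>x. neg_part (deriv A x))" if "0 \<le> R" for R
      by (rule integral_subset_le[OF subset_UNIV integrable_continuous_interval[OF nc] niU ballI[OF n0]])
    obtain C where C: "0 \<le> C" "\<And>\<rho>i ui \<rho> u. bounded_solution UNIV A m I0 \<rho>i ui \<rho> u \<Longrightarrow>
      (\<integral>\<^sup>+p. ennreal (st cubic (\<rho> p) (u p) * A (snd p)) \<partial>lebesgue_on ({0..T} \<times> {-L..L})) \<le> ennreal C"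
      by (rule nozzle_bound[OF Ac A' lo(2,1) nmax nint mI T L], assumption, rule that)
    have aAn: "area_n (Nozzle A) n = A" for n by (simp add: fun_eq_iff)
    show thesis
    proof (rule that[OF C(1)])
      fix n :: nat assume "1 \<le> n"
      from C(2)[OF good[OF this, unfolded Nozzle aAn Omega.simps]]
      show "(\<integral>\<^sup>+p. ennreal (st cubic (\<rho> n p) (u n p) * area_n G n (snd p)) \<partial>lebesgue_on ({0..T} \<times> ({-L..L} \<inter> Omega G))) \<le> ennreal C"
        by (simp add: Nozzle)
    qed
  next
    case (Spherical \<alpha>)
    have O: "Omega G = {0<..}" using Spherical by simp
    obtain C where C: "0 \<le> C"
      "\<And>B \<rho>i ui \<rho> u. \<lbrakk>continuous_on {0<..} B; continuous_on {0<..} (deriv B);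
        \<forall>x>0. 0 < B x; \<forall>x>0. 0 \<le> deriv B x;
        bounded_solution {0<..} B m I0 \<rho>i ui \<rho> u; vanishes_at_origin (\<lambda>p. \<rho> p * u p * B (snd p))\<rbrakk> \<Longrightarrow>
      (\<integral>\<^sup>+p. ennreal (st cubic (\<rho> p) (u p) * B (snd p)) \<partial>lebesgue_on ({0..T} \<times> ({-L..L} \<inter> {0<..}))) \<le> ennreal C"
      by (rule spherical_bound[OF mI T L], rule that)
    show thesis
    proof (rule that[OF C(1)])
      fix n :: nat assume n: "1 \<le> n"
      have van: "vanishes_at_origin (\<lambda>p. \<rho> n p * u n p * area_n G n (snd p))"
        using as n Spherical unfolding approximate_solutions_def by simp
      have pos: "\<forall>x>0. 0 < area_n G n x"
      proof (intro allI impI)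
        fix x :: real assume "0 < x"
        then have "x \<in> Omega G" using O by simp
        then show "0 < area_n G n x" using area_pos[OF G, of x] area_le_area_n[OF G, of x n] by linarith
      qed
      have mono: "\<forall>x>0. 0 \<le> deriv (area_n G n) x" using area_n_deriv(2)[OF G Spherical] by blast
      show "(\<integral>\<^sup>+p. ennreal (st cubic (\<rho> n p) (u n p) * area_n G n (snd p)) \<partial>lebesgue_on ({0..T} \<times> ({-L..L} \<inter> Omega G))) \<le> ennreal C"
        unfolding O
        by (rule C(2)[OF continuous_area_n[OF G, of n, unfolded O] area_n_deriv(1)[OF G Spherical] pos
            mono good[OF n, unfolded O] van])
    qed
  qed
qed

end

section \<open>The weak limits\<close>

lemma spacetime_lebesgue: "spacetime G \<in> sets lebesgue"
proof (cases G)
  case (Nozzle A)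
  have "closed ({0::real..} \<times> (UNIV :: real set))" by (intro closed_Times) auto
  then show ?thesis using Nozzle by (simp add: spacetime_def)
next
  case (Spherical \<alpha>)
  then show ?thesis using half_strip_lebesgue by (simp add: spacetime_def)
qed

context exponent
begin

text \<open>Near a compact set the cubic weight has bounded integral and the areas converge
  uniformly, so the abstract limit theorem applies with the cubic weight as \<open>W\<close>;
  subcubic growth of \<open>F\<close> is the smallness it requires.\<close>

lemma young_limit_state_function:
  assumes G: "admissible G" and fin: "finite_energy_data \<gamma> G \<rho>0 u0"
    and ad: "approximate_data \<gamma> G \<rho>0 u0 \<rho>i ui" and as: "approximate_solutions \<gamma> G \<rho>i ui \<rho> u"
    and zr: "\<And>n p. z n p = riemann \<gamma> (\<rho> n p) (u n p)"
    and gen': "generates_young_measure \<gamma> (spacetime G) z \<nu>"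
    and F: "continuous_on UNIV (\<lambda>p. F (fst p) (snd p))" "subcubic F"
    and f: "\<And>a. a \<in> H_cl \<Longrightarrow> f a = dens \<gamma> a * F (vel a) (half_diff a)"
  shows "young_limit G z \<nu> f"
proof -
  let ?S = "spacetime G"
  let ?a = "\<lambda>p. area G (snd p)" and ?an = "\<lambda>n p. area_n G n (snd p)"
  interpret young_measure \<gamma> ?S z \<nu>
    by unfold_locales (simp_all add: spacetime_lebesgue gen' zr riemann_H_cl)
  note fs = state_function[where F = F and f = f, OF F f]
  have W: "continuous_on H_cl (cubic_weight \<gamma>)" "cubic_weight \<gamma> (s, s) = 0" "a \<in> H_cl \<Longrightarrow> 0 \<le> cubic_weight \<gamma> a" for s a
    using continuous_cubic_weight by (simp_all add: cubic_weight_def dens_diagonal dens_nonneg)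
  have W_z: "cubic_weight \<gamma> (z n p) = st cubic (\<rho> n p) (u n p)" for n p
    unfolding zr cubic_weight_riemann st_def cubic_def by simp
  have meas: "\<rho> n \<in> borel_measurable (lebesgue_on ?S)" "u n \<in> borel_measurable (lebesgue_on ?S)" if "1 \<le> n" for n
    using as that by (auto simp: approximate_solutions_def)
  have zS: "z n \<in> borel_measurable (lebesgue_on ?S)" if "1 \<le> n" for n
  proof -
    have c: "(\<lambda>p. \<rho> n p powr theta \<gamma>) \<in> borel_measurable (lebesgue_on ?S)"
      using meas(1)[OF that] by measurable
    have "(\<lambda>p. (u n p + \<rho> n p powr theta \<gamma>, u n p - \<rho> n p powr theta \<gamma>)) \<in> borel_measurable (lebesgue_on ?S)"
      by (intro borel_measurable_Pair borel_measurable_add borel_measurable_diff meas(2)[OF that] c)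
    then show ?thesis unfolding zr[abs_def] riemann_def .
  qed
  have sub: "S' \<subseteq> ?S \<Longrightarrow> h \<in> borel_measurable (lebesgue_on ?S) \<Longrightarrow> h \<in> borel_measurable (lebesgue_on S')"
    for S' and h :: "real \<times> real \<Rightarrow> 'c :: topological_space"
    by (rule measurable_restrict_mono)
  have cS: "continuous_on ?S (\<lambda>p. b (snd p))" if "continuous_on (Omega G) b" for b :: "real \<Rightarrow> real"
    by (rule continuous_on_compose2[OF that continuous_on_snd[OF continuous_on_id]]) (auto simp: spacetime_def)
  have aS: "?a \<in> borel_measurable (lebesgue_on ?S)" "?an n \<in> borel_measurable (lebesgue_on ?S)" for n
    by (rule continuous_imp_measurable_on_sets_lebesgue[OF cS spacetime_lebesgue], rule continuous_area[OF G])
      (rule continuous_imp_measurable_on_sets_lebesgue[OF cS spacetime_lebesgue], rule continuous_area_n[OF G])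
  have snd_S: "snd p \<in> Omega G" if "p \<in> ?S" for p using that by (auto simp: spacetime_def)
  have loc: "(AE p in lebesgue_on (K \<inter> ?S). set_integrable (\<nu> p) H_vac (on_H_vac f)) \<and>
      (\<forall>n\<ge>1. integrable (lebesgue_on (K \<inter> ?S)) (\<lambda>p. f (z n p) * ?an n p)) \<and>
      integrable (lebesgue_on (K \<inter> ?S)) (\<lambda>p. mean \<nu> f p * ?a p) \<and>
      (\<forall>g. g \<in> borel_measurable (lebesgue_on (K \<inter> ?S)) \<and> (\<exists>C. AE p in lebesgue_on (K \<inter> ?S). \<bar>g p\<bar> \<le> C) \<longrightarrow>
        (\<lambda>n. \<integral>p. f (z n p) * ?an n p * g p \<partial>lebesgue_on (K \<inter> ?S))
          \<longlonglongrightarrow> (\<integral>p. mean \<nu> f p * ?a p * g p \<partial>lebesgue_on (K \<inter> ?S)))"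
    if K: "compact K" for K
  proof -
    obtain L where L: "0 < L" "\<And>p. p \<in> K \<Longrightarrow> norm p \<le> L"
      using compact_imp_bounded[OF K] unfolding bounded_pos by blast
    have KL: "\<bar>fst p\<bar> \<le> L \<and> \<bar>snd p\<bar> \<le> L" if "p \<in> K" for p
      using L(2)[OF that] norm_fst_le[of "fst p" "snd p"] norm_snd_le[of "snd p" "fst p"] by simp
    \<comment> \<open>The bound on the cubic weight is available on boxes; the compact set,
      intersected with space-time, is contained in one.\<close>
    let ?D = "K \<inter> ?S" and ?X = "{0..L} \<times> ({-L..L} \<inter> Omega G)"
    have D: "?D \<in> lmeasurable" "?D \<subseteq> ?S"
      by (rule fmeasurable_Int_fmeasurable[OF lmeasurable_compact[OF K] spacetime_lebesgue]) simp
    have DX: "?D \<subseteq> ?X"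
    proof
      fix p assume p: "p \<in> ?D"
      then show "p \<in> ?X" using KL[of p] by (cases p) (auto simp: spacetime_def)
    qed
    have X: "?X \<in> sets lebesgue" "?X \<subseteq> ?S"
    proof -
      show XS: "?X \<subseteq> ?S" unfolding spacetime_def by (rule Sigma_mono) auto
      have "closed ({0..L} \<times> {-L..L})" by (intro closed_Times) auto
      then have "({0..L} \<times> {-L..L}) \<inter> ?S \<in> sets lebesgue" using spacetime_lebesgue[of G] by (intro sets.Int) simp_all
      moreover have "({0..L} \<times> {-L..L}) \<inter> ?S = ?X" by (auto simp: spacetime_def)
      ultimately show "?X \<in> sets lebesgue" by simp
    qed
    obtain C where C: "0 \<le> C"
      "\<And>n. 1 \<le> n \<Longrightarrow> (\<integral>\<^sup>+p. ennreal (st cubic (\<rho> n p) (u n p) * ?an n p) \<partial>lebesgue_on ?X) \<le> ennreal C"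
      by (rule uniform_cubic_bound[OF G fin ad as L(1) less_imp_le[OF L(1)]], rule that)
    have bound: "(\<integral>\<^sup>+p. ennreal (cubic_weight \<gamma> (z n p) * ?an n p) \<partial>lebesgue_on ?D) \<le> ennreal C" if n: "1 \<le> n" for n
    proof -
      have "(\<integral>\<^sup>+p. ennreal (st cubic (\<rho> n p) (u n p) * ?an n p) \<partial>lebesgue_on ?D) \<le> ennreal (C / 1)"
      proof (rule nn_integral_lebesgue_on_subset_le[OF X(1) _ DX _ C(2)[OF n] zero_less_one C(1)])
        show "?D \<in> sets lebesgue" using D(1) by blast
        have "(\<lambda>p. st cubic (\<rho> n p) (u n p) * ?an n p) \<in> borel_measurable (lebesgue_on ?S)"
          by (rule borel_measurable_times[OF measurable_st[OF continuous_cubic meas[OF n]] aS(2)])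
        then show "(\<lambda>p. st cubic (\<rho> n p) (u n p) * ?an n p) \<in> borel_measurable (lebesgue_on ?X)"
          by (rule sub[OF X(2)])
      qed simp
      then show ?thesis by (simp add: W_z)
    qed
    obtain b where b: "0 \<le> b" "\<And>n x. 1 \<le> n \<Longrightarrow> x \<in> Omega G \<Longrightarrow> \<bar>x\<bar> \<le> L \<Longrightarrow> area_n G n x \<le> b"
      by (rule area_n_bounded[OF G], rule that)
    have bD: "?an n p \<le> b" if "1 \<le> n" "p \<in> ?D" for n p
      using that KL[of p] by (intro b(2) snd_S) auto
    have aan: "?a p \<le> ?an n p" if "p \<in> ?D" for n p
      using that by (intro area_le_area_n[OF G] snd_S) auto
    have ab: "?a p \<le> b" if "p \<in> ?D" for p
      using aan[OF that, of 1] bD[OF le_refl that] by linarith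
    have ul: "uniform_limit ?D ?an ?a sequentially"
    proof (rule uniform_limitI)
      fix e :: real assume e: "0 < e"
      have "uniform_limit {x \<in> Omega G. \<bar>x\<bar> \<le> L} (area_n G) (area G) sequentially"
        by (rule uniform_limit_area_n[OF G subset_refl])
      from uniform_limitD[OF this e]
      show "\<forall>\<^sub>F n in sequentially. \<forall>p\<in>?D. dist (?an n p) (?a p) < e"
        by eventually_elim (use KL snd_S in auto)
    qed
    have ap: "0 < ?a p" if "p \<in> ?D" for p using that by (intro area_pos[OF G] snd_S) auto
    note prem = D sub[OF D(2) aS(1)] ap ab sub[OF D(2) aS(2)] aan bD ul sub[OF D(2) zS] W bound C(1) fs(1,2)
    show ?thesis
      unfolding set_integrable_eq
    proof (intro conjI allI impI)
      show "AE p in lebesgue_on ?D. integrable (\<nu> p) (mean_integrand f)"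
        by (rule mean_integrable_AE[where a = ?a and an = ?an and W = "cubic_weight \<gamma>" and f = f, OF prem fs(3)])
      show "integrable (lebesgue_on ?D) (\<lambda>p. f (z n p) * ?an n p)" if "1 \<le> n" for n
        by (rule integrable_f[where a = ?a and an = ?an and W = "cubic_weight \<gamma>" and f = f, OF prem fs(3) that])
      show "integrable (lebesgue_on ?D) (\<lambda>p. mean \<nu> f p * ?a p)"
        by (rule integrable_mean[where a = ?a and an = ?an and W = "cubic_weight \<gamma>" and f = f, OF prem fs(3)])
      fix g :: "real \<times> real \<Rightarrow> real" assume g: "g \<in> borel_measurable (lebesgue_on ?D) \<and> (\<exists>C. AE p in lebesgue_on ?D. \<bar>g p\<bar> \<le> C)"
      then obtain Cg where Cg: "AE p in lebesgue_on ?D. \<bar>g p\<bar> \<le> Cg" by (elim conjE exE)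
      show "(\<lambda>n. \<integral>p. f (z n p) * ?an n p * g p \<partial>lebesgue_on ?D) \<longlonglongrightarrow> (\<integral>p. mean \<nu> f p * ?a p * g p \<partial>lebesgue_on ?D)"
        by (rule weak_convergence[where a = ?a and an = ?an and W = "cubic_weight \<gamma>" and f = f, OF prem fs(3) conjunct1[OF g] Cg])
    qed
  qed
  \<comment> \<open>Integrability of \<open>f\<close> is known almost everywhere on each ball; the
    countable union of the exceptional sets is null.\<close>
  have hm: "has_mean ?S \<nu> f"
    unfolding has_mean_def
  proof -
    let ?P = "\<lambda>p. set_integrable (\<nu> p) H_vac (on_H_vac f)"
    have "AE p in lebesgue. p \<in> cball 0 (real j) \<inter> ?S \<longrightarrow> ?P p" for j
    proof -
      have "cball 0 (real j) \<inter> ?S \<in> sets lebesgue"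
        using spacetime_lebesgue[of G] by (intro sets.Int) simp_all
      then show ?thesis
        using conjunct1[OF loc[OF compact_cball[of 0 "real j"]]] by (subst (asm) AE_restrict_space_iff) simp_all
    qed
    then have "AE p in lebesgue. \<forall>j. p \<in> cball 0 (real j) \<inter> ?S \<longrightarrow> ?P p" by (subst AE_all_countable) (rule allI)
    then have "AE p in lebesgue. p \<in> ?S \<longrightarrow> ?P p"
    proof eventually_elim
      case (elim p)
      obtain j where "norm p \<le> real j" using real_arch_simple by blast
      then show ?case using elim[rule_format, of j] by simp
    qed
    then show "AE p in lebesgue_on ?S. ?P p"
      using spacetime_lebesgue[of G] by (subst AE_restrict_space_iff) simp_all
  qed
  show ?thesis
    unfolding young_limit_def weakly_L1_loc_def
  proof (intro conjI hm allI impI)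
    fix K assume "compact K \<and> K \<subseteq> closure ?S"
    then have K: "compact K" by simp
    note l = loc[OF K]
    show "integrable (lebesgue_on (K \<inter> ?S)) (\<lambda>p. f (z n p) * ?an n p)" if "1 \<le> n" for n
      by (rule l[THEN conjunct2, THEN conjunct1, rule_format, OF that])
    show "integrable (lebesgue_on (K \<inter> ?S)) (\<lambda>p. mean \<nu> f p * ?a p)"
      by (rule l[THEN conjunct2, THEN conjunct2, THEN conjunct1])
    fix g :: "real \<times> real \<Rightarrow> real" assume "g \<in> borel_measurable (lebesgue_on (K \<inter> ?S)) \<and> (\<exists>C. AE p in lebesgue_on (K \<inter> ?S). \<bar>g p\<bar> \<le> C)"
    from l[THEN conjunct2, THEN conjunct2, THEN conjunct2, THEN spec, THEN mp, OF this]
    show "(\<lambda>n. \<integral>p. f (z n p) * ?an n p * g p \<partial>lebesgue_on (K \<inter> ?S)) \<longlonglongrightarrow> (\<integral>p. mean \<nu> f p * ?a p * g p \<partial>lebesgue_on (K \<inter> ?S))" .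
  qed
qed

end

theorem proposition2p7:
  fixes \<gamma> :: real and G :: geometry
    and \<rho>0 u0 :: "real \<Rightarrow> real"
    and \<rho>i ui :: "nat \<Rightarrow> real \<Rightarrow> real"
    and \<rho> u :: "nat \<Rightarrow> real \<times> real \<Rightarrow> real"
    and z :: "nat \<Rightarrow> real \<times> real \<Rightarrow> real \<times> real"
    and \<nu> :: "real \<times> real \<Rightarrow> ((real \<times> real \<Rightarrow> real) \<Rightarrow> real) measure"
    and \<psi> :: "real \<Rightarrow> real"
  assumes "1 < \<gamma>" and "\<gamma> \<le> 5/3"
    and "admissible G"
    and "finite_energy_data \<gamma> G \<rho>0 u0"
    and "approximate_data \<gamma> G \<rho>0 u0 \<rho>i ui"
    and "approximate_solutions \<gamma> G \<rho>i ui \<rho> u"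
    and "\<And>n p. z n p = riemann \<gamma> (\<rho> n p) (u n p)"
    and "generates_young_measure \<gamma> (spacetime G) z \<nu>"
    and "C2 \<psi>" and "growth_below 3 \<psi>"
  shows "young_limit G z \<nu> (of_riemann \<gamma> (eta \<gamma> \<psi>)) \<and>
    (growth_below 2 \<psi> \<longrightarrow>
       young_limit G z \<nu> (of_riemann \<gamma> (q \<gamma> \<psi>)) \<and>
       young_limit G z \<nu> (of_riemann \<gamma> (ru_eta_r \<gamma> \<psi>)))"
proof -
  interpret exponent \<gamma> by unfold_locales (fact assms)+
  note limit = young_limit_state_function[OF assms(3-8)]
  show ?thesis
  proof (intro conjI impI)
    show "young_limit G z \<nu> (of_riemann \<gamma> (eta \<gamma> \<psi>))"
      by (rule limit[where F = "avg (wgt \<gamma>) \<psi>", OF eta_state[OF assms(9,10)]])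
    assume g: "growth_below 2 \<psi>"
    show "young_limit G z \<nu> (of_riemann \<gamma> (q \<gamma> \<psi>))"
      by (rule limit[where F = "qv \<psi>", OF flux_state(1-3)[OF assms(9) g]])
    show "young_limit G z \<nu> (of_riemann \<gamma> (ru_eta_r \<gamma> \<psi>))"
      by (rule limit[where F = "\<lambda>v c. v * avg (wgtr \<gamma>) \<psi> v c", OF flux_state(4-6)[OF assms(9) g]])
  qed
qed

end
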